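(* Consider the Gaussian state-dependent wiretap channel $$Y=X+S+\eta_1,\qquad Z=X+S+\eta_2,$$ where $\eta_i\sim\mathcal N(0,N_i)$, $i\in\{1,2\}$, is additive white Gaussian noise, the channel state is i.i.d. with $S\sim\mathcal N(0,Q)$ and known non-causally at the transmitter, and the channel input has power constraint $P$. Its secrecy capacity is $$C_S=\Big[\mathcal C\Big(\frac{P}{N_1}\Big)-\mathcal C\Big(\frac{P}{N_2}\Big)\Big]^+,$$ where $\mathcal C(x)=\frac12\log(1+x)$ and $[x]^+=\max\{0,x\}$.
   Context: The channel is memoryless; the state and the noises are independent of each other, and the noises are independent of the input. $Y$ is the output at the legitimate receiver and $Z$ the output at the eavesdropper. $\mathcal N(0,P)$ denotes the zero-mean Gaussian law of variance $P$. The power constraint is $\frac1N\sum_{i=1}^N E[X_i^2]\le P$. Code: a message $W$ uniform on $\{1,\dots,M\}$, independent of $S^N$; the (possibly randomized) encoder produces $x^N$ from $w$ and the whole state sequence $s^N$ (non-causal knowledge); the legitimate decoder outputs $\hat w(Y^N)$ without knowing $S^N$. The average error probability is $P_e=\frac1M\sum_{w=1}^M\Pr(\hat w(Y^N)\ne w\mid W=w)$, the rate is $R=\frac{\log M}{N}$, and the normalized equivocation is $R_e^{(N)}=\frac1N H(W|Z^N,S^N)$ (the eavesdropper is assumed able to decode the state). A pair $(R,R_e)$ is achievable if for every $\epsilon>0$ there are $(M,N,P_e)$ codes of rate $R$ and arbitrarily large block length $N$ with $P_e\le\epsilon$, and $0\le R_e\le\liminf_{N\to\infty}R_e^{(N)}$.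 Perfect secrecy condition: $R\le R_e$. A secrecy rate is achievable if it is the rate $R$ of an achievable pair satisfying the perfect secrecy condition; the secrecy capacity is the supremum of achievable secrecy rates. *)

theory Defs
  imports "HOL-Probability.Probability"
begin

text \<open>Blocks of length \<open>n\<close> are extensional functions on \<open>{..<n}\<close>.\<close>

definition block_space :: "nat \<Rightarrow> (nat \<Rightarrow> real) measure" where
  "block_space n = Pi\<^sub>M {..<n} (\<lambda>_. borel)"

text \<open>The law of \<open>n\<close> i.i.d. zero-mean Gaussian variables of variance \<open>v > 0\<close>;
  the library's normal density is parametrised by the standard deviation.\<close>

definition gaussian_block :: "real \<Rightarrow> nat \<Rightarrow> (nat \<Rightarrow> real) measure" where
  "gaussian_block v n = Pi\<^sub>M {..<n} (\<lambda>_. density lborel (normal_density 0 (sqrt v)))"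

text \<open>The randomized encoder is a Markov kernel from pairs (message, whole state block) to
  input blocks. The decoder is deterministic and sees the output block only.\<close>

record wiretap_code =
  block_length :: nat
  num_messages :: nat
  encoder :: "nat \<times> (nat \<Rightarrow> real) \<Rightarrow> (nat \<Rightarrow> real) measure"
  decoder :: "(nat \<Rightarrow> real) \<Rightarrow> nat"

abbreviation message_space :: "wiretap_code \<Rightarrow> nat measure" where
  "message_space c \<equiv> count_space {1..num_messages c}"

definition wellformed_code :: "wiretap_code \<Rightarrow> bool" where
  "wellformed_code c \<longleftrightarrow>
     block_length c \<ge> 1 \<and> num_messages c \<ge> 1 \<and>
     encoder c \<in> message_space c \<Otimes>\<^sub>M block_space (block_length c)
       \<rightarrow>\<^sub>M prob_algebra (block_space (block_length c)) \<and>
     decoder c \<in> block_space (block_length c) \<rightarrow>\<^sub>M message_space c"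

text \<open>Joint law of message, state block and input block.\<close>

definition input_law :: "real \<Rightarrow> wiretap_code \<Rightarrow> (nat \<times> (nat \<Rightarrow> real) \<times> (nat \<Rightarrow> real)) measure" where
  "input_law Q c =
     (uniform_count_measure {1..num_messages c} \<Otimes>\<^sub>M gaussian_block Q (block_length c)) \<bind>
     (\<lambda>(w, s). distr (encoder c (w, s))
        (message_space c \<Otimes>\<^sub>M block_space (block_length c) \<Otimes>\<^sub>M block_space (block_length c))
        (\<lambda>x. (w, s, x)))"

type_synonym outcome =
  "(nat \<times> (nat \<Rightarrow> real) \<times> (nat \<Rightarrow> real)) \<times> ((nat \<Rightarrow> real) \<times> (nat \<Rightarrow> real))"

text \<open>An outcome is \<open>((w, s, x), (e1, e2))\<close>. The product measure expresses that the two noise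
  blocks are independent of each other and of message, state and input.\<close>

definition code_law :: "real \<Rightarrow> real \<Rightarrow> real \<Rightarrow> wiretap_code \<Rightarrow> outcome measure" where
  "code_law Q N1 N2 c =
     input_law Q c \<Otimes>\<^sub>M
     (gaussian_block N1 (block_length c) \<Otimes>\<^sub>M gaussian_block N2 (block_length c))"

fun message :: "outcome \<Rightarrow> nat" where
  "message ((w, s, x), (e1, e2)) = w"

fun state :: "outcome \<Rightarrow> nat \<Rightarrow> real" where
  "state ((w, s, x), (e1, e2)) = s"

fun channel_input :: "outcome \<Rightarrow> nat \<Rightarrow> real" where
  "channel_input ((w, s, x), (e1, e2)) = x"

fun legit_output :: "nat \<Rightarrow> outcome \<Rightarrow> nat \<Rightarrow> real" where
  "legit_output n ((w, s, x), (e1, e2)) = (\<lambda>i\<in>{..<n}. x i + s i + e1 i)"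

fun eve_output :: "nat \<Rightarrow> outcome \<Rightarrow> nat \<Rightarrow> real" where
  "eve_output n ((w, s, x), (e1, e2)) = (\<lambda>i\<in>{..<n}. x i + s i + e2 i)"

definition power_constraint :: "real \<Rightarrow> real \<Rightarrow> real \<Rightarrow> real \<Rightarrow> wiretap_code \<Rightarrow> bool" where
  "power_constraint P Q N1 N2 c \<longleftrightarrow>
     (\<forall>i<block_length c. integrable (code_law Q N1 N2 c) (\<lambda>\<omega>. (channel_input \<omega> i)\<^sup>2)) \<and>
     (1 / real (block_length c)) *
       (\<Sum>i<block_length c. \<integral>\<omega>. (channel_input \<omega> i)\<^sup>2 \<partial>code_law Q N1 N2 c) \<le> P"

definition error_prob :: "real \<Rightarrow> real \<Rightarrow> real \<Rightarrow> wiretap_code \<Rightarrow> real" where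
  "error_prob Q N1 N2 c =
     (1 / real (num_messages c)) *
     (\<Sum>w = 1..num_messages c.
        \<P>(\<omega> in code_law Q N1 N2 c.
           decoder c (legit_output (block_length c) \<omega>) \<noteq> w \<bar> message \<omega> = w))"

definition code_rate :: "real \<Rightarrow> wiretap_code \<Rightarrow> real" where
  "code_rate b c = log b (real (num_messages c)) / real (block_length c)"

text \<open>The conditional entropy is taken with respect to counting measure for the message and
  Lebesgue measure for the pair (eavesdropper output, state), which has a density because noise
  and state are nondegenerate Gaussian. Its value does not depend on these reference measures.\<close>

definition equivocation :: "real \<Rightarrow> real \<Rightarrow> real \<Rightarrow> real \<Rightarrow> wiretap_code \<Rightarrow> real" where
  "equivocation b Q N1 N2 c =
     (1 / real (block_length c)) *
     prob_space.conditional_entropy (code_law Q N1 N2 c) b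
       (message_space c)
       (Pi\<^sub>M {..<block_length c} (\<lambda>_. lborel) \<Otimes>\<^sub>M Pi\<^sub>M {..<block_length c} (\<lambda>_. lborel))
       message
       (\<lambda>\<omega>. (eve_output (block_length c) \<omega>, state \<omega>))"

text \<open>The codes \<open>c 0, c 1, \<dots>\<close> have strictly increasing block lengths, and the limit inferior is
  taken along them.\<close>

definition achievable ::
    "real \<Rightarrow> real \<Rightarrow> real \<Rightarrow> real \<Rightarrow> real \<Rightarrow> real \<Rightarrow> real \<Rightarrow> bool" where
  "achievable b P Q N1 N2 R Req \<longleftrightarrow>
     0 \<le> Req \<and>
     (\<forall>\<epsilon>>0. \<exists>c :: nat \<Rightarrow> wiretap_code.
        strict_mono (\<lambda>k. block_length (c k)) \<and>
        (\<forall>k. wellformed_code (c k) \<and> power_constraint P Q N1 N2 (c k) \<and>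
             code_rate b (c k) = R \<and> error_prob Q N1 N2 (c k) \<le> \<epsilon>) \<and>
        ereal Req \<le> liminf (\<lambda>k. ereal (equivocation b Q N1 N2 (c k))))"

definition achievable_secrecy_rate ::
    "real \<Rightarrow> real \<Rightarrow> real \<Rightarrow> real \<Rightarrow> real \<Rightarrow> real \<Rightarrow> bool" where
  "achievable_secrecy_rate b P Q N1 N2 R \<longleftrightarrow>
     (\<exists>Req. achievable b P Q N1 N2 R Req \<and> R \<le> Req)"

definition secrecy_capacity :: "real \<Rightarrow> real \<Rightarrow> real \<Rightarrow> real \<Rightarrow> real \<Rightarrow> ereal" where
  "secrecy_capacity b P Q N1 N2 = Sup (ereal ` {R. achievable_secrecy_rate b P Q N1 N2 R})"

definition gaussian_capacity :: "real \<Rightarrow> real \<Rightarrow> real" where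
  "gaussian_capacity b x = (1 / 2) * log b (1 + x)"

end

theory Submission
  imports Defs
begin

text \<open>
  Converse. Given the state the channel is degraded in law, so a decoder for \<open>Y\<close> can be run on a guess
  of \<open>Y\<close> made from \<open>Z\<close> and \<open>S\<close>. Taking the resulting conditional law of the message as test
  distribution in Gibbs' inequality and applying Jensen's inequality after a change of measure bounds
  the equivocation by a Gaussian relative entropy, which is at most \<open>N (C(P/N1) - C(P/N2))\<close> under the
  power constraint, plus a Fano term.

  Achievability. Costa's auxiliary variable \<open>U = X + \<alpha> S\<close> with \<open>\<alpha> = P / (P + N1)\<close> gives
  \<open>I(U;Y) - I(U;Z,S) = C(P/N1) - C(P/N2)\<close>. For every message there is a bundle of slightly more than
  \<open>exp (N I(U;Z,S))\<close> random Gaussian codewords. The encoder draws a codeword of the bundle with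
  probability proportional to the likelihood of the state. By soft covering the joint law of state and
  eavesdropper output then hardly depends on the message, which yields the equivocation and also shows that
  the encoder behaves like the ideal one with uniform codeword and backward state channel, for which a
  threshold decoder succeeds.
\<close>

subsection \<open>Product measures\<close>

text \<open>The encoder in the converse is arbitrary and only its average power is limited.
  Comparing log losses against an explicit test law, one input block at a time, keeps differential
  entropies and their integrability out of the argument. The bound for one block is affine in its
  energy, so the average power alone enters.

  In the achievability part the state is continuous; drawing the codeword from a posterior turns the
  mismatch with the state into an L1 distance that a second moment controls. Bundles have rate
  I(U;Z,S) and not I(U;S) because the eavesdropper is granted the state. Marginalising the covered
  pair covers the state, so one bundle size serves encoding and secrecy. The distance need not decay
  exponentially: the normalised equivocation loses only a constant times it. An input variance
  strictly below the allowed power leaves room for clipping. As every code of a sequence must have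
  exactly the claimed rate, the positive rates constructed are rational multiples of log 2, and
  these are dense.\<close>

lemma product_sigma_finite_const: "sigma_finite_measure M \<Longrightarrow> product_sigma_finite (\<lambda>_. M)"
  by (simp add: product_sigma_finite_def)

lemma emeasure_distr_eq_nn_integral:
  "f \<in> M \<rightarrow>\<^sub>M N \<Longrightarrow> E \<in> sets N \<Longrightarrow> emeasure (distr M N f) E = (\<integral>\<^sup>+ x. indicator E (f x) \<partial>M)"
  by (subst nn_integral_indicator[symmetric]) (simp, subst nn_integral_distr, simp_all)

text \<open>A pair of blocks against a block of pairs: for an integrand that factorises over the
  coordinates both sides reduce by Tonelli to the same finite product, so the two spaces never have
  to be identified.\<close>

lemma nn_integral_pair_PiM_prod:
  fixes h :: "'i \<Rightarrow> 'a \<times> 'b \<Rightarrow> ennreal"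
  assumes I: "finite I" and A: "sigma_finite_measure A" and B: "sigma_finite_measure B"
    and h[measurable]: "\<And>i. i \<in> I \<Longrightarrow> h i \<in> borel_measurable (A \<Otimes>\<^sub>M B)"
  shows "(\<integral>\<^sup>+ p. (\<Prod>i\<in>I. h i (fst p i, snd p i)) \<partial>(PiM I (\<lambda>_. A) \<Otimes>\<^sub>M PiM I (\<lambda>_. B)))
    = (\<Prod>i\<in>I. \<integral>\<^sup>+ p. h i p \<partial>(A \<Otimes>\<^sub>M B))"
proof -
  interpret A: product_sigma_finite "\<lambda>_. A" using A by (rule product_sigma_finite_const)
  interpret B: product_sigma_finite "\<lambda>_. B" using B by (rule product_sigma_finite_const)

  interpret BI: sigma_finite_measure "PiM I (\<lambda>_. B)" using I by (rule B.sigma_finite)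
  have m1[measurable]: "(\<lambda>p. \<Prod>i\<in>I. h i (fst p i, snd p i)) \<in> borel_measurable (PiM I (\<lambda>_. A) \<Otimes>\<^sub>M PiM I (\<lambda>_. B))"
    by (intro borel_measurable_prod_ennreal) measurable
  have "(\<integral>\<^sup>+ p. (\<Prod>i\<in>I. h i (fst p i, snd p i)) \<partial>(PiM I (\<lambda>_. A) \<Otimes>\<^sub>M PiM I (\<lambda>_. B)))
      = (\<integral>\<^sup>+ x. \<integral>\<^sup>+ y. (\<Prod>i\<in>I. h i (x i, y i)) \<partial>PiM I (\<lambda>_. B) \<partial>PiM I (\<lambda>_. A))"
    by (subst BI.nn_integral_fst[symmetric]) simp_all
  also have "\<dots> = (\<integral>\<^sup>+ x. (\<Prod>i\<in>I. \<integral>\<^sup>+ b. h i (x i, b) \<partial>B) \<partial>PiM I (\<lambda>_. A))"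
  proof (intro nn_integral_cong)
    fix x assume "x \<in> space (PiM I (\<lambda>_. A))"
    then have x: "\<And>i. i \<in> I \<Longrightarrow> x i \<in> space A" by (auto simp: space_PiM)
    show "(\<integral>\<^sup>+ y. (\<Prod>i\<in>I. h i (x i, y i)) \<partial>PiM I (\<lambda>_. B)) = (\<Prod>i\<in>I. \<integral>\<^sup>+ b. h i (x i, b) \<partial>B)"
      using I x by (intro B.product_nn_integral_prod) auto
  qed
  also have "\<dots> = (\<Prod>i\<in>I. \<integral>\<^sup>+ a. \<integral>\<^sup>+ b. h i (a, b) \<partial>B \<partial>A)"
    using I by (intro A.product_nn_integral_prod) measurable
  also have "\<dots> = (\<Prod>i\<in>I. \<integral>\<^sup>+ p. h i p \<partial>(A \<Otimes>\<^sub>M B))"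
    by (intro prod.cong refl sigma_finite_measure.nn_integral_fst[OF B]) (rule h)
  finally show ?thesis .
qed

text \<open>Independent coordinates stay independent under a map applied coordinatewise to two
  blocks. Product measures are determined on boxes, and there the indicator of the image is a
  product of indicators of single coordinates.\<close>

lemma distr_pair_PiM:
  assumes I: "finite I" and A: "prob_space A" and B: "prob_space B"
    and f[measurable]: "f \<in> A \<Otimes>\<^sub>M B \<rightarrow>\<^sub>M C"
  shows "distr (PiM I (\<lambda>_. A) \<Otimes>\<^sub>M PiM I (\<lambda>_. B)) (PiM I (\<lambda>_. C)) (\<lambda>p. \<lambda>i\<in>I. f (fst p i, snd p i))
    = PiM I (\<lambda>_. distr (A \<Otimes>\<^sub>M B) C f)"
proof -
  interpret A: prob_space A by fact
  interpret B: prob_space B by fact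
  interpret AB: pair_prob_space A B ..
  interpret C: prob_space "distr (A \<Otimes>\<^sub>M B) C f" by (rule AB.prob_space_distr) fact
  interpret P: product_sigma_finite "\<lambda>_. distr (A \<Otimes>\<^sub>M B) C f"
    by (rule product_sigma_finite_const) unfold_locales
  show ?thesis
  proof (rule P.PiM_eqI)
    fix E assume "\<And>i. i \<in> I \<Longrightarrow> E i \<in> sets (distr (A \<Otimes>\<^sub>M B) C f)"
    then have E[measurable]: "\<And>i. i \<in> I \<Longrightarrow> E i \<in> sets C" by simp
    have EI[measurable]: "Pi\<^sub>E I E \<in> sets (PiM I (\<lambda>_. C))"
      using I E by (intro sets_PiM_I_finite) auto
    have "emeasure (distr (PiM I (\<lambda>_. A) \<Otimes>\<^sub>M PiM I (\<lambda>_. B)) (PiM I (\<lambda>_. C)) (\<lambda>p. \<lambda>i\<in>I. f (fst p i, snd p i))) (Pi\<^sub>E I E)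
      = (\<integral>\<^sup>+ p. indicator (Pi\<^sub>E I E) (\<lambda>i\<in>I. f (fst p i, snd p i)) \<partial>(PiM I (\<lambda>_. A) \<Otimes>\<^sub>M PiM I (\<lambda>_. B)))"
      using EI by (subst emeasure_distr_eq_nn_integral) measurable
    also have "\<dots> = (\<integral>\<^sup>+ p. (\<Prod>i\<in>I. (indicator (E i) (f (fst p i, snd p i)) :: ennreal)) \<partial>(PiM I (\<lambda>_. A) \<Otimes>\<^sub>M PiM I (\<lambda>_. B)))"
    proof (intro nn_integral_cong)
      fix p
      have "(\<Prod>i\<in>I. (indicator (E i) (f (fst p i, snd p i)) :: ennreal)) = (if \<forall>i\<in>I. f (fst p i, snd p i) \<in> E i then 1 else 0)"
        using I by (auto simp: indicator_def prod_zero_iff)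
      then show "indicator (Pi\<^sub>E I E) (\<lambda>i\<in>I. f (fst p i, snd p i)) = (\<Prod>i\<in>I. (indicator (E i) (f (fst p i, snd p i)) :: ennreal))"
        by (auto simp: indicator_def PiE_iff)
    qed
    also have "\<dots> = (\<Prod>i\<in>I. \<integral>\<^sup>+ p. indicator (E i) (f p) \<partial>(A \<Otimes>\<^sub>M B))"
      by (rule nn_integral_pair_PiM_prod[where h="\<lambda>i p. indicator (E i) (f p)"])
         (auto intro!: I A.sigma_finite_measure_axioms B.sigma_finite_measure_axioms)
    also have "\<dots> = (\<Prod>i\<in>I. emeasure (distr (A \<Otimes>\<^sub>M B) C f) (E i))"
    proof (intro prod.cong refl)
      fix i assume i: "i \<in> I"
      show "(\<integral>\<^sup>+ p. indicator (E i) (f p) \<partial>(A \<Otimes>\<^sub>M B)) = emeasure (distr (A \<Otimes>\<^sub>M B) C f) (E i)"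
        using E[OF i] by (subst emeasure_distr_eq_nn_integral) auto
    qed
    finally show "emeasure (distr (PiM I (\<lambda>_. A) \<Otimes>\<^sub>M PiM I (\<lambda>_. B)) (PiM I (\<lambda>_. C)) (\<lambda>p. \<lambda>i\<in>I. f (fst p i, snd p i))) (Pi\<^sub>E I E)
      = (\<Prod>i\<in>I. emeasure (distr (A \<Otimes>\<^sub>M B) C f) (E i))" .
  qed (use I in \<open>auto intro!: sets_PiM_cong\<close>)
qed

text \<open>Again boxes decide. The indicator of a box splits over the coordinates up to
  extensionality, which every point of the product space satisfies.\<close>

lemma PiM_density:
  fixes f :: "'i \<Rightarrow> 'a \<Rightarrow> ennreal"
  assumes I: "finite I" and M: "sigma_finite_measure M"
    and f[measurable]: "\<And>i. f i \<in> borel_measurable M"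
    and D: "\<And>i. sigma_finite_measure (density M (f i))"
  shows "density (PiM I (\<lambda>_. M)) (\<lambda>x. \<Prod>i\<in>I. f i (x i)) = PiM I (\<lambda>i. density M (f i))"
proof -
  interpret M: product_sigma_finite "\<lambda>_. M" using M by (rule product_sigma_finite_const)
  interpret P: product_sigma_finite "\<lambda>i. density M (f i)" using D by (simp add: product_sigma_finite_def)
  have m[measurable]: "(\<lambda>x. \<Prod>i\<in>I. f i (x i)) \<in> borel_measurable (PiM I (\<lambda>_. M))"
    by (intro borel_measurable_prod_ennreal) measurable
  show ?thesis
  proof (rule P.PiM_eqI)
    fix E assume "\<And>i. i \<in> I \<Longrightarrow> E i \<in> sets (density M (f i))"
    then have E[measurable]: "\<And>i. i \<in> I \<Longrightarrow> E i \<in> sets M" by simp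
    have EI[measurable]: "Pi\<^sub>E I E \<in> sets (PiM I (\<lambda>_. M))"
      using I E by (intro sets_PiM_I_finite) auto
    have "emeasure (density (PiM I (\<lambda>_. M)) (\<lambda>x. \<Prod>i\<in>I. f i (x i))) (Pi\<^sub>E I E)
      = (\<integral>\<^sup>+ x. (\<Prod>i\<in>I. f i (x i)) * indicator (Pi\<^sub>E I E) x \<partial>PiM I (\<lambda>_. M))"
      by (simp add: emeasure_density)
    also have "\<dots> = (\<integral>\<^sup>+ x. (\<Prod>i\<in>I. f i (x i) * indicator (E i) (x i)) \<partial>PiM I (\<lambda>_. M))"
    proof (intro nn_integral_cong)
      fix x assume "x \<in> space (PiM I (\<lambda>_. M))"
      then have x: "x \<in> extensional I" by (auto simp: space_PiM PiE_iff)
      have "(\<Prod>i\<in>I. (indicator (E i) (x i) :: ennreal)) = (if \<forall>i\<in>I. x i \<in> E i then 1 else 0)"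
        using I by (auto simp: indicator_def prod_zero_iff)
      then show "(\<Prod>i\<in>I. f i (x i)) * indicator (Pi\<^sub>E I E) x = (\<Prod>i\<in>I. f i (x i) * indicator (E i) (x i))"
        using x by (simp add: prod.distrib) (auto simp: indicator_def PiE_iff)
    qed
    also have "\<dots> = (\<Prod>i\<in>I. \<integral>\<^sup>+ x. f i x * indicator (E i) x \<partial>M)"
      using I by (intro M.product_nn_integral_prod) auto
    also have "\<dots> = (\<Prod>i\<in>I. emeasure (density M (f i)) (E i))"
      by (intro prod.cong refl) (simp add: emeasure_density)
    finally show "emeasure (density (PiM I (\<lambda>_. M)) (\<lambda>x. \<Prod>i\<in>I. f i (x i))) (Pi\<^sub>E I E)
      = (\<Prod>i\<in>I. emeasure (density M (f i)) (E i))" .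
  qed (use I in \<open>auto intro!: sets_PiM_cong\<close>)
qed

text \<open>Blocks are functions on a finite set and not vectors of a Euclidean space, so
  translation invariance is lifted from the line coordinate by coordinate.\<close>

lemma distr_PiM_translate:
  assumes I: "finite I"
  shows "distr (PiM I (\<lambda>_. lborel)) (PiM I (\<lambda>_. lborel)) (\<lambda>x. \<lambda>i\<in>I. x i + t i) = PiM I (\<lambda>_. lborel :: real measure)"
proof -
  interpret P: product_sigma_finite "\<lambda>_. lborel :: real measure"
    by (rule product_sigma_finite_const) (rule lborel.sigma_finite_measure_axioms)
  show ?thesis
  proof (rule P.PiM_eqI)
    fix E assume "\<And>i. i \<in> I \<Longrightarrow> E i \<in> sets (lborel :: real measure)"
    then have E[measurable]: "\<And>i. i \<in> I \<Longrightarrow> E i \<in> sets borel" by simp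
    have EI[measurable]: "Pi\<^sub>E I E \<in> sets (PiM I (\<lambda>_. lborel))"
      using I E by (intro sets_PiM_I_finite) auto
    have m: "(\<lambda>x. x + t i) -` E i \<in> sets borel" if "i \<in> I" for i
      using measurable_sets[of "\<lambda>x. x + t i" borel borel "E i"] E[OF that] by simp
    have "(\<lambda>x. \<lambda>i\<in>I. x i + t i) -` Pi\<^sub>E I E \<inter> space (PiM I (\<lambda>_. lborel)) = Pi\<^sub>E I (\<lambda>i. (\<lambda>x. x + t i) -` E i)"
      by (auto simp: space_PiM PiE_iff)
    then have "emeasure (distr (PiM I (\<lambda>_. lborel)) (PiM I (\<lambda>_. lborel)) (\<lambda>x. \<lambda>i\<in>I. x i + t i)) (Pi\<^sub>E I E)
      = emeasure (PiM I (\<lambda>_. lborel)) (Pi\<^sub>E I (\<lambda>i. (\<lambda>x. x + t i) -` E i))"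
      by (subst emeasure_distr) auto
    also have "\<dots> = (\<Prod>i\<in>I. emeasure lborel ((\<lambda>x. x + t i) -` E i))"
      using I m by (subst P.emeasure_PiM) auto
    also have "\<dots> = (\<Prod>i\<in>I. emeasure lborel (E i))"
    proof (intro prod.cong refl)
      fix i assume i: "i \<in> I"
      have "emeasure lborel (E i) = emeasure (distr lborel borel (\<lambda>x. x + t i)) (E i)"
        using lborel_distr_plus[of "t i"] by (simp add: add.commute[of _ "t i"])
      also have "\<dots> = emeasure lborel ((\<lambda>x. x + t i) -` E i)"
        using E[OF i] by (subst emeasure_distr) auto
      finally show "emeasure lborel ((\<lambda>x. x + t i) -` E i) = emeasure lborel (E i)" by simp
    qed
    finally show "emeasure (distr (PiM I (\<lambda>_. lborel)) (PiM I (\<lambda>_. lborel)) (\<lambda>x. \<lambda>i\<in>I. x i + t i)) (Pi\<^sub>E I E)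
      = (\<Prod>i\<in>I. emeasure lborel (E i))" .
  qed (use I in auto)
qed

text \<open>All other coordinates contribute the factor 1. Pairwise independence is used for the
  variance of a sum and, with codewords as coordinates, for a transmitted codeword against a
  competing one.\<close>

lemma distr_PiM_two_components:
  assumes I: "finite I" and M: "prob_space M" and ij: "i \<in> I" "j \<in> I" "i \<noteq> j"
  shows "distr (PiM I (\<lambda>_. M)) (M \<Otimes>\<^sub>M M) (\<lambda>x. (x i, x j)) = M \<Otimes>\<^sub>M M"
proof -
  interpret M: prob_space M by fact
  interpret MM: pair_prob_space M M ..
  interpret P: product_prob_space "\<lambda>_. M" I by unfold_locales
  interpret P2: finite_product_prob_space "\<lambda>_. M" I by unfold_locales (rule I)
  show ?thesis
  proof (rule pair_measure_eqI[symmetric])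
    fix A B assume [measurable]: "A \<in> sets M" "B \<in> sets M"
    define E where "E k = (if k = i then A else if k = j then B else space M)" for k
    have E: "E k \<in> sets M" for k by (simp add: E_def)
    have "(\<lambda>x. (x i, x j)) -` (A \<times> B) \<inter> space (PiM I (\<lambda>_. M)) = Pi\<^sub>E I E"
      using ij sets.sets_into_space[of A M] sets.sets_into_space[of B M]
      by (auto simp: space_PiM PiE_iff E_def split: if_splits) blast
    then have "emeasure (distr (PiM I (\<lambda>_. M)) (M \<Otimes>\<^sub>M M) (\<lambda>x. (x i, x j))) (A \<times> B) = emeasure (PiM I (\<lambda>_. M)) (Pi\<^sub>E I E)"
      using ij by (subst emeasure_distr) auto
    also have "\<dots> = (\<Prod>k\<in>I. emeasure M (E k))"
      using I E by (subst P.emeasure_PiM) auto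
    also have "\<dots> = (\<Prod>k\<in>{i,j}. emeasure M (E k))"
      using I ij by (intro prod.mono_neutral_right) (auto simp: E_def M.emeasure_space_1)
    also have "\<dots> = emeasure M A * emeasure M B" using ij by (simp add: E_def)
    finally show "emeasure M A * emeasure M B = emeasure (distr (PiM I (\<lambda>_. M)) (M \<Otimes>\<^sub>M M) (\<lambda>x. (x i, x j))) (A \<times> B)" by simp
  qed (simp_all add: M.sigma_finite_measure_axioms)
qed

text \<open>Cross terms vanish because two distinct coordinates are independent and \<open>f\<close>
  has mean 0. The sum runs over a subset \<open>J\<close> because the coordinates will also be the
  codewords of a codebook, of which one message owns only a bundle.\<close>

lemma integral_PiM_sum_power2:
  fixes f :: "'a \<Rightarrow> real"
  assumes I: "finite I" and M: "prob_space M" and J: "J \<subseteq> I"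
    and f: "integrable M f" and f2: "integrable M (\<lambda>x. (f x)\<^sup>2)" and f0: "(\<integral>x. f x \<partial>M) = 0"
  shows "integrable (PiM I (\<lambda>_. M)) (\<lambda>x. (\<Sum>j\<in>J. f (x j))\<^sup>2)"
    and "(\<integral>x. (\<Sum>j\<in>J. f (x j))\<^sup>2 \<partial>PiM I (\<lambda>_. M)) = card J * (\<integral>x. (f x)\<^sup>2 \<partial>M)"
proof -
  interpret M: prob_space M by fact
  interpret MM: pair_prob_space M M ..
  have [measurable]: "f \<in> borel_measurable M" using f by simp
  have fJ: "finite J" using I J finite_subset by blast
  have ne: "integrable (PiM I (\<lambda>_. M)) (\<lambda>x. f (x i) * f (x j)) \<and> (\<integral>x. f (x i) * f (x j) \<partial>PiM I (\<lambda>_. M)) = 0"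
    if ij: "i \<in> I" "j \<in> I" "i \<noteq> j" for i j
  proof -
    have [measurable]: "(\<lambda>x. (x i, x j)) \<in> PiM I (\<lambda>_. M) \<rightarrow>\<^sub>M M \<Otimes>\<^sub>M M" using ij by measurable
    have "integrable (M \<Otimes>\<^sub>M M) (\<lambda>p. f (fst p) * f (snd p))"
      by (rule MM.Fubini_integrable) (auto intro!: integrable_mult_right f integrable_mult_left integrable_abs simp: abs_mult f)
    moreover have "(\<integral>p. f (fst p) * f (snd p) \<partial>(M \<Otimes>\<^sub>M M)) = 0"
      using MM.integral_fst'[OF calculation] by (simp add: f0)
    ultimately have "integrable (distr (PiM I (\<lambda>_. M)) (M \<Otimes>\<^sub>M M) (\<lambda>x. (x i, x j))) (\<lambda>p. f (fst p) * f (snd p))"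
      "(\<integral>p. f (fst p) * f (snd p) \<partial>(distr (PiM I (\<lambda>_. M)) (M \<Otimes>\<^sub>M M) (\<lambda>x. (x i, x j)))) = 0"
      using distr_PiM_two_components[OF I M ij] by simp_all
    then show ?thesis by (simp add: integrable_distr_eq integral_distr)
  qed
  have eq: "integrable (PiM I (\<lambda>_. M)) (\<lambda>x. f (x i) * f (x i)) \<and> (\<integral>x. f (x i) * f (x i) \<partial>PiM I (\<lambda>_. M)) = (\<integral>x. (f x)\<^sup>2 \<partial>M)"
    if i: "i \<in> I" for i
  proof -
    have d: "distr (PiM I (\<lambda>_. M)) M (\<lambda>x. x i) = M" using i M by (rule distr_PiM_component[rotated])
    have [measurable]: "(\<lambda>x. x i) \<in> PiM I (\<lambda>_. M) \<rightarrow>\<^sub>M M" using i by measurable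
    have "integrable (distr (PiM I (\<lambda>_. M)) M (\<lambda>x. x i)) (\<lambda>x. (f x)\<^sup>2)"
      "(\<integral>x. (f x)\<^sup>2 \<partial>(distr (PiM I (\<lambda>_. M)) M (\<lambda>x. x i))) = (\<integral>x. (f x)\<^sup>2 \<partial>M)"
      using f2 d by simp_all
    then show ?thesis by (simp add: integrable_distr_eq integral_distr power2_eq_square)
  qed
  have all: "integrable (PiM I (\<lambda>_. M)) (\<lambda>x. f (x i) * f (x j))" if "i \<in> J" "j \<in> J" for i j
    using that J ne[of i j] eq[of i] by (cases "i = j") auto
  have exp: "(\<lambda>x. (\<Sum>j\<in>J. f (x j))\<^sup>2) = (\<lambda>x. \<Sum>i\<in>J. \<Sum>j\<in>J. f (x i) * f (x j))"
    by (simp add: power2_eq_square sum_product)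
  show "integrable (PiM I (\<lambda>_. M)) (\<lambda>x. (\<Sum>j\<in>J. f (x j))\<^sup>2)"
    unfolding exp using all by (intro Bochner_Integration.integrable_sum) auto
  have "(\<integral>x. (\<Sum>j\<in>J. f (x j))\<^sup>2 \<partial>PiM I (\<lambda>_. M)) = (\<Sum>i\<in>J. \<Sum>j\<in>J. \<integral>x. f (x i) * f (x j) \<partial>PiM I (\<lambda>_. M))"
    unfolding exp using all by (simp add: Bochner_Integration.integral_sum)
  also have "\<dots> = (\<Sum>i\<in>J. \<Sum>j\<in>J. if j = i then (\<integral>x. (f x)\<^sup>2 \<partial>M) else 0)"
    using J ne eq by (intro sum.cong refl) (auto simp: subset_iff)
  also have "\<dots> = card J * (\<integral>x. (f x)\<^sup>2 \<partial>M)" using fJ by simp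
  finally show "(\<integral>x. (\<Sum>j\<in>J. f (x j))\<^sup>2 \<partial>PiM I (\<lambda>_. M)) = card J * (\<integral>x. (f x)\<^sup>2 \<partial>M)" .
qed

subsection \<open>Gaussian blocks\<close>

definition gauss :: "real \<Rightarrow> real measure" where
  "gauss v = density lborel (normal_density 0 (sqrt v))"

definition gauss_density :: "real \<Rightarrow> nat \<Rightarrow> (nat \<Rightarrow> real) \<Rightarrow> real" where
  "gauss_density v n x = (\<Prod>i<n. normal_density 0 (sqrt v) (x i))"

abbreviation blk :: "nat \<Rightarrow> (nat \<Rightarrow> real) measure" where
  "blk n \<equiv> Pi\<^sub>M {..<n} (\<lambda>_. borel)"

abbreviation \<G> :: "real \<Rightarrow> nat \<Rightarrow> (nat \<Rightarrow> real) measure" where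
  "\<G> \<equiv> gaussian_block"

abbreviation lborel_block :: "nat \<Rightarrow> (nat \<Rightarrow> real) measure" where
  "lborel_block n \<equiv> Pi\<^sub>M {..<n} (\<lambda>_. lborel)"

lemma gaussian_block_eq: "\<G> v n = PiM {..<n} (\<lambda>_. gauss v)"
  by (simp add: gaussian_block_def gauss_def)

lemma sets_gauss[simp, measurable_cong]: "sets (gauss v) = sets borel"
  by (simp add: gauss_def)

lemma space_gauss[simp]: "space (gauss v) = UNIV"
  by (simp add: gauss_def)

lemma sets_gaussian_block[simp, measurable_cong]: "sets (\<G> v n) = sets (blk n)"
  unfolding gaussian_block_eq by (intro sets_PiM_cong) auto

lemma space_gaussian_block[simp]: "space (\<G> v n) = space (blk n)"
  by (rule sets_eq_imp_space_eq) simp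

lemma sets_lborel_block[simp, measurable_cong]: "sets (lborel_block n) = sets (blk n)"
  by (intro sets_PiM_cong) auto

lemma space_lborel_block[simp]: "space (lborel_block n) = space (blk n)"
  by (rule sets_eq_imp_space_eq) simp

lemma prob_space_gauss: "0 < v \<Longrightarrow> prob_space (gauss v)"
  unfolding gauss_def by (rule prob_space_normal_density) simp

lemma prob_space_gaussian_block: "0 < v \<Longrightarrow> prob_space (\<G> v n)"
  unfolding gaussian_block_eq by (intro prob_space_PiM prob_space_gauss)

lemma sigma_finite_lborel_block: "sigma_finite_measure (lborel_block n)"
  by (intro product_sigma_finite.sigma_finite product_sigma_finite_const)
     (auto intro: lborel.sigma_finite_measure_axioms)

lemma measurable_block_restrict[measurable (raw)]:
  "(\<And>i. i < n \<Longrightarrow> (\<lambda>x. f x i) \<in> borel_measurable M) \<Longrightarrow> (\<lambda>x. \<lambda>i\<in>{..<n}. f x i) \<in> M \<rightarrow>\<^sub>M blk n"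
  by (rule measurable_restrict) auto

lemma measurable_gauss_density[measurable (raw)]:
  "(\<And>i. i < n \<Longrightarrow> (\<lambda>x. f x i) \<in> borel_measurable M) \<Longrightarrow> (\<lambda>x. gauss_density v n (f x)) \<in> borel_measurable M"
  unfolding gauss_density_def
  by (intro borel_measurable_prod measurable_compose[OF _ borel_measurable_normal_density]) auto

lemma gauss_density_pos: "0 < v \<Longrightarrow> 0 < gauss_density v n x"
  unfolding gauss_density_def by (intro prod_pos) (auto intro: normal_density_pos)

lemma gauss_density_nonneg[simp]: "0 \<le> gauss_density v n x"
  unfolding gauss_density_def by (intro prod_nonneg) auto

lemma gauss_density_cong: "(\<And>i. i < n \<Longrightarrow> x i = y i) \<Longrightarrow> gauss_density v n x = gauss_density v n y"
  unfolding gauss_density_def by (intro prod.cong) auto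

lemma ln_gauss_density:
  assumes "0 < v"
  shows "ln (gauss_density v n x) = - (n / 2) * ln (2 * pi * v) - (\<Sum>i<n. (x i)\<^sup>2) / (2 * v)"
proof -
  have 1: "ln (normal_density 0 (sqrt v) t) = - (1/2) * ln (2 * pi * v) - t\<^sup>2 / (2 * v)" for t
    using assms by (simp add: normal_density_def ln_mult ln_div ln_sqrt)
  have nz: "normal_density 0 (sqrt v) t \<noteq> 0" for t
    using normal_density_pos[of "sqrt v" 0 t] assms by simp
  have "ln (gauss_density v n x) = (\<Sum>i<n. ln (normal_density 0 (sqrt v) (x i)))"
    unfolding gauss_density_def using nz by (intro ln_prod) auto
  also have "\<dots> = - (n / 2) * ln (2 * pi * v) - (\<Sum>i<n. (x i)\<^sup>2) / (2 * v)"
    unfolding 1 by (simp add: sum_subtractf sum_divide_distrib algebra_simps)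
  finally show ?thesis .
qed

lemma gaussian_block_density:
  assumes "0 < v"
  shows "\<G> v n = density (lborel_block n) (gauss_density v n)"
proof -
  have "density (lborel_block n) (\<lambda>x. \<Prod>i<n. ennreal (normal_density 0 (sqrt v) (x i))) = \<G> v n"
    unfolding gaussian_block_def
  proof (rule PiM_density)
    show "sigma_finite_measure (density lborel (\<lambda>x. ennreal (normal_density 0 (sqrt v) x)))"
      using prob_space_gauss[OF assms] unfolding gauss_def
      by (simp add: prob_space_imp_sigma_finite)
  qed (auto intro: lborel.sigma_finite_measure_axioms)
  then show ?thesis by (simp add: gauss_density_def prod_ennreal)
qed

lemma nn_integral_gaussian_block:
  assumes "0 < v" "F \<in> borel_measurable (blk n)"
  shows "(\<integral>\<^sup>+ x. F x \<partial>\<G> v n) = (\<integral>\<^sup>+ x. ennreal (gauss_density v n x) * F x \<partial>lborel_block n)"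
proof -
  have [measurable]: "F \<in> borel_measurable (lborel_block n)" 
    using assms(2) by (simp cong: measurable_cong_sets)
  show ?thesis unfolding gaussian_block_density[OF assms(1)] by (subst nn_integral_density) auto
qed

section \<open>Translations and convolutions of Gaussian blocks\<close>

lemma nn_integral_lborel_block_translate:
  assumes F: "F \<in> borel_measurable (blk n)"
  shows "(\<integral>\<^sup>+ x. F (\<lambda>i\<in>{..<n}. x i + t i) \<partial>lborel_block n) = (\<integral>\<^sup>+ x. F x \<partial>lborel_block n)"
proof -
  have [measurable]: "F \<in> borel_measurable (lborel_block n)" 
    using F by (simp cong: measurable_cong_sets)
  have "(\<integral>\<^sup>+ x. F x \<partial>lborel_block n) = (\<integral>\<^sup>+ x. F x \<partial>distr (lborel_block n) (lborel_block n) (\<lambda>x. \<lambda>i\<in>{..<n}. x i + t i))"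
    by (simp add: distr_PiM_translate)
  also have "\<dots> = (\<integral>\<^sup>+ x. F (\<lambda>i\<in>{..<n}. x i + t i) \<partial>lborel_block n)"
    by (rule nn_integral_distr) measurable
  finally show ?thesis by simp
qed

text \<open>Passes between the two descriptions of an additive channel: a density centred at the
  signal \<open>m\<close>, and Gaussian noise added to \<open>m\<close>.\<close>

lemma nn_integral_gauss_density_shift:
  assumes v: "0 < v" and F[measurable]: "F \<in> borel_measurable (blk n)"
  shows "(\<integral>\<^sup>+ x. ennreal (gauss_density v n (\<lambda>i. x i - m i)) * F x \<partial>lborel_block n)
    = (\<integral>\<^sup>+ x. F (\<lambda>i\<in>{..<n}. x i + m i) \<partial>\<G> v n)"
proof -
  have "(\<integral>\<^sup>+ x. ennreal (gauss_density v n (\<lambda>i. x i - m i)) * F x \<partial>lborel_block n)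
    = (\<integral>\<^sup>+ x. ennreal (gauss_density v n (\<lambda>i. (\<lambda>i\<in>{..<n}. x i + m i) i - m i)) * F (\<lambda>i\<in>{..<n}. x i + m i) \<partial>lborel_block n)"
    by (subst nn_integral_lborel_block_translate[symmetric, where t=m]) auto
  also have "\<dots> = (\<integral>\<^sup>+ x. ennreal (gauss_density v n x) * F (\<lambda>i\<in>{..<n}. x i + m i) \<partial>lborel_block n)"
    by (intro nn_integral_cong arg_cong2[where f="(*)"] arg_cong[where f=ennreal] gauss_density_cong) auto
  also have "\<dots> = (\<integral>\<^sup>+ x. F (\<lambda>i\<in>{..<n}. x i + m i) \<partial>\<G> v n)"
    by (subst nn_integral_gaussian_block) (auto simp: v)
  finally show ?thesis .
qed

lemma nn_integral_gauss_density:
  assumes v: "0 < v"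
  shows "(\<integral>\<^sup>+ x. ennreal (gauss_density v n (\<lambda>i. x i - m i)) \<partial>lborel_block n) = 1"
proof -
  interpret prob_space "\<G> v n" using v by (rule prob_space_gaussian_block)
  show ?thesis using nn_integral_gauss_density_shift[OF v, of "\<lambda>_. 1" n m] emeasure_space_1 by simp
qed

text \<open>For \<open>c \<noteq> 0\<close> the variable \<open>c * y\<close> is again Gaussian and
  this is a convolution of two densities; for \<open>c = 0\<close> that variable has no density, and
  the integrand is constant.\<close>

lemma nn_integral_normal_density_conv:
  assumes [arith]: "0 < a" "0 < d"
  shows "(\<integral>\<^sup>+ y. ennreal (normal_density 0 (sqrt a) (u - c * y)) \<partial>gauss d) = ennreal (normal_density 0 (sqrt (a + c\<^sup>2 * d)) u)"
proof (cases "c = 0")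
  case True
  interpret prob_space "gauss d" by (rule prob_space_gauss) simp
  show ?thesis using True emeasure_space_1 by simp
next
  case False
  interpret prob_space "gauss d" by (rule prob_space_gauss) simp
  have "distributed (gauss d) lborel (\<lambda>y. y) (normal_density 0 (sqrt d))"
    unfolding distributed_def gauss_def by (auto simp: distr_id2)
  from normal_density_affine[OF this, of c 0] False
  have "distributed (gauss d) lborel (\<lambda>y. c * y) (normal_density 0 (\<bar>c\<bar> * sqrt d))" by simp
  then have "(\<integral>\<^sup>+ y. ennreal (normal_density 0 (\<bar>c\<bar> * sqrt d) y) * ennreal (normal_density 0 (sqrt a) (u - y)) \<partial>lborel)
    = (\<integral>\<^sup>+ y. ennreal (normal_density 0 (sqrt a) (u - c * y)) \<partial>gauss d)"
    by (intro distributed_nn_integral) auto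
  moreover have "(\<integral>\<^sup>+ y. ennreal (normal_density 0 (\<bar>c\<bar> * sqrt d) y) * ennreal (normal_density 0 (sqrt a) (u - y)) \<partial>lborel)
     = ennreal (normal_density 0 (sqrt ((sqrt a)\<^sup>2 + (\<bar>c\<bar> * sqrt d)\<^sup>2)) u)"
    using fun_cong[OF conv_normal_density_zero_mean[of "sqrt a" "\<bar>c\<bar> * sqrt d"], of u] False
    by (simp add: ennreal_mult' mult.commute)
  ultimately show ?thesis by (simp add: power_mult_distrib)
qed

lemma nn_integral_gauss_density_conv:
  assumes "0 < a" "0 < d"
  shows "(\<integral>\<^sup>+ y. ennreal (gauss_density a n (\<lambda>i. u i - c * y i)) \<partial>\<G> d n) = ennreal (gauss_density (a + c\<^sup>2 * d) n u)"
proof -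
  interpret product_sigma_finite "\<lambda>_. gauss d"
    using assms(2) by (intro product_sigma_finite_const prob_space_imp_sigma_finite prob_space_gauss)
  have "(\<integral>\<^sup>+ y. ennreal (gauss_density a n (\<lambda>i. u i - c * y i)) \<partial>\<G> d n)
    = (\<integral>\<^sup>+ y. (\<Prod>i<n. ennreal (normal_density 0 (sqrt a) (u i - c * y i))) \<partial>PiM {..<n} (\<lambda>_. gauss d))"
    unfolding gauss_density_def gaussian_block_eq by (simp add: prod_ennreal)
  also have "\<dots> = (\<Prod>i<n. \<integral>\<^sup>+ y. ennreal (normal_density 0 (sqrt a) (u i - c * y)) \<partial>gauss d)"
    by (rule product_nn_integral_prod) (simp, measurable)
  also have "\<dots> = ennreal (gauss_density (a + c\<^sup>2 * d) n u)"
    by (simp add: nn_integral_normal_density_conv[OF assms] gauss_density_def prod_ennreal)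
  finally show ?thesis .
qed

lemma distr_gauss_scale:
  assumes "0 < a" "p \<noteq> 0"
  shows "distr (gauss a) borel (\<lambda>x. p * x) = gauss (p\<^sup>2 * a)"
proof -
  interpret prob_space "gauss a" using assms by (intro prob_space_gauss) simp
  have "distributed (gauss a) lborel (\<lambda>y. y) (normal_density 0 (sqrt a))"
    unfolding distributed_def gauss_def by (auto simp: distr_id2)
  from normal_density_affine[OF this, of p 0] assms
  have "distributed (gauss a) lborel (\<lambda>y. p * y) (normal_density 0 (\<bar>p\<bar> * sqrt a))" by simp
  then have "distr (gauss a) lborel (\<lambda>y. p * y) = density lborel (normal_density 0 (\<bar>p\<bar> * sqrt a))"
    by (rule distributed_distr_eq_density)
  then show ?thesis by (simp add: gauss_def real_sqrt_mult cong: distr_cong)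
qed

text \<open>Only \<open>p\<close> has to be nonzero: the first summand alone supplies a density,
  which the second merely averages. Allowing \<open>q = 0\<close> later covers equal noise variances
  without a special case.\<close>

lemma distr_gauss_linear:
  assumes "0 < a" "0 < d" "p \<noteq> 0"
  shows "distr (gauss a \<Otimes>\<^sub>M gauss d) borel (\<lambda>w. p * fst w + q * snd w) = gauss (p\<^sup>2 * a + q\<^sup>2 * d)"
proof -
  have pa: "0 < p\<^sup>2 * a" using assms by simp
  interpret A: prob_space "gauss a" using assms by (intro prob_space_gauss) simp
  interpret D: prob_space "gauss d" using assms by (intro prob_space_gauss) simp
  interpret PA: prob_space "gauss (p\<^sup>2 * a)" using pa by (intro prob_space_gauss) simp
  interpret AD: pair_prob_space "gauss a" "gauss d" ..
  interpret DL: pair_sigma_finite "gauss d" "lborel :: real measure" ..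
  show ?thesis
  proof (rule measure_eqI)
    fix E assume "E \<in> sets (distr (gauss a \<Otimes>\<^sub>M gauss d) borel (\<lambda>w. p * fst w + q * snd w))"
    then have E[measurable]: "E \<in> sets borel" by simp
    have "emeasure (distr (gauss a \<Otimes>\<^sub>M gauss d) borel (\<lambda>w. p * fst w + q * snd w)) E
      = (\<integral>\<^sup>+ w. indicator E (p * fst w + q * snd w) \<partial>(gauss a \<Otimes>\<^sub>M gauss d))"
      by (rule emeasure_distr_eq_nn_integral) auto
    also have "\<dots> = (\<integral>\<^sup>+ y. \<integral>\<^sup>+ x. indicator E (p * x + q * y) \<partial>gauss a \<partial>gauss d)"
      by (subst AD.nn_integral_snd[symmetric]) auto
    also have "\<dots> = (\<integral>\<^sup>+ y. \<integral>\<^sup>+ x. indicator E (x + q * y) \<partial>gauss (p\<^sup>2 * a) \<partial>gauss d)"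
      unfolding distr_gauss_scale[OF assms(1,3), symmetric] by (subst nn_integral_distr) measurable
    also have "\<dots> = (\<integral>\<^sup>+ y. \<integral>\<^sup>+ u. ennreal (normal_density 0 (sqrt (p\<^sup>2 * a)) (u - q * y)) * indicator E u \<partial>lborel \<partial>gauss d)"
    proof (intro nn_integral_cong)
      fix y :: real
      have "(\<integral>\<^sup>+ x. indicator E (x + q * y) \<partial>gauss (p\<^sup>2 * a)) = (\<integral>\<^sup>+ x. ennreal (normal_density 0 (sqrt (p\<^sup>2 * a)) x) * indicator E (x + q * y) \<partial>lborel)"
        unfolding gauss_def by (subst nn_integral_density) auto
      also have "\<dots> = (\<integral>\<^sup>+ u. ennreal (normal_density 0 (sqrt (p\<^sup>2 * a)) (u - q * y)) * indicator E u \<partial>lborel)"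
        by (subst lborel_distr_plus[of "q * y", symmetric], subst nn_integral_distr) (auto simp: add.commute)
      finally show "(\<integral>\<^sup>+ x. indicator E (x + q * y) \<partial>gauss (p\<^sup>2 * a)) = (\<integral>\<^sup>+ u. ennreal (normal_density 0 (sqrt (p\<^sup>2 * a)) (u - q * y)) * indicator E u \<partial>lborel)" .
    qed
    also have "\<dots> = (\<integral>\<^sup>+ u. \<integral>\<^sup>+ y. ennreal (normal_density 0 (sqrt (p\<^sup>2 * a)) (u - q * y)) * indicator E u \<partial>gauss d \<partial>lborel)"
      by (rule DL.Fubini'[symmetric]) measurable
    also have "\<dots> = (\<integral>\<^sup>+ u. ennreal (normal_density 0 (sqrt (p\<^sup>2 * a + q\<^sup>2 * d)) u) * indicator E u \<partial>lborel)"
      using nn_integral_normal_density_conv[OF pa assms(2)] by (subst nn_integral_multc) auto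
    also have "\<dots> = emeasure (gauss (p\<^sup>2 * a + q\<^sup>2 * d)) E"
      unfolding gauss_def by (subst emeasure_density) auto
    finally show "emeasure (distr (gauss a \<Otimes>\<^sub>M gauss d) borel (\<lambda>w. p * fst w + q * snd w)) E = emeasure (gauss (p\<^sup>2 * a + q\<^sup>2 * d)) E" .
  qed simp
qed

lemma distr_gaussian_block_linear:
  assumes "0 < a" "0 < d" "p \<noteq> 0"
  shows "distr (\<G> a n \<Otimes>\<^sub>M \<G> d n) (blk n) (\<lambda>w. \<lambda>i\<in>{..<n}. p * fst w i + q * snd w i)
    = \<G> (p\<^sup>2 * a + q\<^sup>2 * d) n"
  using distr_pair_PiM[where I="{..<n}" and A="gauss a" and B="gauss d" and C=borel and f="\<lambda>w. p * fst w + q * snd w"]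
    distr_gauss_linear[OF assms, of q] assms
  by (simp add: prob_space_gauss gaussian_block_eq)

text \<open>Merges two independent blocks into one of the combined variance, so that events about
  sums of input, state and noise become events about a single Gaussian block.\<close>

lemma nn_integral_gaussian_block_linear:
  assumes "0 < a" "0 < d" "p \<noteq> 0" and F[measurable]: "F \<in> borel_measurable (blk n)"
  shows "(\<integral>\<^sup>+ x. \<integral>\<^sup>+ y. F (\<lambda>i\<in>{..<n}. p * x i + q * y i) \<partial>\<G> d n \<partial>\<G> a n)
    = (\<integral>\<^sup>+ u. F u \<partial>\<G> (p\<^sup>2 * a + q\<^sup>2 * d) n)"
proof -
  interpret D: prob_space "\<G> d n" using assms by (intro prob_space_gaussian_block) simp
  have m: "(\<lambda>w. \<lambda>i\<in>{..<n}. p * fst w i + q * snd w i) \<in> \<G> a n \<Otimes>\<^sub>M \<G> d n \<rightarrow>\<^sub>M blk n"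
    by measurable
  have "(\<integral>\<^sup>+ u. F u \<partial>\<G> (p\<^sup>2 * a + q\<^sup>2 * d) n)
      = (\<integral>\<^sup>+ w. F (\<lambda>i\<in>{..<n}. p * fst w i + q * snd w i) \<partial>(\<G> a n \<Otimes>\<^sub>M \<G> d n))"
    unfolding distr_gaussian_block_linear[OF assms(1-3), symmetric] by (rule nn_integral_distr[OF m]) simp
  also have "\<dots> = (\<integral>\<^sup>+ x. \<integral>\<^sup>+ y. F (\<lambda>i\<in>{..<n}. p * x i + q * y i) \<partial>\<G> d n \<partial>\<G> a n)"
    by (subst D.nn_integral_fst[symmetric]) auto
  finally show ?thesis by simp
qed

section \<open>Moments, and the weak law for the power of a Gaussian block\<close>

lemma gauss_moments:
  assumes "0 < v"
  shows "integrable (gauss v) (\<lambda>x. x ^ k)" "(\<integral>x. x \<partial>gauss v) = 0" "(\<integral>x. x\<^sup>2 \<partial>gauss v) = v"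
proof -
  show "integrable (gauss v) (\<lambda>x. x ^ k)"
    using integrable_normal_moment[of "sqrt v" 0 k] assms unfolding gauss_def by (subst integrable_density) auto
  show "(\<integral>x. x \<partial>gauss v) = 0" 
    using integral_normal_moment_nz_1[of "sqrt v" 0] assms unfolding gauss_def by (subst integral_density) auto
  show "(\<integral>x. x\<^sup>2 \<partial>gauss v) = v"
    using integral_normal_moment_even[of "sqrt v" 0 1] assms unfolding gauss_def by (subst integral_density) auto
qed

text \<open>The only typicality measure of the proof: logarithms of Gaussian densities depend on a
  block through its sum of squares alone.\<close>

definition norm_tail :: "real \<Rightarrow> real \<Rightarrow> nat \<Rightarrow> real" where
  "norm_tail v \<eta> n = measure (\<G> v n) {x \<in> space (blk n). \<bar>(\<Sum>i<n. (x i)\<^sup>2) - n * v\<bar> \<ge> n * \<eta>}"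

text \<open>Chebyshev's inequality, as the fourth moment is finite. Its rate 1/n suffices: these
  tails are never multiplied by the number of codewords, competing codewords being handled by
  Markov's inequality.\<close>

lemma norm_tail_tendsto_0:
  assumes v: "0 < v" and \<eta>: "0 < \<eta>"
  shows "(\<lambda>n. norm_tail v \<eta> n) \<longlonglongrightarrow> 0"
proof -
  interpret G: prob_space "gauss v" using v by (rule prob_space_gauss)
  define K where "K = (\<integral>x. (x\<^sup>2 - v)\<^sup>2 \<partial>gauss v)"
  have i1: "integrable (gauss v) (\<lambda>x. x\<^sup>2 - v)" using gauss_moments(1)[OF v] by auto
  have i2: "integrable (gauss v) (\<lambda>x. (x\<^sup>2 - v)\<^sup>2)"
  proof -
    have "integrable (gauss v) (\<lambda>x. x ^ 4 - 2 * v * x\<^sup>2 + v\<^sup>2)"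
      using gauss_moments(1)[OF v] by (intro Bochner_Integration.integrable_add Bochner_Integration.integrable_diff integrable_mult_right) auto
    then show ?thesis by (simp add: power2_eq_square power4_eq_xxxx algebra_simps)
  qed
  have i0: "(\<integral>x. x\<^sup>2 - v \<partial>gauss v) = 0"
    using gauss_moments[OF v] by (subst Bochner_Integration.integral_diff) (use G.prob_space in auto)
  have bound: "norm_tail v \<eta> n \<le> K / \<eta>\<^sup>2 * inverse (real n)" if n: "n > 0" for n
  proof -
    interpret B: prob_space "\<G> v n" using v by (rule prob_space_gaussian_block)
    note S = integral_PiM_sum_power2[OF _ G.prob_space_axioms order_refl i1 i2 i0, of "{..<n}", folded gaussian_block_eq K_def]
    have s: "(\<Sum>j<n. (x j)\<^sup>2 - v) = (\<Sum>i<n. (x i)\<^sup>2) - n * v" for x :: "nat \<Rightarrow> real"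
      by (simp add: sum_subtractf)
    have "norm_tail v \<eta> n = measure (\<G> v n) {x \<in> space (\<G> v n). (n * \<eta>)\<^sup>2 \<le> ((\<Sum>i<n. (x i)\<^sup>2) - n * v)\<^sup>2}"
      unfolding norm_tail_def using \<eta> by (intro arg_cong2[where f=measure] Collect_cong) (auto simp: abs_le_square_iff[symmetric])
    also have "\<dots> \<le> (\<integral>x. ((\<Sum>i<n. (x i)\<^sup>2) - n * v)\<^sup>2 \<partial>\<G> v n) / (n * \<eta>)\<^sup>2"
      using S n \<eta> by (intro integral_Markov_inequality_measure[where A="{}"]) (auto simp: s)
    also have "\<dots> = K / \<eta>\<^sup>2 * inverse (real n)"
      using S(2) n \<eta> unfolding s by (simp add: power_mult_distrib) (simp add: field_simps power2_eq_square)
    finally show ?thesis .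
  qed
  show ?thesis
  proof (rule tendsto_sandwich[where f="\<lambda>_. 0" and h="\<lambda>n. K / \<eta>\<^sup>2 * inverse (real n)"])
    show "(\<lambda>n. K / \<eta>\<^sup>2 * inverse (real n)) \<longlonglongrightarrow> 0"
      using tendsto_mult[OF tendsto_const lim_inverse_n, of "K / \<eta>\<^sup>2"] by simp
    show "\<forall>\<^sub>F n in sequentially. norm_tail v \<eta> n \<le> K / \<eta>\<^sup>2 * inverse (real n)"
      using bound by (auto intro!: eventually_sequentiallyI[of 1])
  qed (auto simp: norm_tail_def)
qed

subsection \<open>Soft covering\<close>

lemma nn_integral_PiM_component:
  assumes "prob_space M" "i \<in> I" and F[measurable]: "F \<in> borel_measurable M"
  shows "(\<integral>\<^sup>+ x. F (x i) \<partial>PiM I (\<lambda>_. M)) = (\<integral>\<^sup>+ u. F u \<partial>M)"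
proof -
  have m: "(\<lambda>x. x i) \<in> PiM I (\<lambda>_. M) \<rightarrow>\<^sub>M M" using assms(2) by measurable
  have "(\<integral>\<^sup>+ u. F u \<partial>M) = (\<integral>\<^sup>+ u. F u \<partial>distr (PiM I (\<lambda>_. M)) M (\<lambda>x. x i))"
    using assms by (subst distr_PiM_component) auto
  then show ?thesis using m by (simp add: nn_integral_distr)
qed

lemma nn_integral_PiM_two_components:
  assumes "finite I" "prob_space M" "i \<in> I" "j \<in> I" "i \<noteq> j" and F[measurable]: "F \<in> borel_measurable (M \<Otimes>\<^sub>M M)"
  shows "(\<integral>\<^sup>+ x. F (x i, x j) \<partial>PiM I (\<lambda>_. M)) = (\<integral>\<^sup>+ u. \<integral>\<^sup>+ v. F (u, v) \<partial>M \<partial>M)"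
proof -
  interpret prob_space M by fact
  have m: "(\<lambda>x. (x i, x j)) \<in> PiM I (\<lambda>_. M) \<rightarrow>\<^sub>M M \<Otimes>\<^sub>M M" using assms(3,4) by measurable
  have "(\<integral>\<^sup>+ x. F (x i, x j) \<partial>PiM I (\<lambda>_. M)) = (\<integral>\<^sup>+ p. F p \<partial>(M \<Otimes>\<^sub>M M))"
    using nn_integral_distr[OF m, of F] distr_PiM_two_components[OF assms(1-5)] by simp
  also have "\<dots> = (\<integral>\<^sup>+ u. \<integral>\<^sup>+ v. F (u, v) \<partial>M \<partial>M)" by (rule nn_integral_fst[symmetric]) fact
  finally show ?thesis .
qed

text \<open>A truncated second moment argument. Below the threshold \<open>\<gamma>\<close> the
  variance is at most \<open>\<gamma>\<close>, hence at most \<open>\<gamma> / card J\<close> for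
  the average; the inequality
  \<open>2 * \<bar>t\<bar> * \<rho> \<le> t\<^sup>2 + \<rho>\<^sup>2\<close> converts it into a
  first moment without square roots, and \<open>\<rho>\<close> is left to be optimised. The mass
  above the threshold counts twice: once in the average and once in the mean that truncation
  removes.\<close>

lemma soft_covering_pointwise:
  fixes f :: "'a \<Rightarrow> real" and \<gamma> \<rho> :: real
  assumes M: "prob_space M" and f[measurable]: "f \<in> borel_measurable M" and f0: "\<And>u. 0 \<le> f u"
    and f1: "(\<integral>\<^sup>+ u. ennreal (f u) \<partial>M) = 1"
    and I: "finite I" "J \<subseteq> I" "J \<noteq> {}" and \<gamma>: "0 \<le> \<gamma>" and \<rho>: "0 < \<rho>"
  shows "(\<integral>\<^sup>+ x. ennreal \<bar>(\<Sum>j\<in>J. f (x j)) / card J - 1\<bar> \<partial>PiM I (\<lambda>_. M))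
    \<le> 2 * (\<integral>\<^sup>+ u. ennreal (if \<gamma> < f u then f u else 0) \<partial>M) + ennreal ((\<gamma> / (card J * \<rho>) + \<rho>) / 2)"
proof -
  interpret M: prob_space M by fact
  interpret PI: prob_space "PiM I (\<lambda>_. M)" by (intro prob_space_PiM M)
  define m where "m = real (card J)"
  have fJ: "finite J" using I finite_subset by blast
  have m: "0 < m" using I fJ by (simp add: m_def card_gt_0_iff)
  have fi: "integrable M f" using f0 f1 by (intro integrableI_nonneg) auto
  have fe: "(\<integral>u. f u \<partial>M) = 1" using f0 f1 by (simp add: integral_eq_nn_integral)
  \<comment> \<open>The bounded part \<open>g\<close> is controlled by its variance, the exceptional part \<open>h\<close> by its mass.\<close>
  define g h where "g u = (if \<gamma> < f u then 0 else f u)" and "h u = (if \<gamma> < f u then f u else 0)" for u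
  have gm[measurable]: "g \<in> borel_measurable M" and hm[measurable]: "h \<in> borel_measurable M"
    unfolding g_def[abs_def] h_def[abs_def] by measurable
  have g0: "0 \<le> g u" "g u \<le> \<gamma>" and h0: "0 \<le> h u" and gh: "f u = g u + h u" for u
    using f0 \<gamma> by (auto simp: g_def h_def)
  have gi: "integrable M g" using g0 by (intro M.integrable_const_bound[where B=\<gamma>]) auto
  have hi: "integrable M h" using h0 gh g0
    by (intro Bochner_Integration.integrable_bound[OF fi]) auto
  define a c where "a = (\<integral>u. g u \<partial>M)" and "c = (\<integral>u. h u \<partial>M)"
  have ac: "a + c = 1" using fe Bochner_Integration.integral_add[OF gi hi] by (simp add: a_def c_def gh)
  have c0: "0 \<le> c" unfolding c_def using h0 by (intro Bochner_Integration.integral_nonneg) auto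
  have a1: "a \<le> 1" "0 \<le> a" using ac c0 g0 by (auto simp: a_def intro!: Bochner_Integration.integral_nonneg)
  have ga: "integrable M (\<lambda>u. g u - a)" using gi by auto
  have gb: "\<bar>g u - a\<bar> \<le> \<gamma> + 1" for u using g0[of u] a1 by auto
  have ga2: "integrable M (\<lambda>u. (g u - a)\<^sup>2)"
    using gb \<gamma> by (intro M.integrable_const_bound[where B="(\<gamma> + 1)\<^sup>2"]) (auto simp: abs_le_square_iff[symmetric] abs_of_nonneg[of "\<gamma> + 1"])
  have g2i: "integrable M (\<lambda>u. (g u)\<^sup>2)"
    using g0 by (intro M.integrable_const_bound[where B="\<gamma>\<^sup>2"]) (auto intro!: power_mono)
  have gz: "(\<integral>u. g u - a \<partial>M) = 0" using gi by (simp add: a_def M.prob_space)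
  \<comment> \<open>\<open>g \<le> \<gamma>\<close> gives
    \<open>g\<^sup>2 \<le> \<gamma> * g\<close>, and the mean of \<open>g\<close> is at most
    1.\<close>
  have var: "(\<integral>u. (g u - a)\<^sup>2 \<partial>M) \<le> \<gamma>"
  proof -
    have "(\<integral>u. (g u - a)\<^sup>2 \<partial>M) = (\<integral>u. (g u)\<^sup>2 \<partial>M) - a\<^sup>2"
      using M.variance_eq[OF gi g2i] by (simp add: a_def)
    also have "\<dots> \<le> (\<integral>u. (g u)\<^sup>2 \<partial>M)" by simp
    also have "\<dots> \<le> (\<integral>u. \<gamma> * g u \<partial>M)"
      using g0 gi g2i by (intro integral_mono) (auto simp: power2_eq_square mult_mono')
    also have "\<dots> \<le> \<gamma>" using gi a1 \<gamma> by (simp add: a_def[symmetric] mult_left_le)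
    finally show ?thesis .
  qed
  note S = integral_PiM_sum_power2[OF I(1) M I(2) ga ga2 gz]
  \<comment> \<open>Majorant of the deviation with three summands: the quadratic bound for the
    centred part, the mass above the threshold in the average, and the same mass missing from the
    mean.\<close>
  define R where "R x = ((\<Sum>j\<in>J. g (x j) - a)\<^sup>2 / (m\<^sup>2 * \<rho>) + \<rho>) / 2 + (\<Sum>j\<in>J. h (x j)) / m + c" for x
  have hcomp: "integrable (PiM I (\<lambda>_. M)) (\<lambda>x. h (x j)) \<and> (\<integral>x. h (x j) \<partial>PiM I (\<lambda>_. M)) = c" if "j \<in> J" for j
  proof -
    have j: "j \<in> I" using that I by auto
    have [measurable]: "(\<lambda>x. x j) \<in> PiM I (\<lambda>_. M) \<rightarrow>\<^sub>M M" using j by measurable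
    have d: "distr (PiM I (\<lambda>_. M)) M (\<lambda>x. x j) = M" using j M by (rule distr_PiM_component[rotated])
    have "integrable (distr (PiM I (\<lambda>_. M)) M (\<lambda>x. x j)) h" "(\<integral>x. h x \<partial>(distr (PiM I (\<lambda>_. M)) M (\<lambda>x. x j))) = c"
      using hi d by (simp_all add: c_def)
    then show ?thesis by (simp add: integrable_distr_eq integral_distr)
  qed
  have hs: "integrable (PiM I (\<lambda>_. M)) (\<lambda>x. \<Sum>j\<in>J. h (x j))" "(\<integral>x. (\<Sum>j\<in>J. h (x j)) \<partial>PiM I (\<lambda>_. M)) = m * c"
    using hcomp by (auto simp: Bochner_Integration.integral_sum m_def)
  have Ri: "integrable (PiM I (\<lambda>_. M)) R"
    unfolding R_def[abs_def] using S(1) hs(1) by auto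
  have Re: "(\<integral>x. R x \<partial>PiM I (\<lambda>_. M)) = 2 * c + ((m * (\<integral>u. (g u - a)\<^sup>2 \<partial>M)) / (m\<^sup>2 * \<rho>) + \<rho>) / 2"
    unfolding R_def using S hs m by (simp add: m_def[symmetric] PI.prob_space)
  have pw: "\<bar>(\<Sum>j\<in>J. f (x j)) / m - 1\<bar> \<le> R x" for x
  proof -
    have e: "(\<Sum>j\<in>J. f (x j)) / m - 1 = (\<Sum>j\<in>J. g (x j) - a) / m + (\<Sum>j\<in>J. h (x j)) / m - c"
      using m ac by (simp add: gh sum.distrib sum_subtractf m_def[symmetric] add_divide_distrib diff_divide_distrib)
    have p: "0 \<le> (\<Sum>j\<in>J. h (x j)) / m" using h0 m by (auto intro!: divide_nonneg_nonneg sum_nonneg)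
    define t where "t = (\<Sum>j\<in>J. g (x j) - a) / m"
    have "2 * \<bar>t\<bar> * \<rho> \<le> t\<^sup>2 + \<rho>\<^sup>2" using sum_squares_bound[of "\<bar>t\<bar>" \<rho>] by simp
    then have "\<bar>t\<bar> \<le> (t\<^sup>2 / \<rho> + \<rho>) / 2" using \<rho> by (simp add: field_simps power2_eq_square)
    moreover have "t\<^sup>2 / \<rho> = (\<Sum>j\<in>J. g (x j) - a)\<^sup>2 / (m\<^sup>2 * \<rho>)" by (simp add: t_def power_divide)
    ultimately have "\<bar>t\<bar> \<le> ((\<Sum>j\<in>J. g (x j) - a)\<^sup>2 / (m\<^sup>2 * \<rho>) + \<rho>) / 2" by simp
    then show ?thesis unfolding e R_def t_def[symmetric] using p c0 by linarith
  qed
  have "(\<integral>\<^sup>+ x. ennreal \<bar>(\<Sum>j\<in>J. f (x j)) / m - 1\<bar> \<partial>PiM I (\<lambda>_. M)) \<le> (\<integral>\<^sup>+ x. ennreal (R x) \<partial>PiM I (\<lambda>_. M))"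
    using pw by (intro nn_integral_mono ennreal_leI) auto
  also have "\<dots> = ennreal (\<integral>x. R x \<partial>PiM I (\<lambda>_. M))"
    using Ri pw by (intro nn_integral_eq_integral) (auto intro: order_trans[OF abs_ge_zero])
  also have "\<dots> \<le> ennreal (2 * c + (\<gamma> / (m * \<rho>) + \<rho>) / 2)"
  proof -
    have "(m * (\<integral>u. (g u - a)\<^sup>2 \<partial>M)) / (m\<^sup>2 * \<rho>) \<le> (m * \<gamma>) / (m\<^sup>2 * \<rho>)"
      using var m \<rho> by (intro divide_right_mono mult_left_mono) auto
    also have "\<dots> = \<gamma> / (m * \<rho>)" using m by (simp add: power2_eq_square)
    finally show ?thesis unfolding Re by (intro ennreal_leI add_left_mono divide_right_mono add_right_mono) auto
  qed
  also have "\<dots> = ennreal (2 * c) + ennreal ((\<gamma> / (m * \<rho>) + \<rho>) / 2)"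
    using c0 \<gamma> m \<rho> by (intro ennreal_plus) auto
  also have "ennreal (2 * c) = 2 * (\<integral>\<^sup>+ u. ennreal (h u) \<partial>M)"
    using hi h0 c0 by (subst nn_integral_eq_integral) (auto simp: c_def ennreal_mult')
  finally show ?thesis by (simp add: m_def h_def)
qed

text \<open>\<open>L (u, v)\<close> plays the likelihood ratio of an observation \<open>v\<close>
  for the codeword \<open>u\<close>. Its average over a bundle is then the density, relative to
  \<open>N\<close>, of the observation caused by a uniformly chosen codeword of the bundle. Tonelli
  reduces the claim to a fixed \<open>v\<close>.\<close>

lemma soft_covering:
  fixes L :: "'a \<times> 'b \<Rightarrow> real" and \<gamma> \<rho> :: real
  assumes M: "prob_space M" and N: "prob_space N" and L[measurable]: "L \<in> borel_measurable (M \<Otimes>\<^sub>M N)"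
    and L0: "\<And>p. 0 \<le> L p" and L1: "\<And>v. v \<in> space N \<Longrightarrow> (\<integral>\<^sup>+ u. ennreal (L (u, v)) \<partial>M) = 1"
    and I: "finite I" "J \<subseteq> I" "J \<noteq> {}" and \<gamma>: "0 \<le> \<gamma>" and \<rho>: "0 < \<rho>"
  shows "(\<integral>\<^sup>+ x. \<integral>\<^sup>+ v. ennreal \<bar>(\<Sum>j\<in>J. L (x j, v)) / card J - 1\<bar> \<partial>N \<partial>PiM I (\<lambda>_. M))
    \<le> 2 * (\<integral>\<^sup>+ v. \<integral>\<^sup>+ u. ennreal (if \<gamma> < L (u, v) then L (u, v) else 0) \<partial>M \<partial>N) + ennreal ((\<gamma> / (card J * \<rho>) + \<rho>) / 2)"
proof -
  interpret M: prob_space M by fact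
  interpret N: prob_space N by fact
  interpret PI: prob_space "PiM I (\<lambda>_. M)" by (intro prob_space_PiM M)
  interpret P: pair_prob_space "PiM I (\<lambda>_. M)" N ..
  interpret MN: pair_prob_space M N ..
  have m: "(\<lambda>p. L (fst p j, snd p)) \<in> borel_measurable (PiM I (\<lambda>_. M) \<Otimes>\<^sub>M N)" if "j \<in> J" for j
  proof -
    have "j \<in> I" using that I by auto
    then show ?thesis by measurable
  qed
  have m2: "(\<lambda>(x, v). ennreal \<bar>(\<Sum>j\<in>J. L (x j, v)) / card J - 1\<bar>) \<in> borel_measurable (PiM I (\<lambda>_. M) \<Otimes>\<^sub>M N)"
    using m by (simp add: split_beta')
  have "(\<integral>\<^sup>+ x. \<integral>\<^sup>+ v. ennreal \<bar>(\<Sum>j\<in>J. L (x j, v)) / card J - 1\<bar> \<partial>N \<partial>PiM I (\<lambda>_. M))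
    = (\<integral>\<^sup>+ v. \<integral>\<^sup>+ x. ennreal \<bar>(\<Sum>j\<in>J. L (x j, v)) / card J - 1\<bar> \<partial>PiM I (\<lambda>_. M) \<partial>N)"
    using m2 by (rule P.Fubini'[symmetric])
  also have "\<dots> \<le> (\<integral>\<^sup>+ v. 2 * (\<integral>\<^sup>+ u. ennreal (if \<gamma> < L (u, v) then L (u, v) else 0) \<partial>M) + ennreal ((\<gamma> / (card J * \<rho>) + \<rho>) / 2) \<partial>N)"
    using assms by (intro nn_integral_mono soft_covering_pointwise) auto
  also have "\<dots> = 2 * (\<integral>\<^sup>+ v. \<integral>\<^sup>+ u. ennreal (if \<gamma> < L (u, v) then L (u, v) else 0) \<partial>M \<partial>N) + ennreal ((\<gamma> / (card J * \<rho>) + \<rho>) / 2)"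
    by (subst nn_integral_add) (auto simp: nn_integral_cmult N.emeasure_space_1)
  finally show ?thesis .
qed

subsection \<open>Conditional entropy of a discrete variable\<close>

lemma nn_integral_count_space_pair:
  assumes A: "finite A" and T: "sigma_finite_measure T" and f[measurable]: "f \<in> borel_measurable (count_space A \<Otimes>\<^sub>M T)"
  shows "(\<integral>\<^sup>+ p. f p \<partial>(count_space A \<Otimes>\<^sub>M T)) = (\<Sum>w\<in>A. \<integral>\<^sup>+ v. f (w, v) \<partial>T)"
    and "(\<integral>\<^sup>+ p. f p \<partial>(count_space A \<Otimes>\<^sub>M T)) = (\<integral>\<^sup>+ v. (\<Sum>w\<in>A. f (w, v)) \<partial>T)"
proof -
  interpret T: sigma_finite_measure T by fact
  show 1: "(\<integral>\<^sup>+ p. f p \<partial>(count_space A \<Otimes>\<^sub>M T)) = (\<Sum>w\<in>A. \<integral>\<^sup>+ v. f (w, v) \<partial>T)"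
    using A by (simp add: T.nn_integral_fst[OF f, symmetric] nn_integral_count_space_finite)
  have "(\<lambda>v. f (w, v)) \<in> borel_measurable T" if "w \<in> A" for w
    using that by (intro measurable_compose[OF _ f] measurable_Pair) auto
  then show "(\<integral>\<^sup>+ p. f p \<partial>(count_space A \<Otimes>\<^sub>M T)) = (\<integral>\<^sup>+ v. (\<Sum>w\<in>A. f (w, v)) \<partial>T)"
    unfolding 1 by (intro nn_integral_sum[symmetric])
qed

text \<open>\<open>P / m\<close> is the share of \<open>p\<close> under a uniform message. Above
  this share the ratio \<open>r = m * p / P\<close> lies between 1 and \<open>m\<close>: the excess
  pays at most \<open>ln m\<close>, and the share itself pays \<open>ln r \<le> r - 1\<close>. Below
  it the left side is not positive. This converts an L1 distance into a loss of entropy.\<close>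

lemma mult_ln_ratio_le:
  fixes p P m :: real
  assumes "0 \<le> p" "p \<le> P" "1 \<le> m"
  shows "p * ln (m * p / P) \<le> (ln m + 1) * \<bar>p - P / m\<bar>"
proof (cases "p \<le> P / m")
  case True
  have "p * ln (m * p / P) \<le> 0"
  proof (cases "p = 0")
    case False
    then have "0 < p" "0 < P" using assms by auto
    then have "m * p / P \<le> 1" "0 < m * p / P" using True assms by (auto simp: field_simps)
    then show ?thesis using \<open>0 < p\<close> by (intro mult_nonneg_nonpos) auto
  qed simp
  moreover have "0 \<le> (ln m + 1) * \<bar>p - P / m\<bar>" using assms by simp
  ultimately show ?thesis by linarith
next
  case False
  then have p: "0 < p" "0 < P" using assms by (smt (verit) divide_nonneg_pos)+
  define r where "r = m * p / P"
  have r: "1 < r" "r \<le> m" using False p assms by (auto simp: r_def field_simps)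
  have pr: "p = (P / m) * r" using p assms by (simp add: r_def)
  have d: "0 \<le> p - P / m" using False by simp
  have "(p - P / m) * ln r \<le> (p - P / m) * ln m"
    using d r by (intro mult_left_mono) auto
  moreover have "(P / m) * ln r \<le> (P / m) * (r - 1)"
    using p assms r by (intro mult_left_mono ln_le_minus_one) auto
  moreover have "(P / m) * (r - 1) = p - P / m" by (simp add: pr right_diff_distrib)
  ultimately have "p * ln r \<le> (p - P / m) * (ln m + 1)" by (simp add: algebra_simps)
  then show ?thesis using d by (simp add: r_def mult.commute)
qed

text \<open>A finite variable observed through a general one. The finite alphabet makes the
  conditional entropy an integrable expression without moment conditions on
  \<open>Y\<close>.\<close>

locale discrete_conditional = information_space M b for M :: "'a measure" and b +
  fixes A :: "'w set" and T :: "'v measure" and X :: "'a \<Rightarrow> 'w" and Y :: "'a \<Rightarrow> 'v" and p :: "'w \<times> 'v \<Rightarrow> real"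
  assumes A: "finite A" "A \<noteq> {}" and T: "sigma_finite_measure T"
    and p_meas[measurable]: "p \<in> borel_measurable (count_space A \<Otimes>\<^sub>M T)"
    and p0: "\<And>x. 0 \<le> p x"
    and dist: "distributed M (count_space A \<Otimes>\<^sub>M T) (\<lambda>x. (X x, Y x)) p"
begin

abbreviation "CT \<equiv> count_space A \<Otimes>\<^sub>M T"

definition "marg v = (\<Sum>w\<in>A. p (w, v))"

lemma p_slice[measurable]: "w \<in> A \<Longrightarrow> (\<lambda>v. p (w, v)) \<in> borel_measurable T"
  by (intro measurable_compose[OF _ p_meas] measurable_Pair) auto

lemma marg_meas[measurable]: "marg \<in> borel_measurable T"
  unfolding marg_def[abs_def] by (intro borel_measurable_sum) (rule p_slice)

lemma marg_nonneg: "0 \<le> marg v" unfolding marg_def by (intro sum_nonneg p0)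

lemma p_le_marg: "w \<in> A \<Longrightarrow> p (w, v) \<le> marg v"
  unfolding marg_def using A p0 by (intro member_le_sum) auto

lemma dist_marg: "distributed M T Y marg"
proof -
  have "distributed M T Y (\<lambda>y. (\<integral>\<^sup>+x. ennreal (p (x, y)) \<partial>count_space A))"
    by (rule distr_marginal2[OF sigma_finite_measure_count_space_finite[OF A(1)] T dist])
  then show ?thesis using A p0 by (simp add: nn_integral_count_space_finite marg_def)
qed

lemma nn_integral_joint: "(\<integral>\<^sup>+ x. ennreal (p x) \<partial>CT) = 1"
proof -
  have "(\<integral>\<^sup>+ x. ennreal (p x) \<partial>CT) = emeasure (density CT p) (space CT)" 
    by (subst emeasure_density) (auto intro!: nn_integral_cong)
  also have "\<dots> = emeasure (distr M CT (\<lambda>x. (X x, Y x))) (space CT)"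
    using distributed_distr_eq_density[OF dist] by simp
  also have "\<dots> = 1"
    using prob_space.emeasure_space_1[OF prob_space_distr[OF distributed_measurable[OF dist]]] by simp
  finally show ?thesis .
qed

lemma p_int: "integrable CT p"
  using p0 nn_integral_joint by (intro integrableI_nonneg) auto

lemma p_integral: "(\<integral>x. p x \<partial>CT) = 1"
  using p0 nn_integral_joint by (simp add: integral_eq_nn_integral)

lemma nn_integral_marg: "(\<integral>\<^sup>+ v. ennreal (marg v) \<partial>T) = 1"
  unfolding nn_integral_count_space_pair(2)[OF A(1) T, of "\<lambda>x. ennreal (p x)", simplified nn_integral_joint, simplified]
  using nn_integral_joint nn_integral_count_space_pair(2)[OF A(1) T, of "\<lambda>x. ennreal (p x)"] p0 by (simp add: marg_def)

lemma marg_int: "integrable CT (\<lambda>x. marg (snd x))"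
  using nn_integral_count_space_pair(1)[OF A(1) T, of "\<lambda>x. ennreal (marg (snd x))"] nn_integral_marg marg_nonneg
  by (intro integrableI_nonneg) (auto simp: ennreal_of_nat_eq_real_of_nat)

text \<open>The inequality \<open>ln y \<le> y - 1\<close> at \<open>y = marg / p\<close>. Since
  \<open>marg\<close> has total mass \<open>card A\<close> on the product space, it is an integrable
  majorant.\<close>

lemma log_ratio_bound: "x \<in> space CT \<Longrightarrow> \<bar>p x * ln (p x / marg (snd x))\<bar> \<le> marg (snd x)"
proof -
  assume "x \<in> space CT"
  then obtain w v where x: "x = (w, v)" "w \<in> A" by (auto simp: space_pair_measure)
  show ?thesis
  proof (cases "p x = 0")
    case True then show ?thesis using marg_nonneg by simp
  next
    case False
    have pp: "0 < p x" using False p0[of x] by simp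
    have le: "p x \<le> marg (snd x)" using p_le_marg[of w v] x by simp
    have m: "0 < marg (snd x)" using pp le by simp
    have "ln (marg (snd x) / p x) \<le> marg (snd x) / p x - 1" using pp m by (intro ln_le_minus_one) auto
    then have "p x * ln (marg (snd x) / p x) \<le> marg (snd x) - p x" using pp by (simp add: field_simps)
    moreover have "ln (marg (snd x) / p x) = - ln (p x / marg (snd x))" using pp m by (simp add: ln_div)
    moreover have "0 \<le> p x * ln (marg (snd x) / p x)" using pp le by simp
    ultimately show ?thesis using pp by simp
  qed
qed

lemma log_ratio_int: "integrable CT (\<lambda>x. p x * ln (p x / marg (snd x)))"
  using log_ratio_bound marg_nonneg by (intro Bochner_Integration.integrable_bound[OF marg_int]) (auto intro!: AE_I2)

lemma cond_entropy_eq: "conditional_entropy b (count_space A) T X Y = - (\<integral>x. p x * ln (p x / marg (snd x)) \<partial>CT) / ln b"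
proof -
  have "conditional_entropy b (count_space A) T X Y = - (\<integral>(x, y). p (x, y) * log b (p (x, y) / marg y) \<partial>CT)"
    using A by (intro conditional_entropy_generic_eq sigma_finite_measure_count_space_finite T dist_marg dist p0 marg_nonneg)
  also have "\<dots> = - (\<integral>x. p x * ln (p x / marg (snd x)) / ln b \<partial>CT)"
    by (simp add: log_def split_beta')
  finally show ?thesis by simp
qed

lemma ln_base_pos: "0 < ln b" using b_gt_1 by simp

text \<open>Gibbs' inequality for a conditional test law, which may be defective. The floor
  \<open>\<kappa>\<close> bounds \<open>- ln q\<close>, so that the cross entropy is
  integrable.\<close>

lemma cond_entropy_upper:
  fixes \<kappa> :: real
  assumes q[measurable]: "q \<in> borel_measurable CT" and \<kappa>: "0 < \<kappa>"
    and qb: "\<And>x. x \<in> space CT \<Longrightarrow> \<kappa> \<le> q x" and qs: "\<And>v. v \<in> space T \<Longrightarrow> (\<Sum>w\<in>A. q (w, v)) \<le> 1"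
  shows "conditional_entropy b (count_space A) T X Y \<le> (\<integral>x. p x * (- ln (q x)) \<partial>CT) / ln b"
proof -
  have q1: "q x \<le> 1" if xs: "x \<in> space CT" for x
  proof -
    obtain w v where x: "x = (w, v)" "w \<in> A" "v \<in> space T" using xs by (auto simp: space_pair_measure)
    have "q (w, v) \<le> (\<Sum>w\<in>A. q (w, v))"
    proof (intro member_le_sum)
      fix w' assume "w' \<in> A - {w}"
      then have "\<kappa> \<le> q (w', v)" using x by (intro qb) (auto simp: space_pair_measure)
      then show "0 \<le> q (w', v)" using \<kappa> by simp
    qed (use x A in auto)
    then show ?thesis using qs[OF x(3)] x by simp
  qed
  have lnq: "integrable CT (\<lambda>x. p x * (- ln (q x)))"
  proof (rule Bochner_Integration.integrable_bound[where f="\<lambda>x. p x * \<bar>ln \<kappa>\<bar>"])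
    show "integrable CT (\<lambda>x. p x * \<bar>ln \<kappa>\<bar>)" using p_int by simp
    show "AE x in CT. norm (p x * (- ln (q x))) \<le> norm (p x * \<bar>ln \<kappa>\<bar>)"
    proof (intro AE_I2)
      fix x assume x: "x \<in> space CT"
      have q0: "0 < q x" using qb[OF x] \<kappa> by simp
      have "ln \<kappa> \<le> ln (q x)" "ln (q x) \<le> 0" using qb[OF x] q1[OF x] \<kappa> q0 by auto
      then show "norm (p x * (- ln (q x))) \<le> norm (p x * \<bar>ln \<kappa>\<bar>)" using p0[of x] by (auto simp: abs_mult intro!: mult_left_mono)
    qed
  qed measurable
  have mq: "(\<integral>\<^sup>+ x. ennreal (marg (snd x) * q x) \<partial>CT) \<le> 1"
  proof -
    have "(\<integral>\<^sup>+ x. ennreal (marg (snd x) * q x) \<partial>CT) = (\<integral>\<^sup>+ v. (\<Sum>w\<in>A. ennreal (marg v * q (w, v))) \<partial>T)"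
      by (subst nn_integral_count_space_pair(2)[OF A(1) T]) auto
    also have "\<dots> \<le> (\<integral>\<^sup>+ v. ennreal (marg v) \<partial>T)"
    proof (intro nn_integral_mono)
      fix v assume v: "v \<in> space T"
      have "(\<Sum>w\<in>A. ennreal (marg v * q (w, v))) = ennreal (\<Sum>w\<in>A. marg v * q (w, v))"
      proof (intro sum_ennreal)
        fix w assume "w \<in> A"
        then have "\<kappa> \<le> q (w, v)" using v by (intro qb) (auto simp: space_pair_measure)
        then show "0 \<le> marg v * q (w, v)" using marg_nonneg[of v] \<kappa> by simp
      qed
      also have "(\<Sum>w\<in>A. marg v * q (w, v)) = marg v * (\<Sum>w\<in>A. q (w, v))" by (simp add: sum_distrib_left)
      also have "\<dots> \<le> marg v" using qs[OF v] marg_nonneg by (simp add: mult_left_le)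
      finally show "(\<Sum>w\<in>A. ennreal (marg v * q (w, v))) \<le> ennreal (marg v)" by (simp add: ennreal_leI)
    qed
    finally show ?thesis using nn_integral_marg by simp
  qed
  have q0: "0 \<le> marg (snd x) * q x" if "x \<in> space CT" for x using qb[OF that] \<kappa> marg_nonneg[of "snd x"] by simp
  have mqi: "integrable CT (\<lambda>x. marg (snd x) * q x)"
    using mq q0 by (intro integrableI_nonneg) (auto intro!: AE_I2 simp: less_top[symmetric] top_unique)
  have mq1: "(\<integral>x. marg (snd x) * q x \<partial>CT) \<le> 1"
    using mq q0 mqi by (subst integral_eq_nn_integral) (auto intro!: AE_I2 enn2real_leI)
  \<comment> \<open>The pointwise inequality to be integrated is
    \<open>p - marg * q \<le> p * ln (p / (marg * q))\<close>; its left side has nonnegative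
    integral because \<open>marg * q\<close> has mass at most 1.\<close>
  have "0 \<le> (\<integral>x. p x \<partial>CT) - (\<integral>x. marg (snd x) * q x \<partial>CT)" using mq1 p_integral by simp
  also have "\<dots> = (\<integral>x. p x - marg (snd x) * q x \<partial>CT)" using p_int mqi by simp
  also have "\<dots> \<le> (\<integral>x. p x * ln (p x / marg (snd x)) + p x * (- ln (q x)) \<partial>CT)"
  proof (intro integral_mono)
    fix x assume x: "x \<in> space CT"
    show "p x - marg (snd x) * q x \<le> p x * ln (p x / marg (snd x)) + p x * (- ln (q x))"
    proof (cases "p x = 0")
      case True then show ?thesis using q0[OF x] by simp
    next
      case False
      obtain w v where xw: "x = (w, v)" "w \<in> A" using x by (auto simp: space_pair_measure)
      have pp: "0 < p x" using False p0[of x] by simp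
      have m: "0 < marg (snd x)" using pp p_le_marg[of w v] xw by simp
      have qq: "0 < q x" using qb[OF x] \<kappa> by simp
      have "ln (marg (snd x) * q x / p x) \<le> marg (snd x) * q x / p x - 1" using pp m qq by (intro ln_le_minus_one) auto
      then have "p x * ln (marg (snd x) * q x / p x) \<le> marg (snd x) * q x - p x" using pp by (simp add: field_simps)
      moreover have "ln (marg (snd x) * q x / p x) = - ln (p x / marg (snd x)) + ln (q x)" using pp m qq by (simp add: ln_div ln_mult)
      moreover have "p x * (- ln (p x / marg (snd x)) + ln (q x)) = - (p x * ln (p x / marg (snd x))) - p x * (- ln (q x))"
        by (simp add: ring_distribs)
      ultimately show ?thesis by simp
    qed
  qed (use p_int mqi log_ratio_int lnq in auto)
  also have "\<dots> = (\<integral>x. p x * ln (p x / marg (snd x)) \<partial>CT) + (\<integral>x. p x * (- ln (q x)) \<partial>CT)"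
    using log_ratio_int lnq by (rule Bochner_Integration.integral_add)
  finally show ?thesis unfolding cond_entropy_eq using ln_base_pos by (intro divide_right_mono) auto
qed

text \<open>A joint density close in L1 to a function of the observation alone forces a nearly
  uniform message. The message-free \<open>h\<close> is arbitrary; passing from it to the uniform
  share \<open>marg / card A\<close> costs a second \<open>D\<close>, hence the factor 2.\<close>

lemma cond_entropy_lower:
  fixes D :: real
  assumes h[measurable]: "h \<in> borel_measurable T" and D: "0 \<le> D" "(\<integral>\<^sup>+ x. ennreal \<bar>p x - h (snd x)\<bar> \<partial>CT) \<le> ennreal D"
  shows "log b (card A) - 2 * (ln (card A) + 1) * D / ln b \<le> conditional_entropy b (count_space A) T X Y"
proof -
  define m where "m = real (card A)"
  have m: "1 \<le> m" using A by (simp add: m_def card_gt_0_iff Suc_leI)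
  have "(\<integral>\<^sup>+ x. ennreal \<bar>h (snd x) - marg (snd x) / m\<bar> \<partial>CT) = ennreal m * (\<integral>\<^sup>+ v. ennreal \<bar>h v - marg v / m\<bar> \<partial>T)"
    by (subst nn_integral_count_space_pair(1)[OF A(1) T]) (auto simp: m_def ennreal_of_nat_eq_real_of_nat)
  also have "\<dots> = (\<integral>\<^sup>+ v. ennreal (m * \<bar>h v - marg v / m\<bar>) \<partial>T)"
    using m by (subst nn_integral_cmult[symmetric]) (auto simp: ennreal_mult')
  also have "\<dots> \<le> (\<integral>\<^sup>+ v. (\<Sum>w\<in>A. ennreal \<bar>p (w, v) - h v\<bar>) \<partial>T)"
  proof (intro nn_integral_mono)
    fix v
    have "m * \<bar>h v - marg v / m\<bar> = \<bar>m * (h v - marg v / m)\<bar>" using m by (simp add: abs_mult)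
    \<comment> \<open>Summed over the messages, the differences \<open>p (w, v) - h v\<close> give
      \<open>marg v - m * h v\<close>, so \<open>h\<close> is as close to the uniform share as it is
      to the joint density.\<close>
    also have "m * (h v - marg v / m) = - (\<Sum>w\<in>A. p (w, v) - h v)" using m by (simp add: sum_subtractf marg_def m_def algebra_simps)
    also have "\<bar>\<dots>\<bar> \<le> (\<Sum>w\<in>A. \<bar>p (w, v) - h v\<bar>)" by (simp only: abs_minus_cancel sum_abs)
    finally show "ennreal (m * \<bar>h v - marg v / m\<bar>) \<le> (\<Sum>w\<in>A. ennreal \<bar>p (w, v) - h v\<bar>)"
      by (subst sum_ennreal) (auto intro: ennreal_leI)
  qed
  also have "\<dots> = (\<integral>\<^sup>+ x. ennreal \<bar>p x - h (snd x)\<bar> \<partial>CT)"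
    by (subst nn_integral_count_space_pair(2)[OF A(1) T]) auto
  finally have 1: "(\<integral>\<^sup>+ x. ennreal \<bar>h (snd x) - marg (snd x) / m\<bar> \<partial>CT) \<le> ennreal D" using D by simp
  have "(\<integral>\<^sup>+ x. ennreal \<bar>p x - marg (snd x) / m\<bar> \<partial>CT) \<le> (\<integral>\<^sup>+ x. ennreal \<bar>p x - h (snd x)\<bar> + ennreal \<bar>h (snd x) - marg (snd x) / m\<bar> \<partial>CT)"
    by (intro nn_integral_mono) (auto simp: ennreal_plus[symmetric] simp del: ennreal_plus intro!: ennreal_leI)
  also have "\<dots> = (\<integral>\<^sup>+ x. ennreal \<bar>p x - h (snd x)\<bar> \<partial>CT) + (\<integral>\<^sup>+ x. ennreal \<bar>h (snd x) - marg (snd x) / m\<bar> \<partial>CT)"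
    by (intro nn_integral_add) measurable
  also have "\<dots> \<le> ennreal D + ennreal D" using D 1 by (intro add_mono)
  finally have 2: "(\<integral>\<^sup>+ x. ennreal \<bar>p x - marg (snd x) / m\<bar> \<partial>CT) \<le> ennreal (2 * D)"
    using D by (simp add: ennreal_plus[symmetric] del: ennreal_plus)
  have di: "integrable CT (\<lambda>x. \<bar>p x - marg (snd x) / m\<bar>)" using p_int marg_int by auto
  have d2: "(\<integral>x. \<bar>p x - marg (snd x) / m\<bar> \<partial>CT) \<le> 2 * D"
    using 2 D by (subst integral_eq_nn_integral) (auto intro!: enn2real_leI)
  have "(\<integral>x. p x * ln (p x / marg (snd x)) \<partial>CT) + ln m = (\<integral>x. p x * ln (p x / marg (snd x)) + p x * ln m \<partial>CT)"
    using log_ratio_int p_int p_integral by simp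
  also have "\<dots> \<le> (\<integral>x. (ln m + 1) * \<bar>p x - marg (snd x) / m\<bar> \<partial>CT)"
  proof (intro integral_mono)
    fix x assume x: "x \<in> space CT"
    obtain w v where xw: "x = (w, v)" "w \<in> A" using x by (auto simp: space_pair_measure)
    have le: "p x \<le> marg (snd x)" using p_le_marg[of w v] xw by simp
    have "p x * ln (p x / marg (snd x)) + p x * ln m = p x * ln (m * p x / marg (snd x))"
    proof (cases "p x = 0")
      case False
      then have "0 < p x" "0 < marg (snd x)" using p0[of x] le by auto
      then show ?thesis using m by (simp add: ln_div ln_mult algebra_simps)
    qed simp
    also have "\<dots> \<le> (ln m + 1) * \<bar>p x - marg (snd x) / m\<bar>" using p0 le m by (rule mult_ln_ratio_le)
    finally show "p x * ln (p x / marg (snd x)) + p x * ln m \<le> (ln m + 1) * \<bar>p x - marg (snd x) / m\<bar>" .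
  qed (use p_int log_ratio_int di in auto)
  also have "\<dots> = (ln m + 1) * (\<integral>x. \<bar>p x - marg (snd x) / m\<bar> \<partial>CT)" by simp
  also have "\<dots> \<le> (ln m + 1) * (2 * D)" using d2 m by (intro mult_left_mono) auto
  finally have "ln m - (ln m + 1) * (2 * D) \<le> - (\<integral>x. p x * ln (p x / marg (snd x)) \<partial>CT)" by simp
  from divide_right_mono[OF this, of "ln b"] ln_base_pos show ?thesis
    unfolding cond_entropy_eq m_def[symmetric] by (simp add: log_def diff_divide_distrib mult_ac)
qed

end

subsection \<open>The law induced by a code\<close>

declare One_nat_def [simp del]

text \<open>The output densities below are averages of this bounded function over an arbitrary
  encoder, hence finite.\<close>

lemma gauss_density_bound: "gauss_density v n x \<le> (1 / sqrt (2 * pi * (sqrt v)\<^sup>2)) ^ n"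
proof -
  have "normal_density 0 (sqrt v) t \<le> 1 / sqrt (2 * pi * (sqrt v)\<^sup>2)" for t
    unfolding normal_density_def by (intro mult_left_le) auto
  then have "gauss_density v n x \<le> (\<Prod>i<n. 1 / sqrt (2 * pi * (sqrt v)\<^sup>2))"
    unfolding gauss_density_def by (intro prod_mono) auto
  then show ?thesis by simp
qed

lemma outcome_projections:
  "message \<omega> = fst (fst \<omega>)" "state \<omega> = fst (snd (fst \<omega>))" "channel_input \<omega> = snd (snd (fst \<omega>))"
  "legit_output n \<omega> = (\<lambda>i\<in>{..<n}. snd (snd (fst \<omega>)) i + fst (snd (fst \<omega>)) i + fst (snd \<omega>) i)"
  "eve_output n \<omega> = (\<lambda>i\<in>{..<n}. snd (snd (fst \<omega>)) i + fst (snd (fst \<omega>)) i + snd (snd \<omega>) i)"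
  by (cases \<omega> rule: message.cases; simp)+

locale wiretap =
  fixes Q N1 N2 :: real and c :: wiretap_code
  assumes Q: "0 < Q" and N1: "0 < N1" and N2: "0 < N2" and wf: "wellformed_code c"
begin

abbreviation "n \<equiv> block_length c"
abbreviation "m \<equiv> num_messages c"
abbreviation "enc \<equiv> encoder c"
abbreviation "input_space \<equiv> message_space c \<Otimes>\<^sub>M (blk n \<Otimes>\<^sub>M blk n)"

lemma n: "1 \<le> n" and m: "1 \<le> m"
  and enc_meas: "enc \<in> message_space c \<Otimes>\<^sub>M blk n \<rightarrow>\<^sub>M prob_algebra (blk n)"
  and dec_meas[measurable]: "decoder c \<in> blk n \<rightarrow>\<^sub>M message_space c"
  using wf by (auto simp: wellformed_code_def block_space_def)

lemma enc_subprob[measurable]: "enc \<in> message_space c \<Otimes>\<^sub>M blk n \<rightarrow>\<^sub>M subprob_algebra (blk n)"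
  using enc_meas by (rule measurable_prob_algebraD)

lemma enc_prob: assumes "w \<in> {1..m}" "s \<in> space (blk n)" shows "prob_space (enc (w, s))" "sets (enc (w, s)) = sets (blk n)"
  using measurable_space[OF enc_meas, of "(w, s)"] assms by (auto simp: space_pair_measure space_prob_algebra)

lemma enc_slice[measurable]: assumes "w \<in> {1..m}" shows "(\<lambda>s. enc (w, s)) \<in> blk n \<rightarrow>\<^sub>M subprob_algebra (blk n)"
  using assms by (intro measurable_compose[OF _ enc_subprob] measurable_Pair) auto

lemma sets_base: "sets (uniform_count_measure {1..m} \<Otimes>\<^sub>M \<G> Q n) = sets (message_space c \<Otimes>\<^sub>M blk n)"
  by (intro sets_pair_measure_cong) (auto simp: sets_uniform_count_measure)

lemma space_base: "space (uniform_count_measure {1..m} \<Otimes>\<^sub>M \<G> Q n) = space (message_space c \<Otimes>\<^sub>M blk n)"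
  by (rule sets_eq_imp_space_eq[OF sets_base])

lemma kernel_meas: "(\<lambda>(w, s). distr (enc (w, s)) input_space (\<lambda>x. (w, s, x)))
   \<in> uniform_count_measure {1..m} \<Otimes>\<^sub>M \<G> Q n \<rightarrow>\<^sub>M subprob_algebra input_space"
proof -
  have "(\<lambda>ws. distr (enc ws) input_space ((\<lambda>ws x. (fst ws, snd ws, x)) ws)) \<in> message_space c \<Otimes>\<^sub>M blk n \<rightarrow>\<^sub>M subprob_algebra input_space"
    unfolding split_beta' by (rule measurable_distr2[where M="blk n"]) measurable
  then show ?thesis by (simp add: measurable_cong_sets[OF sets_base refl] split_beta')
qed

lemma input_law_eq: "input_law Q c = (uniform_count_measure {1..m} \<Otimes>\<^sub>M \<G> Q n) \<bind>
     (\<lambda>(w, s). distr (enc (w, s)) input_space (\<lambda>x. (w, s, x)))"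
  unfolding input_law_def block_space_def by simp

lemma space_blk_ne: "space (blk n) \<noteq> {}" by (simp add: space_PiM_empty_iff)

lemma sets_input_law[simp, measurable_cong]: "sets (input_law Q c) = sets input_space"
proof -
  have "space (uniform_count_measure {1..m} \<Otimes>\<^sub>M \<G> Q n) \<noteq> {}"
    using space_blk_ne m by (simp add: space_base space_pair_measure)
  then show ?thesis unfolding input_law_eq by (subst sets_bind[where N=input_space]) auto
qed

lemma space_input_law: "space (input_law Q c) = {1..m} \<times> space (blk n) \<times> space (blk n)"
  using sets_eq_imp_space_eq[OF sets_input_law] by (simp add: space_pair_measure)

text \<open>Integrals against the monadic law of a code become a finite average over messages of
  iterated integrals over state and input, the form in which both bounds on the code are
  computed.\<close>

lemma nn_integral_input_law:
  assumes F[measurable]: "F \<in> borel_measurable input_space"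
  shows "(\<integral>\<^sup>+ t. F t \<partial>input_law Q c) = (\<Sum>w\<in>{1..m}. ennreal (1 / m) * (\<integral>\<^sup>+ s. \<integral>\<^sup>+ x. F (w, s, x) \<partial>enc (w, s) \<partial>\<G> Q n))"
proof -
  interpret G: prob_space "\<G> Q n" using Q by (rule prob_space_gaussian_block)
  have inner: "(\<lambda>ws. \<integral>\<^sup>+ x. F (fst ws, snd ws, x) \<partial>enc ws) \<in> borel_measurable (message_space c \<Otimes>\<^sub>M blk n)"
    by (rule nn_integral_measurable_subprob_algebra2[where N="blk n"]) measurable
  have "(\<integral>\<^sup>+ t. F t \<partial>input_law Q c) = (\<integral>\<^sup>+ ws. \<integral>\<^sup>+ t. F t \<partial>(case ws of (w, s) \<Rightarrow> distr (enc (w, s)) input_space (\<lambda>x. (w, s, x))) \<partial>(uniform_count_measure {1..m} \<Otimes>\<^sub>M \<G> Q n))"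
    unfolding input_law_eq by (rule nn_integral_bind[OF F kernel_meas])
  also have "\<dots> = (\<integral>\<^sup>+ ws. \<integral>\<^sup>+ x. F (fst ws, snd ws, x) \<partial>enc ws \<partial>(uniform_count_measure {1..m} \<Otimes>\<^sub>M \<G> Q n))"
  proof (intro nn_integral_cong)
    fix ws assume "ws \<in> space (uniform_count_measure {1..m} \<Otimes>\<^sub>M \<G> Q n)"
    then obtain w s where ws: "ws = (w, s)" "w \<in> {1..m}" "s \<in> space (blk n)" by (auto simp: space_base space_pair_measure space_uniform_count_measure)
    have [measurable_cong]: "sets (enc (w, s)) = sets (blk n)" using ws by (intro enc_prob)
    have "(\<lambda>x. (w, s, x)) \<in> enc (w, s) \<rightarrow>\<^sub>M input_space" using ws by (intro measurable_Pair) auto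
    then show "(\<integral>\<^sup>+ t. F t \<partial>(case ws of (w, s) \<Rightarrow> distr (enc (w, s)) input_space (\<lambda>x. (w, s, x)))) = (\<integral>\<^sup>+ x. F (fst ws, snd ws, x) \<partial>enc ws)"
      by (simp add: ws nn_integral_distr)
  qed
  also have "\<dots> = (\<integral>\<^sup>+ w. \<integral>\<^sup>+ s. \<integral>\<^sup>+ x. F (w, s, x) \<partial>enc (w, s) \<partial>\<G> Q n \<partial>uniform_count_measure {1..m})"
    by (subst G.nn_integral_fst[symmetric]) (auto simp: measurable_cong_sets[OF sets_base refl] inner)
  also have "\<dots> = (\<Sum>w\<in>{1..m}. ennreal (1 / m) * (\<integral>\<^sup>+ s. \<integral>\<^sup>+ x. F (w, s, x) \<partial>enc (w, s) \<partial>\<G> Q n))"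
    unfolding uniform_count_measure_def by (subst nn_integral_point_measure_finite) auto
  finally show ?thesis .
qed

lemma sum_const_messages: "(\<Sum>w\<in>{1..m}. ennreal (1 / m) * 1) = 1"
  using m by (simp add: ennreal_of_nat_eq_real_of_nat ennreal_mult'[symmetric])

lemma prob_space_input_law: "prob_space (input_law Q c)"
proof
  interpret G: prob_space "\<G> Q n" using Q by (rule prob_space_gaussian_block)
  have "emeasure (input_law Q c) (space (input_law Q c)) = (\<integral>\<^sup>+ t. 1 \<partial>input_law Q c)" by simp
  also have "\<dots> = (\<Sum>w\<in>{1..m}. ennreal (1 / m) * (\<integral>\<^sup>+ s. \<integral>\<^sup>+ x. 1 \<partial>enc (w, s) \<partial>\<G> Q n))"
    by (rule nn_integral_input_law) auto
  also have "\<dots> = (\<Sum>w\<in>{1..m}. ennreal (1 / m) * 1)"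
  proof (intro sum.cong refl arg_cong2[where f="(*)"])
    fix w assume w: "w \<in> {1..m}"
    have "(\<integral>\<^sup>+ s. \<integral>\<^sup>+ x. 1 \<partial>enc (w, s) \<partial>\<G> Q n) = (\<integral>\<^sup>+ s. 1 \<partial>\<G> Q n)"
      using prob_space.emeasure_space_1[OF enc_prob(1)[OF w]] by (intro nn_integral_cong) auto
    then show "(\<integral>\<^sup>+ s. \<integral>\<^sup>+ x. 1 \<partial>enc (w, s) \<partial>\<G> Q n) = 1" using G.emeasure_space_1 by simp
  qed
  finally show "emeasure (input_law Q c) (space (input_law Q c)) = 1" using sum_const_messages by simp
qed

lemma prob_space_code_law: "prob_space (code_law Q N1 N2 c)"
proof -
  interpret I: prob_space "input_law Q c" by (rule prob_space_input_law)
  interpret A: prob_space "\<G> N1 n" using N1 by (rule prob_space_gaussian_block)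
  interpret B: prob_space "\<G> N2 n" using N2 by (rule prob_space_gaussian_block)
  interpret AB: pair_prob_space "\<G> N1 n" "\<G> N2 n" ..
  interpret T: pair_prob_space "input_law Q c" "\<G> N1 n \<Otimes>\<^sub>M \<G> N2 n" ..
  show ?thesis unfolding code_law_def by (rule T.prob_space_axioms)
qed

lemma sets_code_law[simp, measurable_cong]: "sets (code_law Q N1 N2 c) = sets (input_space \<Otimes>\<^sub>M (blk n \<Otimes>\<^sub>M blk n))"
  unfolding code_law_def by (intro sets_pair_measure_cong) auto

lemma space_code_law: "space (code_law Q N1 N2 c) = ({1..m} \<times> space (blk n) \<times> space (blk n)) \<times> (space (blk n) \<times> space (blk n))"
  using sets_eq_imp_space_eq[OF sets_code_law] by (simp add: space_pair_measure)

lemma nn_integral_code_law: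
  assumes F[measurable]: "F \<in> borel_measurable (input_space \<Otimes>\<^sub>M (blk n \<Otimes>\<^sub>M blk n))"
  shows "(\<integral>\<^sup>+ \<omega>. F \<omega> \<partial>code_law Q N1 N2 c) = (\<integral>\<^sup>+ t. \<integral>\<^sup>+ e1. \<integral>\<^sup>+ e2. F (t, e1, e2) \<partial>\<G> N2 n \<partial>\<G> N1 n \<partial>input_law Q c)"
proof -
  interpret A: prob_space "\<G> N1 n" using N1 by (rule prob_space_gaussian_block)
  interpret B: prob_space "\<G> N2 n" using N2 by (rule prob_space_gaussian_block)
  interpret AB: pair_prob_space "\<G> N1 n" "\<G> N2 n" ..
  have "(\<integral>\<^sup>+ \<omega>. F \<omega> \<partial>code_law Q N1 N2 c) = (\<integral>\<^sup>+ t. \<integral>\<^sup>+ e. F (t, e) \<partial>(\<G> N1 n \<Otimes>\<^sub>M \<G> N2 n) \<partial>input_law Q c)"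
    unfolding code_law_def by (subst AB.nn_integral_fst[symmetric]) auto
  also have "\<dots> = (\<integral>\<^sup>+ t. \<integral>\<^sup>+ e1. \<integral>\<^sup>+ e2. F (t, e1, e2) \<partial>\<G> N2 n \<partial>\<G> N1 n \<partial>input_law Q c)"
  proof (intro nn_integral_cong)
    fix t assume t: "t \<in> space (input_law Q c)"
    have t': "t \<in> space input_space" using t sets_eq_imp_space_eq[OF sets_input_law] by simp
    have "(\<lambda>e. F (t, e)) \<in> borel_measurable (blk n \<Otimes>\<^sub>M blk n)"
      using t' by (intro measurable_compose[OF _ F] measurable_Pair) auto
    then show "(\<integral>\<^sup>+ e. F (t, e) \<partial>(\<G> N1 n \<Otimes>\<^sub>M \<G> N2 n)) = (\<integral>\<^sup>+ e1. \<integral>\<^sup>+ e2. F (t, e1, e2) \<partial>\<G> N2 n \<partial>\<G> N1 n)"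
      by (subst B.nn_integral_fst[symmetric]) auto
  qed
  finally show ?thesis .
qed

lemma pred_decoding_error:
  assumes [measurable]: "f \<in> M \<rightarrow>\<^sub>M blk n" "g \<in> M \<rightarrow>\<^sub>M message_space c"
  shows "Measurable.pred M (\<lambda>x. decoder c (f x) \<noteq> g x)"
proof -
  have "Measurable.pred M (\<lambda>x. \<not> (\<exists>w. decoder c (f x) = w \<and> g x = w))" by measurable
  moreover have "(\<lambda>x. \<not> (\<exists>w. decoder c (f x) = w \<and> g x = w)) = (\<lambda>x. decoder c (f x) \<noteq> g x)" by auto
  ultimately show ?thesis by (simp only:)
qed

text \<open>Each message has probability exactly \<open>1 / m\<close>, so the weight in front of a
  conditional probability cancels its denominator, and the average error is the plain probability
  that the decoder misses the message.\<close>

lemma error_prob_eq: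
  "ennreal (error_prob Q N1 N2 c) = (\<integral>\<^sup>+ t. \<integral>\<^sup>+ e. (if decoder c (\<lambda>i\<in>{..<n}. snd (snd t) i + fst (snd t) i + e i) \<noteq> fst t then 1 else 0) \<partial>\<G> N1 n \<partial>input_law Q c)"
proof -
  interpret prob_space "code_law Q N1 N2 c" by (rule prob_space_code_law)
  interpret I: prob_space "input_law Q c" by (rule prob_space_input_law)
  interpret G: prob_space "\<G> Q n" using Q by (rule prob_space_gaussian_block)
  interpret A: prob_space "\<G> N1 n" using N1 by (rule prob_space_gaussian_block)
  interpret B: prob_space "\<G> N2 n" using N2 by (rule prob_space_gaussian_block)
  let ?S = "input_space \<Otimes>\<^sub>M (blk n \<Otimes>\<^sub>M blk n)"
  have lm[measurable]: "legit_output n \<in> ?S \<rightarrow>\<^sub>M blk n" 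
    unfolding outcome_projections[abs_def] by measurable
  have mm[measurable]: "message \<in> ?S \<rightarrow>\<^sub>M message_space c"
    unfolding outcome_projections[abs_def] by measurable
  have [measurable]: "Measurable.pred ?S (\<lambda>\<omega>. decoder c (legit_output n \<omega>) \<noteq> message \<omega>)"
    by (rule pred_decoding_error) (rule lm mm)+
  have msg: "emeasure (code_law Q N1 N2 c) {\<omega> \<in> space (code_law Q N1 N2 c). message \<omega> = w} = ennreal (1 / m)" if w: "w \<in> {1..m}" for w
  proof -
    have "emeasure (code_law Q N1 N2 c) {\<omega> \<in> space (code_law Q N1 N2 c). message \<omega> = w} = (\<integral>\<^sup>+ \<omega>. (if message \<omega> = w then 1 else 0) \<partial>code_law Q N1 N2 c)"
      by (subst nn_integral_indicator[symmetric]) (measurable, auto intro!: nn_integral_cong simp: indicator_def)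
    also have "\<dots> = (\<integral>\<^sup>+ t. \<integral>\<^sup>+ e1. \<integral>\<^sup>+ e2. (if fst t = w then 1 else 0) \<partial>\<G> N2 n \<partial>\<G> N1 n \<partial>input_law Q c)"
      by (subst nn_integral_code_law) (measurable, auto simp: outcome_projections)
    also have "\<dots> = (\<integral>\<^sup>+ t. (if fst t = w then 1 else 0) \<partial>input_law Q c)"
      using A.emeasure_space_1 B.emeasure_space_1 by simp
    also have "\<dots> = (\<Sum>w'\<in>{1..m}. ennreal (1 / m) * (\<integral>\<^sup>+ s. \<integral>\<^sup>+ x. (if w' = w then 1 else 0) \<partial>enc (w', s) \<partial>\<G> Q n))"
      by (subst nn_integral_input_law) auto
    also have "\<dots> = (\<Sum>w'\<in>{1..m}. if w' = w then ennreal (1 / m) else 0)"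
    proof (intro sum.cong refl)
      fix w' assume w': "w' \<in> {1..m}"
      have "(\<integral>\<^sup>+ s. \<integral>\<^sup>+ x. (if w' = w then 1 else 0) \<partial>enc (w', s) \<partial>\<G> Q n) = (\<integral>\<^sup>+ s. (if w' = w then 1 else 0) \<partial>\<G> Q n)"
        using prob_space.emeasure_space_1[OF enc_prob(1)[OF w']] by (intro nn_integral_cong) auto
      then show "ennreal (1 / m) * (\<integral>\<^sup>+ s. \<integral>\<^sup>+ x. (if w' = w then 1 else 0) \<partial>enc (w', s) \<partial>\<G> Q n) = (if w' = w then ennreal (1 / m) else 0)"
        using G.emeasure_space_1 by simp
    qed
    also have "\<dots> = ennreal (1 / m)" using w by simp
    finally show ?thesis .
  qed
  have pm: "prob {\<omega> \<in> space (code_law Q N1 N2 c). message \<omega> = w} = 1 / m" if w: "w \<in> {1..m}" for w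
    using msg[OF w] by (simp add: measure_def)
  have "error_prob Q N1 N2 c = (\<Sum>w\<in>{1..m}. prob {\<omega> \<in> space (code_law Q N1 N2 c). decoder c (legit_output n \<omega>) \<noteq> w \<and> message \<omega> = w})"
    unfolding error_prob_def cond_prob_def using m by (simp add: pm sum_distrib_left)
  then have "ennreal (error_prob Q N1 N2 c) = (\<Sum>w\<in>{1..m}. emeasure (code_law Q N1 N2 c) {\<omega> \<in> space (code_law Q N1 N2 c). decoder c (legit_output n \<omega>) \<noteq> w \<and> message \<omega> = w})"
    by (simp add: emeasure_eq_measure sum_ennreal)
  also have "\<dots> = (\<Sum>w\<in>{1..m}. \<integral>\<^sup>+ \<omega>. (if decoder c (legit_output n \<omega>) \<noteq> w \<and> message \<omega> = w then 1 else 0) \<partial>code_law Q N1 N2 c)"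
    by (intro sum.cong refl, subst nn_integral_indicator[symmetric]) (measurable, auto intro!: nn_integral_cong simp: indicator_def)
  also have "\<dots> = (\<integral>\<^sup>+ \<omega>. (\<Sum>w\<in>{1..m}. (if decoder c (legit_output n \<omega>) \<noteq> w \<and> message \<omega> = w then 1 else 0)) \<partial>code_law Q N1 N2 c)"
    by (intro nn_integral_sum[symmetric]) measurable
  also have "\<dots> = (\<integral>\<^sup>+ \<omega>. (if decoder c (legit_output n \<omega>) \<noteq> message \<omega> then 1 else 0) \<partial>code_law Q N1 N2 c)"
  proof (intro nn_integral_cong)
    fix \<omega> assume "\<omega> \<in> space (code_law Q N1 N2 c)"
    then have "message \<omega> \<in> {1..m}" by (auto simp: space_code_law outcome_projections)
    moreover have "(if decoder c (legit_output n \<omega>) \<noteq> w \<and> message \<omega> = w then 1 else 0) = (if w = message \<omega> then (if decoder c (legit_output n \<omega>) \<noteq> message \<omega> then 1 else 0) else (0::ennreal))" for w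
      by auto
    ultimately show "(\<Sum>w\<in>{1..m}. (if decoder c (legit_output n \<omega>) \<noteq> w \<and> message \<omega> = w then 1 else 0)) = (if decoder c (legit_output n \<omega>) \<noteq> message \<omega> then 1 else (0::ennreal))"
      by simp
  qed
  also have "\<dots> = (\<integral>\<^sup>+ t. \<integral>\<^sup>+ e. \<integral>\<^sup>+ e2. (if decoder c (\<lambda>i\<in>{..<n}. snd (snd t) i + fst (snd t) i + e i) \<noteq> fst t then 1 else 0) \<partial>\<G> N2 n \<partial>\<G> N1 n \<partial>input_law Q c)"
    by (subst nn_integral_code_law) (measurable, auto simp: outcome_projections)
  also have "\<dots> = (\<integral>\<^sup>+ t. \<integral>\<^sup>+ e. (if decoder c (\<lambda>i\<in>{..<n}. snd (snd t) i + fst (snd t) i + e i) \<noteq> fst t then 1 else 0) \<partial>\<G> N1 n \<partial>input_law Q c)"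
    using B.emeasure_space_1 by simp
  finally show ?thesis .
qed

end

section \<open>Power constraint and the density seen by the eavesdropper\<close>

context wiretap begin

text \<open>The extended integral absorbs the integrability clause: a finite bound on the sum makes
  every coordinate square integrable. \<open>0 \<le> P\<close> keeps \<open>ennreal\<close> from
  truncating the bound.\<close>

lemma power_constraint_iff:
  fixes P :: real
  assumes P: "0 \<le> P"
  shows "power_constraint P Q N1 N2 c \<longleftrightarrow> (\<integral>\<^sup>+ t. ennreal (\<Sum>i<n. (snd (snd t) i)\<^sup>2) \<partial>input_law Q c) \<le> ennreal (n * P)"
proof -
  interpret prob_space "code_law Q N1 N2 c" by (rule prob_space_code_law)
  interpret A: prob_space "\<G> N1 n" using N1 by (rule prob_space_gaussian_block)
  interpret B: prob_space "\<G> N2 n" using N2 by (rule prob_space_gaussian_block)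
  let ?S = "input_space \<Otimes>\<^sub>M (blk n \<Otimes>\<^sub>M blk n)"
  have gm[measurable]: "(\<lambda>\<omega>. (channel_input \<omega> i)\<^sup>2) \<in> borel_measurable ?S" if "i \<in> {..<n}" for i
    unfolding outcome_projections[abs_def] using that by measurable
  have tot: "(\<integral>\<^sup>+ t. ennreal (\<Sum>i<n. (snd (snd t) i)\<^sup>2) \<partial>input_law Q c) = (\<integral>\<^sup>+ \<omega>. (\<Sum>i<n. ennreal ((channel_input \<omega> i)\<^sup>2)) \<partial>code_law Q N1 N2 c)"
    using A.emeasure_space_1 B.emeasure_space_1
    by (subst nn_integral_code_law) (measurable, simp add: outcome_projections sum_ennreal)
  also have "\<dots> = (\<Sum>i<n. \<integral>\<^sup>+ \<omega>. ennreal ((channel_input \<omega> i)\<^sup>2) \<partial>code_law Q N1 N2 c)"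
    by (rule nn_integral_sum) measurable
  finally have tot2: "(\<integral>\<^sup>+ t. ennreal (\<Sum>i<n. (snd (snd t) i)\<^sup>2) \<partial>input_law Q c) = (\<Sum>i<n. \<integral>\<^sup>+ \<omega>. ennreal ((channel_input \<omega> i)\<^sup>2) \<partial>code_law Q N1 N2 c)" .
  have n0: "0 < real n" using n by simp
  have avg: "1 / real n * a \<le> P \<longleftrightarrow> a \<le> n * P" for a using n0 by (simp add: field_simps)
  have eq: "(\<Sum>i<n. \<integral>\<^sup>+ \<omega>. ennreal ((channel_input \<omega> i)\<^sup>2) \<partial>code_law Q N1 N2 c) = ennreal (\<Sum>i<n. \<integral>\<omega>. (channel_input \<omega> i)\<^sup>2 \<partial>code_law Q N1 N2 c)"
    if "\<forall>i<n. integrable (code_law Q N1 N2 c) (\<lambda>\<omega>. (channel_input \<omega> i)\<^sup>2)"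
  proof -
    have "(\<Sum>i<n. \<integral>\<^sup>+ \<omega>. ennreal ((channel_input \<omega> i)\<^sup>2) \<partial>code_law Q N1 N2 c) = (\<Sum>i<n. ennreal (\<integral>\<omega>. (channel_input \<omega> i)\<^sup>2 \<partial>code_law Q N1 N2 c))"
      using that by (intro sum.cong refl nn_integral_eq_integral) auto
    also have "\<dots> = ennreal (\<Sum>i<n. \<integral>\<omega>. (channel_input \<omega> i)\<^sup>2 \<partial>code_law Q N1 N2 c)"
      by (intro sum_ennreal) auto
    finally show ?thesis .
  qed
  show ?thesis
  proof
    assume "power_constraint P Q N1 N2 c"
    then have i: "\<forall>i<n. integrable (code_law Q N1 N2 c) (\<lambda>\<omega>. (channel_input \<omega> i)\<^sup>2)"
      and "(\<Sum>i<n. \<integral>\<omega>. (channel_input \<omega> i)\<^sup>2 \<partial>code_law Q N1 N2 c) \<le> n * P"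
      unfolding power_constraint_def avg by auto
    then show "(\<integral>\<^sup>+ t. ennreal (\<Sum>i<n. (snd (snd t) i)\<^sup>2) \<partial>input_law Q c) \<le> ennreal (n * P)"
      unfolding tot2 eq[OF i] by (intro ennreal_leI)
  next
    assume L: "(\<integral>\<^sup>+ t. ennreal (\<Sum>i<n. (snd (snd t) i)\<^sup>2) \<partial>input_law Q c) \<le> ennreal (n * P)"
    have i: "\<forall>i<n. integrable (code_law Q N1 N2 c) (\<lambda>\<omega>. (channel_input \<omega> i)\<^sup>2)"
    proof (intro allI impI)
      fix i assume i: "i < n"
      have "(\<integral>\<^sup>+ \<omega>. ennreal ((channel_input \<omega> i)\<^sup>2) \<partial>code_law Q N1 N2 c) \<le> ennreal (n * P)"
        using L i unfolding tot2 by (intro order_trans[OF member_le_sum[of i "{..<n}" "\<lambda>i. \<integral>\<^sup>+ \<omega>. ennreal ((channel_input \<omega> i)\<^sup>2) \<partial>code_law Q N1 N2 c"]]) auto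
      then show "integrable (code_law Q N1 N2 c) (\<lambda>\<omega>. (channel_input \<omega> i)\<^sup>2)"
        using i by (intro integrableI_nonneg) (auto simp: le_less_trans[OF _ ennreal_less_top])
    qed
    have "0 \<le> n * P" using P by simp
    then have "(\<Sum>i<n. \<integral>\<omega>. (channel_input \<omega> i)\<^sup>2 \<partial>code_law Q N1 N2 c) \<le> n * P"
      using L unfolding tot2 eq[OF i] by (simp add: ennreal_le_iff)
    then show "power_constraint P Q N1 N2 c"
      unfolding power_constraint_def avg using i by simp
  qed
qed

text \<open>Conditional density of the eavesdropper's output given message and state: a Gaussian
  mixture, so it exists for every encoder, even a deterministic one.\<close>

definition "eve_density w z s = enn2real (\<integral>\<^sup>+ x. ennreal (gauss_density N2 n (\<lambda>i. z i - s i - x i)) \<partial>enc (w, s))"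

lemma ennreal_eve_density:
  assumes "w \<in> {1..m}" "s \<in> space (blk n)"
  shows "ennreal (eve_density w z s) = (\<integral>\<^sup>+ x. ennreal (gauss_density N2 n (\<lambda>i. z i - s i - x i)) \<partial>enc (w, s))"
proof -
  interpret E: prob_space "enc (w, s)" using assms by (rule enc_prob)
  define B where "B = (1 / sqrt (2 * pi * (sqrt N2)\<^sup>2)) ^ n"
  have "(\<integral>\<^sup>+ x. ennreal (gauss_density N2 n (\<lambda>i. z i - s i - x i)) \<partial>enc (w, s)) \<le> (\<integral>\<^sup>+ x. ennreal B \<partial>enc (w, s))"
    unfolding B_def by (intro nn_integral_mono ennreal_leI gauss_density_bound)
  also have "\<dots> = ennreal B" using E.emeasure_space_1 by simp
  finally have "(\<integral>\<^sup>+ x. ennreal (gauss_density N2 n (\<lambda>i. z i - s i - x i)) \<partial>enc (w, s)) < \<top>"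
    using ennreal_less_top le_less_trans by blast
  then show ?thesis unfolding eve_density_def by (rule ennreal_enn2real)
qed

lemma eve_density_nonneg[simp]: "0 \<le> eve_density w z s" by (simp add: eve_density_def)

lemma eve_density_meas[measurable]:
  assumes w: "w \<in> {1..m}"
  shows "(\<lambda>v. eve_density w (fst v) (snd v)) \<in> borel_measurable (blk n \<Otimes>\<^sub>M blk n)"
proof -
  have "(\<lambda>v. \<integral>\<^sup>+ x. ennreal (gauss_density N2 n (\<lambda>i. fst v i - snd v i - x i)) \<partial>enc (w, snd v)) \<in> borel_measurable (blk n \<Otimes>\<^sub>M blk n)"
    by (rule nn_integral_measurable_subprob_algebra2[where N="blk n"])
       (simp_all add: split_beta' measurable_compose[OF measurable_snd enc_slice[OF w]])
  then show ?thesis unfolding eve_density_def by measurable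
qed

definition "joint_density p = 1 / m * gauss_density Q n (snd (snd p)) * eve_density (fst p) (fst (snd p)) (snd (snd p))"

lemma joint_density_nonneg: "0 \<le> joint_density p"
  unfolding joint_density_def by simp

lemma joint_density_meas[measurable]: "joint_density \<in> borel_measurable (message_space c \<Otimes>\<^sub>M (lborel_block n \<Otimes>\<^sub>M lborel_block n))"
proof (rule measurable_pair_measure_countable1)
  fix w assume "w \<in> {1..m}"
  note [measurable] = eve_density_meas[OF this]
  show "(\<lambda>v. joint_density (w, v)) \<in> borel_measurable (lborel_block n \<Otimes>\<^sub>M lborel_block n)"
    unfolding joint_density_def fst_conv snd_conv by measurable
qed simp

text \<open>Tonelli exchanges output and input; for a fixed input the density of the output becomes
  additive noise of variance \<open>N2\<close>.\<close>

lemma nn_integral_joint_density: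
  assumes w: "w \<in> {1..m}" and F[measurable]: "F \<in> borel_measurable (blk n \<Otimes>\<^sub>M blk n)"
  shows "(\<integral>\<^sup>+ v. ennreal (joint_density (w, v)) * F v \<partial>(lborel_block n \<Otimes>\<^sub>M lborel_block n))
    = ennreal (1 / m) * (\<integral>\<^sup>+ s. \<integral>\<^sup>+ x. \<integral>\<^sup>+ e. F (\<lambda>i\<in>{..<n}. x i + s i + e i, s) \<partial>\<G> N2 n \<partial>enc (w, s) \<partial>\<G> Q n)"
proof -
  interpret L: sigma_finite_measure "lborel_block n" by (rule sigma_finite_lborel_block)
  interpret LL: pair_sigma_finite "lborel_block n" "lborel_block n" ..
  interpret G: prob_space "\<G> N2 n" using N2 by (rule prob_space_gaussian_block)
  note [measurable] = eve_density_meas[OF w]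
  define H where "H s = (\<integral>\<^sup>+ z. ennreal (eve_density w z s) * F (z, s) \<partial>lborel_block n)" for s
  have Hm[measurable]: "H \<in> borel_measurable (blk n)"
  proof -
    have 1: "(\<lambda>v. ennreal (eve_density w (fst v) (snd v)) * F v) \<in> borel_measurable (lborel_block n \<Otimes>\<^sub>M blk n)" by measurable
    then have "(\<lambda>p. ennreal (eve_density w (snd p) (fst p)) * F (snd p, fst p)) \<in> borel_measurable (blk n \<Otimes>\<^sub>M lborel_block n)"
      using measurable_compose[OF measurable_pair_swap' 1] by (simp add: split_beta')
    from L.borel_measurable_nn_integral_fst[OF this] show ?thesis unfolding H_def[abs_def] by simp
  qed
  have Heq: "H s = (\<integral>\<^sup>+ x. \<integral>\<^sup>+ e. F (\<lambda>i\<in>{..<n}. x i + s i + e i, s) \<partial>\<G> N2 n \<partial>enc (w, s))" if s: "s \<in> space (blk n)" for s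
  proof -
    interpret E: prob_space "enc (w, s)" using w s by (rule enc_prob)
    have [measurable_cong]: "sets (enc (w, s)) = sets (blk n)" using w s by (rule enc_prob)
    interpret EL: pair_sigma_finite "enc (w, s)" "lborel_block n" ..
    have [measurable]: "(\<lambda>z. F (z, s)) \<in> borel_measurable (blk n)" using s by measurable
    have ff[measurable]: "(\<lambda>p. F (snd p, s)) \<in> borel_measurable (enc (w, s) \<Otimes>\<^sub>M lborel_block n)" 
      by (rule measurable_compose[of snd _ "blk n"]) (use s in measurable)
    have "H s = (\<integral>\<^sup>+ z. \<integral>\<^sup>+ x. ennreal (gauss_density N2 n (\<lambda>i. z i - s i - x i)) * F (z, s) \<partial>enc (w, s) \<partial>lborel_block n)"
      unfolding H_def ennreal_eve_density[OF w s] by (intro nn_integral_cong nn_integral_multc[symmetric]) measurable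
    also have "\<dots> = (\<integral>\<^sup>+ x. \<integral>\<^sup>+ z. ennreal (gauss_density N2 n (\<lambda>i. z i - s i - x i)) * F (z, s) \<partial>lborel_block n \<partial>enc (w, s))"
      using ff by (intro EL.Fubini') (simp add: split_beta')
    also have "\<dots> = (\<integral>\<^sup>+ x. \<integral>\<^sup>+ e. F (\<lambda>i\<in>{..<n}. x i + s i + e i, s) \<partial>\<G> N2 n \<partial>enc (w, s))"
    proof (intro nn_integral_cong)
      fix x
      have "(\<integral>\<^sup>+ z. ennreal (gauss_density N2 n (\<lambda>i. z i - s i - x i)) * F (z, s) \<partial>lborel_block n)
        = (\<integral>\<^sup>+ z. ennreal (gauss_density N2 n (\<lambda>i. z i - (x i + s i))) * F (z, s) \<partial>lborel_block n)" by (simp add: algebra_simps)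
      also have "\<dots> = (\<integral>\<^sup>+ e. F (\<lambda>i\<in>{..<n}. e i + (x i + s i), s) \<partial>\<G> N2 n)"
        by (rule nn_integral_gauss_density_shift) (use N2 in auto)
      finally show "(\<integral>\<^sup>+ z. ennreal (gauss_density N2 n (\<lambda>i. z i - s i - x i)) * F (z, s) \<partial>lborel_block n) = (\<integral>\<^sup>+ e. F (\<lambda>i\<in>{..<n}. x i + s i + e i, s) \<partial>\<G> N2 n)"
        by (simp add: add.commute)
    qed
    finally show ?thesis .
  qed
  have "(\<integral>\<^sup>+ v. ennreal (joint_density (w, v)) * F v \<partial>(lborel_block n \<Otimes>\<^sub>M lborel_block n))
    = (\<integral>\<^sup>+ v. ennreal (1 / m) * (ennreal (gauss_density Q n (snd v)) * (ennreal (eve_density w (fst v) (snd v)) * F v)) \<partial>(lborel_block n \<Otimes>\<^sub>M lborel_block n))"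
  proof -
    have "ennreal (joint_density (w, v)) = ennreal (1 / m) * (ennreal (gauss_density Q n (snd v)) * ennreal (eve_density w (fst v) (snd v)))" for v
      by (simp add: joint_density_def ennreal_mult'[symmetric])
    then show ?thesis by (simp only: mult.assoc)
  qed
  also have "\<dots> = ennreal (1 / m) * (\<integral>\<^sup>+ v. ennreal (gauss_density Q n (snd v)) * (ennreal (eve_density w (fst v) (snd v)) * F v) \<partial>(lborel_block n \<Otimes>\<^sub>M lborel_block n))"
    by (rule nn_integral_cmult) measurable
  also have "(\<integral>\<^sup>+ v. ennreal (gauss_density Q n (snd v)) * (ennreal (eve_density w (fst v) (snd v)) * F v) \<partial>(lborel_block n \<Otimes>\<^sub>M lborel_block n))
    = (\<integral>\<^sup>+ s. \<integral>\<^sup>+ z. ennreal (gauss_density Q n s) * (ennreal (eve_density w z s) * F (z, s)) \<partial>lborel_block n \<partial>lborel_block n)"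
    by (subst LL.nn_integral_snd[symmetric]) auto
  also have "\<dots> = (\<integral>\<^sup>+ s. ennreal (gauss_density Q n s) * H s \<partial>lborel_block n)"
  proof (intro nn_integral_cong)
    fix s assume "s \<in> space (lborel_block n)"
    then have s: "s \<in> space (blk n)" by simp
    have e1: "(\<lambda>z. eve_density w z s) \<in> borel_measurable (blk n)"
      using measurable_compose[OF measurable_Pair1'[OF s] eve_density_meas[OF w]] s
      by (intro measurable_compose[of "\<lambda>z. (z, s)" _ _ "\<lambda>v. eve_density w (fst v) (snd v)" borel, OF _ eve_density_meas[OF w], simplified]) auto
    have e2: "(\<lambda>z. F (z, s)) \<in> borel_measurable (blk n)" using s by measurable
    have "(\<lambda>z. ennreal (eve_density w z s) * F (z, s)) \<in> borel_measurable (blk n)"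
      by (intro borel_measurable_times_ennreal measurable_compose[OF e1 measurable_ennreal] e2)
    then have "(\<lambda>z. ennreal (eve_density w z s) * F (z, s)) \<in> borel_measurable (lborel_block n)"
      by (simp cong: measurable_cong_sets)
    then show "(\<integral>\<^sup>+ z. ennreal (gauss_density Q n s) * (ennreal (eve_density w z s) * F (z, s)) \<partial>lborel_block n) = ennreal (gauss_density Q n s) * H s"
      unfolding H_def by (rule nn_integral_cmult)
  qed
  also have "\<dots> = (\<integral>\<^sup>+ s. H s \<partial>\<G> Q n)"
    using Q by (subst nn_integral_gaussian_block) auto
  also have "\<dots> = (\<integral>\<^sup>+ s. \<integral>\<^sup>+ x. \<integral>\<^sup>+ e. F (\<lambda>i\<in>{..<n}. x i + s i + e i, s) \<partial>\<G> N2 n \<partial>enc (w, s) \<partial>\<G> Q n)"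
    by (intro nn_integral_cong Heq) simp
  finally show ?thesis .
qed

lemma nn_integral_eve:
  assumes F[measurable]: "F \<in> borel_measurable (message_space c \<Otimes>\<^sub>M (blk n \<Otimes>\<^sub>M blk n))"
  shows "(\<integral>\<^sup>+ p. ennreal (joint_density p) * F p \<partial>(message_space c \<Otimes>\<^sub>M (lborel_block n \<Otimes>\<^sub>M lborel_block n)))
    = (\<integral>\<^sup>+ t. \<integral>\<^sup>+ e. F (fst t, \<lambda>i\<in>{..<n}. snd (snd t) i + fst (snd t) i + e i, fst (snd t)) \<partial>\<G> N2 n \<partial>input_law Q c)"
proof -
  interpret G: prob_space "\<G> N2 n" using N2 by (rule prob_space_gaussian_block)
  interpret L: sigma_finite_measure "lborel_block n" by (rule sigma_finite_lborel_block)
  interpret LL: pair_sigma_finite "lborel_block n" "lborel_block n" ..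
  have "(\<integral>\<^sup>+ p. ennreal (joint_density p) * F p \<partial>(message_space c \<Otimes>\<^sub>M (lborel_block n \<Otimes>\<^sub>M lborel_block n)))
    = (\<Sum>w\<in>{1..m}. \<integral>\<^sup>+ v. ennreal (joint_density (w, v)) * F (w, v) \<partial>(lborel_block n \<Otimes>\<^sub>M lborel_block n))"
    by (rule nn_integral_count_space_pair(1)[OF _ LL.sigma_finite_measure_axioms]) auto
  also have "\<dots> = (\<Sum>w\<in>{1..m}. ennreal (1 / m) * (\<integral>\<^sup>+ s. \<integral>\<^sup>+ x. \<integral>\<^sup>+ e. F (w, \<lambda>i\<in>{..<n}. x i + s i + e i, s) \<partial>\<G> N2 n \<partial>enc (w, s) \<partial>\<G> Q n))"
  proof (intro sum.cong refl)
    fix w assume w: "w \<in> {1..m}"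
    have "(\<lambda>v. F (w, v)) \<in> borel_measurable (blk n \<Otimes>\<^sub>M blk n)" using w by (intro measurable_compose[OF _ F] measurable_Pair) auto
    from nn_integral_joint_density[OF w this] show "(\<integral>\<^sup>+ v. ennreal (joint_density (w, v)) * F (w, v) \<partial>(lborel_block n \<Otimes>\<^sub>M lborel_block n)) = ennreal (1 / m) * (\<integral>\<^sup>+ s. \<integral>\<^sup>+ x. \<integral>\<^sup>+ e. F (w, \<lambda>i\<in>{..<n}. x i + s i + e i, s) \<partial>\<G> N2 n \<partial>enc (w, s) \<partial>\<G> Q n)" .
  qed
  also have "\<dots> = (\<integral>\<^sup>+ t. \<integral>\<^sup>+ e. F (fst t, \<lambda>i\<in>{..<n}. snd (snd t) i + fst (snd t) i + e i, fst (snd t)) \<partial>\<G> N2 n \<partial>input_law Q c)"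
    by (subst nn_integral_input_law) auto
  finally show ?thesis .
qed

lemma distributed_message_eve:
  "distributed (code_law Q N1 N2 c) (message_space c \<Otimes>\<^sub>M (lborel_block n \<Otimes>\<^sub>M lborel_block n)) (\<lambda>\<omega>. (message \<omega>, (eve_output n \<omega>, state \<omega>))) joint_density"
proof -
  interpret A: prob_space "\<G> N1 n" using N1 by (rule prob_space_gaussian_block)
  let ?T = "message_space c \<Otimes>\<^sub>M (lborel_block n \<Otimes>\<^sub>M lborel_block n)"
  let ?X = "\<lambda>\<omega>. (message \<omega>, (eve_output n \<omega>, state \<omega>))"
  have Xm: "?X \<in> code_law Q N1 N2 c \<rightarrow>\<^sub>M ?T"
    unfolding outcome_projections[abs_def] by measurable
  have Xm': "?X \<in> input_space \<Otimes>\<^sub>M (blk n \<Otimes>\<^sub>M blk n) \<rightarrow>\<^sub>M ?T"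
    using Xm by (simp cong: measurable_cong_sets)
  have "distr (code_law Q N1 N2 c) ?T ?X = density ?T joint_density"
  proof (rule measure_eqI)
    fix E assume "E \<in> sets (distr (code_law Q N1 N2 c) ?T ?X)"
    then have E: "E \<in> sets ?T" by simp
    have "sets ?T = sets (message_space c \<Otimes>\<^sub>M (blk n \<Otimes>\<^sub>M blk n))" by (intro sets_pair_measure_cong) auto
    then have E'[measurable]: "E \<in> sets (message_space c \<Otimes>\<^sub>M (blk n \<Otimes>\<^sub>M blk n))" using E by simp
    have "emeasure (distr (code_law Q N1 N2 c) ?T ?X) E = (\<integral>\<^sup>+ \<omega>. indicator E (?X \<omega>) \<partial>code_law Q N1 N2 c)"
      using Xm E by (rule emeasure_distr_eq_nn_integral)
    also have "\<dots> = (\<integral>\<^sup>+ t. \<integral>\<^sup>+ e1. \<integral>\<^sup>+ e. indicator E (fst t, \<lambda>i\<in>{..<n}. snd (snd t) i + fst (snd t) i + e i, fst (snd t)) \<partial>\<G> N2 n \<partial>\<G> N1 n \<partial>input_law Q c)"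
      by (subst nn_integral_code_law, rule measurable_compose[OF Xm' borel_measurable_indicator[OF E]])
         (simp add: outcome_projections)
    also have "\<dots> = (\<integral>\<^sup>+ t. \<integral>\<^sup>+ e. indicator E (fst t, \<lambda>i\<in>{..<n}. snd (snd t) i + fst (snd t) i + e i, fst (snd t)) \<partial>\<G> N2 n \<partial>input_law Q c)"
      using A.emeasure_space_1 by simp
    also have "\<dots> = (\<integral>\<^sup>+ p. ennreal (joint_density p) * indicator E p \<partial>?T)"
      by (rule nn_integral_eve[symmetric]) measurable
    also have "\<dots> = emeasure (density ?T joint_density) E"
      using E by (subst emeasure_density) auto
    finally show "emeasure (distr (code_law Q N1 N2 c) ?T ?X) E = emeasure (density ?T joint_density) E" .
  qed simp
  then show ?thesis unfolding distributed_def using Xm by auto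
qed

lemma discrete_conditional_eve:
  assumes "1 < b"
  shows "discrete_conditional (code_law Q N1 N2 c) b {1..m} (lborel_block n \<Otimes>\<^sub>M lborel_block n) message (\<lambda>\<omega>. (eve_output n \<omega>, state \<omega>)) joint_density"
proof -
  interpret prob_space "code_law Q N1 N2 c" by (rule prob_space_code_law)
  interpret L: sigma_finite_measure "lborel_block n" by (rule sigma_finite_lborel_block)
  interpret LL: pair_sigma_finite "lborel_block n" "lborel_block n" ..
  show ?thesis
    using assms m by unfold_locales (auto simp: joint_density_nonneg distributed_message_eve LL.sigma_finite_countable)
qed

text \<open>The cross entropy is expressed through message, state, input and noise instead of the
  joint density, so that the converse can argue for one input block at a time.\<close>

lemma equivocation_upper:
  fixes \<kappa> D :: real
  assumes b: "1 < b" and q[measurable]: "q \<in> borel_measurable (message_space c \<Otimes>\<^sub>M (blk n \<Otimes>\<^sub>M blk n))" and \<kappa>: "0 < \<kappa>"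
    and qb: "\<And>w v. w \<in> {1..m} \<Longrightarrow> v \<in> space (blk n \<Otimes>\<^sub>M blk n) \<Longrightarrow> \<kappa> \<le> q (w, v)"
    and qs: "\<And>v. v \<in> space (blk n \<Otimes>\<^sub>M blk n) \<Longrightarrow> (\<Sum>w\<in>{1..m}. q (w, v)) \<le> 1"
    and D: "0 \<le> D" "(\<integral>\<^sup>+ t. \<integral>\<^sup>+ e. ennreal (- ln (q (fst t, \<lambda>i\<in>{..<n}. snd (snd t) i + fst (snd t) i + e i, fst (snd t)))) \<partial>\<G> N2 n \<partial>input_law Q c) \<le> ennreal D"
  shows "n * equivocation b Q N1 N2 c \<le> D / ln b"
proof -
  interpret discrete_conditional "code_law Q N1 N2 c" b "{1..m}" "lborel_block n \<Otimes>\<^sub>M lborel_block n" message "\<lambda>\<omega>. (eve_output n \<omega>, state \<omega>)" joint_density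
    using b by (rule discrete_conditional_eve)
  have sp: "space (lborel_block n \<Otimes>\<^sub>M lborel_block n) = space (blk n \<Otimes>\<^sub>M blk n)" by (simp add: space_pair_measure)
  have n0: "real n \<noteq> 0" using n by simp
  have le: "q (w, v) \<le> 1" if "w \<in> {1..m}" "v \<in> space (blk n \<Otimes>\<^sub>M blk n)" for w v
    using qs[OF that(2)] member_le_sum[of w "{1..m}" "\<lambda>w. q (w, v)"] that qb \<kappa> by (smt (verit) DiffD1 finite_atLeastAtMost)
  have "n * equivocation b Q N1 N2 c = conditional_entropy b (message_space c) (lborel_block n \<Otimes>\<^sub>M lborel_block n) message (\<lambda>\<omega>. (eve_output n \<omega>, state \<omega>))"
    unfolding equivocation_def using n0 by simp
  also have "\<dots> \<le> (\<integral>x. joint_density x * (- ln (q x)) \<partial>CT) / ln b"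
    using qb qs by (intro cond_entropy_upper[where \<kappa>=\<kappa>] \<kappa>) (auto simp: space_pair_measure)
  also have "(\<integral>x. joint_density x * (- ln (q x)) \<partial>CT) \<le> D"
  proof -
    have nn: "0 \<le> joint_density x * (- ln (q x))" if "x \<in> space CT" for x
    proof -
      have x: "fst x \<in> {1..m}" "snd x \<in> space (blk n \<Otimes>\<^sub>M blk n)"
        using that by (auto simp: space_pair_measure)
      have "0 < q x" "q x \<le> 1" using qb[OF x] le[OF x] \<kappa> by auto
      then show ?thesis using joint_density_nonneg[of x] by (intro mult_nonneg_nonneg) auto
    qed
    have "(\<integral>\<^sup>+ x. ennreal (joint_density x * (- ln (q x))) \<partial>CT) = (\<integral>\<^sup>+ x. ennreal (joint_density x) * ennreal (- ln (q x)) \<partial>CT)"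
      by (intro nn_integral_cong ennreal_mult' joint_density_nonneg)
    also have "\<dots> = (\<integral>\<^sup>+ t. \<integral>\<^sup>+ e. ennreal (- ln (q (fst t, \<lambda>i\<in>{..<n}. snd (snd t) i + fst (snd t) i + e i, fst (snd t)))) \<partial>\<G> N2 n \<partial>input_law Q c)"
      by (rule nn_integral_eve) measurable
    finally have le: "(\<integral>\<^sup>+ x. ennreal (joint_density x * (- ln (q x))) \<partial>CT) \<le> ennreal D" using D by simp
    show ?thesis
      using le D nn by (subst integral_eq_nn_integral) (auto intro!: AE_I2 enn2real_leI)
  qed
  finally show ?thesis using ln_base_pos by (simp add: divide_right_mono)
qed

text \<open>The reference law makes \<open>Z - S\<close> Gaussian of variance \<open>v\<close>,
  independent of state and message. Subtracting the state is what an eavesdropper who knows it can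
  do, and it leaves the fixed target \<open>gauss_density v n\<close>.\<close>

lemma equivocation_lower:
  fixes v D :: real
  assumes b: "1 < b" and v: "0 < v" and D: "0 \<le> D"
    "(\<Sum>w\<in>{1..m}. ennreal (1 / m) * (\<integral>\<^sup>+ s. \<integral>\<^sup>+ z. ennreal \<bar>eve_density w (\<lambda>i\<in>{..<n}. z i + s i) s - gauss_density v n z\<bar> \<partial>lborel_block n \<partial>\<G> Q n)) \<le> ennreal D"
  shows "log b m - 2 * (ln m + 1) * D / ln b \<le> n * equivocation b Q N1 N2 c"
proof -
  interpret discrete_conditional "code_law Q N1 N2 c" b "{1..m}" "lborel_block n \<Otimes>\<^sub>M lborel_block n" message "\<lambda>\<omega>. (eve_output n \<omega>, state \<omega>)" joint_density
    using b by (rule discrete_conditional_eve)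
  interpret L: sigma_finite_measure "lborel_block n" by (rule sigma_finite_lborel_block)
  interpret LL: pair_sigma_finite "lborel_block n" "lborel_block n" ..
  have n0: "real n \<noteq> 0" using n by simp
  define h where "h v' = 1 / m * gauss_density Q n (snd v') * gauss_density v n (\<lambda>i. fst v' i - snd v' i)" for v'
  have h[measurable]: "h \<in> borel_measurable (lborel_block n \<Otimes>\<^sub>M lborel_block n)"
    unfolding h_def[abs_def] by measurable
  have "(\<integral>\<^sup>+ x. ennreal \<bar>joint_density x - h (snd x)\<bar> \<partial>CT) = (\<Sum>w\<in>{1..m}. \<integral>\<^sup>+ v'. ennreal \<bar>joint_density (w, v') - h v'\<bar> \<partial>(lborel_block n \<Otimes>\<^sub>M lborel_block n))"
    by (subst nn_integral_count_space_pair(1)[OF _ LL.sigma_finite_measure_axioms]) auto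
  also have "\<dots> = (\<Sum>w\<in>{1..m}. ennreal (1 / m) * (\<integral>\<^sup>+ s. \<integral>\<^sup>+ z. ennreal \<bar>eve_density w (\<lambda>i\<in>{..<n}. z i + s i) s - gauss_density v n z\<bar> \<partial>lborel_block n \<partial>\<G> Q n))"
  proof (intro sum.cong refl)
    fix w assume w: "w \<in> {1..m}"
    note em[measurable] = eve_density_meas[OF w]
    define K where "K p = ennreal \<bar>eve_density w (fst p) (snd p) - gauss_density v n (\<lambda>i. fst p i - snd p i)\<bar>" for p
    have K[measurable]: "K \<in> borel_measurable (blk n \<Otimes>\<^sub>M blk n)" unfolding K_def[abs_def] by measurable
    have jK: "ennreal \<bar>joint_density (w, v') - h v'\<bar> = ennreal (1 / m) * (ennreal (gauss_density Q n (snd v')) * K v')" for v'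
    proof -
      have "joint_density (w, v') - h v' = 1 / m * (gauss_density Q n (snd v') * (eve_density w (fst v') (snd v') - gauss_density v n (\<lambda>i. fst v' i - snd v' i)))"
        by (simp add: joint_density_def h_def algebra_simps)
      then show ?thesis by (simp add: abs_mult K_def ennreal_mult'[symmetric])
    qed
    have "(\<integral>\<^sup>+ v'. ennreal \<bar>joint_density (w, v') - h v'\<bar> \<partial>(lborel_block n \<Otimes>\<^sub>M lborel_block n))
      = ennreal (1 / m) * (\<integral>\<^sup>+ v'. ennreal (gauss_density Q n (snd v')) * K v' \<partial>(lborel_block n \<Otimes>\<^sub>M lborel_block n))"
      unfolding jK by (rule nn_integral_cmult) measurable
    also have "(\<integral>\<^sup>+ v'. ennreal (gauss_density Q n (snd v')) * K v' \<partial>(lborel_block n \<Otimes>\<^sub>M lborel_block n))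
      = (\<integral>\<^sup>+ s. \<integral>\<^sup>+ z. ennreal (gauss_density Q n s) * K (z, s) \<partial>lborel_block n \<partial>lborel_block n)"
      by (subst LL.nn_integral_snd[symmetric]) auto
    also have "\<dots> = (\<integral>\<^sup>+ s. ennreal (gauss_density Q n s) * (\<integral>\<^sup>+ z. K (z, s) \<partial>lborel_block n) \<partial>lborel_block n)"
      by (intro nn_integral_cong nn_integral_cmult) measurable
    also have "\<dots> = (\<integral>\<^sup>+ s. (\<integral>\<^sup>+ z. K (z, s) \<partial>lborel_block n) \<partial>\<G> Q n)"
    proof -
      have "(\<lambda>s. \<integral>\<^sup>+ z. K (z, s) \<partial>lborel_block n) \<in> borel_measurable (blk n)"
      proof -
        have "(\<lambda>p. K (snd p, fst p)) \<in> borel_measurable (blk n \<Otimes>\<^sub>M lborel_block n)"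
          using measurable_compose[OF measurable_pair_swap'[of "blk n" "blk n"] K] by (simp add: split_beta' cong: measurable_cong_sets)
        from L.borel_measurable_nn_integral_fst[OF this] show ?thesis by simp
      qed
      then show ?thesis using Q by (subst nn_integral_gaussian_block) auto
    qed
    also have "\<dots> = (\<integral>\<^sup>+ s. (\<integral>\<^sup>+ z. K (\<lambda>i\<in>{..<n}. z i + s i, s) \<partial>lborel_block n) \<partial>\<G> Q n)"
    proof (rule nn_integral_cong)
      fix s assume "s \<in> space (\<G> Q n)"
      then have s: "s \<in> space (blk n)" by simp
      have "(\<lambda>z. K (z, s)) \<in> borel_measurable (blk n)" using s by measurable
      from nn_integral_lborel_block_translate[OF this, of s] show "(\<integral>\<^sup>+ z. K (z, s) \<partial>lborel_block n) = (\<integral>\<^sup>+ z. K (\<lambda>i\<in>{..<n}. z i + s i, s) \<partial>lborel_block n)" by simp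
    qed
    also have "\<dots> = (\<integral>\<^sup>+ s. \<integral>\<^sup>+ z. ennreal \<bar>eve_density w (\<lambda>i\<in>{..<n}. z i + s i) s - gauss_density v n z\<bar> \<partial>lborel_block n \<partial>\<G> Q n)"
      unfolding K_def by (intro nn_integral_cong arg_cong[where f=ennreal] arg_cong[where f=abs] arg_cong2[where f="(-)"] gauss_density_cong) auto
    finally show "(\<integral>\<^sup>+ v'. ennreal \<bar>joint_density (w, v') - h v'\<bar> \<partial>(lborel_block n \<Otimes>\<^sub>M lborel_block n)) = ennreal (1 / m) * (\<integral>\<^sup>+ s. \<integral>\<^sup>+ z. ennreal \<bar>eve_density w (\<lambda>i\<in>{..<n}. z i + s i) s - gauss_density v n z\<bar> \<partial>lborel_block n \<partial>\<G> Q n)" .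
  qed
  finally have "(\<integral>\<^sup>+ x. ennreal \<bar>joint_density x - h (snd x)\<bar> \<partial>CT) \<le> ennreal D" using D by simp
  from cond_entropy_lower[OF h D(1) this] show ?thesis
    unfolding equivocation_def using n0 by simp
qed

end

subsection \<open>Converse\<close>

text \<open>Jensen's inequality for \<open>d * r\<close> under \<open>M\<close>, in the form
  \<open>ln y \<le> y - 1\<close> at \<open>y = d x * r x / q\<close>, where \<open>q\<close> is the
  integral of \<open>d * r\<close>. The bounds on \<open>d\<close> make its logarithm integrable and
  \<open>q\<close> positive.\<close>

lemma neg_ln_integral_le:
  fixes d r :: "'a \<Rightarrow> real"
  assumes M: "prob_space M" and d[measurable]: "d \<in> borel_measurable M" and \<kappa>: "0 < \<kappa>"
    and db: "\<And>x. \<kappa> \<le> d x" "\<And>x. d x \<le> 1"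
    and r[measurable]: "r \<in> borel_measurable M" and r0: "\<And>x. 0 < r x" and ri: "integrable M r" and re: "(\<integral>x. r x \<partial>M) = 1"
    and lri: "integrable M (\<lambda>x. ln (r x))"
  shows "- ln (\<integral>x. d x * r x \<partial>M) \<le> (\<integral>x. - ln (d x) \<partial>M) - (\<integral>x. ln (r x) \<partial>M)"
    and "integrable M (\<lambda>x. - ln (d x))"
proof -
  interpret prob_space M by fact
  have d0: "0 < d x" for x using db(1)[of x] \<kappa> by simp
  show ldi: "integrable M (\<lambda>x. - ln (d x))"
  proof (rule integrable_const_bound[where B="- ln \<kappa>"])
    show "AE x in M. norm (- ln (d x)) \<le> - ln \<kappa>"
      using db d0 \<kappa> by (auto intro!: AE_I2)
  qed measurable
  have dri: "integrable M (\<lambda>x. d x * r x)"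
    using db d0 r0 by (intro Bochner_Integration.integrable_bound[OF ri]) (auto simp: abs_mult less_imp_le mult_left_le_one_le)
  define q where "q = (\<integral>x. d x * r x \<partial>M)"
  have "(\<integral>x. \<kappa> * r x \<partial>M) \<le> q"
    unfolding q_def using ri dri db r0 by (intro integral_mono) (auto intro!: mult_right_mono simp: less_imp_le)
  then have q0: "0 < q" using \<kappa> re by simp
  have "(\<integral>x. ln (d x) + ln (r x) - ln q \<partial>M) \<le> (\<integral>x. d x * r x / q - 1 \<partial>M)"
  proof (rule integral_mono)
    show "ln (d x) + ln (r x) - ln q \<le> d x * r x / q - 1" for x
      using ln_le_minus_one[of "d x * r x / q"] d0[of x] r0[of x] q0 by (simp add: ln_mult ln_div)
  qed (use ldi lri dri in auto)
  also have "\<dots> = 0" using dri q0 prob_space by (simp add: q_def)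
  finally show "- ln (\<integral>x. d x * r x \<partial>M) \<le> (\<integral>x. - ln (d x) \<partial>M) - (\<integral>x. ln (r x) \<partial>M)"
    using ldi lri prob_space unfolding q_def by simp
qed

text \<open>Jensen's inequality for the logarithm after a change of measure from \<open>M\<close> to \<open>density M r\<close>;
  the price is the relative entropy of \<open>M\<close> with respect to \<open>density M r\<close>.\<close>

lemma neg_ln_change_of_measure:
  fixes d r :: "'a \<Rightarrow> real"
  assumes M: "prob_space M" and d[measurable]: "d \<in> borel_measurable M" and \<kappa>: "0 < \<kappa>"
    and db: "\<And>x. \<kappa> \<le> d x" "\<And>x. d x \<le> 1"
    and r[measurable]: "r \<in> borel_measurable M" and r0: "\<And>x. 0 < r x" and r1: "(\<integral>\<^sup>+ x. ennreal (r x) \<partial>M) = 1"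
    and lri: "integrable M (\<lambda>x. ln (r x))" and V: "V = - (\<integral>x. ln (r x) \<partial>M)"
  shows "0 \<le> V" and "ennreal (- ln (\<integral>x. d x * r x \<partial>M)) \<le> (\<integral>\<^sup>+ x. ennreal (- ln (d x)) \<partial>M) + ennreal V"
proof -
  have ri: "integrable M r" using r0 r1 by (intro integrableI_nonneg) (auto simp: less_imp_le)
  have re: "(\<integral>x. r x \<partial>M) = 1" using r0 r1 by (subst integral_eq_nn_integral) (auto simp: less_imp_le)
  \<comment> \<open>The case \<open>d = 1\<close> of the preceding inequality: relative entropy is
    nonnegative.\<close>
  show V0: "0 \<le> V"
    using neg_ln_integral_le(1)[OF M _ zero_less_one _ _ r r0 ri re lri, of "\<lambda>_. 1"] re V by simp
  note * = neg_ln_integral_le[OF M d \<kappa> db r r0 ri re lri]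
  have l0: "0 \<le> - ln (d x)" for x using db[of x] \<kappa> by simp
  have "(\<integral>\<^sup>+ x. ennreal (- ln (d x)) \<partial>M) = ennreal (\<integral>x. - ln (d x) \<partial>M)"
    using *(2) l0 by (intro nn_integral_eq_integral) auto
  moreover have "0 \<le> (\<integral>x. - ln (d x) \<partial>M)" using l0 by (intro Bochner_Integration.integral_nonneg)
  ultimately show "ennreal (- ln (\<integral>x. d x * r x \<partial>M)) \<le> (\<integral>\<^sup>+ x. ennreal (- ln (d x)) \<partial>M) + ennreal V"
    using *(1) V0 V by (simp add: ennreal_plus[symmetric] ennreal_leI del: ennreal_plus)
qed

lemma gaussian_block_component_square:
  assumes v: "0 < v" and i: "i < n"
  shows "integrable (\<G> v n) (\<lambda>g. (k + p * g i)\<^sup>2)"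
    and "(\<integral>g. (k + p * g i)\<^sup>2 \<partial>\<G> v n) = k\<^sup>2 + p\<^sup>2 * v"
proof -
  interpret G: prob_space "gauss v" using v by (rule prob_space_gauss)
  have d: "distr (\<G> v n) (gauss v) (\<lambda>g. g i) = gauss v"
    unfolding gaussian_block_eq using i by (intro distr_PiM_component G.prob_space_axioms) auto
  have "i \<in> {..<n}" using i by simp
  then have m: "(\<lambda>g. g i) \<in> \<G> v n \<rightarrow>\<^sub>M gauss v" by measurable
  have ex: "(\<lambda>t. (k + p * t)\<^sup>2) = (\<lambda>t. k\<^sup>2 + 2 * k * p * t + p\<^sup>2 * t\<^sup>2)" by (auto simp: power2_eq_square algebra_simps)
  have i1: "integrable (gauss v) (\<lambda>t. t)" using gauss_moments(1)[OF v, of 1] by simp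
  have i2: "integrable (gauss v) (\<lambda>t. t\<^sup>2)" using gauss_moments(1)[OF v, of 2] .
  have I: "integrable (gauss v) (\<lambda>t. (k + p * t)\<^sup>2)" unfolding ex using i1 i2 by auto
  have E: "(\<integral>t. (k + p * t)\<^sup>2 \<partial>gauss v) = k\<^sup>2 + p\<^sup>2 * v"
    unfolding ex using i1 i2 gauss_moments(2,3)[OF v] G.prob_space by simp
  show "integrable (\<G> v n) (\<lambda>g. (k + p * g i)\<^sup>2)"
    using I integrable_distr_eq[OF m, of "\<lambda>t. (k + p * t)\<^sup>2"] d by simp
  show "(\<integral>g. (k + p * g i)\<^sup>2 \<partial>\<G> v n) = k\<^sup>2 + p\<^sup>2 * v"
    using E integral_distr[OF m, of "\<lambda>t. (k + p * t)\<^sup>2"] d by simp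
qed

context wiretap begin

text \<open>The decoder mixed with the uniform law, so that logarithms stay bounded; \<open>blur\<close> runs it on the
  estimate \<open>s + \<beta> (z - s)\<close> of the legitimate output, perturbed by Gaussian noise of variance \<open>v\<close>.\<close>

definition "guess w y = (if decoder c y = w then 1 / 2 else 0) + 1 / (2 * real m)"

lemma guess_bounds: "1 / (2 * real m) \<le> guess w y" "guess w y \<le> 1" "0 < 1 / (2 * real m)"
  using m by (auto simp: guess_def field_simps)

lemma guess_meas[measurable]: "w \<in> {1..m} \<Longrightarrow> guess w \<in> borel_measurable (blk n)"
  unfolding guess_def[abs_def] by measurable

lemma sum_guess: "y \<in> space (blk n) \<Longrightarrow> (\<Sum>w\<in>{1..m}. guess w y) = 1"
  using measurable_space[OF dec_meas, of y] m by (simp add: guess_def sum.distrib)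

text \<open>Fano's inequality in pointwise form: mixing with the uniform law costs at most
  \<open>ln 2\<close> on a correct decision and caps the loss of a wrong one at
  \<open>ln 2 + ln m\<close>.\<close>

lemma neg_ln_guess: "- ln (guess w y) \<le> ln 2 + (if decoder c y \<noteq> w then ln m else 0)"
proof (cases "decoder c y = w")
  case True
  then have "ln (1/2) \<le> ln (guess w y)" using m by (intro ln_mono) (auto simp: guess_def)
  then show ?thesis using True by (simp add: ln_div)
next
  case False
  then have "ln (guess w y) = - ln 2 - ln m" using m by (simp add: guess_def ln_div ln_mult)
  then show ?thesis using False by simp
qed

definition "blur v \<beta> \<rho> w z s = (\<integral>g. guess w (\<lambda>i\<in>{..<n}. s i + \<beta> * (z i - s i) + \<rho> * g i) \<partial>\<G> v n)"

text \<open>\<open>blur\<close> is the conditional test law. Hypothesis \<open>A\<close> compares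
  log losses for one message, state and input block; since its right side is affine in the energy of
  the block, averaging turns it into the power constraint and the error probability.\<close>

lemma converse_core:
  fixes P K \<mu> \<epsilon> v \<beta> \<rho> :: real
  assumes b: "1 < b" and P: "0 \<le> P" and pc: "power_constraint P Q N1 N2 c" and v: "0 < v"
    and err: "error_prob Q N1 N2 c \<le> \<epsilon>" and \<epsilon>: "0 \<le> \<epsilon>" and K: "0 \<le> K" "0 \<le> \<mu>"
    and A: "\<And>w s x. w \<in> {1..m} \<Longrightarrow> s \<in> space (blk n) \<Longrightarrow> x \<in> space (blk n) \<Longrightarrow>
      (\<integral>\<^sup>+ e. ennreal (- ln (blur v \<beta> \<rho> w (\<lambda>i\<in>{..<n}. x i + s i + e i) s)) \<partial>\<G> N2 n)
      \<le> (\<integral>\<^sup>+ e. ennreal (- ln (guess w (\<lambda>i\<in>{..<n}. x i + s i + e i))) \<partial>\<G> N1 n) + ennreal (K + \<mu> * (\<Sum>i<n. (x i)\<^sup>2))"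
  shows "n * equivocation b Q N1 N2 c \<le> (K + \<mu> * (n * P) + ln 2 + \<epsilon> * ln m) / ln b"
proof -
  interpret I: prob_space "input_law Q c" by (rule prob_space_input_law)
  interpret G: prob_space "\<G> v n" using v by (rule prob_space_gaussian_block)
  interpret A: prob_space "\<G> N1 n" using N1 by (rule prob_space_gaussian_block)
  interpret B: prob_space "\<G> N2 n" using N2 by (rule prob_space_gaussian_block)
  define q where "q p = blur v \<beta> \<rho> (fst p) (fst (snd p)) (snd (snd p))" for p
  have gi: "integrable (\<G> v n) (\<lambda>g. guess w (\<lambda>i\<in>{..<n}. s i + \<beta> * (z i - s i) + \<rho> * g i))"
    if w: "w \<in> {1..m}" for w s z
  proof (rule G.integrable_const_bound[where B=1])
    have "0 \<le> guess w y" for y using guess_bounds(1)[of w y] guess_bounds(3) by linarith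
    then show "AE g in \<G> v n. norm (guess w (\<lambda>i\<in>{..<n}. s i + \<beta> * (z i - s i) + \<rho> * g i)) \<le> 1"
      using guess_bounds(2) by (auto intro!: AE_I2)
  qed (use w in measurable)
  have qm[measurable]: "q \<in> borel_measurable (message_space c \<Otimes>\<^sub>M (blk n \<Otimes>\<^sub>M blk n))"
  proof (rule measurable_pair_measure_countable1)
    fix w assume w: "w \<in> {1..m}"
    note [measurable] = guess_meas[OF w]
    show "(\<lambda>y. q (w, y)) \<in> borel_measurable (blk n \<Otimes>\<^sub>M blk n)"
      unfolding q_def blur_def fst_conv snd_conv by (rule G.borel_measurable_lebesgue_integral) measurable
  qed simp
  have qb: "1 / (2 * real m) \<le> q (w, u)" if w: "w \<in> {1..m}" for w u
  proof -
    have "1 / (2 * real m) = (\<integral>g. 1 / (2 * real m) \<partial>\<G> v n)" using G.prob_space by simp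
    also have "\<dots> \<le> q (w, u)" unfolding q_def blur_def fst_conv snd_conv
      by (rule integral_mono[OF _ gi[OF w]]) (auto intro: guess_bounds)
    finally show ?thesis .
  qed
  have qs: "(\<Sum>w\<in>{1..m}. q (w, u)) \<le> 1" for u
  proof -
    have "(\<Sum>w\<in>{1..m}. q (w, u)) = (\<integral>g. (\<Sum>w\<in>{1..m}. guess w (\<lambda>i\<in>{..<n}. snd u i + \<beta> * (fst u i - snd u i) + \<rho> * g i)) \<partial>\<G> v n)"
      unfolding q_def blur_def fst_conv snd_conv by (rule Bochner_Integration.integral_sum[symmetric]) (rule gi)
    also have "\<dots> = 1" using G.prob_space by (subst sum_guess) (auto simp: space_PiM)
    finally show ?thesis by simp
  qed
  have l0: "0 \<le> - ln (guess w y)" for w y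
  proof -
    have "0 < guess w y" using guess_bounds(1)[of w y] guess_bounds(3) by linarith
    then show ?thesis using guess_bounds(2)[of w y] by simp
  qed
  have mm: "Measurable.pred (input_space \<Otimes>\<^sub>M blk n) (\<lambda>p. decoder c (\<lambda>i\<in>{..<n}. snd (snd (fst p)) i + fst (snd (fst p)) i + snd p i) \<noteq> fst (fst p))"
    by (rule pred_decoding_error) measurable
  have mm1: "(\<lambda>p. if decoder c (\<lambda>i\<in>{..<n}. snd (snd (fst p)) i + fst (snd (fst p)) i + snd p i) \<noteq> fst (fst p) then (1::ennreal) else 0) \<in> borel_measurable (input_law Q c \<Otimes>\<^sub>M \<G> N1 n)"
    using mm by measurable
  have mm2[measurable]: "(\<lambda>t. \<integral>\<^sup>+ e. (if decoder c (\<lambda>i\<in>{..<n}. snd (snd t) i + fst (snd t) i + e i) \<noteq> fst t then 1 else 0) \<partial>\<G> N1 n) \<in> borel_measurable (input_law Q c)"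
    using A.borel_measurable_nn_integral_fst[OF mm1] by simp
  have "(\<integral>\<^sup>+ t. \<integral>\<^sup>+ e. ennreal (- ln (q (fst t, \<lambda>i\<in>{..<n}. snd (snd t) i + fst (snd t) i + e i, fst (snd t)))) \<partial>\<G> N2 n \<partial>input_law Q c)
    \<le> (\<integral>\<^sup>+ t. (ennreal (ln 2) + ennreal (ln m) * (\<integral>\<^sup>+ e. (if decoder c (\<lambda>i\<in>{..<n}. snd (snd t) i + fst (snd t) i + e i) \<noteq> fst t then 1 else 0) \<partial>\<G> N1 n))
      + (ennreal K + ennreal \<mu> * ennreal (\<Sum>i<n. (snd (snd t) i)\<^sup>2)) \<partial>input_law Q c)"
  proof (intro nn_integral_mono)
    fix t assume "t \<in> space (input_law Q c)"
    then obtain w s x where t: "t = (w, s, x)" "w \<in> {1..m}" "s \<in> space (blk n)" "x \<in> space (blk n)"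
      by (cases t) (auto simp: space_input_law)
    note [measurable] = guess_meas[OF t(2)]
    have [measurable]: "Measurable.pred (blk n) (\<lambda>e. decoder c (\<lambda>i\<in>{..<n}. x i + s i + e i) \<noteq> w)"
      using t(2) by (intro pred_decoding_error) measurable
    have "(\<integral>\<^sup>+ e. ennreal (- ln (guess w (\<lambda>i\<in>{..<n}. x i + s i + e i))) \<partial>\<G> N1 n)
      \<le> (\<integral>\<^sup>+ e. ennreal (ln 2) + ennreal (ln m) * (if decoder c (\<lambda>i\<in>{..<n}. x i + s i + e i) \<noteq> w then 1 else 0) \<partial>\<G> N1 n)"
    proof (intro nn_integral_mono)
      fix e
      show "ennreal (- ln (guess w (\<lambda>i\<in>{..<n}. x i + s i + e i))) \<le> ennreal (ln 2) + ennreal (ln m) * (if decoder c (\<lambda>i\<in>{..<n}. x i + s i + e i) \<noteq> w then 1 else 0)"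
        using neg_ln_guess[of w "\<lambda>i\<in>{..<n}. x i + s i + e i"] m
        by (auto simp: ennreal_plus[symmetric] simp del: ennreal_plus intro!: ennreal_leI split: if_splits)
    qed
    also have "\<dots> = ennreal (ln 2) + ennreal (ln m) * (\<integral>\<^sup>+ e. (if decoder c (\<lambda>i\<in>{..<n}. x i + s i + e i) \<noteq> w then 1 else 0) \<partial>\<G> N1 n)"
      using A.emeasure_space_1 by (subst nn_integral_add) (auto simp: nn_integral_cmult)
    finally have g1: "(\<integral>\<^sup>+ e. ennreal (- ln (guess w (\<lambda>i\<in>{..<n}. x i + s i + e i))) \<partial>\<G> N1 n) \<le> \<dots>" .
    have g2: "ennreal (K + \<mu> * (\<Sum>i<n. (x i)\<^sup>2)) = ennreal K + ennreal \<mu> * ennreal (\<Sum>i<n. (x i)\<^sup>2)"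
      using K by (simp add: ennreal_mult'[symmetric] ennreal_plus[symmetric] sum_nonneg del: ennreal_plus)
    show "(\<integral>\<^sup>+ e. ennreal (- ln (q (fst t, \<lambda>i\<in>{..<n}. snd (snd t) i + fst (snd t) i + e i, fst (snd t)))) \<partial>\<G> N2 n)
      \<le> (ennreal (ln 2) + ennreal (ln m) * (\<integral>\<^sup>+ e. (if decoder c (\<lambda>i\<in>{..<n}. snd (snd t) i + fst (snd t) i + e i) \<noteq> fst t then 1 else 0) \<partial>\<G> N1 n))
      + (ennreal K + ennreal \<mu> * ennreal (\<Sum>i<n. (snd (snd t) i)\<^sup>2))"
      unfolding t q_def fst_conv snd_conv by (rule order_trans[OF A[OF t(2-4)] add_mono[OF g1 eq_refl[OF g2]]])
  qed
  also have "\<dots> = (ennreal (ln 2) + ennreal (ln m) * ennreal (error_prob Q N1 N2 c)) + (ennreal K + ennreal \<mu> * (\<integral>\<^sup>+ t. ennreal (\<Sum>i<n. (snd (snd t) i)\<^sup>2) \<partial>input_law Q c))"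
  proof -
    have "(\<lambda>t. ennreal (\<Sum>i<n. (snd (snd t) i)\<^sup>2)) \<in> borel_measurable (input_law Q c)" by measurable
    then show ?thesis unfolding error_prob_eq using mm2
      by (simp add: nn_integral_add nn_integral_cmult I.emeasure_space_1)
  qed
  also have "\<dots> \<le> (ennreal (ln 2) + ennreal (ln m) * ennreal \<epsilon>) + (ennreal K + ennreal \<mu> * ennreal (n * P))"
    by (rule add_mono[OF add_left_mono[OF mult_left_mono] add_left_mono[OF mult_left_mono]])
       (use pc err in \<open>simp_all add: power_constraint_iff[OF P] ennreal_leI\<close>)
  also have "\<dots> = ennreal ((ln 2 + ln m * \<epsilon>) + (K + \<mu> * (n * P)))"
    using K P m \<epsilon> by (simp add: ennreal_mult' ennreal_plus)
  also have "(ln 2 + ln m * \<epsilon>) + (K + \<mu> * (n * P)) = K + \<mu> * (n * P) + ln 2 + \<epsilon> * ln m"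
    by (simp add: mult.commute)
  finally have D: "(\<integral>\<^sup>+ t. \<integral>\<^sup>+ e. ennreal (- ln (q (fst t, \<lambda>i\<in>{..<n}. snd (snd t) i + fst (snd t) i + e i, fst (snd t)))) \<partial>\<G> N2 n \<partial>input_law Q c) \<le> ennreal (K + \<mu> * (n * P) + ln 2 + \<epsilon> * ln m)" .
  show ?thesis
    by (rule equivocation_upper[OF b qm guess_bounds(3) qb qs _ D]) (use K P m \<epsilon> in auto)
qed

text \<open>Adding noise to \<open>Z\<close> produces the law of \<open>Y\<close> for every input
  and state, so the eavesdropper decodes as well as the receiver and only the Fano term is left. The
  change of measure is trivial here, with density 1.\<close>

lemma converse_stronger_eavesdropper:
  fixes P \<epsilon> :: real
  assumes b: "1 < b" and P: "0 \<le> P" and pc: "power_constraint P Q N1 N2 c"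
    and err: "error_prob Q N1 N2 c \<le> \<epsilon>" and \<epsilon>: "0 \<le> \<epsilon>" and N: "N2 \<le> N1"
  shows "n * equivocation b Q N1 N2 c \<le> (ln 2 + \<epsilon> * ln m) / ln b"
proof -
  interpret G: prob_space "\<G> 1 n" by (rule prob_space_gaussian_block) simp
  interpret B: prob_space "\<G> N2 n" using N2 by (rule prob_space_gaussian_block)
  \<comment> \<open>Standard noise is scaled by \<open>\<rho>\<close>, in place of noise of variance
    \<open>N1 - N2\<close>, because this variance vanishes when both channels are equally
    good.\<close>
  define \<rho> where "\<rho> = sqrt (N1 - N2)"
  have \<rho>: "\<rho>\<^sup>2 = N1 - N2" using N by (simp add: \<rho>_def)
  have "n * equivocation b Q N1 N2 c \<le> (0 + 0 * (n * P) + ln 2 + \<epsilon> * ln m) / ln b"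
  proof (rule converse_core[OF b P pc zero_less_one err \<epsilon> order_refl order_refl, where \<beta>=1 and \<rho>=\<rho>])
    fix w s x assume w: "w \<in> {1..m}" and s: "s \<in> space (blk n)" and x: "x \<in> space (blk n)"
    note [measurable] = guess_meas[OF w]
    define F where "F u = ennreal (- ln (guess w (\<lambda>i\<in>{..<n}. x i + s i + u i)))" for u
    have F[measurable]: "F \<in> borel_measurable (blk n)" unfolding F_def by measurable
    have "(\<integral>\<^sup>+ e. ennreal (- ln (blur 1 1 \<rho> w (\<lambda>i\<in>{..<n}. x i + s i + e i) s)) \<partial>\<G> N2 n)
      \<le> (\<integral>\<^sup>+ e. \<integral>\<^sup>+ g. F (\<lambda>i\<in>{..<n}. 1 * e i + \<rho> * g i) \<partial>\<G> 1 n \<partial>\<G> N2 n)"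
    proof (intro nn_integral_mono)
      fix e
      have eq: "(\<lambda>i\<in>{..<n}. s i + 1 * ((\<lambda>i\<in>{..<n}. x i + s i + e i) i - s i) + \<rho> * g i) = (\<lambda>i\<in>{..<n}. x i + s i + (\<lambda>i\<in>{..<n}. 1 * e i + \<rho> * g i) i)" for g
        by (auto simp: fun_eq_iff)
      have "(\<lambda>g. \<lambda>i\<in>{..<n}. x i + s i + (\<lambda>i\<in>{..<n}. 1 * e i + \<rho> * g i) i) = (\<lambda>g. \<lambda>i\<in>{..<n}. x i + s i + (1 * e i + \<rho> * g i))"
        by (auto simp: fun_eq_iff)
      then have ym[measurable]: "(\<lambda>g. \<lambda>i\<in>{..<n}. x i + s i + (\<lambda>i\<in>{..<n}. 1 * e i + \<rho> * g i) i) \<in> blk n \<rightarrow>\<^sub>M blk n" by simp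
      have "ennreal (- ln (\<integral>g. guess w (\<lambda>i\<in>{..<n}. x i + s i + (\<lambda>i\<in>{..<n}. 1 * e i + \<rho> * g i) i) * 1 \<partial>\<G> 1 n))
        \<le> (\<integral>\<^sup>+ g. ennreal (- ln (guess w (\<lambda>i\<in>{..<n}. x i + s i + (\<lambda>i\<in>{..<n}. 1 * e i + \<rho> * g i) i))) \<partial>\<G> 1 n) + ennreal 0"
        by (rule neg_ln_change_of_measure(2)[OF G.prob_space_axioms _ guess_bounds(3) guess_bounds(1,2)])
           (use G.emeasure_space_1 measurable_compose[OF ym guess_meas[OF w]] in \<open>simp_all cong: measurable_cong_sets\<close>)
      then show "ennreal (- ln (blur 1 1 \<rho> w (\<lambda>i\<in>{..<n}. x i + s i + e i) s)) \<le> (\<integral>\<^sup>+ g. F (\<lambda>i\<in>{..<n}. 1 * e i + \<rho> * g i) \<partial>\<G> 1 n)"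
        unfolding blur_def eq F_def by simp
    qed
    also have "\<dots> = (\<integral>\<^sup>+ u. F u \<partial>\<G> (1\<^sup>2 * N2 + \<rho>\<^sup>2 * 1) n)"
      using N2 by (intro nn_integral_gaussian_block_linear) auto
    also have "1\<^sup>2 * N2 + \<rho>\<^sup>2 * 1 = N1" using \<rho> by simp
    finally show "(\<integral>\<^sup>+ e. ennreal (- ln (blur 1 1 \<rho> w (\<lambda>i\<in>{..<n}. x i + s i + e i) s)) \<partial>\<G> N2 n)
      \<le> (\<integral>\<^sup>+ e. ennreal (- ln (guess w (\<lambda>i\<in>{..<n}. x i + s i + e i))) \<partial>\<G> N1 n) + ennreal (0 + 0 * (\<Sum>i<n. (x i)\<^sup>2))"
      unfolding F_def by (simp only: mult_zero_left add_0_left ennreal_0 add_0_right)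
  qed
  then show ?thesis by simp
qed

text \<open>The channel is degraded in law: \<open>\<eta>\<^sub>1\<close> has the law of \<open>a * \<eta>\<^sub>2 + g\<close> with \<open>a = N1 / N2\<close> and an
  independent \<open>g\<close> of variance \<open>\<tau>\<close>. The reference kernel guesses \<open>X + \<eta>\<^sub>1\<close> from \<open>X + \<eta>\<^sub>2\<close> with
  the conditional law that is correct for Gaussian input of variance \<open>P\<close>.\<close>

lemma converse_weaker_eavesdropper:
  fixes P \<epsilon> :: real
  assumes b: "1 < b" and P: "0 \<le> P" and pc: "power_constraint P Q N1 N2 c"
    and err: "error_prob Q N1 N2 c \<le> \<epsilon>" and \<epsilon>: "0 \<le> \<epsilon>" and N: "N1 < N2"
  shows "n * equivocation b Q N1 N2 c \<le> (n * (ln (1 + P / N1) / 2 - ln (1 + P / N2) / 2) + ln 2 + \<epsilon> * ln m) / ln b"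
proof -
  define a where "a = N1 / N2"
  define \<tau> where "\<tau> = N1 * (N2 - N1) / N2"
  \<comment> \<open>For Gaussian input of variance \<open>P\<close> and the coupling above,
    \<open>P + N1\<close> is the covariance of \<open>X + \<eta>\<^sub>1\<close> and
    \<open>X + \<eta>\<^sub>2\<close>. So \<open>\<beta>\<close> is the regression coefficient of
    the former on the latter, and \<open>v\<close> is the variance of the residual.\<close>
  define \<beta> where "\<beta> = (P + N1) / (P + N2)"
  define v where "v = (P + N1) * (N2 - N1) / (P + N2)"
  have PN: "0 < P + N1" "0 < P + N2" using P N1 N2 by auto
  have \<tau>: "0 < \<tau>" and v: "0 < v" and a: "a \<noteq> 0" using N N1 N2 PN by (auto simp: \<tau>_def v_def a_def)
  have id1: "a\<^sup>2 * N2 + 1\<^sup>2 * \<tau> = N1" using N2 by (simp add: a_def \<tau>_def field_simps power2_eq_square)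
  \<comment> \<open>The residual variance at input power \<open>P\<close>, split into the
    contributions of input, eavesdropper noise and \<open>g\<close>. By this identity the quadratic
    terms cancel exactly at full power and only \<open>ln (v / \<tau>)\<close> survives.\<close>
  have id2: "(1 - \<beta>)\<^sup>2 * P + ((a - \<beta>)\<^sup>2 * N2 + \<tau>) = v"
  proof -
    have e1: "1 - \<beta> = (N2 - N1) / (P + N2)" using PN by (simp add: \<beta>_def field_simps)
    have e2: "a - \<beta> = - (P * (N2 - N1)) / (N2 * (P + N2))" using PN N2 by (simp add: \<beta>_def a_def field_simps)
    have "N2 * (P + N2)\<^sup>2 * ((1 - \<beta>)\<^sup>2 * P + ((a - \<beta>)\<^sup>2 * N2 + \<tau>)) = N2 * (P + N2)\<^sup>2 * v"
    proof -
      have t1: "N2 * (P + N2)\<^sup>2 * ((1 - \<beta>)\<^sup>2 * P) = N2 * (N2 - N1)\<^sup>2 * P" unfolding e1 using PN by (simp add: power_divide)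
      have t2: "N2 * (P + N2)\<^sup>2 * ((a - \<beta>)\<^sup>2 * N2) = (P * (N2 - N1))\<^sup>2"
        unfolding e2 using PN N2 by (simp add: power_divide power_mult_distrib power2_eq_square)
      have t3: "N2 * (P + N2)\<^sup>2 * \<tau> = (P + N2)\<^sup>2 * (N1 * (N2 - N1))" using N2 by (simp add: \<tau>_def)
      have t4: "N2 * (P + N2)\<^sup>2 * v = N2 * (P + N2) * ((P + N1) * (N2 - N1))" using PN by (simp add: v_def power2_eq_square)
      show ?thesis unfolding distrib_left t1 t2 t3 t4 by (simp add: power2_eq_square algebra_simps)
    qed
    then show ?thesis using PN N2 by simp
  qed
  interpret G: prob_space "\<G> \<tau> n" using \<tau> by (rule prob_space_gaussian_block)
  interpret B: prob_space "\<G> N2 n" using N2 by (rule prob_space_gaussian_block)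
  define K where "K = n / 2 * (ln (v / \<tau>) - 1 + ((a - \<beta>)\<^sup>2 * N2 + \<tau>) / v)"
  define \<mu> where "\<mu> = (1 - \<beta>)\<^sup>2 / (2 * v)"
  \<comment> \<open>The constants enter as extended nonnegative reals, so their sign matters; it
    follows from \<open>ln y \<le> y - 1\<close> at \<open>y = \<tau> / v\<close>.\<close>
  have K0: "0 \<le> K"
  proof -
    have "ln (\<tau> / v) \<le> \<tau> / v - 1" using \<tau> v by (intro ln_le_minus_one) auto
    moreover have "ln (\<tau> / v) = - ln (v / \<tau>)" using \<tau> v by (simp add: ln_div)
    moreover have "\<tau> / v \<le> ((a - \<beta>)\<^sup>2 * N2 + \<tau>) / v" using v N2 by (intro divide_right_mono) auto
    ultimately have "0 \<le> ln (v / \<tau>) - 1 + ((a - \<beta>)\<^sup>2 * N2 + \<tau>) / v" by linarith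
    then show ?thesis unfolding K_def by (intro mult_nonneg_nonneg) auto
  qed
  have \<mu>0: "0 \<le> \<mu>" using v by (simp add: \<mu>_def)
  have "n * equivocation b Q N1 N2 c \<le> (K + \<mu> * (n * P) + ln 2 + \<epsilon> * ln m) / ln b"
  proof (rule converse_core[OF b P pc v err \<epsilon> K0 \<mu>0, where \<beta>=\<beta> and \<rho>=1])
    fix w s x assume w: "w \<in> {1..m}" and s: "s \<in> space (blk n)" and x: "x \<in> space (blk n)"
    note [measurable] = guess_meas[OF w]
    define F where "F u = ennreal (- ln (guess w (\<lambda>i\<in>{..<n}. x i + s i + u i)))" for u
    have F[measurable]: "F \<in> borel_measurable (blk n)" unfolding F_def by measurable
    \<comment> \<open>For fixed \<open>x\<close> and \<open>e\<close> this is the relative entropy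
      of the true noise \<open>g\<close>, of variance \<open>\<tau>\<close>, with respect to the law
      that \<open>blur\<close> assumes for it: variance \<open>v\<close> and mean
      \<open>- t\<close>, where \<open>t\<close> below is the error of the linear estimate apart
      from \<open>g\<close>.\<close>
    define V where "V e = n / 2 * (ln (v / \<tau>) - 1) + (\<Sum>i<n. ((1 - \<beta>) * x i + (a - \<beta>) * e i)\<^sup>2 + \<tau>) / (2 * v)" for e
    have step: "ennreal (- ln (blur v \<beta> 1 w (\<lambda>i\<in>{..<n}. x i + s i + e i) s)) \<le> (\<integral>\<^sup>+ g. F (\<lambda>i\<in>{..<n}. a * e i + 1 * g i) \<partial>\<G> \<tau> n) + ennreal (V e)"
      and V0: "0 \<le> V e" for e
    proof -
      define t where "t i = (1 - \<beta>) * x i + (a - \<beta>) * e i" for i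
      define y where "y g = (\<lambda>i\<in>{..<n}. x i + s i + (\<lambda>i\<in>{..<n}. a * e i + 1 * g i) i)" for g
      have "y = (\<lambda>g. \<lambda>i\<in>{..<n}. x i + s i + (a * e i + 1 * g i))" by (auto simp: y_def fun_eq_iff)
      then have ym[measurable]: "y \<in> blk n \<rightarrow>\<^sub>M blk n" by simp
      \<comment> \<open>Likelihood ratio from the noise \<open>g\<close> to the shifted noise of
        \<open>blur\<close>; with it the integral defining \<open>blur\<close> becomes an integral
        over \<open>g\<close>.\<close>
      define r where "r g = gauss_density v n (\<lambda>i. g i - - t i) / gauss_density \<tau> n g" for g
      have rm[measurable]: "r \<in> borel_measurable (blk n)" unfolding r_def by measurable
      have r0: "0 < r g" for g unfolding r_def using v \<tau> by (intro divide_pos_pos gauss_density_pos)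
      have gr: "ennreal (gauss_density \<tau> n g) * ennreal (r g) = ennreal (gauss_density v n (\<lambda>i. g i - - t i))" for g
        using gauss_density_pos[OF \<tau>, of n g] by (simp add: r_def ennreal_mult'[symmetric])
      have r1: "(\<integral>\<^sup>+ g. ennreal (r g) \<partial>\<G> \<tau> n) = 1"
        using nn_integral_gauss_density[OF v, of n "\<lambda>i. - t i"] by (subst nn_integral_gaussian_block[OF \<tau>]) (auto simp only: gr rm measurable_compose[OF rm measurable_ennreal])
      have lnr: "ln (r g) = - (n / 2) * ln (v / \<tau>) - (\<Sum>i<n. (t i + 1 * g i)\<^sup>2) / (2 * v) + (\<Sum>i<n. (0 + 1 * g i)\<^sup>2) / (2 * \<tau>)" for g
      proof -
        have "ln (r g) = ln (gauss_density v n (\<lambda>i. g i - - t i)) - ln (gauss_density \<tau> n g)"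
          unfolding r_def using gauss_density_pos[OF \<tau>, of n g] gauss_density_pos[OF v, of n "\<lambda>i. g i - - t i"] by (simp add: ln_div)
        also have "\<dots> = - (n / 2) * (ln (2 * pi * v) - ln (2 * pi * \<tau>)) - (\<Sum>i<n. (t i + 1 * g i)\<^sup>2) / (2 * v) + (\<Sum>i<n. (0 + 1 * g i)\<^sup>2) / (2 * \<tau>)"
          unfolding ln_gauss_density[OF v] ln_gauss_density[OF \<tau>] by (simp add: algebra_simps)
        also have "ln (2 * pi * v) - ln (2 * pi * \<tau>) = ln (v / \<tau>)" using v \<tau> by (simp add: ln_mult ln_div)
        finally show ?thesis .
      qed
      have si: "integrable (\<G> \<tau> n) (\<lambda>g. (\<Sum>i<n. (k i + 1 * g i)\<^sup>2))" 
        and se: "(\<integral>g. (\<Sum>i<n. (k i + 1 * g i)\<^sup>2) \<partial>\<G> \<tau> n) = (\<Sum>i<n. (k i)\<^sup>2 + \<tau>)" for k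
        using gaussian_block_component_square[OF \<tau>, where p=1] by (auto simp: Bochner_Integration.integral_sum)
      have lri: "integrable (\<G> \<tau> n) (\<lambda>g. ln (r g))"
        unfolding lnr using si[of t] si[of "\<lambda>_. 0"] by (intro Bochner_Integration.integrable_add Bochner_Integration.integrable_diff) auto
      have Ve: "V e = - (\<integral>g. ln (r g) \<partial>\<G> \<tau> n)"
      proof -
        have "(\<integral>g. ln (r g) \<partial>\<G> \<tau> n) = - (n / 2) * ln (v / \<tau>) - (\<Sum>i<n. (t i)\<^sup>2 + \<tau>) / (2 * v) + (\<Sum>i<n. 0\<^sup>2 + \<tau>) / (2 * \<tau>)"
          unfolding lnr using si[of t] si[of "\<lambda>_. 0"] se[of t] se[of "\<lambda>_. 0"] G.prob_space by simp
        also have "(\<Sum>i<n. 0\<^sup>2 + \<tau>) / (2 * \<tau>) = n / 2" using \<tau> by simp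
        finally show ?thesis unfolding V_def t_def by (simp add: right_diff_distrib)
      qed
      have ym': "(\<lambda>g. guess w (y g)) \<in> borel_measurable (\<G> \<tau> n)"
        and rm': "r \<in> borel_measurable (\<G> \<tau> n)" by measurable
      note J = neg_ln_change_of_measure[OF G.prob_space_axioms ym' guess_bounds(3) guess_bounds(1,2) rm' r0 r1 lri Ve]
      show "0 \<le> V e" by (rule J(1))
      have "blur v \<beta> 1 w (\<lambda>i\<in>{..<n}. x i + s i + e i) s = (\<integral>g. guess w (y g) * r g \<partial>\<G> \<tau> n)"
      proof -
        have gp: "0 \<le> guess w u" for u using guess_bounds(1)[of w u] guess_bounds(3) by linarith
        have gm: "(\<lambda>g. ennreal (guess w (y g))) \<in> borel_measurable (blk n)" by measurable
        have "(\<integral>\<^sup>+ g. ennreal (guess w (y g) * r g) \<partial>\<G> \<tau> n) = (\<integral>\<^sup>+ g. ennreal (gauss_density \<tau> n g) * ennreal (guess w (y g) * r g) \<partial>lborel_block n)"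
          by (rule nn_integral_gaussian_block[OF \<tau>]) measurable
        also have "\<dots> = (\<integral>\<^sup>+ g. ennreal (gauss_density v n (\<lambda>i. g i - - t i)) * ennreal (guess w (y g)) \<partial>lborel_block n)"
        proof (intro nn_integral_cong)
          fix g
          have "ennreal (guess w (y g) * r g) = ennreal (guess w (y g)) * ennreal (r g)" by (rule ennreal_mult'[OF gp])
          then show "ennreal (gauss_density \<tau> n g) * ennreal (guess w (y g) * r g) = ennreal (gauss_density v n (\<lambda>i. g i - - t i)) * ennreal (guess w (y g))"
            by (simp only: gr[symmetric] mult_ac)
        qed
        also have "\<dots> = (\<integral>\<^sup>+ g. ennreal (guess w (y (\<lambda>i\<in>{..<n}. g i + - t i))) \<partial>\<G> v n)"
          by (rule nn_integral_gauss_density_shift[OF v gm])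
        also have "\<dots> = (\<integral>\<^sup>+ g. ennreal (guess w (\<lambda>i\<in>{..<n}. s i + \<beta> * ((\<lambda>i\<in>{..<n}. x i + s i + e i) i - s i) + 1 * g i)) \<partial>\<G> v n)"
          by (intro nn_integral_cong arg_cong[where f=ennreal] arg_cong[where f="guess w"]) (auto simp: y_def t_def fun_eq_iff algebra_simps)
        finally have "(\<integral>\<^sup>+ g. ennreal (guess w (y g) * r g) \<partial>\<G> \<tau> n) = \<dots>" .
        then show ?thesis unfolding blur_def using gp r0
          by (subst (1 2) integral_eq_nn_integral) (auto intro!: AE_I2 mult_nonneg_nonneg simp: less_imp_le)
      qed
      moreover have "ennreal (- ln (\<integral>g. guess w (y g) * r g \<partial>\<G> \<tau> n)) \<le> (\<integral>\<^sup>+ g. ennreal (- ln (guess w (y g))) \<partial>\<G> \<tau> n) + ennreal (V e)"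
        by (rule J(2))
      ultimately show "ennreal (- ln (blur v \<beta> 1 w (\<lambda>i\<in>{..<n}. x i + s i + e i) s)) \<le> (\<integral>\<^sup>+ g. F (\<lambda>i\<in>{..<n}. a * e i + 1 * g i) \<partial>\<G> \<tau> n) + ennreal (V e)"
        by (simp only: F_def y_def)
    qed
    have Vi: "integrable (\<G> N2 n) V" and Vint: "(\<integral>e. V e \<partial>\<G> N2 n) = K + \<mu> * (\<Sum>i<n. (x i)\<^sup>2)"
    proof -
      have ci: "integrable (\<G> N2 n) (\<lambda>e. ((1 - \<beta>) * x i + (a - \<beta>) * e i)\<^sup>2)"
        and ce: "(\<integral>e. ((1 - \<beta>) * x i + (a - \<beta>) * e i)\<^sup>2 \<partial>\<G> N2 n) = ((1 - \<beta>) * x i)\<^sup>2 + (a - \<beta>)\<^sup>2 * N2" if "i < n" for i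
        using gaussian_block_component_square[OF N2 that] by auto
      have si: "integrable (\<G> N2 n) (\<lambda>e. \<Sum>i<n. ((1 - \<beta>) * x i + (a - \<beta>) * e i)\<^sup>2 + \<tau>)"
        using ci by (intro Bochner_Integration.integrable_sum Bochner_Integration.integrable_add) auto
      show "integrable (\<G> N2 n) V" unfolding V_def[abs_def] using si by auto
      have "(\<integral>e. (\<Sum>i<n. ((1 - \<beta>) * x i + (a - \<beta>) * e i)\<^sup>2 + \<tau>) \<partial>\<G> N2 n) = (\<Sum>i<n. \<integral>e. ((1 - \<beta>) * x i + (a - \<beta>) * e i)\<^sup>2 + \<tau> \<partial>\<G> N2 n)"
        using ci by (intro Bochner_Integration.integral_sum Bochner_Integration.integrable_add) auto
      also have "\<dots> = (\<Sum>i<n. (((1 - \<beta>) * x i)\<^sup>2 + (a - \<beta>)\<^sup>2 * N2) + \<tau>)"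
        using ci ce B.prob_space by (intro sum.cong refl) simp
      also have "\<dots> = (1 - \<beta>)\<^sup>2 * (\<Sum>i<n. (x i)\<^sup>2) + n * ((a - \<beta>)\<^sup>2 * N2 + \<tau>)"
        by (simp add: sum.distrib power_mult_distrib sum_distrib_left distrib_left)
      finally have "(\<integral>e. V e \<partial>\<G> N2 n) = n / 2 * (ln (v / \<tau>) - 1) + ((1 - \<beta>)\<^sup>2 * (\<Sum>i<n. (x i)\<^sup>2) + n * ((a - \<beta>)\<^sup>2 * N2 + \<tau>)) / (2 * v)"
        unfolding V_def using si B.prob_space by simp
      also have "\<dots> = K + \<mu> * (\<Sum>i<n. (x i)\<^sup>2)"
        unfolding K_def \<mu>_def using v by (simp add: field_simps)
      finally show "(\<integral>e. V e \<partial>\<G> N2 n) = K + \<mu> * (\<Sum>i<n. (x i)\<^sup>2)" .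
    qed
    have [measurable]: "(\<lambda>e. \<integral>\<^sup>+ g. F (\<lambda>i\<in>{..<n}. a * e i + 1 * g i) \<partial>\<G> \<tau> n) \<in> borel_measurable (\<G> N2 n)"
      by measurable
    have Vm[measurable]: "V \<in> borel_measurable (\<G> N2 n)" using Vi by auto
    have "(\<integral>\<^sup>+ e. ennreal (- ln (blur v \<beta> 1 w (\<lambda>i\<in>{..<n}. x i + s i + e i) s)) \<partial>\<G> N2 n)
      \<le> (\<integral>\<^sup>+ e. (\<integral>\<^sup>+ g. F (\<lambda>i\<in>{..<n}. a * e i + 1 * g i) \<partial>\<G> \<tau> n) + ennreal (V e) \<partial>\<G> N2 n)"
      by (intro nn_integral_mono step)
    also have "\<dots> = (\<integral>\<^sup>+ e. \<integral>\<^sup>+ g. F (\<lambda>i\<in>{..<n}. a * e i + 1 * g i) \<partial>\<G> \<tau> n \<partial>\<G> N2 n) + (\<integral>\<^sup>+ e. ennreal (V e) \<partial>\<G> N2 n)"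
      by (rule nn_integral_add) measurable
    also have "(\<integral>\<^sup>+ e. \<integral>\<^sup>+ g. F (\<lambda>i\<in>{..<n}. a * e i + 1 * g i) \<partial>\<G> \<tau> n \<partial>\<G> N2 n) = (\<integral>\<^sup>+ u. F u \<partial>\<G> (a\<^sup>2 * N2 + 1\<^sup>2 * \<tau>) n)"
      using N2 \<tau> a by (intro nn_integral_gaussian_block_linear) auto
    also have "a\<^sup>2 * N2 + 1\<^sup>2 * \<tau> = N1" by (rule id1)
    also have "(\<integral>\<^sup>+ e. ennreal (V e) \<partial>\<G> N2 n) = ennreal (K + \<mu> * (\<Sum>i<n. (x i)\<^sup>2))"
      using Vi V0 Vint by (subst nn_integral_eq_integral) auto
    finally show "(\<integral>\<^sup>+ e. ennreal (- ln (blur v \<beta> 1 w (\<lambda>i\<in>{..<n}. x i + s i + e i) s)) \<partial>\<G> N2 n)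
      \<le> (\<integral>\<^sup>+ e. ennreal (- ln (guess w (\<lambda>i\<in>{..<n}. x i + s i + e i))) \<partial>\<G> N1 n) + ennreal (K + \<mu> * (\<Sum>i<n. (x i)\<^sup>2))"
      unfolding F_def .
  qed
  also have "K + \<mu> * (n * P) = n * (ln (1 + P / N1) / 2 - ln (1 + P / N2) / 2)"
  proof -
    have "K + \<mu> * (n * P) = n / 2 * (ln (v / \<tau>) - 1 + ((1 - \<beta>)\<^sup>2 * P + ((a - \<beta>)\<^sup>2 * N2 + \<tau>)) / v)"
      unfolding K_def \<mu>_def using v by (simp add: field_simps)
    also have "\<dots> = n / 2 * ln (v / \<tau>)" unfolding id2 using v by simp
    also have "v / \<tau> = (1 + P / N1) / (1 + P / N2)" 
    proof -
      have "((P + N1) * D / (P + N2)) / (N1 * D / N2) = (1 + P / N1) / (1 + P / N2)" if "D \<noteq> 0" for D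
      proof -
        have 1: "1 + P / N1 = (P + N1) / N1" "1 + P / N2 = (P + N2) / N2"
          using N1 N2 by (simp_all add: add_divide_distrib)
        show ?thesis unfolding 1 using that by (simp add: mult_ac)
      qed
      from this[of "N2 - N1"] show ?thesis using N unfolding v_def \<tau>_def by simp
    qed
    also have "ln \<dots> = ln (1 + P / N1) - ln (1 + P / N2)"
    proof -
      have "0 < 1 + P / N1" "0 < 1 + P / N2" using P N1 N2 by (auto intro: add_pos_nonneg)
      then show ?thesis by (simp add: ln_div)
    qed
    finally show ?thesis by (simp add: algebra_simps)
  qed
  finally show ?thesis .
qed

text \<open>The maximum merges the two orderings of the noise variances. The Fano term
  \<open>\<epsilon> * code_rate b c\<close> does not vanish with growing block length and is left to
  the choice of \<open>\<epsilon>\<close>.\<close>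

lemma converse:
  fixes P \<epsilon> :: real
  assumes b: "1 < b" and P: "0 \<le> P" and pc: "power_constraint P Q N1 N2 c"
    and err: "error_prob Q N1 N2 c \<le> \<epsilon>" and \<epsilon>: "0 \<le> \<epsilon>"
  shows "equivocation b Q N1 N2 c \<le> max 0 (gaussian_capacity b (P / N1) - gaussian_capacity b (P / N2)) + ln 2 / ln b / n + \<epsilon> * code_rate b c"
proof -
  have n0: "0 < real n" using n by simp
  have lb: "0 < ln b" using b by simp
  have cr: "n * (\<epsilon> * code_rate b c) = \<epsilon> * ln m / ln b" using n0 by (simp add: code_rate_def log_def)
  have cap: "gaussian_capacity b (P / N1) - gaussian_capacity b (P / N2) = (ln (1 + P / N1) / 2 - ln (1 + P / N2) / 2) / ln b"
    by (simp add: gaussian_capacity_def log_def diff_divide_distrib)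
  have "n * equivocation b Q N1 N2 c \<le> n * max 0 (gaussian_capacity b (P / N1) - gaussian_capacity b (P / N2)) + ln 2 / ln b + n * (\<epsilon> * code_rate b c)"
  proof (cases "N2 \<le> N1")
    case True
    have "n * equivocation b Q N1 N2 c \<le> ln 2 / ln b + n * (\<epsilon> * code_rate b c)"
      using converse_stronger_eavesdropper[OF b P pc err \<epsilon> True] by (simp add: cr add_divide_distrib)
    moreover have "0 \<le> n * max 0 (gaussian_capacity b (P / N1) - gaussian_capacity b (P / N2))" by simp
    ultimately show ?thesis by linarith
  next
    case False
    have "n * equivocation b Q N1 N2 c \<le> n * (gaussian_capacity b (P / N1) - gaussian_capacity b (P / N2)) + ln 2 / ln b + n * (\<epsilon> * code_rate b c)"
      using converse_weaker_eavesdropper[OF b P pc err \<epsilon>] False by (simp add: cr cap add_divide_distrib)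
    also have "\<dots> \<le> n * max 0 (gaussian_capacity b (P / N1) - gaussian_capacity b (P / N2)) + ln 2 / ln b + n * (\<epsilon> * code_rate b c)"
      by (intro add_right_mono mult_left_mono) auto
    finally show ?thesis .
  qed
  also have "\<dots> = n * (max 0 (gaussian_capacity b (P / N1) - gaussian_capacity b (P / N2)) + ln 2 / ln b / n + \<epsilon> * code_rate b c)"
    using n0 by (simp add: algebra_simps)
  finally show ?thesis using n0 by simp
qed

end

subsection \<open>Dirty paper coding\<close>

text \<open>Inputs are drawn with variance \<open>p\<close> strictly below the allowed power
  \<open>P\<close>, so that exceeding the power is an atypical event.\<close>

locale dirty_paper =
  fixes p P Q N1 N2 :: real and n :: nat
  assumes p: "0 < p" and pP: "p < P" and Q: "0 < Q" and N1: "0 < N1" and N2: "0 < N2"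
begin

definition "\<alpha> = p / (p + N1)"
definition "U = p + \<alpha>\<^sup>2 * Q"
definition "\<tau> = p * N1 / (p + N1)"

text \<open>Densities of the laws of \<open>(U, S)\<close>, \<open>(U, (Z - S, S))\<close> and \<open>(U, Y)\<close> relative to the product of the
  marginals, where \<open>X\<close> has variance \<open>p < P\<close>. With Costa's \<open>\<alpha>\<close> the variable \<open>U - \<alpha> Y\<close> is independent of
  \<open>Y\<close> and has variance \<open>\<tau>\<close>.\<close>

definition "state_ratio u s = gauss_density p n (\<lambda>i. u i - \<alpha> * s i) / gauss_density U n u"
definition "eve_ratio u z s = state_ratio u s * gauss_density N2 n (\<lambda>i. z i - (u i - \<alpha> * s i)) / gauss_density (p + N2) n z"
definition "output_ratio u y = gauss_density \<tau> n (\<lambda>i. u i - \<alpha> * y i) / gauss_density U n u"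

lemma \<alpha>: "0 < \<alpha>" and U: "0 < U" and \<tau>: "0 < \<tau>" and pN2: "0 < p + N2"
  using p Q N1 N2 by (auto simp: \<alpha>_def U_def \<tau>_def intro!: add_pos_nonneg)

text \<open>The state cancels in the difference of the auxiliary variable and
  \<open>\<alpha> * Y\<close>, which leaves
  \<open>(1 - \<alpha>) * X - \<alpha> * \<eta>\<^sub>1\<close>. Costa's \<open>\<alpha>\<close>
  minimises the variance of this combination, and \<open>\<tau>\<close> is the minimum.\<close>

lemma \<tau>_eq: "(1 - \<alpha>)\<^sup>2 * p + \<alpha>\<^sup>2 * N1 = \<tau>"
proof -
  have e: "1 - \<alpha> = N1 / (p + N1)" using p N1 by (simp add: \<alpha>_def field_simps)
  have "(1 - \<alpha>)\<^sup>2 * p + \<alpha>\<^sup>2 * N1 = p * N1 * (p + N1) / (p + N1)\<^sup>2"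
    unfolding e unfolding \<alpha>_def by (simp add: power_divide add_divide_distrib[symmetric]) (simp add: power2_eq_square algebra_simps)
  also have "\<dots> = \<tau>" using p N1 by (simp add: \<tau>_def power2_eq_square)
  finally show ?thesis .
qed

lemma ratio_pos: "0 < state_ratio u s" "0 < eve_ratio u z s" "0 < output_ratio u y"
  unfolding eve_ratio_def state_ratio_def output_ratio_def
  by (intro divide_pos_pos mult_pos_pos gauss_density_pos p U \<tau> N2 pN2)+

lemmas ratio_nonneg[simp] = ratio_pos[THEN less_imp_le]

lemma ratio_meas[measurable (raw)]:
  assumes [measurable]: "f \<in> M \<rightarrow>\<^sub>M blk n" "g \<in> M \<rightarrow>\<^sub>M blk n"
  shows "(\<lambda>x. state_ratio (f x) (g x)) \<in> borel_measurable M"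
    "(\<lambda>x. output_ratio (f x) (g x)) \<in> borel_measurable M"
  unfolding state_ratio_def output_ratio_def by measurable

lemma eve_ratio_meas[measurable (raw)]:
  assumes [measurable]: "f \<in> M \<rightarrow>\<^sub>M blk n" "g \<in> M \<rightarrow>\<^sub>M blk n" "h \<in> M \<rightarrow>\<^sub>M blk n"
  shows "(\<lambda>x. eve_ratio (f x) (h x) (g x)) \<in> borel_measurable M"
  unfolding eve_ratio_def by measurable

sublocale GU: prob_space "\<G> U n" by (rule prob_space_gaussian_block[OF U])
sublocale GQ: prob_space "\<G> Q n" by (rule prob_space_gaussian_block[OF Q])
sublocale Gp: prob_space "\<G> p n" by (rule prob_space_gaussian_block[OF p])
sublocale G1: prob_space "\<G> N1 n" by (rule prob_space_gaussian_block[OF N1])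
sublocale G2: prob_space "\<G> N2 n" by (rule prob_space_gaussian_block[OF N2])
sublocale GZ: prob_space "\<G> (p + N2) n" by (rule prob_space_gaussian_block[OF pN2])
sublocale L: sigma_finite_measure "lborel_block n" by (rule sigma_finite_lborel_block)

text \<open>\<open>state_ratio\<close> is a conditional density given the state: weighting
  \<open>\<G> U n\<close> by it gives the law of \<open>\<alpha> * s\<close> plus an independent
  block of variance \<open>p\<close>. Expectations of the ideal scheme thus reduce to independent
  Gaussian blocks.\<close>

lemma state_ratio_change:
  assumes F[measurable]: "F \<in> borel_measurable (blk n)" and s: "s \<in> space (blk n)"
  shows "(\<integral>\<^sup>+ u. ennreal (state_ratio u s) * F u \<partial>\<G> U n) = (\<integral>\<^sup>+ x. F (\<lambda>i\<in>{..<n}. x i + \<alpha> * s i) \<partial>\<G> p n)"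
proof -
  have [measurable]: "(\<lambda>u. state_ratio u s) \<in> borel_measurable (blk n)" using s by (intro ratio_meas(1)) auto
  have "(\<integral>\<^sup>+ u. ennreal (state_ratio u s) * F u \<partial>\<G> U n) = (\<integral>\<^sup>+ u. ennreal (gauss_density U n u) * (ennreal (state_ratio u s) * F u) \<partial>lborel_block n)"
    by (rule nn_integral_gaussian_block[OF U]) measurable
  also have "\<dots> = (\<integral>\<^sup>+ u. ennreal (gauss_density p n (\<lambda>i. u i - \<alpha> * s i)) * F u \<partial>lborel_block n)"
  proof (intro nn_integral_cong)
    fix u
    have "ennreal (gauss_density U n u) * ennreal (state_ratio u s) = ennreal (gauss_density p n (\<lambda>i. u i - \<alpha> * s i))"
      using gauss_density_pos[OF U, of n u] by (simp add: ennreal_mult'[symmetric] state_ratio_def)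
    then show "ennreal (gauss_density U n u) * (ennreal (state_ratio u s) * F u) = ennreal (gauss_density p n (\<lambda>i. u i - \<alpha> * s i)) * F u"
      by (simp only: mult.assoc[symmetric])
  qed
  also have "\<dots> = (\<integral>\<^sup>+ x. F (\<lambda>i\<in>{..<n}. x i + \<alpha> * s i) \<partial>\<G> p n)"
    by (rule nn_integral_gauss_density_shift[OF p F])
  finally show ?thesis .
qed

lemma state_ratio_change2:
  assumes F[measurable]: "F \<in> borel_measurable (blk n \<Otimes>\<^sub>M blk n)"
  shows "(\<integral>\<^sup>+ u. \<integral>\<^sup>+ s. ennreal (state_ratio u s) * F (u, s) \<partial>\<G> Q n \<partial>\<G> U n)
    = (\<integral>\<^sup>+ s. \<integral>\<^sup>+ x. F (\<lambda>i\<in>{..<n}. x i + \<alpha> * s i, s) \<partial>\<G> p n \<partial>\<G> Q n)"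
proof -
  interpret UQ: pair_sigma_finite "\<G> U n" "\<G> Q n" ..
  have "(\<integral>\<^sup>+ u. \<integral>\<^sup>+ s. ennreal (state_ratio u s) * F (u, s) \<partial>\<G> Q n \<partial>\<G> U n)
    = (\<integral>\<^sup>+ s. \<integral>\<^sup>+ u. ennreal (state_ratio u s) * F (u, s) \<partial>\<G> U n \<partial>\<G> Q n)"
    by (rule UQ.Fubini'[symmetric]) (simp add: split_beta')
  also have "\<dots> = (\<integral>\<^sup>+ s. \<integral>\<^sup>+ x. F (\<lambda>i\<in>{..<n}. x i + \<alpha> * s i, s) \<partial>\<G> p n \<partial>\<G> Q n)"
  proof (intro nn_integral_cong)
    fix s assume "s \<in> space (\<G> Q n)"
    then have s: "s \<in> space (blk n)" by simp
    then have "(\<lambda>u. F (u, s)) \<in> borel_measurable (blk n)" by measurable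
    from state_ratio_change[OF this s]
    show "(\<integral>\<^sup>+ u. ennreal (state_ratio u s) * F (u, s) \<partial>\<G> U n) = (\<integral>\<^sup>+ x. F (\<lambda>i\<in>{..<n}. x i + \<alpha> * s i, s) \<partial>\<G> p n)" .
  qed
  finally show ?thesis .
qed

text \<open>\<open>eve_ratio\<close> is \<open>state_ratio\<close> times a channel density, so the
  change of measure for the state leaves only the channel density behind.\<close>

lemma eve_ratio_change:
  assumes F[measurable]: "F \<in> borel_measurable (blk n)" and z: "z \<in> space (blk n)" and s: "s \<in> space (blk n)"
  shows "(\<integral>\<^sup>+ u. ennreal (eve_ratio u z s) * F u \<partial>\<G> U n)
    = (\<integral>\<^sup>+ x. ennreal (gauss_density N2 n (\<lambda>i. z i - x i) / gauss_density (p + N2) n z) * F (\<lambda>i\<in>{..<n}. x i + \<alpha> * s i) \<partial>\<G> p n)"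
proof -
  have "(\<integral>\<^sup>+ u. ennreal (eve_ratio u z s) * F u \<partial>\<G> U n)
    = (\<integral>\<^sup>+ u. ennreal (state_ratio u s) * (ennreal (gauss_density N2 n (\<lambda>i. z i - (u i - \<alpha> * s i)) / gauss_density (p + N2) n z) * F u) \<partial>\<G> U n)"
    by (simp add: eve_ratio_def ennreal_mult' mult.assoc times_divide_eq_right[symmetric] del: times_divide_eq_right)
  also have "\<dots> = (\<integral>\<^sup>+ x. ennreal (gauss_density N2 n (\<lambda>i. z i - ((\<lambda>i\<in>{..<n}. x i + \<alpha> * s i) i - \<alpha> * s i)) / gauss_density (p + N2) n z) * F (\<lambda>i\<in>{..<n}. x i + \<alpha> * s i) \<partial>\<G> p n)"
    by (rule state_ratio_change[OF _ s]) measurable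
  also have "\<dots> = (\<integral>\<^sup>+ x. ennreal (gauss_density N2 n (\<lambda>i. z i - x i) / gauss_density (p + N2) n z) * F (\<lambda>i\<in>{..<n}. x i + \<alpha> * s i) \<partial>\<G> p n)"
    by (intro nn_integral_cong arg_cong2[where f="(*)"] arg_cong[where f=ennreal] arg_cong2[where f="(/)"] gauss_density_cong) auto
  finally show ?thesis .
qed

text \<open>Averaging over the codeword reproduces the density of \<open>Z - S\<close>, a
  convolution of variances \<open>p\<close> and \<open>N2\<close>. Mean 1 is the normalisation that
  soft covering asks for.\<close>

lemma eve_ratio_normalized:
  assumes "z \<in> space (blk n)" "s \<in> space (blk n)"
  shows "(\<integral>\<^sup>+ u. ennreal (eve_ratio u z s) \<partial>\<G> U n) = 1"
proof -
  have g: "0 < gauss_density (p + N2) n z" by (rule gauss_density_pos[OF pN2])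
  have "(\<integral>\<^sup>+ u. ennreal (eve_ratio u z s) \<partial>\<G> U n) = (\<integral>\<^sup>+ x. ennreal (1 / gauss_density (p + N2) n z) * ennreal (gauss_density N2 n (\<lambda>i. z i - 1 * x i)) \<partial>\<G> p n)"
    using eve_ratio_change[OF _ assms, of "\<lambda>_. 1"] by (simp add: ennreal_mult'[symmetric])
  also have "\<dots> = ennreal (1 / gauss_density (p + N2) n z) * ennreal (gauss_density (N2 + 1\<^sup>2 * p) n z)"
    by (subst nn_integral_cmult, measurable) (simp only: nn_integral_gauss_density_conv[OF N2 p])
  also have "\<dots> = 1" using g by (simp add: ennreal_mult'[symmetric] add.commute)
  finally show ?thesis .
qed

text \<open>Mean 1 over an independent codeword is what lets Markov's inequality bound a false alarm
  of the threshold decoder.\<close>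

lemma output_ratio_normalized:
  "(\<integral>\<^sup>+ u. ennreal (output_ratio u y) \<partial>\<G> U n) = 1"
proof -
  have m: "(\<lambda>u. output_ratio u y) \<in> borel_measurable (blk n)" unfolding output_ratio_def by measurable
  have "(\<integral>\<^sup>+ u. ennreal (output_ratio u y) \<partial>\<G> U n) = (\<integral>\<^sup>+ u. ennreal (gauss_density U n u) * ennreal (output_ratio u y) \<partial>lborel_block n)"
    by (rule nn_integral_gaussian_block[OF U measurable_compose[OF m measurable_ennreal]])
  also have "\<dots> = (\<integral>\<^sup>+ u. ennreal (gauss_density \<tau> n (\<lambda>i. u i - \<alpha> * y i)) \<partial>lborel_block n)"
  proof (intro nn_integral_cong)
    fix u show "ennreal (gauss_density U n u) * ennreal (output_ratio u y) = ennreal (gauss_density \<tau> n (\<lambda>i. u i - \<alpha> * y i))"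
      using gauss_density_pos[OF U, of n u] by (simp add: ennreal_mult'[symmetric] output_ratio_def)
  qed
  finally show ?thesis using nn_integral_gauss_density[OF \<tau>, of n "\<lambda>i. \<alpha> * y i"] by simp
qed

text \<open>An indicator with values in the extended reals, so that a union bound is a sum. The
  deviation is relative: \<open>\<eta>\<close> is a fraction of the variance, so a typical quadratic
  form, normalised by twice its variance, is off by at most \<open>n * \<eta> / 2\<close>.\<close>

definition atypical :: "real \<Rightarrow> real \<Rightarrow> (nat \<Rightarrow> real) \<Rightarrow> ennreal" where
  "atypical \<eta> v x = (if \<bar>(\<Sum>i<n. (x i)\<^sup>2) - real n * v\<bar> \<ge> real n * (v * \<eta>) then 1 else 0)"

lemma atypical_meas[measurable]: "atypical \<eta> v \<in> borel_measurable (blk n)"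
  unfolding atypical_def[abs_def] by measurable

lemma nn_integral_atypical: "0 < v \<Longrightarrow> (\<integral>\<^sup>+ x. atypical \<eta> v x \<partial>\<G> v n) = ennreal (norm_tail v (v * \<eta>) n)"
proof -
  assume v: "0 < v"
  interpret prob_space "\<G> v n" using v by (rule prob_space_gaussian_block)
  have "(\<integral>\<^sup>+ x. atypical \<eta> v x \<partial>\<G> v n) = (\<integral>\<^sup>+ x. indicator {x \<in> space (blk n). \<bar>(\<Sum>i<n. (x i)\<^sup>2) - n * v\<bar> \<ge> n * (v * \<eta>)} x \<partial>\<G> v n)"
    by (intro nn_integral_cong) (auto simp: atypical_def indicator_def)
  also have "\<dots> = emeasure (\<G> v n) {x \<in> space (blk n). \<bar>(\<Sum>i<n. (x i)\<^sup>2) - n * v\<bar> \<ge> n * (v * \<eta>)}"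
    by (rule nn_integral_indicator) measurable
  finally show ?thesis by (simp add: norm_tail_def emeasure_eq_measure)
qed

lemma typical_bounds:
  fixes v \<eta> :: real
  assumes "0 < v" "atypical \<eta> v x = 0"
  shows "n * (1 - \<eta>) / 2 \<le> (\<Sum>i<n. (x i)\<^sup>2) / (2 * v)" "(\<Sum>i<n. (x i)\<^sup>2) / (2 * v) \<le> n * (1 + \<eta>) / 2"
  using assms by (auto simp: atypical_def field_simps abs_if split: if_splits)

lemma ln_gauss_density_split:
  assumes "0 < v"
  shows "ln (gauss_density v n x) = - (n * ln (2 * pi)) / 2 - n * ln v / 2 - (\<Sum>i<n. (x i)\<^sup>2) / (2 * v)"
  using assms by (simp add: ln_gauss_density ln_mult distrib_left add_divide_distrib)

text \<open>I(U;Z,S) in nats per symbol. With \<open>U\<close> the variance of the auxiliary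
  variable it is the sum of I(U;S) = \<open>ln (U / p) / 2\<close> and I(U;Z|S) =
  \<open>ln ((p + N2) / N2) / 2\<close>.\<close>

definition "eve_info = (ln U + ln (p + N2) - ln p - ln N2) / 2"
text \<open>I(U;Y) in nats per symbol: half the logarithm of the variance of the auxiliary variable
  over its conditional variance \<open>\<tau>\<close> given the output.\<close>

definition "output_info = (ln U - ln \<tau>) / 2"

text \<open>The log ratio is \<open>n * eve_info\<close> plus four signed quadratic forms, each
  within \<open>n * \<eta> / 2\<close> of \<open>n / 2\<close> when typical. Their leading terms
  cancel in pairs, leaving at most \<open>2 * n * \<eta>\<close>.\<close>

lemma eve_ratio_typical:
  fixes \<eta> :: real
  assumes "exp (n * (eve_info + 2 * \<eta>)) < eve_ratio (\<lambda>i\<in>{..<n}. x i + \<alpha> * s i) (\<lambda>i\<in>{..<n}. x i + e i) s"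
  shows "1 \<le> atypical \<eta> p x + atypical \<eta> N2 e + atypical \<eta> U (\<lambda>i\<in>{..<n}. x i + \<alpha> * s i) + atypical \<eta> (p + N2) (\<lambda>i\<in>{..<n}. x i + e i)"
proof (rule ccontr)
  let ?u = "\<lambda>i\<in>{..<n}. x i + \<alpha> * s i" and ?z = "\<lambda>i\<in>{..<n}. x i + e i"
  assume "\<not> ?thesis"
  then have t: "atypical \<eta> p x = 0" "atypical \<eta> N2 e = 0" "atypical \<eta> U ?u = 0" "atypical \<eta> (p + N2) ?z = 0"
    by (auto simp: atypical_def split: if_splits)
  have c1: "gauss_density p n (\<lambda>i. ?u i - \<alpha> * s i) = gauss_density p n x" by (intro gauss_density_cong) auto
  have c2: "gauss_density N2 n (\<lambda>i. ?z i - (?u i - \<alpha> * s i)) = gauss_density N2 n e" by (intro gauss_density_cong) auto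
  have "ln (eve_ratio ?u ?z s) = ln (gauss_density p n x) - ln (gauss_density U n ?u) + ln (gauss_density N2 n e) - ln (gauss_density (p + N2) n ?z)"
    unfolding eve_ratio_def state_ratio_def c1 c2
    using gauss_density_pos[OF p, of n x] gauss_density_pos[OF U, of n ?u] gauss_density_pos[OF N2, of n e] gauss_density_pos[OF pN2, of n ?z]
    by (simp add: ln_mult ln_div)
  also have "\<dots> = n * eve_info - (\<Sum>i<n. (x i)\<^sup>2) / (2 * p) + (\<Sum>i<n. (?u i)\<^sup>2) / (2 * U) - (\<Sum>i<n. (e i)\<^sup>2) / (2 * N2) + (\<Sum>i<n. (?z i)\<^sup>2) / (2 * (p + N2))"
    unfolding ln_gauss_density_split[OF p] ln_gauss_density_split[OF U] ln_gauss_density_split[OF N2] ln_gauss_density_split[OF pN2] eve_info_def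
    by (simp add: distrib_left right_diff_distrib add_divide_distrib diff_divide_distrib)
  also have "\<dots> \<le> n * eve_info + (n * (1 + \<eta>) / 2 - n * (1 - \<eta>) / 2) + (n * (1 + \<eta>) / 2 - n * (1 - \<eta>) / 2)"
    using typical_bounds[OF p t(1)] typical_bounds[OF N2 t(2)] typical_bounds[OF U t(3)] typical_bounds[OF pN2 t(4)] by linarith
  also have "\<dots> = n * (eve_info + 2 * \<eta>)" by (simp add: field_simps)
  finally have "eve_ratio ?u ?z s \<le> exp (n * (eve_info + 2 * \<eta>))"
    using ratio_pos(2)[of ?u ?z s] by (metis exp_le_cancel_iff exp_ln)
  then show False using assms by simp
qed

text \<open>Only two quadratic forms occur, so for typical blocks the log ratio is at least
  \<open>n * (output_info - \<eta>)\<close>. The threshold with \<open>2 * \<eta>\<close> lies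
  strictly below, which is where \<open>0 < \<eta>\<close> and \<open>0 < n\<close> enter.\<close>

lemma output_ratio_typical:
  fixes \<eta> :: real
  assumes "output_ratio (\<lambda>i\<in>{..<n}. x i + \<alpha> * s i) y \<le> exp (n * (output_info - 2 * \<eta>))" and \<eta>: "0 < \<eta>" and n: "0 < n"
    and y: "y = (\<lambda>i\<in>{..<n}. x i + s i + e i)"
  shows "1 \<le> atypical \<eta> U (\<lambda>i\<in>{..<n}. x i + \<alpha> * s i) + atypical \<eta> \<tau> (\<lambda>i\<in>{..<n}. (1 - \<alpha>) * x i + (- \<alpha>) * e i)"
proof (rule ccontr)
  let ?u = "\<lambda>i\<in>{..<n}. x i + \<alpha> * s i" and ?t = "\<lambda>i\<in>{..<n}. (1 - \<alpha>) * x i + (- \<alpha>) * e i"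
  assume "\<not> ?thesis"
  then have t: "atypical \<eta> U ?u = 0" "atypical \<eta> \<tau> ?t = 0"
    by (auto simp: atypical_def split: if_splits)
  have c1: "gauss_density \<tau> n (\<lambda>i. ?u i - \<alpha> * y i) = gauss_density \<tau> n ?t" by (intro gauss_density_cong) (auto simp: y algebra_simps)
  have "n * (output_info - 2 * \<eta>) < n * (output_info - \<eta>)" using \<eta> n by simp
  also have "\<dots> = n * output_info + n * (1 - \<eta>) / 2 - n * (1 + \<eta>) / 2" by (simp add: field_simps)
  also have "\<dots> \<le> n * output_info + (\<Sum>i<n. (?u i)\<^sup>2) / (2 * U) - (\<Sum>i<n. (?t i)\<^sup>2) / (2 * \<tau>)"
    using typical_bounds[OF U t(1)] typical_bounds[OF \<tau> t(2)] by linarith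
  also have "\<dots> = ln (gauss_density \<tau> n ?t) - ln (gauss_density U n ?u)"
    unfolding ln_gauss_density_split[OF \<tau>] ln_gauss_density_split[OF U] output_info_def
    by (simp add: distrib_left right_diff_distrib add_divide_distrib diff_divide_distrib)
  also have "\<dots> = ln (output_ratio ?u y)"
    unfolding output_ratio_def c1
    using gauss_density_pos[OF \<tau>, of n ?t] gauss_density_pos[OF U, of n ?u] by (simp add: ln_div)
  finally have "exp (n * (output_info - 2 * \<eta>)) < output_ratio ?u y"
    using ratio_pos(3)[of ?u y] by (metis exp_less_cancel_iff exp_ln)
  then show False using assms by simp
qed

end

text \<open>Integrating out an observation cannot increase the distance to the reference
  law.\<close>

lemma (in prob_space) ennreal_abs_integral_minus_one_le:
  fixes f :: "'a \<Rightarrow> real" and a :: real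
  assumes f[measurable]: "f \<in> borel_measurable M" and f0: "\<And>x. 0 \<le> f x" and a: "0 \<le> a" "(\<integral>\<^sup>+ x. ennreal (f x) \<partial>M) = ennreal a"
  shows "ennreal \<bar>a - 1\<bar> \<le> (\<integral>\<^sup>+ x. ennreal \<bar>f x - 1\<bar> \<partial>M)"
proof -
  have i: "integrable M f" using a f0 by (intro integrableI_nonneg) auto
  have e: "(\<integral>x. f x \<partial>M) = a" using a f0 by (subst integral_eq_nn_integral) auto
  have "\<bar>a - 1\<bar> = \<bar>\<integral>x. f x - 1 \<partial>M\<bar>" using i e prob_space by simp
  also have "\<dots> \<le> (\<integral>x. \<bar>f x - 1\<bar> \<partial>M)" by (rule integral_abs_bound)
  finally have "ennreal \<bar>a - 1\<bar> \<le> ennreal (\<integral>x. \<bar>f x - 1\<bar> \<partial>M)" by (rule ennreal_leI)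
  also have "\<dots> = (\<integral>\<^sup>+ x. ennreal \<bar>f x - 1\<bar> \<partial>M)" using i by (intro nn_integral_eq_integral[symmetric]) auto
  finally show ?thesis .
qed

section \<open>Likelihood encoder and threshold decoder for a fixed codebook\<close>

locale dirty_paper_code = dirty_paper +
  fixes M J :: nat and \<gamma> :: real and C :: "nat \<times> nat \<Rightarrow> nat \<Rightarrow> real"
  assumes n: "0 < n" and M: "0 < M" and J: "0 < J" 
    and C: "\<And>w j. w \<in> {1..M} \<Longrightarrow> j \<in> {1..J} \<Longrightarrow> C (w, j) \<in> space (blk n)"
begin

definition "ratio_sum w s = (\<Sum>j\<in>{1..J}. state_ratio (C (w, j)) s)"
text \<open>Posterior probability of codeword \<open>j\<close> of bundle \<open>w\<close> given the
  state, when the codeword has a uniform prior and generates the state through the backward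
  channel.\<close>

definition "weight w j s = state_ratio (C (w, j)) s / ratio_sum w s"
definition "raw w j s = (\<lambda>i\<in>{..<n}. C (w, j) i - \<alpha> * s i)"
definition "clip x = (if (\<Sum>i<n. (x i)\<^sup>2) \<le> n * P then x else (\<lambda>i\<in>{..<n}. 0))" for x :: "nat \<Rightarrow> real"
text \<open>Clipping makes the power constraint hold surely. The message bounds in \<open>dpc_dec\<close> keep \<open>LEAST\<close>
  well defined: message \<open>M\<close> is the default.\<close>

definition "dpc_enc ws = distr (point_measure {1..J} (\<lambda>j. ennreal (weight (fst ws) j (snd ws)))) (blk n) (\<lambda>j. clip (raw (fst ws) j (snd ws)))"
definition "found w y \<longleftrightarrow> (\<exists>j\<in>{1..J}. \<gamma> < output_ratio (C (w, j)) y)"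
definition "dpc_dec y = (LEAST w. 1 \<le> w \<and> (M \<le> w \<or> (w \<le> M \<and> found w y)))"
definition "code = \<lparr>block_length = n, num_messages = M, encoder = dpc_enc, decoder = dpc_dec\<rparr>"

lemma code_simps[simp]: "block_length code = n" "num_messages code = M" "encoder code = dpc_enc" "decoder code = dpc_dec"
  by (simp_all add: code_def)

lemma ratio_sum_pos: "0 < ratio_sum w s" unfolding ratio_sum_def using J ratio_pos by (intro sum_pos) auto
lemma weight_nonneg[simp]: "0 \<le> weight w j s" unfolding weight_def using ratio_sum_pos[of w s] by simp
lemma sum_weight: "(\<Sum>j\<in>{1..J}. weight w j s) = 1"
  unfolding weight_def using ratio_sum_pos[of w s] by (simp add: sum_divide_distrib[symmetric] ratio_sum_def)

lemma state_ratio_code_meas[measurable]: "w \<in> {1..M} \<Longrightarrow> j \<in> {1..J} \<Longrightarrow> (\<lambda>s. state_ratio (C (w, j)) s) \<in> borel_measurable (blk n)"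
  using C by (intro ratio_meas) auto
lemma ratio_sum_meas[measurable]: "w \<in> {1..M} \<Longrightarrow> ratio_sum w \<in> borel_measurable (blk n)"
  unfolding ratio_sum_def[abs_def] by (intro borel_measurable_sum state_ratio_code_meas)
lemma weight_meas[measurable]: "w \<in> {1..M} \<Longrightarrow> j \<in> {1..J} \<Longrightarrow> (\<lambda>s. weight w j s) \<in> borel_measurable (blk n)"
  unfolding weight_def by measurable
lemma raw_meas[measurable]: "raw w j \<in> blk n \<rightarrow>\<^sub>M blk n"
  unfolding raw_def[abs_def] by measurable
lemma clip_meas[measurable]: "clip \<in> blk n \<rightarrow>\<^sub>M blk n"
  unfolding clip_def[abs_def] by measurable
lemma raw_space: "raw w j s \<in> space (blk n)" and clip_space: "x \<in> space (blk n) \<Longrightarrow> clip x \<in> space (blk n)"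
  by (auto simp: raw_def clip_def space_PiM)
lemma output_ratio_code_meas[measurable]: "w \<in> {1..M} \<Longrightarrow> j \<in> {1..J} \<Longrightarrow> (\<lambda>s. output_ratio (C (w, j)) s) \<in> borel_measurable (blk n)"
  using C by (intro ratio_meas) auto
lemma found_meas[measurable]: "w \<in> {1..M} \<Longrightarrow> Measurable.pred (blk n) (found w)"
  unfolding found_def[abs_def] by measurable

lemma nn_integral_dpc_enc:
  assumes F: "F \<in> borel_measurable (blk n)"
  shows "(\<integral>\<^sup>+ x. F x \<partial>dpc_enc (w, s)) = (\<Sum>j\<in>{1..J}. ennreal (weight w j s) * F (clip (raw w j s)))"
proof -
  have m: "(\<lambda>j. clip (raw w j s)) \<in> point_measure {1..J} (\<lambda>j. ennreal (weight w j s)) \<rightarrow>\<^sub>M blk n"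
    using raw_space clip_space by (auto simp: measurable_point_measure_eq1)
  show ?thesis unfolding dpc_enc_def fst_conv snd_conv
    using m F by (subst nn_integral_distr) (auto simp: nn_integral_point_measure_finite)
qed

lemma sets_dpc_enc[simp]: "sets (dpc_enc ws) = sets (blk n)" by (simp add: dpc_enc_def)

lemma sum_ennreal_weight: "(\<Sum>j\<in>{1..J}. ennreal (weight w j s)) = 1"
  by (subst sum_ennreal) (auto simp: sum_weight)

lemma prob_space_dpc_enc: "prob_space (dpc_enc ws)"
proof
  have "emeasure (dpc_enc ws) (space (dpc_enc ws)) = (\<integral>\<^sup>+ x. 1 \<partial>dpc_enc (fst ws, snd ws))" by simp
  also have "\<dots> = 1" by (subst nn_integral_dpc_enc) (auto simp: sum_ennreal_weight)
  finally show "emeasure (dpc_enc ws) (space (dpc_enc ws)) = 1" .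
qed

text \<open>For a fixed message the probability of an event is a finite sum of measurable functions
  of the state; as the messages are countable, this is joint measurability.\<close>

lemma dpc_enc_meas: "dpc_enc \<in> count_space {1..M} \<Otimes>\<^sub>M blk n \<rightarrow>\<^sub>M prob_algebra (blk n)"
proof (intro measurable_prob_algebraI prob_space_dpc_enc measurable_subprob_algebra)
  fix A assume A[measurable]: "A \<in> sets (blk n)"
  show "(\<lambda>ws. emeasure (dpc_enc ws) A) \<in> borel_measurable (count_space {1..M} \<Otimes>\<^sub>M blk n)"
  proof (rule measurable_pair_measure_countable1)
    fix w assume w: "w \<in> {1..M}"
    have "(\<lambda>s. emeasure (dpc_enc (w, s)) A) = (\<lambda>s. \<Sum>j\<in>{1..J}. ennreal (weight w j s) * indicator A (clip (raw w j s)))"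
      by (subst nn_integral_dpc_enc[symmetric]) (auto simp: nn_integral_indicator)
    also have "\<dots> \<in> borel_measurable (blk n)"
    proof (intro borel_measurable_sum borel_measurable_times_ennreal)
      fix j assume "j \<in> {1..J}"
      then show "(\<lambda>s. ennreal (weight w j s)) \<in> borel_measurable (blk n)" using w by measurable
      show "(\<lambda>s. indicator A (clip (raw w j s))) \<in> borel_measurable (blk n)" by measurable
    qed
    finally show "(\<lambda>s. emeasure (dpc_enc (w, s)) A) \<in> borel_measurable (blk n)" .
  qed simp
qed (auto intro: prob_space_imp_subprob_space prob_space_dpc_enc)

lemma dpc_dec_range: "dpc_dec y \<in> {1..M}"
proof -
  let ?Q = "\<lambda>w. 1 \<le> w \<and> (M \<le> w \<or> (w \<le> M \<and> found w y))"
  have "?Q M" using M by auto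
  then have "?Q (dpc_dec y)" "dpc_dec y \<le> M" unfolding dpc_dec_def by (rule LeastI, rule Least_le)
  then show ?thesis by auto
qed

lemma dpc_dec_meas: "dpc_dec \<in> blk n \<rightarrow>\<^sub>M count_space {1..M}"
proof -
  have m: "Measurable.pred (blk n) (\<lambda>y. 1 \<le> w \<and> (M \<le> w \<or> (w \<le> M \<and> found w y)))" for w
  proof (cases "w \<in> {1..M}")
    case True
    then show ?thesis using found_meas[OF True] by measurable
  next
    case False
    then have "(\<lambda>y. 1 \<le> w \<and> (M \<le> w \<or> (w \<le> M \<and> found w y))) = (\<lambda>y. 1 \<le> w \<and> M \<le> w)" by (auto simp: fun_eq_iff)
    then show ?thesis by simp
  qed
  have "dpc_dec \<in> blk n \<rightarrow>\<^sub>M count_space UNIV" unfolding dpc_dec_def[abs_def] by (rule measurable_Least) (rule m)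
  then have "dpc_dec \<in> blk n \<rightarrow>\<^sub>M restrict_space (count_space UNIV) {1..M}"
    by (rule measurable_restrict_space2[rotated]) (use dpc_dec_range in auto)
  then show ?thesis by (simp add: restrict_count_space)
qed

text \<open>All competing codewords are excluded, those of the same message included. This costs no
  rate, since the union bound counts all \<open>M * J\<close> codewords anyway.\<close>

lemma dpc_dec_correct:
  assumes w: "w \<in> {1..M}" and j: "j \<in> {1..J}" and g: "\<gamma> < output_ratio (C (w, j)) y"
    and o: "\<And>i. i \<in> {1..M} \<times> {1..J} - {(w, j)} \<Longrightarrow> \<not> \<gamma> < output_ratio (C i) y"
  shows "dpc_dec y = w"
  unfolding dpc_dec_def
proof (rule Least_equality)
  show "1 \<le> w \<and> (M \<le> w \<or> (w \<le> M \<and> found w y))" using w j g by (auto simp: found_def)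
next
  fix w' assume w': "1 \<le> w' \<and> (M \<le> w' \<or> (w' \<le> M \<and> found w' y))"
  show "w \<le> w'"
  proof (cases "M \<le> w'")
    \<comment> \<open>The default answer \<open>M\<close> cannot undercut a correct message, which
      is at most \<open>M\<close>.\<close>
    case True then show ?thesis using w by simp
  next
    case False
    then have "found w' y" "w' \<in> {1..M}" using w' by auto
    then obtain j' where "j' \<in> {1..J}" "\<gamma> < output_ratio (C (w', j')) y" by (auto simp: found_def)
    then have "(w', j') = (w, j)" using o[of "(w', j')"] \<open>w' \<in> {1..M}\<close> by auto
    then show ?thesis by simp
  qed
qed

lemma wf_code: "wellformed_code code"
  unfolding wellformed_code_def using n M dpc_enc_meas dpc_dec_meas by (auto simp: block_space_def)

sublocale W: wiretap Q N1 N2 code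
  using Q N1 N2 wf_code by unfold_locales

lemma clip_power: "(\<Sum>i<n. (clip x i)\<^sup>2) \<le> n * P"
  using p pP by (auto simp: clip_def)

lemma power_code: "power_constraint P Q N1 N2 code"
proof -
  have P0: "0 \<le> P" using p pP by simp
  have "(\<integral>\<^sup>+ t. ennreal (\<Sum>i<n. (snd (snd t) i)\<^sup>2) \<partial>input_law Q code) = (\<Sum>w\<in>{1..M}. ennreal (1 / M) * (\<integral>\<^sup>+ s. \<integral>\<^sup>+ x. ennreal (\<Sum>i<n. (x i)\<^sup>2) \<partial>dpc_enc (w, s) \<partial>\<G> Q n))"
    using W.nn_integral_input_law[of "\<lambda>t. ennreal (\<Sum>i<n. (snd (snd t) i)\<^sup>2)"] by simp
  also have "\<dots> \<le> (\<Sum>w\<in>{1..M}. ennreal (1 / M) * (\<integral>\<^sup>+ s. ennreal (n * P) \<partial>\<G> Q n))"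
  proof (intro sum_mono mult_left_mono nn_integral_mono)
    fix w s
    have "(\<integral>\<^sup>+ x. ennreal (\<Sum>i<n. (x i)\<^sup>2) \<partial>dpc_enc (w, s)) = (\<Sum>j\<in>{1..J}. ennreal (weight w j s) * ennreal (\<Sum>i<n. (clip (raw w j s) i)\<^sup>2))"
      by (rule nn_integral_dpc_enc) measurable
    also have "\<dots> \<le> (\<Sum>j\<in>{1..J}. ennreal (weight w j s) * ennreal (n * P))"
      using clip_power by (intro sum_mono mult_left_mono ennreal_leI) auto
    also have "\<dots> = ennreal (n * P)" by (simp add: sum_distrib_right[symmetric] sum_ennreal_weight)
    finally show "(\<integral>\<^sup>+ x. ennreal (\<Sum>i<n. (x i)\<^sup>2) \<partial>dpc_enc (w, s)) \<le> ennreal (n * P)" .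
  qed auto
  also have "\<dots> = (\<Sum>w\<in>{1..M}. ennreal (1 / M) * 1) * ennreal (n * P)"
    using GQ.emeasure_space_1 by (simp add: sum_distrib_right mult.assoc)
  also have "\<dots> = ennreal (n * P)" using W.sum_const_messages by simp
  finally show ?thesis using W.power_constraint_iff[OF P0] by simp
qed

text \<open>\<open>dev\<close> and \<open>evedev\<close> measure how far the densities induced by a
  uniform codeword of the bundle are from 1: that of the state relative to its true law, and that of
  \<open>(Z - S, S)\<close> relative to independent Gaussian blocks.\<close>

definition "dev w s = \<bar>(\<Sum>j\<in>{1..J}. state_ratio (C (w, j)) s) / J - 1\<bar>"
definition "evedev w z s = \<bar>(\<Sum>j\<in>{1..J}. eve_ratio (C (w, j)) z s) / J - 1\<bar>"
definition "over w j s = (if (\<Sum>i<n. (raw w j s i)\<^sup>2) \<le> n * P then 0 else 1 :: ennreal)"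
text \<open>A sum in place of the indicator of a decoding error: the union bound is built in, so
  that each term involves at most two codewords.\<close>

definition "bad w j y = (if output_ratio (C (w, j)) y \<le> \<gamma> then 1 else 0) + (\<Sum>i\<in>{1..M} \<times> {1..J} - {(w, j)}. if \<gamma> < output_ratio (C i) y then 1 else 0 :: ennreal)"

text \<open>These averages refer to the ideal scheme, in which a uniform codeword of the bundle
  generates the state: \<open>state_ratio / J\<close> stands in for \<open>weight\<close>. The
  normalisation in \<open>weight\<close> couples all codewords of a bundle; without it expectations
  over random codebooks become explicit.\<close>

definition "overload = (\<Sum>w\<in>{1..M}. ennreal (1 / M) * (\<integral>\<^sup>+ s. (\<Sum>j\<in>{1..J}. ennreal (state_ratio (C (w, j)) s / J) * over w j s) \<partial>\<G> Q n))"
definition "confusion = (\<Sum>w\<in>{1..M}. ennreal (1 / M) * (\<integral>\<^sup>+ s. (\<Sum>j\<in>{1..J}. ennreal (state_ratio (C (w, j)) s / J) *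
   (\<integral>\<^sup>+ e. bad w j (\<lambda>i\<in>{..<n}. raw w j s i + s i + e i) \<partial>\<G> N1 n)) \<partial>\<G> Q n))"
definition "leakage = (\<Sum>w\<in>{1..M}. ennreal (1 / M) * (\<integral>\<^sup>+ s. \<integral>\<^sup>+ z. ennreal (evedev w z s) \<partial>\<G> (p + N2) n \<partial>\<G> Q n))"

text \<open>As functions of \<open>j\<close>, \<open>weight\<close> and its ideal counterpart are
  proportional, so their L1 distance is the difference of their total masses 1 and
  \<open>ratio_sum w s / J\<close>.\<close>

lemma sum_weight_dev: "(\<Sum>j\<in>{1..J}. \<bar>weight w j s - state_ratio (C (w, j)) s / J\<bar>) = dev w s"
proof -
  have t: "0 < ratio_sum w s" by (rule ratio_sum_pos)
  have "\<bar>weight w j s - state_ratio (C (w, j)) s / J\<bar> = state_ratio (C (w, j)) s * \<bar>1 / ratio_sum w s - 1 / J\<bar>" for j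
  proof -
    have "weight w j s - state_ratio (C (w, j)) s / J = state_ratio (C (w, j)) s * (1 / ratio_sum w s - 1 / J)"
      by (simp add: weight_def algebra_simps)
    then show ?thesis by (simp add: abs_mult)
  qed
  then have "(\<Sum>j\<in>{1..J}. \<bar>weight w j s - state_ratio (C (w, j)) s / J\<bar>) = ratio_sum w s * \<bar>1 / ratio_sum w s - 1 / J\<bar>"
    by (simp add: ratio_sum_def sum_distrib_right)
  also have "\<dots> = \<bar>ratio_sum w s * (1 / ratio_sum w s - 1 / J)\<bar>" using t by (simp add: abs_mult)
  also have "ratio_sum w s * (1 / ratio_sum w s - 1 / J) = 1 - ratio_sum w s / J" using t by (simp add: right_diff_distrib)
  finally show ?thesis by (simp add: dev_def ratio_sum_def abs_minus_commute)
qed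

lemma eve_ratio_code_meas: "w \<in> {1..M} \<Longrightarrow> j \<in> {1..J} \<Longrightarrow> s \<in> space (blk n) \<Longrightarrow> (\<lambda>z. eve_ratio (C (w, j)) z s) \<in> borel_measurable (blk n)"
  using C by (intro eve_ratio_meas) auto

lemma nn_integral_eve_ratio_code:
  assumes "w \<in> {1..M}" "j \<in> {1..J}" "s \<in> space (blk n)"
  shows "(\<integral>\<^sup>+ z. ennreal (eve_ratio (C (w, j)) z s) \<partial>\<G> (p + N2) n) = ennreal (state_ratio (C (w, j)) s)"
proof -
  have "(\<integral>\<^sup>+ z. ennreal (eve_ratio (C (w, j)) z s) \<partial>\<G> (p + N2) n) = (\<integral>\<^sup>+ z. ennreal (gauss_density (p + N2) n z) * ennreal (eve_ratio (C (w, j)) z s) \<partial>lborel_block n)"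
    by (rule nn_integral_gaussian_block[OF pN2 measurable_compose[OF eve_ratio_code_meas[OF assms] measurable_ennreal]])
  also have "\<dots> = (\<integral>\<^sup>+ z. ennreal (state_ratio (C (w, j)) s) * ennreal (gauss_density N2 n (\<lambda>i. z i - (C (w, j) i - \<alpha> * s i))) \<partial>lborel_block n)"
  proof (intro nn_integral_cong)
    fix z show "ennreal (gauss_density (p + N2) n z) * ennreal (eve_ratio (C (w, j)) z s) = ennreal (state_ratio (C (w, j)) s) * ennreal (gauss_density N2 n (\<lambda>i. z i - (C (w, j) i - \<alpha> * s i)))"
      using gauss_density_pos[OF pN2, of n z] by (simp add: ennreal_mult'[symmetric] eve_ratio_def)
  qed
  also have "\<dots> = ennreal (state_ratio (C (w, j)) s) * (\<integral>\<^sup>+ z. ennreal (gauss_density N2 n (\<lambda>i. z i - (C (w, j) i - \<alpha> * s i))) \<partial>lborel_block n)"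
    by (rule nn_integral_cmult) measurable
  also have "\<dots> = ennreal (state_ratio (C (w, j)) s)" unfolding nn_integral_gauss_density[OF N2] by simp
  finally show ?thesis .
qed

text \<open>Integrating out the eavesdropper's output shows that a bundle covering the pair covers
  the state. Hence the actual encoder is close to the ideal one under the very bound that gives
  secrecy.\<close>

lemma dev_le_evedev:
  assumes w: "w \<in> {1..M}" and s: "s \<in> space (blk n)"
  shows "ennreal (dev w s) \<le> (\<integral>\<^sup>+ z. ennreal (evedev w z s) \<partial>\<G> (p + N2) n)"
  unfolding dev_def evedev_def
proof (rule GZ.ennreal_abs_integral_minus_one_le)
  note m[measurable] = eve_ratio_code_meas[OF w _ s]
  have m': "(\<lambda>z. \<Sum>j\<in>{1..J}. eve_ratio (C (w, j)) z s) \<in> borel_measurable (\<G> (p + N2) n)" by measurable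
  show "(\<lambda>z. (\<Sum>j\<in>{1..J}. eve_ratio (C (w, j)) z s) / real J) \<in> borel_measurable (\<G> (p + N2) n)" using m' by measurable
  show "0 \<le> (\<Sum>j\<in>{1..J}. eve_ratio (C (w, j)) x s) / real J" for x by (intro divide_nonneg_nonneg sum_nonneg) auto
  show "0 \<le> (\<Sum>j\<in>{1..J}. state_ratio (C (w, j)) s) / real J" by (intro divide_nonneg_nonneg sum_nonneg) auto
  have "(\<integral>\<^sup>+ z. ennreal ((\<Sum>j\<in>{1..J}. eve_ratio (C (w, j)) z s) / real J) \<partial>\<G> (p + N2) n)
    = (\<integral>\<^sup>+ z. ennreal (1 / J) * (\<Sum>j\<in>{1..J}. ennreal (eve_ratio (C (w, j)) z s)) \<partial>\<G> (p + N2) n)"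
    by (intro nn_integral_cong) (simp add: sum_ennreal ennreal_mult'[symmetric])
  also have "\<dots> = ennreal (1 / J) * (\<Sum>j\<in>{1..J}. \<integral>\<^sup>+ z. ennreal (eve_ratio (C (w, j)) z s) \<partial>\<G> (p + N2) n)"
    by (subst nn_integral_cmult, measurable, subst nn_integral_sum) measurable
  also have "\<dots> = ennreal (1 / J) * (\<Sum>j\<in>{1..J}. ennreal (state_ratio (C (w, j)) s))"
    using w s by (intro arg_cong2[where f="(*)"] sum.cong refl nn_integral_eve_ratio_code)
  also have "\<dots> = ennreal ((\<Sum>j\<in>{1..J}. state_ratio (C (w, j)) s) / real J)"
    by (simp add: sum_ennreal ennreal_mult'[symmetric])
  finally show "(\<integral>\<^sup>+ z. ennreal ((\<Sum>j\<in>{1..J}. eve_ratio (C (w, j)) z s) / real J) \<partial>\<G> (p + N2) n) = ennreal ((\<Sum>j\<in>{1..J}. state_ratio (C (w, j)) s) / real J)" .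
qed

lemma weight_le: "ennreal (weight w j s) \<le> ennreal \<bar>weight w j s - state_ratio (C (w, j)) s / J\<bar> + ennreal (state_ratio (C (w, j)) s / J)"
proof -
  have "ennreal (weight w j s) \<le> ennreal (\<bar>weight w j s - state_ratio (C (w, j)) s / J\<bar> + state_ratio (C (w, j)) s / J)"
    by (intro ennreal_leI) linarith
  also have "\<dots> = ennreal \<bar>weight w j s - state_ratio (C (w, j)) s / J\<bar> + ennreal (state_ratio (C (w, j)) s / J)"
    by (rule ennreal_plus) auto
  finally show ?thesis .
qed

lemma dev_meas[measurable]: "w \<in> {1..M} \<Longrightarrow> dev w \<in> borel_measurable (blk n)"
  unfolding dev_def[abs_def] by measurable
lemma over_meas[measurable]: "over w j \<in> borel_measurable (blk n)"
  unfolding over_def[abs_def] by measurable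
lemma bad_meas[measurable]: "w \<in> {1..M} \<Longrightarrow> j \<in> {1..J} \<Longrightarrow> bad w j \<in> borel_measurable (blk n)"
  unfolding bad_def[abs_def]
proof (intro borel_measurable_add borel_measurable_sum)
  assume "w \<in> {1..M}" "j \<in> {1..J}"
  then show "(\<lambda>y. if output_ratio (C (w, j)) y \<le> \<gamma> then 1 else 0) \<in> borel_measurable (blk n)" by measurable
next
  fix i assume "i \<in> {1..M} \<times> {1..J} - {(w, j)}"
  then obtain w' j' where i: "i = (w', j')" "w' \<in> {1..M}" "j' \<in> {1..J}" by auto
  note [measurable] = output_ratio_code_meas[OF i(2,3)]
  show "(\<lambda>y. if \<gamma> < output_ratio (C i) y then 1 else 0) \<in> borel_measurable (blk n)" unfolding i by measurable
qed
lemma evedev_meas[measurable]: "w \<in> {1..M} \<Longrightarrow> (\<lambda>v. evedev w (fst v) (snd v)) \<in> borel_measurable (blk n \<Otimes>\<^sub>M blk n)"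
proof -
  assume w: "w \<in> {1..M}"
  have "(\<lambda>v. \<Sum>j\<in>{1..J}. eve_ratio (C (w, j)) (fst v) (snd v)) \<in> borel_measurable (blk n \<Otimes>\<^sub>M blk n)"
    using C[OF w] by (intro borel_measurable_sum eve_ratio_meas) auto
  then show ?thesis unfolding evedev_def by measurable
qed

lemma leakage_inner_meas[measurable]: "w \<in> {1..M} \<Longrightarrow> (\<lambda>s. \<integral>\<^sup>+ z. ennreal (evedev w z s) \<partial>\<G> (p + N2) n) \<in> borel_measurable (blk n)"
proof -
  assume w: "w \<in> {1..M}"
  have "(\<lambda>v. ennreal (evedev w (snd v) (fst v))) \<in> borel_measurable (blk n \<Otimes>\<^sub>M \<G> (p + N2) n)"
    using measurable_compose[OF measurable_pair_swap'[of "blk n" "blk n"] evedev_meas[OF w]] by (simp add: split_beta' cong: measurable_cong_sets)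
  from GZ.borel_measurable_nn_integral_fst[OF this] show ?thesis by simp
qed

text \<open>Exchanging the weights for the ideal ones costs \<open>dev\<close>, which the leakage
  dominates. A clipped input is charged as an error, and otherwise the union bound
  \<open>bad\<close> applies.\<close>

lemma error_code_le: "ennreal (error_prob Q N1 N2 code) \<le> leakage + (overload + confusion)"
proof -
  have mm: "Measurable.pred (W.input_space \<Otimes>\<^sub>M blk n) (\<lambda>q. dpc_dec (\<lambda>i\<in>{..<n}. snd (snd (fst q)) i + fst (snd (fst q)) i + snd q i) \<noteq> fst (fst q))"
    using W.pred_decoding_error[of "\<lambda>q. \<lambda>i\<in>{..<n}. snd (snd (fst q)) i + fst (snd (fst q)) i + snd q i" "W.input_space \<Otimes>\<^sub>M blk n" "\<lambda>q. fst (fst q)"] by simp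
  have mm1: "(\<lambda>q. if dpc_dec (\<lambda>i\<in>{..<n}. snd (snd (fst q)) i + fst (snd (fst q)) i + snd q i) \<noteq> fst (fst q) then (1::ennreal) else 0) \<in> borel_measurable (W.input_space \<Otimes>\<^sub>M \<G> N1 n)"
    using mm by measurable
  have mm2: "(\<lambda>t. \<integral>\<^sup>+ e. (if dpc_dec (\<lambda>i\<in>{..<n}. snd (snd t) i + fst (snd t) i + e i) \<noteq> fst t then 1 else 0) \<partial>\<G> N1 n) \<in> borel_measurable W.input_space"
    using G1.borel_measurable_nn_integral_fst[OF mm1] by simp
  have "ennreal (error_prob Q N1 N2 code) = (\<Sum>w\<in>{1..M}. ennreal (1 / M) * (\<integral>\<^sup>+ s. \<integral>\<^sup>+ x. \<integral>\<^sup>+ e. (if dpc_dec (\<lambda>i\<in>{..<n}. x i + s i + e i) \<noteq> w then 1 else 0) \<partial>\<G> N1 n \<partial>dpc_enc (w, s) \<partial>\<G> Q n))"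
    using W.nn_integral_input_law[OF mm2] W.error_prob_eq by simp
  also have "\<dots> \<le> (\<Sum>w\<in>{1..M}. ennreal (1 / M) * (\<integral>\<^sup>+ s. (\<integral>\<^sup>+ z. ennreal (evedev w z s) \<partial>\<G> (p + N2) n)
      + ((\<Sum>j\<in>{1..J}. ennreal (state_ratio (C (w, j)) s / J) * over w j s)
        + (\<Sum>j\<in>{1..J}. ennreal (state_ratio (C (w, j)) s / J) * (\<integral>\<^sup>+ e. bad w j (\<lambda>i\<in>{..<n}. raw w j s i + s i + e i) \<partial>\<G> N1 n))) \<partial>\<G> Q n))"
  proof (intro sum_mono mult_left_mono nn_integral_mono)
    fix w s assume w: "w \<in> {1..M}" and "s \<in> space (\<G> Q n)"
    then have s: "s \<in> space (blk n)" by simp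
    define E where "E x = (\<integral>\<^sup>+ e. (if dpc_dec (\<lambda>i\<in>{..<n}. x i + s i + e i) \<noteq> w then 1 else 0) \<partial>\<G> N1 n)" for x
    have ei: "(\<lambda>x. (w, s, x)) \<in> blk n \<rightarrow>\<^sub>M W.input_space" using w s by (intro measurable_Pair) auto
    have Em: "E \<in> borel_measurable (blk n)"
      unfolding E_def[abs_def] using measurable_compose[OF ei mm2] by simp
    have E1: "E x \<le> 1" for x
    proof -
      have "E x \<le> (\<integral>\<^sup>+ e. 1 \<partial>\<G> N1 n)" unfolding E_def by (intro nn_integral_mono) auto
      then show ?thesis using G1.emeasure_space_1 by simp
    qed
    \<comment> \<open>When clipping acts nothing is claimed about the decoder and the full
      probability 1 is paid by \<open>over\<close>; otherwise the receiver sees exactly the output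
      of the ideal scheme.\<close>
    have Eb: "E (clip (raw w j s)) \<le> over w j s + (\<integral>\<^sup>+ e. bad w j (\<lambda>i\<in>{..<n}. raw w j s i + s i + e i) \<partial>\<G> N1 n)"
      if j: "j \<in> {1..J}" for j
    proof (cases "(\<Sum>i<n. (raw w j s i)\<^sup>2) \<le> n * P")
      case False
      then have "over w j s = 1" by (simp add: over_def)
      then show ?thesis using add_mono[OF E1[of "clip (raw w j s)"] zero_le[of "\<integral>\<^sup>+ e. bad w j (\<lambda>i\<in>{..<n}. raw w j s i + s i + e i) \<partial>\<G> N1 n"]]
        by (simp only: add_0_right)
    next
      case True
      then have c: "clip (raw w j s) = raw w j s" "over w j s = 0" by (auto simp: clip_def over_def)
      have "E (raw w j s) \<le> (\<integral>\<^sup>+ e. bad w j (\<lambda>i\<in>{..<n}. raw w j s i + s i + e i) \<partial>\<G> N1 n)"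
        unfolding E_def
      proof (intro nn_integral_mono)
        fix e
        let ?y = "\<lambda>i\<in>{..<n}. raw w j s i + s i + e i"
        show "(if dpc_dec ?y \<noteq> w then 1 else 0) \<le> bad w j ?y"
        proof (cases "dpc_dec ?y = w")
          case False
          show ?thesis
          proof (cases "output_ratio (C (w, j)) ?y \<le> \<gamma>")
            case True
            then have "bad w j ?y = 1 + (\<Sum>i\<in>{1..M} \<times> {1..J} - {(w, j)}. if \<gamma> < output_ratio (C i) ?y then 1 else 0)"
              by (simp only: bad_def if_True)
            moreover have "(1::ennreal) \<le> 1 + a" for a by simp
            ultimately show ?thesis using False by simp
          next
            case ratio: False
            have "\<exists>i\<in>{1..M} \<times> {1..J} - {(w, j)}. \<gamma> < output_ratio (C i) ?y"
            proof (rule ccontr)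
              assume "\<not> ?thesis"
              then have "dpc_dec ?y = w" using ratio by (intro dpc_dec_correct[OF w j]) (simp_all only: not_le bex_simps not_False_eq_True, blast)
              then show False using False by contradiction
            qed
            then obtain i where 2: "i \<in> {1..M} \<times> {1..J} - {(w, j)}" "\<gamma> < output_ratio (C i) ?y" by blast
            have "(1::ennreal) = (if \<gamma> < output_ratio (C i) ?y then 1 else 0)" using 2(2) by (simp only: if_True)
            also have "\<dots> \<le> (\<Sum>i\<in>{1..M} \<times> {1..J} - {(w, j)}. if \<gamma> < output_ratio (C i) ?y then 1 else 0)"
              using 2(1) by (rule member_le_sum[where f="\<lambda>i. if \<gamma> < output_ratio (C i) ?y then 1 else 0"]) simp_all
            also have "\<dots> \<le> bad w j ?y" unfolding bad_def by simp
            finally show ?thesis using False by simp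
          qed
        qed simp
      qed
      then show ?thesis by (simp add: c)
    qed
    have "(\<integral>\<^sup>+ x. E x \<partial>dpc_enc (w, s)) = (\<Sum>j\<in>{1..J}. ennreal (weight w j s) * E (clip (raw w j s)))"
      by (rule nn_integral_dpc_enc[OF Em])
    also have "\<dots> \<le> (\<Sum>j\<in>{1..J}. ennreal \<bar>weight w j s - state_ratio (C (w, j)) s / J\<bar> * 1 + ennreal (state_ratio (C (w, j)) s / J) * (over w j s + (\<integral>\<^sup>+ e. bad w j (\<lambda>i\<in>{..<n}. raw w j s i + s i + e i) \<partial>\<G> N1 n)))"
    proof (intro sum_mono)
      fix j assume j: "j \<in> {1..J}"
      have "ennreal (weight w j s) * E (clip (raw w j s)) \<le> (ennreal \<bar>weight w j s - state_ratio (C (w, j)) s / J\<bar> + ennreal (state_ratio (C (w, j)) s / J)) * E (clip (raw w j s))"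
        by (intro mult_right_mono weight_le) simp
      also have "\<dots> = ennreal \<bar>weight w j s - state_ratio (C (w, j)) s / J\<bar> * E (clip (raw w j s)) + ennreal (state_ratio (C (w, j)) s / J) * E (clip (raw w j s))"
        by (rule distrib_right)
      also have "\<dots> \<le> ennreal \<bar>weight w j s - state_ratio (C (w, j)) s / J\<bar> * 1 + ennreal (state_ratio (C (w, j)) s / J) * (over w j s + (\<integral>\<^sup>+ e. bad w j (\<lambda>i\<in>{..<n}. raw w j s i + s i + e i) \<partial>\<G> N1 n))"
        using E1 Eb[OF j] by (intro add_mono mult_left_mono) auto
      finally show "ennreal (weight w j s) * E (clip (raw w j s)) \<le> \<dots>" .
    qed
    also have "\<dots> = ennreal (dev w s) + ((\<Sum>j\<in>{1..J}. ennreal (state_ratio (C (w, j)) s / J) * over w j s)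
        + (\<Sum>j\<in>{1..J}. ennreal (state_ratio (C (w, j)) s / J) * (\<integral>\<^sup>+ e. bad w j (\<lambda>i\<in>{..<n}. raw w j s i + s i + e i) \<partial>\<G> N1 n)))"
    proof -
      have "(\<Sum>j\<in>{1..J}. ennreal \<bar>weight w j s - state_ratio (C (w, j)) s / J\<bar>) = ennreal (dev w s)"
        unfolding sum_weight_dev[symmetric] by (intro sum_ennreal) auto
      then show ?thesis by (simp only: sum.distrib distrib_left mult_1_right)
    qed
    also have "\<dots> \<le> (\<integral>\<^sup>+ z. ennreal (evedev w z s) \<partial>\<G> (p + N2) n) + ((\<Sum>j\<in>{1..J}. ennreal (state_ratio (C (w, j)) s / J) * over w j s)
        + (\<Sum>j\<in>{1..J}. ennreal (state_ratio (C (w, j)) s / J) * (\<integral>\<^sup>+ e. bad w j (\<lambda>i\<in>{..<n}. raw w j s i + s i + e i) \<partial>\<G> N1 n)))"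
      by (intro add_right_mono dev_le_evedev w s)
    finally show "(\<integral>\<^sup>+ x. \<integral>\<^sup>+ e. (if dpc_dec (\<lambda>i\<in>{..<n}. x i + s i + e i) \<noteq> w then 1 else 0) \<partial>\<G> N1 n \<partial>dpc_enc (w, s)) \<le> \<dots>"
      unfolding E_def .
  qed auto
  also have "\<dots> = leakage + (overload + confusion)"
  proof -
    have "(\<integral>\<^sup>+ s. (\<integral>\<^sup>+ z. ennreal (evedev w z s) \<partial>\<G> (p + N2) n)
      + ((\<Sum>j\<in>{1..J}. ennreal (state_ratio (C (w, j)) s / J) * over w j s)
        + (\<Sum>j\<in>{1..J}. ennreal (state_ratio (C (w, j)) s / J) * (\<integral>\<^sup>+ e. bad w j (\<lambda>i\<in>{..<n}. raw w j s i + s i + e i) \<partial>\<G> N1 n))) \<partial>\<G> Q n)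
      = (\<integral>\<^sup>+ s. (\<integral>\<^sup>+ z. ennreal (evedev w z s) \<partial>\<G> (p + N2) n) \<partial>\<G> Q n)
      + ((\<integral>\<^sup>+ s. (\<Sum>j\<in>{1..J}. ennreal (state_ratio (C (w, j)) s / J) * over w j s) \<partial>\<G> Q n)
        + (\<integral>\<^sup>+ s. (\<Sum>j\<in>{1..J}. ennreal (state_ratio (C (w, j)) s / J) * (\<integral>\<^sup>+ e. bad w j (\<lambda>i\<in>{..<n}. raw w j s i + s i + e i) \<partial>\<G> N1 n)) \<partial>\<G> Q n))"
      if w: "w \<in> {1..M}" for w
    proof -
      have a: "(\<lambda>s. \<Sum>j\<in>{1..J}. ennreal (state_ratio (C (w, j)) s / J) * over w j s) \<in> borel_measurable (\<G> Q n)"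
        using w by (intro borel_measurable_sum) measurable
      have b: "(\<lambda>s. \<Sum>j\<in>{1..J}. ennreal (state_ratio (C (w, j)) s / J) * (\<integral>\<^sup>+ e. bad w j (\<lambda>i\<in>{..<n}. raw w j s i + s i + e i) \<partial>\<G> N1 n)) \<in> borel_measurable (\<G> Q n)"
      proof (intro borel_measurable_sum)
        fix j assume j: "j \<in> {1..J}"
        note [measurable] = bad_meas[OF w j] state_ratio_code_meas[OF w j]
        have "(\<lambda>q. bad w j (\<lambda>i\<in>{..<n}. raw w j (fst q) i + fst q i + snd q i)) \<in> borel_measurable (blk n \<Otimes>\<^sub>M \<G> N1 n)"
          by measurable
        from G1.borel_measurable_nn_integral_fst[OF this]
        have [measurable]: "(\<lambda>s. \<integral>\<^sup>+ e. bad w j (\<lambda>i\<in>{..<n}. raw w j s i + s i + e i) \<partial>\<G> N1 n) \<in> borel_measurable (blk n)" by simp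
        show "(\<lambda>s. ennreal (state_ratio (C (w, j)) s / J) * (\<integral>\<^sup>+ e. bad w j (\<lambda>i\<in>{..<n}. raw w j s i + s i + e i) \<partial>\<G> N1 n)) \<in> borel_measurable (\<G> Q n)"
          by measurable
      qed
      have l: "(\<lambda>s. \<integral>\<^sup>+ z. ennreal (evedev w z s) \<partial>\<G> (p + N2) n) \<in> borel_measurable (\<G> Q n)"
        using leakage_inner_meas[OF w] by (simp cong: measurable_cong_sets)
      show ?thesis unfolding nn_integral_add[OF l borel_measurable_add[OF a b]] nn_integral_add[OF a b] ..
    qed
    then show ?thesis unfolding leakage_def overload_def confusion_def
      by (simp only: sum.distrib distrib_left cong: sum.cong)
  qed
  finally show ?thesis .
qed

lemma eve_density_code:
  assumes w: "w \<in> {1..M}" and s: "s \<in> space (blk n)"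
  shows "W.eve_density w (\<lambda>i\<in>{..<n}. z i + s i) s = (\<Sum>j\<in>{1..J}. weight w j s * gauss_density N2 n (\<lambda>i. z i - clip (raw w j s) i))"
proof -
  have "ennreal (W.eve_density w (\<lambda>i\<in>{..<n}. z i + s i) s) = (\<integral>\<^sup>+ x. ennreal (gauss_density N2 n (\<lambda>i. (\<lambda>i\<in>{..<n}. z i + s i) i - s i - x i)) \<partial>dpc_enc (w, s))"
    using W.ennreal_eve_density[of w s] w s by simp
  also have "\<dots> = (\<Sum>j\<in>{1..J}. ennreal (weight w j s) * ennreal (gauss_density N2 n (\<lambda>i. (\<lambda>i\<in>{..<n}. z i + s i) i - s i - clip (raw w j s) i)))"
    by (rule nn_integral_dpc_enc) measurable
  also have "\<dots> = (\<Sum>j\<in>{1..J}. ennreal (weight w j s * gauss_density N2 n (\<lambda>i. z i - clip (raw w j s) i)))"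
  proof (intro sum.cong refl)
    fix j
    have "gauss_density N2 n (\<lambda>i. (\<lambda>i\<in>{..<n}. z i + s i) i - s i - clip (raw w j s) i) = gauss_density N2 n (\<lambda>i. z i - clip (raw w j s) i)"
      by (intro gauss_density_cong) auto
    then show "ennreal (weight w j s) * ennreal (gauss_density N2 n (\<lambda>i. (\<lambda>i\<in>{..<n}. z i + s i) i - s i - clip (raw w j s) i)) = ennreal (weight w j s * gauss_density N2 n (\<lambda>i. z i - clip (raw w j s) i))"
      by (simp only: ennreal_mult'[OF weight_nonneg])
  qed
  also have "\<dots> = ennreal (\<Sum>j\<in>{1..J}. weight w j s * gauss_density N2 n (\<lambda>i. z i - clip (raw w j s) i))"
    by (intro sum_ennreal) auto
  finally show ?thesis by (subst (asm) ennreal_inj) (auto intro!: sum_nonneg)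
qed

text \<open>Three exchanges: the weights for ideal weights, clipped inputs for raw ones, and the
  resulting mixture for a Gaussian. Clipping is paid twice because the noise densities around the
  clipped and the raw input each have mass 1.\<close>

lemma eve_density_code_dev:
  assumes w: "w \<in> {1..M}" and s: "s \<in> space (blk n)"
  shows "(\<integral>\<^sup>+ z. ennreal \<bar>W.eve_density w (\<lambda>i\<in>{..<n}. z i + s i) s - gauss_density (p + N2) n z\<bar> \<partial>lborel_block n)
    \<le> ennreal (dev w s) + (2 * (\<Sum>j\<in>{1..J}. ennreal (state_ratio (C (w, j)) s / J) * over w j s) + (\<integral>\<^sup>+ z. ennreal (evedev w z s) \<partial>\<G> (p + N2) n))"
proof -
  define a where "a j z = gauss_density N2 n (\<lambda>i. z i - clip (raw w j s) i)" for j z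
  define a' where "a' j z = gauss_density N2 n (\<lambda>i. z i - raw w j s i)" for j z
  define r where "r j = state_ratio (C (w, j)) s / J" for j
  define G where "G = gauss_density (p + N2) n"
  have nn: "0 \<le> a j z" "0 \<le> a' j z" "0 \<le> r j" "0 \<le> G z" for j z by (simp_all add: a_def a'_def r_def G_def)
  have [measurable]: "a j \<in> borel_measurable (lborel_block n)" "a' j \<in> borel_measurable (lborel_block n)" for j
    unfolding a_def a'_def by measurable
  have [measurable]: "G \<in> borel_measurable (lborel_block n)" unfolding G_def by measurable
  have em: "(\<lambda>z. evedev w z s) \<in> borel_measurable (blk n)"
    using measurable_compose[OF measurable_Pair2'[OF s] evedev_meas[OF w]] 
      measurable_compose[OF _ evedev_meas[OF w], of "\<lambda>z. (z, s)" "blk n"] s by simp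
  have [measurable]: "(\<lambda>z. evedev w z s) \<in> borel_measurable (lborel_block n)"
    using em by (simp cong: measurable_cong_sets)
  \<comment> \<open>The third difference is the covering deviation: \<open>eve_ratio\<close> carries
    the target density \<open>G z\<close> as its denominator, so \<open>G z\<close> factors
    out.\<close>
  have ev: "(\<Sum>j\<in>{1..J}. r j * a' j z) - G z = G z * ((\<Sum>j\<in>{1..J}. eve_ratio (C (w, j)) z s) / J - 1)" for z
  proof -
    have g: "0 < G z" unfolding G_def by (rule gauss_density_pos[OF pN2])
    have "eve_ratio (C (w, j)) z s = state_ratio (C (w, j)) s * a' j z / G z" for j
    proof -
      have "gauss_density N2 n (\<lambda>i. z i - (C (w, j) i - \<alpha> * s i)) = a' j z" unfolding a'_def by (intro gauss_density_cong) (auto simp: raw_def)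
      then show ?thesis by (simp add: eve_ratio_def G_def)
    qed
    then have "(\<Sum>j\<in>{1..J}. eve_ratio (C (w, j)) z s) / J = (\<Sum>j\<in>{1..J}. state_ratio (C (w, j)) s * a' j z / G z / J)"
      by (simp only: sum_divide_distrib)
    also have "\<dots> = (\<Sum>j\<in>{1..J}. r j * a' j z / G z)"
      by (intro sum.cong refl) (simp only: r_def divide_inverse mult_ac)
    also have "\<dots> = (\<Sum>j\<in>{1..J}. r j * a' j z) / G z" by (simp only: sum_divide_distrib)
    finally have "(\<Sum>j\<in>{1..J}. eve_ratio (C (w, j)) z s) / J = (\<Sum>j\<in>{1..J}. r j * a' j z) / G z" .
    then have "G z * ((\<Sum>j\<in>{1..J}. eve_ratio (C (w, j)) z s) / J - 1) = G z * ((\<Sum>j\<in>{1..J}. r j * a' j z) / G z) - G z"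
      by (simp only: right_diff_distrib mult_1_right)
    also have "G z * ((\<Sum>j\<in>{1..J}. r j * a' j z) / G z) = (\<Sum>j\<in>{1..J}. r j * a' j z)" using g by (intro nonzero_mult_div_cancel_left[THEN trans[OF times_divide_eq_right]]) simp
    finally show ?thesis by (rule sym)
  qed
  have pw: "ennreal \<bar>W.eve_density w (\<lambda>i\<in>{..<n}. z i + s i) s - G z\<bar>
    \<le> (\<Sum>j\<in>{1..J}. ennreal \<bar>weight w j s - r j\<bar> * ennreal (a j z)) + ((\<Sum>j\<in>{1..J}. (ennreal (r j) * over w j s) * (ennreal (a j z) + ennreal (a' j z))) + ennreal (G z) * ennreal (evedev w z s))" for z
  proof -
    define ov where "ov j = (if (\<Sum>i<n. (raw w j s i)\<^sup>2) \<le> n * P then 0 else 1 :: real)" for j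
    have ov: "over w j s = ennreal (ov j)" "0 \<le> ov j" for j by (simp_all add: over_def ov_def)
    \<comment> \<open>Telescoping over the three exchanges; a term of the second sum vanishes unless
      clipping acts on its codeword.\<close>
    have split: "W.eve_density w (\<lambda>i\<in>{..<n}. z i + s i) s - G z = (\<Sum>j\<in>{1..J}. (weight w j s - r j) * a j z) + ((\<Sum>j\<in>{1..J}. r j * (a j z - a' j z)) + ((\<Sum>j\<in>{1..J}. r j * a' j z) - G z))"
      unfolding eve_density_code[OF w s] a_def[symmetric] by (simp add: left_diff_distrib right_diff_distrib sum_subtractf)
    have "\<bar>W.eve_density w (\<lambda>i\<in>{..<n}. z i + s i) s - G z\<bar> \<le> (\<Sum>j\<in>{1..J}. \<bar>weight w j s - r j\<bar> * a j z) + ((\<Sum>j\<in>{1..J}. (r j * ov j) * (a j z + a' j z)) + G z * evedev w z s)"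
      unfolding split
    proof (intro order_trans[OF abs_triangle_ineq] add_mono)
      show "\<bar>\<Sum>j\<in>{1..J}. (weight w j s - r j) * a j z\<bar> \<le> (\<Sum>j\<in>{1..J}. \<bar>weight w j s - r j\<bar> * a j z)"
        using nn by (intro order_trans[OF sum_abs] sum_mono) (simp add: abs_mult)
      show "\<bar>\<Sum>j\<in>{1..J}. r j * (a j z - a' j z)\<bar> \<le> (\<Sum>j\<in>{1..J}. (r j * ov j) * (a j z + a' j z))"
      proof (intro order_trans[OF sum_abs] sum_mono)
        fix j
        show "\<bar>r j * (a j z - a' j z)\<bar> \<le> (r j * ov j) * (a j z + a' j z)"
        proof (cases "(\<Sum>i<n. (raw w j s i)\<^sup>2) \<le> n * P")
          case True
          then have "a j z = a' j z" by (simp add: a_def a'_def clip_def)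
          then show ?thesis using nn ov(2)[of j] by simp
        next
          case False
          have "\<bar>a j z - a' j z\<bar> \<le> a j z + a' j z" using nn(1)[of j z] nn(2)[of j z] by linarith
          then have "r j * \<bar>a j z - a' j z\<bar> \<le> r j * (a j z + a' j z)" by (intro mult_left_mono nn)
          then show ?thesis using False nn(3)[of j] by (simp add: ov_def abs_mult)
        qed
      qed
      show "\<bar>(\<Sum>j\<in>{1..J}. r j * a' j z) - G z\<bar> \<le> G z * evedev w z s"
        unfolding ev using nn(4)[of z] by (simp add: abs_mult evedev_def)
    qed
    then have "ennreal \<bar>W.eve_density w (\<lambda>i\<in>{..<n}. z i + s i) s - G z\<bar> \<le> ennreal (((\<Sum>j\<in>{1..J}. \<bar>weight w j s - r j\<bar> * a j z) + ((\<Sum>j\<in>{1..J}. (r j * ov j) * (a j z + a' j z)) + G z * evedev w z s)))" by (rule ennreal_leI)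
    also have "\<dots> = ennreal (\<Sum>j\<in>{1..J}. \<bar>weight w j s - r j\<bar> * a j z) + (ennreal (\<Sum>j\<in>{1..J}. (r j * ov j) * (a j z + a' j z)) + ennreal (G z * evedev w z s))"
    proof -
      have n1: "0 \<le> (\<Sum>j\<in>{1..J}. \<bar>weight w j s - r j\<bar> * a j z)"
        by (rule sum_nonneg, rule mult_nonneg_nonneg[OF abs_ge_zero nn(1)])
      have n2: "0 \<le> (\<Sum>j\<in>{1..J}. (r j * ov j) * (a j z + a' j z))"
        by (rule sum_nonneg, rule mult_nonneg_nonneg[OF mult_nonneg_nonneg[OF nn(3) ov(2)] add_nonneg_nonneg[OF nn(1,2)]])
      have "0 \<le> evedev w z s" by (simp add: evedev_def)
      then have n3: "0 \<le> G z * evedev w z s" by (rule mult_nonneg_nonneg[OF nn(4)])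
      show ?thesis
        unfolding ennreal_plus[OF n1 add_nonneg_nonneg[OF n2 n3]] ennreal_plus[OF n2 n3] ..
    qed
    also have "\<dots> = (\<Sum>j\<in>{1..J}. ennreal \<bar>weight w j s - r j\<bar> * ennreal (a j z)) + ((\<Sum>j\<in>{1..J}. (ennreal (r j) * over w j s) * (ennreal (a j z) + ennreal (a' j z))) + ennreal (G z) * ennreal (evedev w z s))"
    proof -
      have e1: "ennreal (\<Sum>j\<in>{1..J}. \<bar>weight w j s - r j\<bar> * a j z) = (\<Sum>j\<in>{1..J}. ennreal \<bar>weight w j s - r j\<bar> * ennreal (a j z))"
      proof (rule trans[OF sum_ennreal[symmetric] sum.cong[OF refl]])
        fix j
        show "0 \<le> \<bar>weight w j s - r j\<bar> * a j z" by (rule mult_nonneg_nonneg[OF abs_ge_zero nn(1)])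
        show "ennreal (\<bar>weight w j s - r j\<bar> * a j z) = ennreal \<bar>weight w j s - r j\<bar> * ennreal (a j z)"
          by (rule ennreal_mult'[OF abs_ge_zero])
      qed
      have e2: "ennreal (\<Sum>j\<in>{1..J}. (r j * ov j) * (a j z + a' j z)) = (\<Sum>j\<in>{1..J}. (ennreal (r j) * over w j s) * (ennreal (a j z) + ennreal (a' j z)))"
      proof (rule trans[OF sum_ennreal[symmetric] sum.cong[OF refl]])
        fix j
        show "0 \<le> (r j * ov j) * (a j z + a' j z)"
          by (rule mult_nonneg_nonneg[OF mult_nonneg_nonneg[OF nn(3) ov(2)] add_nonneg_nonneg[OF nn(1,2)]])
        show "ennreal ((r j * ov j) * (a j z + a' j z)) = (ennreal (r j) * over w j s) * (ennreal (a j z) + ennreal (a' j z))"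
          unfolding ov(1) ennreal_mult'[OF mult_nonneg_nonneg[OF nn(3) ov(2)]] ennreal_mult'[OF nn(3)] ennreal_plus[OF nn(1,2)] ..
      qed
      show ?thesis unfolding e1 e2 ennreal_mult'[OF nn(4)] ..
    qed
    finally show ?thesis .
  qed
  have ia: "(\<integral>\<^sup>+ z. ennreal (a j z) \<partial>lborel_block n) = 1" "(\<integral>\<^sup>+ z. ennreal (a' j z) \<partial>lborel_block n) = 1" for j
    unfolding a_def a'_def by (rule nn_integral_gauss_density[OF N2])+
  have "(\<integral>\<^sup>+ z. ennreal \<bar>W.eve_density w (\<lambda>i\<in>{..<n}. z i + s i) s - G z\<bar> \<partial>lborel_block n)
    \<le> (\<integral>\<^sup>+ z. (\<Sum>j\<in>{1..J}. ennreal \<bar>weight w j s - r j\<bar> * ennreal (a j z)) + ((\<Sum>j\<in>{1..J}. (ennreal (r j) * over w j s) * (ennreal (a j z) + ennreal (a' j z))) + ennreal (G z) * ennreal (evedev w z s)) \<partial>lborel_block n)"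
    by (intro nn_integral_mono pw)
  also have "\<dots> = (\<integral>\<^sup>+ z. (\<Sum>j\<in>{1..J}. ennreal \<bar>weight w j s - r j\<bar> * ennreal (a j z)) \<partial>lborel_block n)
    + ((\<integral>\<^sup>+ z. (\<Sum>j\<in>{1..J}. (ennreal (r j) * over w j s) * (ennreal (a j z) + ennreal (a' j z))) \<partial>lborel_block n) + (\<integral>\<^sup>+ z. ennreal (G z) * ennreal (evedev w z s) \<partial>lborel_block n))"
    by (subst nn_integral_add, measurable, subst nn_integral_add) measurable
  also have "\<dots> = ennreal (dev w s) + (2 * (\<Sum>j\<in>{1..J}. ennreal (r j) * over w j s) + (\<integral>\<^sup>+ z. ennreal (evedev w z s) \<partial>\<G> (p + N2) n))"
  proof -
    have "(\<integral>\<^sup>+ z. (\<Sum>j\<in>{1..J}. ennreal \<bar>weight w j s - r j\<bar> * ennreal (a j z)) \<partial>lborel_block n) = (\<Sum>j\<in>{1..J}. ennreal \<bar>weight w j s - r j\<bar>)"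
      by (subst nn_integral_sum, measurable) (simp add: nn_integral_cmult ia)
    also have "\<dots> = ennreal (dev w s)"
      unfolding sum_weight_dev[symmetric] r_def by (intro sum_ennreal) auto
    finally have e1: "(\<integral>\<^sup>+ z. (\<Sum>j\<in>{1..J}. ennreal \<bar>weight w j s - r j\<bar> * ennreal (a j z)) \<partial>lborel_block n) = ennreal (dev w s)" .
    have "(\<integral>\<^sup>+ z. (\<Sum>j\<in>{1..J}. (ennreal (r j) * over w j s) * (ennreal (a j z) + ennreal (a' j z))) \<partial>lborel_block n) = (\<Sum>j\<in>{1..J}. (ennreal (r j) * over w j s) * 2)"
      by (subst nn_integral_sum, measurable) (simp add: nn_integral_cmult nn_integral_add ia)
    also have "\<dots> = 2 * (\<Sum>j\<in>{1..J}. ennreal (r j) * over w j s)"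
      by (subst sum_distrib_right[symmetric]) (rule mult.commute)
    finally have e2: "(\<integral>\<^sup>+ z. (\<Sum>j\<in>{1..J}. (ennreal (r j) * over w j s) * (ennreal (a j z) + ennreal (a' j z))) \<partial>lborel_block n) = 2 * (\<Sum>j\<in>{1..J}. ennreal (r j) * over w j s)" .
    have e3: "(\<integral>\<^sup>+ z. ennreal (G z) * ennreal (evedev w z s) \<partial>lborel_block n) = (\<integral>\<^sup>+ z. ennreal (evedev w z s) \<partial>\<G> (p + N2) n)"
      unfolding G_def by (rule nn_integral_gaussian_block[OF pN2 measurable_compose[OF em measurable_ennreal], symmetric])
    show ?thesis unfolding e1 e2 e3 ..
  qed
  finally show ?thesis by (simp only: G_def r_def)
qed

text \<open>The leakage appears twice: once for the mixture itself, and once as a bound for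
  \<open>dev\<close>, the error of the weights.\<close>

lemma eve_code_le:
  "(\<Sum>w\<in>{1..M}. ennreal (1 / M) * (\<integral>\<^sup>+ s. \<integral>\<^sup>+ z. ennreal \<bar>W.eve_density w (\<lambda>i\<in>{..<n}. z i + s i) s - gauss_density (p + N2) n z\<bar> \<partial>lborel_block n \<partial>\<G> Q n)) \<le> 2 * leakage + 2 * overload"
proof -
  have "(\<Sum>w\<in>{1..M}. ennreal (1 / M) * (\<integral>\<^sup>+ s. \<integral>\<^sup>+ z. ennreal \<bar>W.eve_density w (\<lambda>i\<in>{..<n}. z i + s i) s - gauss_density (p + N2) n z\<bar> \<partial>lborel_block n \<partial>\<G> Q n))
    \<le> (\<Sum>w\<in>{1..M}. ennreal (1 / M) * (2 * (\<integral>\<^sup>+ s. \<integral>\<^sup>+ z. ennreal (evedev w z s) \<partial>\<G> (p + N2) n \<partial>\<G> Q n)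
       + 2 * (\<integral>\<^sup>+ s. (\<Sum>j\<in>{1..J}. ennreal (state_ratio (C (w, j)) s / J) * over w j s) \<partial>\<G> Q n)))"
  proof (intro sum_mono mult_left_mono)
    fix w assume w: "w \<in> {1..M}"
    have l: "(\<lambda>s. \<integral>\<^sup>+ z. ennreal (evedev w z s) \<partial>\<G> (p + N2) n) \<in> borel_measurable (\<G> Q n)"
      using leakage_inner_meas[OF w] by (simp cong: measurable_cong_sets)
    have a: "(\<lambda>s. \<Sum>j\<in>{1..J}. ennreal (state_ratio (C (w, j)) s / J) * over w j s) \<in> borel_measurable (\<G> Q n)"
      using w by (intro borel_measurable_sum) measurable
    have "(\<integral>\<^sup>+ s. \<integral>\<^sup>+ z. ennreal \<bar>W.eve_density w (\<lambda>i\<in>{..<n}. z i + s i) s - gauss_density (p + N2) n z\<bar> \<partial>lborel_block n \<partial>\<G> Q n)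
      \<le> (\<integral>\<^sup>+ s. 2 * (\<integral>\<^sup>+ z. ennreal (evedev w z s) \<partial>\<G> (p + N2) n) + 2 * (\<Sum>j\<in>{1..J}. ennreal (state_ratio (C (w, j)) s / J) * over w j s) \<partial>\<G> Q n)"
    proof (rule nn_integral_mono)
      fix s assume "s \<in> space (\<G> Q n)"
      then have s: "s \<in> space (blk n)" by simp
      let ?E = "\<integral>\<^sup>+ z. ennreal (evedev w z s) \<partial>\<G> (p + N2) n"
      let ?O = "\<Sum>j\<in>{1..J}. ennreal (state_ratio (C (w, j)) s / J) * over w j s"
      note eve_density_code_dev[OF w s]
      also have "ennreal (dev w s) + (2 * ?O + ?E) \<le> ?E + (2 * ?O + ?E)" by (intro add_right_mono dev_le_evedev w s)
      also have "\<dots> = 2 * ?E + 2 * ?O" by (simp only: mult_2 add_ac)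
      finally show "(\<integral>\<^sup>+ z. ennreal \<bar>W.eve_density w (\<lambda>i\<in>{..<n}. z i + s i) s - gauss_density (p + N2) n z\<bar> \<partial>lborel_block n) \<le> 2 * ?E + 2 * ?O" .
    qed
    also have "\<dots> = 2 * (\<integral>\<^sup>+ s. \<integral>\<^sup>+ z. ennreal (evedev w z s) \<partial>\<G> (p + N2) n \<partial>\<G> Q n)
       + 2 * (\<integral>\<^sup>+ s. (\<Sum>j\<in>{1..J}. ennreal (state_ratio (C (w, j)) s / J) * over w j s) \<partial>\<G> Q n)"
      using l a by (subst nn_integral_add) (simp_all add: nn_integral_cmult)
    finally show "(\<integral>\<^sup>+ s. \<integral>\<^sup>+ z. ennreal \<bar>W.eve_density w (\<lambda>i\<in>{..<n}. z i + s i) s - gauss_density (p + N2) n z\<bar> \<partial>lborel_block n \<partial>\<G> Q n) \<le> \<dots>" .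
  qed simp
  also have "\<dots> = 2 * leakage + 2 * overload"
    unfolding leakage_def overload_def by (simp only: sum.distrib distrib_left sum_distrib_left mult.left_commute)
  finally show ?thesis .
qed

text \<open>One number \<open>D\<close> controls reliability and secrecy. The equivocation loses
  \<open>D\<close> times a quantity of the order of \<open>ln M\<close>, so at a fixed rate a small
  constant \<open>D\<close> is enough after division by \<open>n\<close>.\<close>

lemma code_properties:
  fixes b D :: real
  assumes b: "1 < b" and D: "0 \<le> D" "leakage + (overload + confusion) \<le> ennreal D"
  shows "error_prob Q N1 N2 code \<le> D" "log b M - 4 * (ln M + 1) * D / ln b \<le> n * equivocation b Q N1 N2 code"
proof -
  show "error_prob Q N1 N2 code \<le> D"
    using order_trans[OF error_code_le D(2)] D(1) by simp
  have "2 * leakage + 2 * overload = 2 * (leakage + overload)" by (simp add: distrib_left)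
  also have "\<dots> \<le> 2 * (leakage + (overload + confusion))" by (intro mult_left_mono add_left_mono) auto
  also have "\<dots> \<le> 2 * ennreal D" by (intro mult_left_mono D) auto
  also have "\<dots> = ennreal (2 * D)" by (simp add: ennreal_mult')
  finally have "2 * leakage + 2 * overload \<le> ennreal (2 * D)" .
  \<comment> \<open>One factor 2 comes from \<open>eve_code_le\<close>, the other from
    \<open>equivocation_lower\<close>.\<close>
  have eq: "4 * (ln M + 1) * D = 2 * (ln M + 1) * (2 * D)" by simp
  from order_trans[OF eve_code_le \<open>2 * leakage + 2 * overload \<le> ennreal (2 * D)\<close>] W.equivocation_lower[OF b pN2, of "2 * D"] D(1)
  have "log b M - 2 * (ln M + 1) * (2 * D) / ln b \<le> n * equivocation b Q N1 N2 code" by simp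
  then show "log b M - 4 * (ln M + 1) * D / ln b \<le> n * equivocation b Q N1 N2 code" by (simp only: eq)
qed

end

subsection \<open>Random codebooks\<close>

lemma soft_covering_measurable:
  fixes L :: "'a \<times> 'b \<Rightarrow> real"
  assumes N: "prob_space N" and L[measurable]: "L \<in> borel_measurable (M \<Otimes>\<^sub>M N)" and J: "J \<subseteq> I"
  shows "(\<lambda>x. \<integral>\<^sup>+ v. ennreal \<bar>(\<Sum>j\<in>J. L (x j, v)) / card J - 1\<bar> \<partial>N) \<in> borel_measurable (PiM I (\<lambda>_. M))"
proof -
  interpret N: prob_space N by fact
  have m: "(\<lambda>q. L (fst q j, snd q)) \<in> borel_measurable (PiM I (\<lambda>_. M) \<Otimes>\<^sub>M N)" if "j \<in> J" for j
  proof -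
    have "j \<in> I" using that J by auto
    then show ?thesis by measurable
  qed
  have "(\<lambda>q. ennreal \<bar>(\<Sum>j\<in>J. L (fst q j, snd q)) / card J - 1\<bar>) \<in> borel_measurable (PiM I (\<lambda>_. M) \<Otimes>\<^sub>M N)"
    using m by simp
  from N.borel_measurable_nn_integral_fst[OF this] show ?thesis by simp
qed

context dirty_paper begin

definition "channel_out u s e = (\<lambda>i\<in>{..<n}. u i - \<alpha> * s i + s i + e i)" for u s e :: "nat \<Rightarrow> real"
text \<open>Functionals of one codeword, or of an ordered pair in the case of
  \<open>hit_mass\<close>. The defects of a codebook are averages of these, so their expectation
  over random codebooks involves one or two coordinates at a time.\<close>

definition "over_mass u = (\<integral>\<^sup>+ s. ennreal (state_ratio u s) * (if (\<Sum>i<n. (u i - \<alpha> * s i)\<^sup>2) \<le> n * P then 0 else 1) \<partial>\<G> Q n)"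
definition "miss_mass \<gamma> u = (\<integral>\<^sup>+ s. ennreal (state_ratio u s) * (\<integral>\<^sup>+ e. (if output_ratio u (channel_out u s e) \<le> \<gamma> then 1 else 0) \<partial>\<G> N1 n) \<partial>\<G> Q n)"
definition "hit_mass \<gamma> u u' = (\<integral>\<^sup>+ s. ennreal (state_ratio u s) * (\<integral>\<^sup>+ e. (if \<gamma> < output_ratio u' (channel_out u s e) then 1 else 0) \<partial>\<G> N1 n) \<partial>\<G> Q n)"

lemma channel_out_meas[measurable (raw)]:
  assumes [measurable]: "f \<in> M \<rightarrow>\<^sub>M blk n" "g \<in> M \<rightarrow>\<^sub>M blk n" "h \<in> M \<rightarrow>\<^sub>M blk n"
  shows "(\<lambda>x. channel_out (f x) (g x) (h x)) \<in> M \<rightarrow>\<^sub>M blk n"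
  unfolding channel_out_def by measurable

lemma over_mass_meas[measurable]: "over_mass \<in> borel_measurable (blk n)"
proof -
  have "(\<lambda>q. ennreal (state_ratio (fst q) (snd q)) * (if (\<Sum>i<n. (fst q i - \<alpha> * snd q i)\<^sup>2) \<le> n * P then 0 else 1)) \<in> borel_measurable (blk n \<Otimes>\<^sub>M \<G> Q n)"
    by measurable
  from GQ.borel_measurable_nn_integral_fst[OF this] show ?thesis unfolding over_mass_def[abs_def] by simp
qed

lemma miss_mass_meas[measurable]: "miss_mass \<gamma> \<in> borel_measurable (blk n)"
proof -
  have "(\<lambda>q. if output_ratio (fst (fst q)) (channel_out (fst (fst q)) (snd (fst q)) (snd q)) \<le> \<gamma> then 1 else 0 :: ennreal) \<in> borel_measurable ((blk n \<Otimes>\<^sub>M blk n) \<Otimes>\<^sub>M \<G> N1 n)"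
    by measurable
  from G1.borel_measurable_nn_integral_fst[OF this]
  have [measurable]: "(\<lambda>q. \<integral>\<^sup>+ e. (if output_ratio (fst q) (channel_out (fst q) (snd q) e) \<le> \<gamma> then 1 else 0) \<partial>\<G> N1 n) \<in> borel_measurable (blk n \<Otimes>\<^sub>M blk n)" by simp
  have "(\<lambda>q. ennreal (state_ratio (fst q) (snd q)) * (\<integral>\<^sup>+ e. (if output_ratio (fst q) (channel_out (fst q) (snd q) e) \<le> \<gamma> then 1 else 0) \<partial>\<G> N1 n)) \<in> borel_measurable (blk n \<Otimes>\<^sub>M \<G> Q n)"
    by measurable
  from GQ.borel_measurable_nn_integral_fst[OF this] show ?thesis unfolding miss_mass_def[abs_def] by simp
qed

lemma hit_inner_meas:
  "(\<lambda>q. \<integral>\<^sup>+ e. (if \<gamma> < output_ratio (snd (fst q)) (channel_out (fst (fst q)) (snd q) e) then 1 else 0) \<partial>\<G> N1 n) \<in> borel_measurable ((blk n \<Otimes>\<^sub>M blk n) \<Otimes>\<^sub>M blk n)"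
proof -
  have "(\<lambda>q. if \<gamma> < output_ratio (snd (fst (fst q))) (channel_out (fst (fst (fst q))) (snd (fst q)) (snd q)) then 1 else 0 :: ennreal) \<in> borel_measurable (((blk n \<Otimes>\<^sub>M blk n) \<Otimes>\<^sub>M blk n) \<Otimes>\<^sub>M \<G> N1 n)"
    by measurable
  from G1.borel_measurable_nn_integral_fst[OF this] show ?thesis by simp
qed

lemma hit_mass_meas[measurable]: "(\<lambda>q. hit_mass \<gamma> (fst q) (snd q)) \<in> borel_measurable (blk n \<Otimes>\<^sub>M blk n)"
proof -
  note [measurable] = hit_inner_meas[of \<gamma>]
  have "(\<lambda>q. ennreal (state_ratio (fst (fst q)) (snd q)) * (\<integral>\<^sup>+ e. (if \<gamma> < output_ratio (snd (fst q)) (channel_out (fst (fst q)) (snd q) e) then 1 else 0) \<partial>\<G> N1 n)) \<in> borel_measurable ((blk n \<Otimes>\<^sub>M blk n) \<Otimes>\<^sub>M \<G> Q n)"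
    by measurable
  from GQ.borel_measurable_nn_integral_fst[OF this] show ?thesis unfolding hit_mass_def by simp
qed

lemma nn_integral_over_mass: "(\<integral>\<^sup>+ u. over_mass u \<partial>\<G> U n) \<le> ennreal (norm_tail p (P - p) n)"
proof -
  have "(\<integral>\<^sup>+ u. over_mass u \<partial>\<G> U n) = (\<integral>\<^sup>+ s. \<integral>\<^sup>+ x. (if (\<Sum>i<n. ((\<lambda>i\<in>{..<n}. x i + \<alpha> * s i) i - \<alpha> * s i)\<^sup>2) \<le> n * P then 0 else 1) \<partial>\<G> p n \<partial>\<G> Q n)"
    unfolding over_mass_def
    using state_ratio_change2[of "\<lambda>q. if (\<Sum>i<n. (fst q i - \<alpha> * snd q i)\<^sup>2) \<le> n * P then 0 else 1"] by simp
  also have "\<dots> \<le> (\<integral>\<^sup>+ s. \<integral>\<^sup>+ x. atypical ((P - p) / p) p x \<partial>\<G> p n \<partial>\<G> Q n)"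
  proof (intro nn_integral_mono)
    fix s x :: "nat \<Rightarrow> real"
    have e1: "(\<Sum>i<n. ((\<lambda>i\<in>{..<n}. x i + \<alpha> * s i) i - \<alpha> * s i)\<^sup>2) = (\<Sum>i<n. (x i)\<^sup>2)" by (intro sum.cong) auto
    \<comment> \<open>The relative deviation \<open>(P - p) / p\<close> is chosen so that a sum of
      squares beyond \<open>n * P\<close> is atypical.\<close>
    have e2: "p * ((P - p) / p) = P - p" using p by simp
    show "(if (\<Sum>i<n. ((\<lambda>i\<in>{..<n}. x i + \<alpha> * s i) i - \<alpha> * s i)\<^sup>2) \<le> n * P then 0 else 1) \<le> atypical ((P - p) / p) p x"
      unfolding atypical_def e1 e2 right_diff_distrib by auto
  qed
  also have "\<dots> = ennreal (norm_tail p (P - p) n)"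
    using p GQ.emeasure_space_1 by (simp add: nn_integral_atypical)
  finally show ?thesis .
qed

lemma nn_integral_atypical_U: "(\<integral>\<^sup>+ s. \<integral>\<^sup>+ x. atypical \<eta> U (\<lambda>i\<in>{..<n}. x i + \<alpha> * s i) \<partial>\<G> p n \<partial>\<G> Q n) = ennreal (norm_tail U (U * \<eta>) n)"
proof -
  have "(\<integral>\<^sup>+ s. \<integral>\<^sup>+ x. atypical \<eta> U (\<lambda>i\<in>{..<n}. \<alpha> * s i + 1 * x i) \<partial>\<G> p n \<partial>\<G> Q n) = (\<integral>\<^sup>+ u. atypical \<eta> U u \<partial>\<G> (\<alpha>\<^sup>2 * Q + 1\<^sup>2 * p) n)"
    using \<alpha> by (intro nn_integral_gaussian_block_linear Q p) auto
  also have "\<alpha>\<^sup>2 * Q + 1\<^sup>2 * p = U" by (simp add: U_def)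
  also have "(\<integral>\<^sup>+ u. atypical \<eta> U u \<partial>\<G> U n) = ennreal (norm_tail U (U * \<eta>) n)" by (rule nn_integral_atypical[OF U])
  finally show ?thesis by (simp only: mult_1_left add.commute)
qed

text \<open>After the change of measure input, state and noise are independent, and the codeword
  minus \<open>\<alpha>\<close> times the output is
  \<open>(1 - \<alpha>) * x - \<alpha> * e\<close>, of variance \<open>\<tau>\<close>. A miss
  therefore needs one of two Gaussian blocks to be atypical.\<close>

lemma nn_integral_miss_mass:
  assumes \<eta>: "0 < \<eta>" and n: "0 < n"
  shows "(\<integral>\<^sup>+ u. miss_mass (exp (n * (output_info - 2 * \<eta>))) u \<partial>\<G> U n) \<le> ennreal (norm_tail U (U * \<eta>) n) + ennreal (norm_tail \<tau> (\<tau> * \<eta>) n)"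
proof -
  let ?\<gamma> = "exp (n * (output_info - 2 * \<eta>))"
  have "(\<lambda>q. if output_ratio (fst (fst q)) (channel_out (fst (fst q)) (snd (fst q)) (snd q)) \<le> ?\<gamma> then 1 else 0 :: ennreal) \<in> borel_measurable ((blk n \<Otimes>\<^sub>M blk n) \<Otimes>\<^sub>M \<G> N1 n)"
    by measurable
  from G1.borel_measurable_nn_integral_fst[OF this]
  have m: "(\<lambda>q. \<integral>\<^sup>+ e. (if output_ratio (fst q) (channel_out (fst q) (snd q) e) \<le> ?\<gamma> then 1 else 0) \<partial>\<G> N1 n) \<in> borel_measurable (blk n \<Otimes>\<^sub>M blk n)" by simp
  have "(\<integral>\<^sup>+ u. miss_mass ?\<gamma> u \<partial>\<G> U n) = (\<integral>\<^sup>+ s. \<integral>\<^sup>+ x. \<integral>\<^sup>+ e. (if output_ratio (\<lambda>i\<in>{..<n}. x i + \<alpha> * s i) (channel_out (\<lambda>i\<in>{..<n}. x i + \<alpha> * s i) s e) \<le> ?\<gamma> then 1 else 0) \<partial>\<G> N1 n \<partial>\<G> p n \<partial>\<G> Q n)"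
    unfolding miss_mass_def using state_ratio_change2[OF m] by (simp only: fst_conv snd_conv)
  also have "\<dots> \<le> (\<integral>\<^sup>+ s. \<integral>\<^sup>+ x. \<integral>\<^sup>+ e. atypical \<eta> U (\<lambda>i\<in>{..<n}. x i + \<alpha> * s i) + atypical \<eta> \<tau> (\<lambda>i\<in>{..<n}. (1 - \<alpha>) * x i + (- \<alpha>) * e i) \<partial>\<G> N1 n \<partial>\<G> p n \<partial>\<G> Q n)"
  proof (intro nn_integral_mono)
    fix s x e :: "nat \<Rightarrow> real"
    let ?y = "\<lambda>i\<in>{..<n}. x i + s i + e i"
    have y: "channel_out (\<lambda>i\<in>{..<n}. x i + \<alpha> * s i) s e = ?y" by (auto simp: channel_out_def fun_eq_iff)
    show "(if output_ratio (\<lambda>i\<in>{..<n}. x i + \<alpha> * s i) (channel_out (\<lambda>i\<in>{..<n}. x i + \<alpha> * s i) s e) \<le> ?\<gamma> then 1 else 0) \<le> atypical \<eta> U (\<lambda>i\<in>{..<n}. x i + \<alpha> * s i) + atypical \<eta> \<tau> (\<lambda>i\<in>{..<n}. (1 - \<alpha>) * x i + (- \<alpha>) * e i)"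
    proof (cases "output_ratio (\<lambda>i\<in>{..<n}. x i + \<alpha> * s i) (channel_out (\<lambda>i\<in>{..<n}. x i + \<alpha> * s i) s e) \<le> ?\<gamma>")
      case True
      then show ?thesis using output_ratio_typical[OF True \<eta> n y] by (simp only: if_True)
    next
      case False
      then show ?thesis by (simp only: if_False zero_le)
    qed
  qed
  also have "\<dots> = (\<integral>\<^sup>+ s. \<integral>\<^sup>+ x. atypical \<eta> U (\<lambda>i\<in>{..<n}. x i + \<alpha> * s i) \<partial>\<G> p n \<partial>\<G> Q n)
     + (\<integral>\<^sup>+ s. \<integral>\<^sup>+ x. \<integral>\<^sup>+ e. atypical \<eta> \<tau> (\<lambda>i\<in>{..<n}. (1 - \<alpha>) * x i + (- \<alpha>) * e i) \<partial>\<G> N1 n \<partial>\<G> p n \<partial>\<G> Q n)"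
  proof -
    have "(\<lambda>q. atypical \<eta> \<tau> (\<lambda>i\<in>{..<n}. (1 - \<alpha>) * fst q i + (- \<alpha>) * snd q i)) \<in> borel_measurable (blk n \<Otimes>\<^sub>M \<G> N1 n)" by measurable
    from G1.borel_measurable_nn_integral_fst[OF this]
    have [measurable]: "(\<lambda>x. \<integral>\<^sup>+ e. atypical \<eta> \<tau> (\<lambda>i\<in>{..<n}. (1 - \<alpha>) * x i + (- \<alpha>) * e i) \<partial>\<G> N1 n) \<in> borel_measurable (blk n)" by simp
    have "(\<lambda>q. atypical \<eta> U (\<lambda>i\<in>{..<n}. snd q i + \<alpha> * fst q i)) \<in> borel_measurable (blk n \<Otimes>\<^sub>M \<G> p n)" by measurable
    from Gp.borel_measurable_nn_integral_fst[OF this]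
    have [measurable]: "(\<lambda>s. \<integral>\<^sup>+ x. atypical \<eta> U (\<lambda>i\<in>{..<n}. x i + \<alpha> * s i) \<partial>\<G> p n) \<in> borel_measurable (blk n)" by simp
    have e: "(\<integral>\<^sup>+ e. atypical \<eta> U (\<lambda>i\<in>{..<n}. x i + \<alpha> * s i) + atypical \<eta> \<tau> (\<lambda>i\<in>{..<n}. (1 - \<alpha>) * x i + (- \<alpha>) * e i) \<partial>\<G> N1 n)
      = atypical \<eta> U (\<lambda>i\<in>{..<n}. x i + \<alpha> * s i) + (\<integral>\<^sup>+ e. atypical \<eta> \<tau> (\<lambda>i\<in>{..<n}. (1 - \<alpha>) * x i + (- \<alpha>) * e i) \<partial>\<G> N1 n)" for s x :: "nat \<Rightarrow> real"
    proof -
      have "(\<lambda>e. atypical \<eta> \<tau> (\<lambda>i\<in>{..<n}. (1 - \<alpha>) * x i + (- \<alpha>) * e i)) \<in> borel_measurable (\<G> N1 n)" by measurable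
      from nn_integral_add[OF borel_measurable_const this] show ?thesis using G1.emeasure_space_1 by simp
    qed
    show ?thesis unfolding e
      by (subst nn_integral_add[symmetric], measurable) (intro nn_integral_cong nn_integral_add, measurable)
  qed
  also have "(\<integral>\<^sup>+ s. \<integral>\<^sup>+ x. atypical \<eta> U (\<lambda>i\<in>{..<n}. x i + \<alpha> * s i) \<partial>\<G> p n \<partial>\<G> Q n) = ennreal (norm_tail U (U * \<eta>) n)"
    by (rule nn_integral_atypical_U)
  also have "(\<integral>\<^sup>+ x. \<integral>\<^sup>+ e. atypical \<eta> \<tau> (\<lambda>i\<in>{..<n}. (1 - \<alpha>) * x i + (- \<alpha>) * e i) \<partial>\<G> N1 n \<partial>\<G> p n) = ennreal (norm_tail \<tau> (\<tau> * \<eta>) n)"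
  proof -
    \<comment> \<open>This coefficient is \<open>N1 / (p + N1)\<close>; the first coefficient of a
      linear combination of blocks has to be nonzero.\<close>
    have "1 - \<alpha> \<noteq> 0" using p N1 by (simp add: \<alpha>_def)
    then have "(\<integral>\<^sup>+ x. \<integral>\<^sup>+ e. atypical \<eta> \<tau> (\<lambda>i\<in>{..<n}. (1 - \<alpha>) * x i + (- \<alpha>) * e i) \<partial>\<G> N1 n \<partial>\<G> p n) = (\<integral>\<^sup>+ u. atypical \<eta> \<tau> u \<partial>\<G> ((1 - \<alpha>)\<^sup>2 * p + (- \<alpha>)\<^sup>2 * N1) n)"
      by (intro nn_integral_gaussian_block_linear p N1) measurable
    then show ?thesis using \<tau>_eq \<tau> by (simp add: nn_integral_atypical)
  qed
  finally show ?thesis using GQ.emeasure_space_1 by simp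
qed

text \<open>The competing codeword is independent of the output, so for every fixed output Markov's
  inequality for a variable of mean 1 gives \<open>1 / \<gamma>\<close>, uniformly in the
  output.\<close>

lemma nn_integral_hit_mass:
  assumes \<gamma>: "0 < \<gamma>"
  shows "(\<integral>\<^sup>+ u. \<integral>\<^sup>+ u'. hit_mass \<gamma> u u' \<partial>\<G> U n \<partial>\<G> U n) \<le> ennreal (1 / \<gamma>)"
proof -
  interpret UQ: pair_sigma_finite "\<G> U n" "\<G> Q n" ..
  interpret U1: pair_sigma_finite "\<G> U n" "\<G> N1 n" ..
  have "(\<integral>\<^sup>+ u. \<integral>\<^sup>+ u'. hit_mass \<gamma> u u' \<partial>\<G> U n \<partial>\<G> U n)
    \<le> (\<integral>\<^sup>+ u. \<integral>\<^sup>+ s. ennreal (state_ratio u s) * ennreal (1 / \<gamma>) \<partial>\<G> Q n \<partial>\<G> U n)"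
  proof (rule nn_integral_mono)
    fix u assume "u \<in> space (\<G> U n)"
    then have u: "u \<in> space (blk n)" by simp
    define H where "H q = (\<integral>\<^sup>+ e. (if \<gamma> < output_ratio (fst q) (channel_out u (snd q) e) then 1 else 0) \<partial>\<G> N1 n)" for q
    have "(\<lambda>q. ((u, fst q), snd q)) \<in> blk n \<Otimes>\<^sub>M blk n \<rightarrow>\<^sub>M (blk n \<Otimes>\<^sub>M blk n) \<Otimes>\<^sub>M blk n"
      using u by measurable
    from measurable_compose[OF this hit_inner_meas[of \<gamma>]]
    have Hm[measurable]: "H \<in> borel_measurable (blk n \<Otimes>\<^sub>M blk n)" unfolding H_def[abs_def] by simp
    have [measurable]: "(\<lambda>s. state_ratio u s) \<in> borel_measurable (blk n)" using u by (intro ratio_meas) auto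
    have "(\<integral>\<^sup>+ u'. hit_mass \<gamma> u u' \<partial>\<G> U n) = (\<integral>\<^sup>+ u'. \<integral>\<^sup>+ s. ennreal (state_ratio u s) * H (u', s) \<partial>\<G> Q n \<partial>\<G> U n)"
      unfolding hit_mass_def H_def by simp
    also have "\<dots> = (\<integral>\<^sup>+ s. \<integral>\<^sup>+ u'. ennreal (state_ratio u s) * H (u', s) \<partial>\<G> U n \<partial>\<G> Q n)"
      by (rule UQ.Fubini'[symmetric]) (simp add: split_beta')
    also have "\<dots> \<le> (\<integral>\<^sup>+ s. ennreal (state_ratio u s) * ennreal (1 / \<gamma>) \<partial>\<G> Q n)"
    proof (rule nn_integral_mono)
      fix s assume "s \<in> space (\<G> Q n)"
      then have s: "s \<in> space (blk n)" by simp
      have Hs: "(\<lambda>u'. H (u', s)) \<in> borel_measurable (\<G> U n)" using s by measurable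
      have cm: "(\<lambda>e. channel_out u s e) \<in> blk n \<rightarrow>\<^sub>M blk n" using u s by (intro channel_out_meas) auto
      have "(\<lambda>q. if \<gamma> < output_ratio (fst q) (channel_out u s (snd q)) then 1 else 0 :: ennreal) \<in> borel_measurable (\<G> U n \<Otimes>\<^sub>M \<G> N1 n)"
        using measurable_compose[OF measurable_snd cm] by measurable
      then have fm: "(\<lambda>(u', e). if \<gamma> < output_ratio u' (channel_out u s e) then 1 else 0 :: ennreal) \<in> borel_measurable (\<G> U n \<Otimes>\<^sub>M \<G> N1 n)"
        by (simp add: split_beta')
      have "(\<integral>\<^sup>+ u'. H (u', s) \<partial>\<G> U n) = (\<integral>\<^sup>+ e. \<integral>\<^sup>+ u'. (if \<gamma> < output_ratio u' (channel_out u s e) then 1 else 0) \<partial>\<G> U n \<partial>\<G> N1 n)"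
        unfolding H_def fst_conv snd_conv by (rule U1.Fubini'[OF fm, symmetric])
      also have "\<dots> \<le> (\<integral>\<^sup>+ e. ennreal (1 / \<gamma>) \<partial>\<G> N1 n)"
      proof (rule nn_integral_mono)
        fix e assume "e \<in> space (\<G> N1 n)"
        have om: "(\<lambda>u'. output_ratio u' (channel_out u s e)) \<in> borel_measurable (\<G> U n)"
          unfolding output_ratio_def by measurable
        have "(\<integral>\<^sup>+ u'. (if \<gamma> < output_ratio u' (channel_out u s e) then 1 else 0) \<partial>\<G> U n) \<le> (\<integral>\<^sup>+ u'. ennreal (1 / \<gamma>) * ennreal (output_ratio u' (channel_out u s e)) \<partial>\<G> U n)"
        proof (rule nn_integral_mono)
          fix u'
          have "ennreal 1 \<le> ennreal (1 / \<gamma> * output_ratio u' (channel_out u s e))" if "\<gamma> < output_ratio u' (channel_out u s e)"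
            using that \<gamma> by (intro ennreal_leI) (simp add: field_simps)
          then show "(if \<gamma> < output_ratio u' (channel_out u s e) then 1 else 0) \<le> ennreal (1 / \<gamma>) * ennreal (output_ratio u' (channel_out u s e))"
            using \<gamma> by (simp add: ennreal_mult'[symmetric])
        qed
        also have "\<dots> = ennreal (1 / \<gamma>)"
          by (subst nn_integral_cmult) (use om in \<open>auto simp: output_ratio_normalized\<close>)
        finally show "(\<integral>\<^sup>+ u'. (if \<gamma> < output_ratio u' (channel_out u s e) then 1 else 0) \<partial>\<G> U n) \<le> ennreal (1 / \<gamma>)" .
      qed
      also have "\<dots> = ennreal (1 / \<gamma>)" using G1.emeasure_space_1 by simp
      finally show "(\<integral>\<^sup>+ u'. ennreal (state_ratio u s) * H (u', s) \<partial>\<G> U n) \<le> ennreal (state_ratio u s) * ennreal (1 / \<gamma>)"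
        using Hs by (subst nn_integral_cmult) (auto intro: mult_left_mono)
    qed
    finally show "(\<integral>\<^sup>+ u'. hit_mass \<gamma> u u' \<partial>\<G> U n) \<le> (\<integral>\<^sup>+ s. ennreal (state_ratio u s) * ennreal (1 / \<gamma>) \<partial>\<G> Q n)" .
  qed
  also have "\<dots> = ennreal (1 / \<gamma>)"
    using state_ratio_change2[of "\<lambda>_. ennreal (1 / \<gamma>)"] Gp.emeasure_space_1 GQ.emeasure_space_1 by simp
  finally show ?thesis .
qed

definition "eve_tail \<eta> = ennreal (norm_tail p (p * \<eta>) n) + ennreal (norm_tail N2 (N2 * \<eta>) n) + ennreal (norm_tail U (U * \<eta>) n) + ennreal (norm_tail (p + N2) ((p + N2) * \<eta>) n)"

text \<open>Being weighted by the ratio itself, the exceptional part of soft covering is a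
  probability under the true joint law, where the codeword is \<open>x + \<alpha> * s\<close> and
  the eavesdropper has \<open>x + e\<close> after removing the state. There a large ratio is
  atypical.\<close>

lemma nn_integral_eve_ratio_tail:
  "(\<integral>\<^sup>+ v. \<integral>\<^sup>+ u. ennreal (if exp (n * (eve_info + 2 * \<eta>)) < eve_ratio u (snd v) (fst v) then eve_ratio u (snd v) (fst v) else 0) \<partial>\<G> U n
      \<partial>(\<G> Q n \<Otimes>\<^sub>M \<G> (p + N2) n)) \<le> eve_tail \<eta>"
proof -
  let ?g = "exp (n * (eve_info + 2 * \<eta>))"
  interpret ZP: pair_sigma_finite "\<G> (p + N2) n" "\<G> p n" ..
  interpret QZ: pair_sigma_finite "\<G> Q n" "\<G> (p + N2) n" ..
  define I where "I u z s = (if ?g < eve_ratio u z s then 1 else 0 :: ennreal)" for u z s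
  have Im[measurable (raw)]: "(\<lambda>x. I (f x) (h x) (k x)) \<in> borel_measurable M" 
    if [measurable]: "f \<in> M \<rightarrow>\<^sub>M blk n" "h \<in> M \<rightarrow>\<^sub>M blk n" "k \<in> M \<rightarrow>\<^sub>M blk n" for f h k and M :: "'z measure"
    unfolding I_def by measurable
  have eI: "ennreal (if ?g < eve_ratio u z s then eve_ratio u z s else 0) = ennreal (eve_ratio u z s) * I u z s" for u z s
    by (simp add: I_def)
  have "(\<lambda>q. ennreal (eve_ratio (snd q) (snd (fst q)) (fst (fst q))) * I (snd q) (snd (fst q)) (fst (fst q))) \<in> borel_measurable ((\<G> Q n \<Otimes>\<^sub>M \<G> (p + N2) n) \<Otimes>\<^sub>M \<G> U n)"
    by (intro borel_measurable_times_ennreal measurable_compose[OF _ measurable_ennreal] Im eve_ratio_meas) measurable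
  from GU.borel_measurable_nn_integral_fst[OF this]
  have m0: "(\<lambda>v. \<integral>\<^sup>+ u. ennreal (eve_ratio u (snd v) (fst v)) * I u (snd v) (fst v) \<partial>\<G> U n) \<in> borel_measurable (\<G> Q n \<Otimes>\<^sub>M \<G> (p + N2) n)" by simp
  have "(\<integral>\<^sup>+ v. \<integral>\<^sup>+ u. ennreal (eve_ratio u (snd v) (fst v)) * I u (snd v) (fst v) \<partial>\<G> U n \<partial>(\<G> Q n \<Otimes>\<^sub>M \<G> (p + N2) n))
    = (\<integral>\<^sup>+ s. \<integral>\<^sup>+ z. \<integral>\<^sup>+ u. ennreal (eve_ratio u z s) * I u z s \<partial>\<G> U n \<partial>\<G> (p + N2) n \<partial>\<G> Q n)"
    using GZ.nn_integral_fst[OF m0] by simp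
  also have "\<dots> = (\<integral>\<^sup>+ s. \<integral>\<^sup>+ x. \<integral>\<^sup>+ e. I (\<lambda>i\<in>{..<n}. x i + \<alpha> * s i) (\<lambda>i\<in>{..<n}. e i + x i) s \<partial>\<G> N2 n \<partial>\<G> p n \<partial>\<G> Q n)"
  proof (rule nn_integral_cong)
    fix s assume "s \<in> space (\<G> Q n)"
    then have s: "s \<in> space (blk n)" by simp
    have sm[measurable]: "(\<lambda>_. s) \<in> N \<rightarrow>\<^sub>M blk n" for N :: "'y measure" using s by simp
    have "(\<integral>\<^sup>+ z. \<integral>\<^sup>+ u. ennreal (eve_ratio u z s) * I u z s \<partial>\<G> U n \<partial>\<G> (p + N2) n)
      = (\<integral>\<^sup>+ z. \<integral>\<^sup>+ x. ennreal (gauss_density N2 n (\<lambda>i. z i - x i) / gauss_density (p + N2) n z) * I (\<lambda>i\<in>{..<n}. x i + \<alpha> * s i) z s \<partial>\<G> p n \<partial>\<G> (p + N2) n)"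
    proof (rule nn_integral_cong)
      fix z assume "z \<in> space (\<G> (p + N2) n)"
      then have z: "z \<in> space (blk n)" by simp
      have "(\<lambda>u. I u z s) \<in> borel_measurable (blk n)" using z s by (intro Im) auto
      from eve_ratio_change[OF this z s]
      show "(\<integral>\<^sup>+ u. ennreal (eve_ratio u z s) * I u z s \<partial>\<G> U n) = (\<integral>\<^sup>+ x. ennreal (gauss_density N2 n (\<lambda>i. z i - x i) / gauss_density (p + N2) n z) * I (\<lambda>i\<in>{..<n}. x i + \<alpha> * s i) z s \<partial>\<G> p n)" .
    qed
    also have "\<dots> = (\<integral>\<^sup>+ x. \<integral>\<^sup>+ z. ennreal (gauss_density N2 n (\<lambda>i. z i - x i) / gauss_density (p + N2) n z) * I (\<lambda>i\<in>{..<n}. x i + \<alpha> * s i) z s \<partial>\<G> (p + N2) n \<partial>\<G> p n)"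
    proof (rule ZP.Fubini'[symmetric])
      show "(\<lambda>(z, x). ennreal (gauss_density N2 n (\<lambda>i. z i - x i) / gauss_density (p + N2) n z) * I (\<lambda>i\<in>{..<n}. x i + \<alpha> * s i) z s) \<in> borel_measurable (\<G> (p + N2) n \<Otimes>\<^sub>M \<G> p n)"
        unfolding split_beta' by (intro borel_measurable_times_ennreal measurable_compose[OF _ measurable_ennreal] Im) (measurable, use s in simp)
    qed
    also have "\<dots> = (\<integral>\<^sup>+ x. \<integral>\<^sup>+ e. I (\<lambda>i\<in>{..<n}. x i + \<alpha> * s i) (\<lambda>i\<in>{..<n}. e i + x i) s \<partial>\<G> N2 n \<partial>\<G> p n)"
    proof (rule nn_integral_cong)
      fix x assume x: "x \<in> space (\<G> p n)"
      have us: "(\<lambda>i\<in>{..<n}. x i + \<alpha> * s i) \<in> space (blk n)" by (simp add: space_PiM)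
      have i1: "(\<lambda>z. I (\<lambda>i\<in>{..<n}. x i + \<alpha> * s i) z s) \<in> borel_measurable (blk n)" using us s by (intro Im) auto
      have i2: "(\<lambda>z. ennreal (gauss_density N2 n (\<lambda>i. z i - x i) / gauss_density (p + N2) n z) * I (\<lambda>i\<in>{..<n}. x i + \<alpha> * s i) z s) \<in> borel_measurable (blk n)"
        by (intro borel_measurable_times_ennreal measurable_compose[OF _ measurable_ennreal] i1) measurable
      have "(\<integral>\<^sup>+ z. ennreal (gauss_density N2 n (\<lambda>i. z i - x i) / gauss_density (p + N2) n z) * I (\<lambda>i\<in>{..<n}. x i + \<alpha> * s i) z s \<partial>\<G> (p + N2) n)
        = (\<integral>\<^sup>+ z. ennreal (gauss_density (p + N2) n z) * (ennreal (gauss_density N2 n (\<lambda>i. z i - x i) / gauss_density (p + N2) n z) * I (\<lambda>i\<in>{..<n}. x i + \<alpha> * s i) z s) \<partial>lborel_block n)"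
        by (rule nn_integral_gaussian_block[OF pN2 i2])
      also have "\<dots> = (\<integral>\<^sup>+ z. ennreal (gauss_density N2 n (\<lambda>i. z i - x i)) * I (\<lambda>i\<in>{..<n}. x i + \<alpha> * s i) z s \<partial>lborel_block n)"
      proof (rule nn_integral_cong)
        fix z
        have "ennreal (gauss_density (p + N2) n z) * ennreal (gauss_density N2 n (\<lambda>i. z i - x i) / gauss_density (p + N2) n z) = ennreal (gauss_density N2 n (\<lambda>i. z i - x i))"
          using gauss_density_pos[OF pN2, of n z] by (simp add: ennreal_mult'[symmetric])
        then show "ennreal (gauss_density (p + N2) n z) * (ennreal (gauss_density N2 n (\<lambda>i. z i - x i) / gauss_density (p + N2) n z) * I (\<lambda>i\<in>{..<n}. x i + \<alpha> * s i) z s) = ennreal (gauss_density N2 n (\<lambda>i. z i - x i)) * I (\<lambda>i\<in>{..<n}. x i + \<alpha> * s i) z s"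
          by (simp only: mult.assoc[symmetric])
      qed
      also have "\<dots> = (\<integral>\<^sup>+ e. I (\<lambda>i\<in>{..<n}. x i + \<alpha> * s i) (\<lambda>i\<in>{..<n}. e i + x i) s \<partial>\<G> N2 n)"
        by (rule nn_integral_gauss_density_shift[OF N2 i1])
      finally show "(\<integral>\<^sup>+ z. ennreal (gauss_density N2 n (\<lambda>i. z i - x i) / gauss_density (p + N2) n z) * I (\<lambda>i\<in>{..<n}. x i + \<alpha> * s i) z s \<partial>\<G> (p + N2) n) = (\<integral>\<^sup>+ e. I (\<lambda>i\<in>{..<n}. x i + \<alpha> * s i) (\<lambda>i\<in>{..<n}. e i + x i) s \<partial>\<G> N2 n)" .
    qed
    finally show "(\<integral>\<^sup>+ z. \<integral>\<^sup>+ u. ennreal (eve_ratio u z s) * I u z s \<partial>\<G> U n \<partial>\<G> (p + N2) n) = (\<integral>\<^sup>+ x. \<integral>\<^sup>+ e. I (\<lambda>i\<in>{..<n}. x i + \<alpha> * s i) (\<lambda>i\<in>{..<n}. e i + x i) s \<partial>\<G> N2 n \<partial>\<G> p n)" .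
  qed
  also have "\<dots> \<le> (\<integral>\<^sup>+ s. \<integral>\<^sup>+ x. \<integral>\<^sup>+ e. atypical \<eta> p x + atypical \<eta> N2 e + atypical \<eta> U (\<lambda>i\<in>{..<n}. x i + \<alpha> * s i) + atypical \<eta> (p + N2) (\<lambda>i\<in>{..<n}. x i + e i) \<partial>\<G> N2 n \<partial>\<G> p n \<partial>\<G> Q n)"
  proof (intro nn_integral_mono)
    fix s x e :: "nat \<Rightarrow> real"
    have c: "(\<lambda>i\<in>{..<n}. e i + x i) = (\<lambda>i\<in>{..<n}. x i + e i)" by (simp add: add.commute)
    show "I (\<lambda>i\<in>{..<n}. x i + \<alpha> * s i) (\<lambda>i\<in>{..<n}. e i + x i) s \<le> atypical \<eta> p x + atypical \<eta> N2 e + atypical \<eta> U (\<lambda>i\<in>{..<n}. x i + \<alpha> * s i) + atypical \<eta> (p + N2) (\<lambda>i\<in>{..<n}. x i + e i)"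
    proof (cases "?g < eve_ratio (\<lambda>i\<in>{..<n}. x i + \<alpha> * s i) (\<lambda>i\<in>{..<n}. x i + e i) s")
      case True
      then show ?thesis using eve_ratio_typical[OF True] unfolding I_def c by (simp only: if_True)
    next
      case False
      then show ?thesis unfolding I_def c by (simp only: if_False zero_le)
    qed
  qed
  also have "\<dots> = eve_tail \<eta>"
  proof -
    have "(\<lambda>q. atypical \<eta> (p + N2) (\<lambda>i\<in>{..<n}. fst q i + snd q i)) \<in> borel_measurable (blk n \<Otimes>\<^sub>M \<G> N2 n)" by measurable
    from G2.borel_measurable_nn_integral_fst[OF this]
    have zm[measurable]: "(\<lambda>x. \<integral>\<^sup>+ e. atypical \<eta> (p + N2) (\<lambda>i\<in>{..<n}. x i + e i) \<partial>\<G> N2 n) \<in> borel_measurable (blk n)" by simp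
    have "(\<lambda>q. atypical \<eta> U (\<lambda>i\<in>{..<n}. snd q i + \<alpha> * fst q i)) \<in> borel_measurable (blk n \<Otimes>\<^sub>M \<G> p n)" by measurable
    from Gp.borel_measurable_nn_integral_fst[OF this]
    have um[measurable]: "(\<lambda>s. \<integral>\<^sup>+ x. atypical \<eta> U (\<lambda>i\<in>{..<n}. x i + \<alpha> * s i) \<partial>\<G> p n) \<in> borel_measurable (blk n)" by simp
    have ez: "(\<integral>\<^sup>+ x. \<integral>\<^sup>+ e. atypical \<eta> (p + N2) (\<lambda>i\<in>{..<n}. x i + e i) \<partial>\<G> N2 n \<partial>\<G> p n) = ennreal (norm_tail (p + N2) ((p + N2) * \<eta>) n)"
      using nn_integral_gaussian_block_linear[OF p N2 one_neq_zero, of "atypical \<eta> (p + N2)" n 1] by (simp add: nn_integral_atypical pN2)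
    have e1: "(\<integral>\<^sup>+ e. atypical \<eta> p x + atypical \<eta> N2 e + atypical \<eta> U (\<lambda>i\<in>{..<n}. x i + \<alpha> * s i) + atypical \<eta> (p + N2) (\<lambda>i\<in>{..<n}. x i + e i) \<partial>\<G> N2 n)
      = (atypical \<eta> p x + ennreal (norm_tail N2 (N2 * \<eta>) n)) + atypical \<eta> U (\<lambda>i\<in>{..<n}. x i + \<alpha> * s i) + (\<integral>\<^sup>+ e. atypical \<eta> (p + N2) (\<lambda>i\<in>{..<n}. x i + e i) \<partial>\<G> N2 n)" for x s :: "nat \<Rightarrow> real"
      using G2.emeasure_space_1 by (simp add: nn_integral_add nn_integral_atypical N2)
    have e2: "(\<integral>\<^sup>+ x. (atypical \<eta> p x + ennreal (norm_tail N2 (N2 * \<eta>) n)) + atypical \<eta> U (\<lambda>i\<in>{..<n}. x i + \<alpha> * s i) + (\<integral>\<^sup>+ e. atypical \<eta> (p + N2) (\<lambda>i\<in>{..<n}. x i + e i) \<partial>\<G> N2 n) \<partial>\<G> p n)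
      = ennreal (norm_tail p (p * \<eta>) n) + ennreal (norm_tail N2 (N2 * \<eta>) n) + (\<integral>\<^sup>+ x. atypical \<eta> U (\<lambda>i\<in>{..<n}. x i + \<alpha> * s i) \<partial>\<G> p n) + ennreal (norm_tail (p + N2) ((p + N2) * \<eta>) n)" for s :: "nat \<Rightarrow> real"
      using Gp.emeasure_space_1 by (simp add: nn_integral_add nn_integral_atypical p ez)
    show ?thesis unfolding e1 e2 eve_tail_def
      using GQ.emeasure_space_1 by (simp add: nn_integral_add nn_integral_atypical_U)
  qed
  finally show ?thesis unfolding eI .
qed

end

section \<open>The three defects as averages over codewords\<close>

context dirty_paper_code begin

text \<open>Messages and bundle indices merge into one index set, the one over which random
  codebooks are drawn.\<close>

lemma average_codewords:
  fixes X :: "nat \<Rightarrow> nat \<Rightarrow> (nat \<Rightarrow> real) \<Rightarrow> ennreal"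
  assumes X: "\<And>w j. w \<in> {1..M} \<Longrightarrow> j \<in> {1..J} \<Longrightarrow> X w j \<in> borel_measurable (blk n)"
  shows "(\<Sum>w\<in>{1..M}. ennreal (1 / M) * (\<integral>\<^sup>+ s. (\<Sum>j\<in>{1..J}. ennreal (state_ratio (C (w, j)) s / J) * X w j s) \<partial>\<G> Q n))
    = (\<Sum>i\<in>{1..M} \<times> {1..J}. ennreal (1 / (real M * real J)) * (\<integral>\<^sup>+ s. ennreal (state_ratio (C i) s) * X (fst i) (snd i) s \<partial>\<G> Q n))"
proof -
  have 1: "(\<integral>\<^sup>+ s. (\<Sum>j\<in>{1..J}. ennreal (state_ratio (C (w, j)) s / J) * X w j s) \<partial>\<G> Q n)
    = (\<Sum>j\<in>{1..J}. ennreal (1 / J) * (\<integral>\<^sup>+ s. ennreal (state_ratio (C (w, j)) s) * X w j s \<partial>\<G> Q n))" if w: "w \<in> {1..M}" for w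
  proof -
    have m: "(\<lambda>s. ennreal (state_ratio (C (w, j)) s) * X w j s) \<in> borel_measurable (\<G> Q n)" if j: "j \<in> {1..J}" for j
    proof -
      note [measurable] = X[OF w j] state_ratio_code_meas[OF w j]
      show ?thesis by measurable
    qed
    have e: "ennreal (state_ratio (C (w, j)) s / J) * X w j s = ennreal (1 / J) * (ennreal (state_ratio (C (w, j)) s) * X w j s)" for j s
    proof -
      have "ennreal (state_ratio (C (w, j)) s / J) = ennreal (1 / J) * ennreal (state_ratio (C (w, j)) s)"
        by (subst ennreal_mult'[symmetric]) simp_all
      then show ?thesis by (simp only: mult.assoc)
    qed
    have "(\<integral>\<^sup>+ s. (\<Sum>j\<in>{1..J}. ennreal (1 / J) * (ennreal (state_ratio (C (w, j)) s) * X w j s)) \<partial>\<G> Q n)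
      = (\<Sum>j\<in>{1..J}. \<integral>\<^sup>+ s. ennreal (1 / J) * (ennreal (state_ratio (C (w, j)) s) * X w j s) \<partial>\<G> Q n)"
      by (rule nn_integral_sum) (intro borel_measurable_times_ennreal borel_measurable_const m)
    also have "\<dots> = (\<Sum>j\<in>{1..J}. ennreal (1 / J) * (\<integral>\<^sup>+ s. ennreal (state_ratio (C (w, j)) s) * X w j s \<partial>\<G> Q n))"
      by (intro sum.cong refl nn_integral_cmult m)
    finally show ?thesis unfolding e .
  qed
  have "(\<Sum>w\<in>{1..M}. ennreal (1 / M) * (\<integral>\<^sup>+ s. (\<Sum>j\<in>{1..J}. ennreal (state_ratio (C (w, j)) s / J) * X w j s) \<partial>\<G> Q n))
    = (\<Sum>w\<in>{1..M}. \<Sum>j\<in>{1..J}. ennreal (1 / (real M * real J)) * (\<integral>\<^sup>+ s. ennreal (state_ratio (C (w, j)) s) * X w j s \<partial>\<G> Q n))"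
  proof (intro sum.cong refl)
    fix w assume w: "w \<in> {1..M}"
    have "ennreal (1 / (real M * real J)) = ennreal (1 / M) * ennreal (1 / J)"
      by (subst ennreal_mult'[symmetric]) simp_all
    then show "ennreal (1 / M) * (\<integral>\<^sup>+ s. (\<Sum>j\<in>{1..J}. ennreal (state_ratio (C (w, j)) s / J) * X w j s) \<partial>\<G> Q n)
      = (\<Sum>j\<in>{1..J}. ennreal (1 / (real M * real J)) * (\<integral>\<^sup>+ s. ennreal (state_ratio (C (w, j)) s) * X w j s \<partial>\<G> Q n))"
      unfolding 1[OF w] by (simp only: sum_distrib_left mult.assoc)
  qed
  also have "\<dots> = (\<Sum>i\<in>{1..M} \<times> {1..J}. ennreal (1 / (real M * real J)) * (\<integral>\<^sup>+ s. ennreal (state_ratio (C i) s) * X (fst i) (snd i) s \<partial>\<G> Q n))"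
    by (subst sum.cartesian_product) (intro sum.cong, auto)
  finally show ?thesis .
qed

lemma overload_eq: "overload = (\<Sum>i\<in>{1..M} \<times> {1..J}. ennreal (1 / (real M * real J)) * over_mass (C i))"
proof -
  have "over (fst i) (snd i) s = (if (\<Sum>k<n. (C i k - \<alpha> * s k)\<^sup>2) \<le> n * P then 0 else 1)" for i s
  proof -
    have "(\<Sum>k<n. (raw (fst i) (snd i) s k)\<^sup>2) = (\<Sum>k<n. (C i k - \<alpha> * s k)\<^sup>2)" by (intro sum.cong) (auto simp: raw_def)
    then show ?thesis by (simp only: over_def)
  qed
  then show ?thesis unfolding overload_def over_mass_def by (subst average_codewords) (auto intro!: over_meas)
qed

lemma confusion_eq: "confusion = (\<Sum>i\<in>{1..M} \<times> {1..J}. ennreal (1 / (real M * real J)) *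
   (miss_mass \<gamma> (C i) + (\<Sum>i'\<in>{1..M} \<times> {1..J} - {i}. hit_mass \<gamma> (C i) (C i'))))"
proof -
  define Miss where "Miss i s = (\<integral>\<^sup>+ e. (if output_ratio (C i) (channel_out (C i) s e) \<le> \<gamma> then 1 else 0) \<partial>\<G> N1 n)" for i s
  define Hit where "Hit i i' s = (\<integral>\<^sup>+ e. (if \<gamma> < output_ratio (C i') (channel_out (C i) s e) then 1 else 0) \<partial>\<G> N1 n)" for i i' s
  have C': "C i \<in> space (blk n)" if "i \<in> {1..M} \<times> {1..J}" for i using C[of "fst i" "snd i"] that by auto
  have Em: "(\<lambda>q. if output_ratio (C i) (channel_out (C i) (fst q) (snd q)) \<le> \<gamma> then 1 else 0 :: ennreal) \<in> borel_measurable (blk n \<Otimes>\<^sub>M \<G> N1 n)"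
    "(\<lambda>q. if \<gamma> < output_ratio (C i') (channel_out (C i) (fst q) (snd q)) then 1 else 0 :: ennreal) \<in> borel_measurable (blk n \<Otimes>\<^sub>M \<G> N1 n)"
    if "i \<in> {1..M} \<times> {1..J}" "i' \<in> {1..M} \<times> {1..J}" for i i'
    using C'[OF that(1)] C'[OF that(2)] by measurable
  have Mm[measurable]: "Miss i \<in> borel_measurable (blk n)" if "i \<in> {1..M} \<times> {1..J}" for i
    using G1.borel_measurable_nn_integral_fst[OF Em(1)[OF that that]] unfolding Miss_def[abs_def] by simp
  have Hm[measurable]: "Hit i i' \<in> borel_measurable (blk n)" if "i \<in> {1..M} \<times> {1..J}" "i' \<in> {1..M} \<times> {1..J}" for i i'
    using G1.borel_measurable_nn_integral_fst[OF Em(2)[OF that]] unfolding Hit_def[abs_def] by simp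
  have b: "(\<integral>\<^sup>+ e. bad w j (\<lambda>i\<in>{..<n}. raw w j s i + s i + e i) \<partial>\<G> N1 n) = Miss (w, j) s + (\<Sum>i'\<in>{1..M} \<times> {1..J} - {(w, j)}. Hit (w, j) i' s)"
    if w: "w \<in> {1..M}" and j: "j \<in> {1..J}" and s: "s \<in> space (blk n)" for w j s
  proof -
    have wj: "(w, j) \<in> {1..M} \<times> {1..J}" using w j by simp
    have o: "(\<lambda>i\<in>{..<n}. raw w j s i + s i + e i) = channel_out (C (w, j)) s e" for e by (auto simp: raw_def channel_out_def fun_eq_iff)
    have ps: "(\<lambda>e. (s, e)) \<in> \<G> N1 n \<rightarrow>\<^sub>M blk n \<Otimes>\<^sub>M \<G> N1 n" using s by (intro measurable_Pair) auto
    have m1: "(\<lambda>e. if output_ratio (C (w, j)) (channel_out (C (w, j)) s e) \<le> \<gamma> then 1 else 0 :: ennreal) \<in> borel_measurable (\<G> N1 n)"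
      using measurable_compose[OF ps Em(1)[OF wj wj]] by simp
    have m2: "(\<lambda>e. if \<gamma> < output_ratio (C i') (channel_out (C (w, j)) s e) then 1 else 0 :: ennreal) \<in> borel_measurable (\<G> N1 n)" if "i' \<in> {1..M} \<times> {1..J} - {(w, j)}" for i'
      using measurable_compose[OF ps Em(2)[OF wj, of i']] that by simp
    have m3: "(\<lambda>e. \<Sum>i'\<in>{1..M} \<times> {1..J} - {(w, j)}. if \<gamma> < output_ratio (C i') (channel_out (C (w, j)) s e) then 1 else 0 :: ennreal) \<in> borel_measurable (\<G> N1 n)"
      by (intro borel_measurable_sum m2)
    have sm: "(\<integral>\<^sup>+ e. (\<Sum>i'\<in>{1..M} \<times> {1..J} - {(w, j)}. if \<gamma> < output_ratio (C i') (channel_out (C (w, j)) s e) then 1 else 0 :: ennreal) \<partial>\<G> N1 n)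
      = (\<Sum>i'\<in>{1..M} \<times> {1..J} - {(w, j)}. \<integral>\<^sup>+ e. (if \<gamma> < output_ratio (C i') (channel_out (C (w, j)) s e) then 1 else 0) \<partial>\<G> N1 n)"
      by (rule nn_integral_sum) (rule m2)
    show ?thesis unfolding o bad_def nn_integral_add[OF m1 m3] sm Miss_def Hit_def ..
  qed
  have bm: "(\<lambda>s. Miss (w, j) s + (\<Sum>i'\<in>{1..M} \<times> {1..J} - {(w, j)}. Hit (w, j) i' s)) \<in> borel_measurable (blk n)" if "w \<in> {1..M}" "j \<in> {1..J}" for w j
    using that by (intro borel_measurable_add borel_measurable_sum Mm Hm) auto
  have "confusion = (\<Sum>w\<in>{1..M}. ennreal (1 / M) * (\<integral>\<^sup>+ s. (\<Sum>j\<in>{1..J}. ennreal (state_ratio (C (w, j)) s / J) * (Miss (w, j) s + (\<Sum>i'\<in>{1..M} \<times> {1..J} - {(w, j)}. Hit (w, j) i' s))) \<partial>\<G> Q n))"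
    unfolding confusion_def by (intro sum.cong refl arg_cong2[where f="(*)"] nn_integral_cong b) auto
  also have "\<dots> = (\<Sum>i\<in>{1..M} \<times> {1..J}. ennreal (1 / (real M * real J)) * (\<integral>\<^sup>+ s. ennreal (state_ratio (C i) s) * (Miss i s + (\<Sum>i'\<in>{1..M} \<times> {1..J} - {i}. Hit i i' s)) \<partial>\<G> Q n))"
    using average_codewords[OF bm] by simp
  also have "\<dots> = (\<Sum>i\<in>{1..M} \<times> {1..J}. ennreal (1 / (real M * real J)) * (miss_mass \<gamma> (C i) + (\<Sum>i'\<in>{1..M} \<times> {1..J} - {i}. hit_mass \<gamma> (C i) (C i'))))"
  proof (intro sum.cong refl arg_cong2[where f="(*)"])
    fix i assume i: "i \<in> {1..M} \<times> {1..J}"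
    have sm: "(\<lambda>s. state_ratio (C i) s) \<in> borel_measurable (blk n)" using C'[OF i] by (intro ratio_meas) auto
    have m1: "(\<lambda>s. ennreal (state_ratio (C i) s) * Miss i s) \<in> borel_measurable (\<G> Q n)"
      using sm Mm[OF i] by measurable
    have m2: "(\<lambda>s. ennreal (state_ratio (C i) s) * Hit i i' s) \<in> borel_measurable (\<G> Q n)" if "i' \<in> {1..M} \<times> {1..J} - {i}" for i'
    proof -
      have "i' \<in> {1..M} \<times> {1..J}" using that by simp
      from sm Hm[OF i this] show ?thesis by measurable
    qed
    have m3: "(\<lambda>s. \<Sum>i'\<in>{1..M} \<times> {1..J} - {i}. ennreal (state_ratio (C i) s) * Hit i i' s) \<in> borel_measurable (\<G> Q n)"
      by (intro borel_measurable_sum m2)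
    show "(\<integral>\<^sup>+ s. ennreal (state_ratio (C i) s) * (Miss i s + (\<Sum>i'\<in>{1..M} \<times> {1..J} - {i}. Hit i i' s)) \<partial>\<G> Q n)
      = miss_mass \<gamma> (C i) + (\<Sum>i'\<in>{1..M} \<times> {1..J} - {i}. hit_mass \<gamma> (C i) (C i'))"
    proof -
      have sm: "(\<integral>\<^sup>+ s. (\<Sum>i'\<in>{1..M} \<times> {1..J} - {i}. ennreal (state_ratio (C i) s) * Hit i i' s) \<partial>\<G> Q n)
        = (\<Sum>i'\<in>{1..M} \<times> {1..J} - {i}. \<integral>\<^sup>+ s. ennreal (state_ratio (C i) s) * Hit i i' s \<partial>\<G> Q n)"
        by (rule nn_integral_sum) (rule m2)
      show ?thesis
        unfolding miss_mass_def hit_mass_def Miss_def[symmetric] Hit_def[symmetric] distrib_left sum_distrib_left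
        unfolding nn_integral_add[OF m1 m3] sm ..
    qed
  qed
  finally show ?thesis .
qed

text \<open>In this shape the leakage of message \<open>w\<close> is a soft covering error for the
  bundle \<open>{w} \<times> {1..J}\<close> inside the whole codebook.\<close>

lemma leakage_eq: "leakage = (\<Sum>w\<in>{1..M}. ennreal (1 / M) *
   (\<integral>\<^sup>+ v. ennreal \<bar>(\<Sum>i\<in>{w} \<times> {1..J}. eve_ratio (C i) (snd v) (fst v)) / card ({w} \<times> {1..J}) - 1\<bar> \<partial>(\<G> Q n \<Otimes>\<^sub>M \<G> (p + N2) n)))"
  unfolding leakage_def
proof (intro sum.cong refl arg_cong2[where f="(*)"])
  fix w assume w: "w \<in> {1..M}"
  have e: "\<bar>(\<Sum>i\<in>{w} \<times> {1..J}. eve_ratio (C i) z s) / card ({w} \<times> {1..J}) - 1\<bar> = evedev w z s" for z s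
  proof -
    have "(\<Sum>i\<in>{w} \<times> {1..J}. eve_ratio (C i) z s) = (\<Sum>j\<in>{1..J}. eve_ratio (C (w, j)) z s)"
      by (rule sum.reindex_bij_witness[of _ "\<lambda>j. (w, j)" snd]) auto
    then show ?thesis by (simp only: evedev_def card_cartesian_product_singleton card_atLeastAtMost diff_Suc_1 add_diff_cancel_right' Suc_eq_plus1)
  qed
  have "(\<lambda>v. ennreal (evedev w (snd v) (fst v))) \<in> borel_measurable (\<G> Q n \<Otimes>\<^sub>M \<G> (p + N2) n)"
    using measurable_compose[OF measurable_pair_swap'[of "blk n" "blk n"] evedev_meas[OF w]] by (simp add: split_beta' cong: measurable_cong_sets)
  from GZ.nn_integral_fst[OF this]
  show "(\<integral>\<^sup>+ s. \<integral>\<^sup>+ z. ennreal (evedev w z s) \<partial>\<G> (p + N2) n \<partial>\<G> Q n)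
    = (\<integral>\<^sup>+ v. ennreal \<bar>(\<Sum>i\<in>{w} \<times> {1..J}. eve_ratio (C i) (snd v) (fst v)) / card ({w} \<times> {1..J}) - 1\<bar> \<partial>(\<G> Q n \<Otimes>\<^sub>M \<G> (p + N2) n))"
    unfolding e by simp
qed

end

section \<open>Existence of a good codebook\<close>

lemma sum_average_const:
  fixes X :: ennreal
  assumes "finite A" "A \<noteq> {}"
  shows "(\<Sum>i\<in>A. ennreal (1 / card A) * X) = X"
proof -
  have "(\<Sum>i\<in>A. ennreal (1 / card A) * X) = ennreal (real (card A)) * ennreal (1 / card A) * X"
    by (simp add: ennreal_of_nat_eq_real_of_nat mult.assoc)
  also have "ennreal (real (card A)) * ennreal (1 / card A) = 1"
    using assms by (subst ennreal_mult'[symmetric]) (auto simp: card_gt_0_iff)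
  finally show ?thesis by simp
qed

context dirty_paper begin

text \<open>Random coding with independent codewords drawn from \<open>\<G> U n\<close>. The sum of
  the three defects is averaged, and not each one alone, so that a single codebook is good for all
  of them.\<close>

lemma exists_code:
  fixes b \<delta> \<eta> \<rho> :: real and M J :: nat
  assumes n: "0 < n" and M: "0 < M" and J: "0 < J" and \<eta>: "0 < \<eta>" and \<rho>: "0 < \<rho>" and b: "1 < b"
    and \<delta>: "norm_tail p (P - p) n + (norm_tail U (U * \<eta>) n + norm_tail \<tau> (\<tau> * \<eta>) n + real M * real J * exp (- (n * (output_info - 2 * \<eta>))))
      + (2 * (norm_tail p (p * \<eta>) n + norm_tail N2 (N2 * \<eta>) n + norm_tail U (U * \<eta>) n + norm_tail (p + N2) ((p + N2) * \<eta>) n)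
        + (exp (n * (eve_info + 2 * \<eta>)) / (J * \<rho>) + \<rho>) / 2) < \<delta>"
  shows "\<exists>c. wellformed_code c \<and> block_length c = n \<and> num_messages c = M \<and> power_constraint P Q N1 N2 c \<and>
    error_prob Q N1 N2 c \<le> \<delta> \<and> log b M - 4 * (ln M + 1) * \<delta> / ln b \<le> n * equivocation b Q N1 N2 c"
proof -
  define I where "I = {1..M} \<times> {1..J}"
  define \<gamma> where "\<gamma> = exp (n * (output_info - 2 * \<eta>))"
  define books where "books = PiM I (\<lambda>_. \<G> U n)"
  define V where "V = \<G> Q n \<Otimes>\<^sub>M \<G> (p + N2) n"
  interpret QZ: pair_prob_space "\<G> Q n" "\<G> (p + N2) n" ..
  have V: "prob_space V" unfolding V_def by (rule QZ.prob_space_axioms)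
  interpret books: prob_space books unfolding books_def by (intro prob_space_PiM GU.prob_space_axioms)
  have fI: "finite I" and cI: "real (card I) = real M * real J" and nI: "I \<noteq> {}" using M J by (auto simp: I_def)
  define T1 where "T1 C = (\<Sum>i\<in>I. ennreal (1 / card I) * over_mass (C i))" for C :: "nat \<times> nat \<Rightarrow> nat \<Rightarrow> real"
  define T2 where "T2 C = (\<Sum>i\<in>I. ennreal (1 / card I) * (miss_mass \<gamma> (C i) + (\<Sum>i'\<in>I - {i}. hit_mass \<gamma> (C i) (C i'))))" for C :: "nat \<times> nat \<Rightarrow> nat \<Rightarrow> real"
  define S where "S w C = (\<integral>\<^sup>+ v. ennreal \<bar>(\<Sum>i\<in>{w} \<times> {1..J}. eve_ratio (C i) (snd v) (fst v)) / card ({w} \<times> {1..J}) - 1\<bar> \<partial>V)" for w and C :: "nat \<times> nat \<Rightarrow> nat \<Rightarrow> real"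
  define T3 where "T3 C = (\<Sum>w\<in>{1..M}. ennreal (1 / M) * S w C)" for C :: "nat \<times> nat \<Rightarrow> nat \<Rightarrow> real"
  have comp: "(\<lambda>C. C i) \<in> books \<rightarrow>\<^sub>M blk n" if "i \<in> I" for i
    using measurable_component_singleton[OF that, of "\<lambda>_. \<G> U n"] unfolding books_def by (simp cong: measurable_cong_sets)
  have om: "(\<lambda>C. over_mass (C i)) \<in> borel_measurable books" if "i \<in> I" for i
    by (rule measurable_compose[OF comp[OF that] over_mass_meas])
  have mm: "(\<lambda>C. miss_mass \<gamma> (C i)) \<in> borel_measurable books" if "i \<in> I" for i
    by (rule measurable_compose[OF comp[OF that] miss_mass_meas])
  have hm: "(\<lambda>C. hit_mass \<gamma> (C i) (C i')) \<in> borel_measurable books" if "i \<in> I" "i' \<in> I" for i i'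
    using measurable_compose[OF measurable_Pair[OF comp[OF that(1)] comp[OF that(2)]] hit_mass_meas[of \<gamma>]] by simp
  have Lm: "(\<lambda>q. eve_ratio (fst q) (snd (snd q)) (fst (snd q))) \<in> borel_measurable (\<G> U n \<Otimes>\<^sub>M V)"
    unfolding V_def by (intro eve_ratio_meas) measurable
  have Jw: "{w} \<times> {1..J} \<subseteq> I" "{w} \<times> {1..J} \<noteq> {}" if "w \<in> {1..M}" for w using that J by (auto simp: I_def)
  have Sm: "S w \<in> borel_measurable books" if "w \<in> {1..M}" for w
    using soft_covering_measurable[OF V Lm Jw(1)[OF that]] unfolding S_def[abs_def] books_def by simp
  have T1m: "T1 \<in> borel_measurable books" unfolding T1_def[abs_def] by (intro borel_measurable_sum borel_measurable_times_ennreal borel_measurable_const om)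
  have hsm: "(\<lambda>C. \<Sum>i'\<in>I - {i}. hit_mass \<gamma> (C i) (C i')) \<in> borel_measurable books" if "i \<in> I" for i
    using that by (intro borel_measurable_sum hm) auto
  have T2im: "(\<lambda>C. miss_mass \<gamma> (C i) + (\<Sum>i'\<in>I - {i}. hit_mass \<gamma> (C i) (C i'))) \<in> borel_measurable books" if "i \<in> I" for i
    by (intro borel_measurable_add mm hsm that)
  have T2m: "T2 \<in> borel_measurable books" unfolding T2_def[abs_def] by (intro borel_measurable_sum borel_measurable_times_ennreal borel_measurable_const T2im)
  have T3m: "T3 \<in> borel_measurable books" unfolding T3_def[abs_def] by (intro borel_measurable_sum borel_measurable_times_ennreal borel_measurable_const Sm)
  have E1: "(\<integral>\<^sup>+ C. T1 C \<partial>books) \<le> ennreal (norm_tail p (P - p) n)"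
  proof -
    have "(\<integral>\<^sup>+ C. T1 C \<partial>books) = (\<Sum>i\<in>I. \<integral>\<^sup>+ C. ennreal (1 / card I) * over_mass (C i) \<partial>books)"
      unfolding T1_def by (rule nn_integral_sum) (intro borel_measurable_times_ennreal borel_measurable_const om)
    also have "\<dots> = (\<Sum>i\<in>I. ennreal (1 / card I) * (\<integral>\<^sup>+ u. over_mass u \<partial>\<G> U n))"
    proof (intro sum.cong refl)
      fix i assume i: "i \<in> I"
      have "(\<integral>\<^sup>+ C. over_mass (C i) \<partial>books) = (\<integral>\<^sup>+ u. over_mass u \<partial>\<G> U n)"
        unfolding books_def by (rule nn_integral_PiM_component[OF GU.prob_space_axioms i]) measurable
      then show "(\<integral>\<^sup>+ C. ennreal (1 / card I) * over_mass (C i) \<partial>books) = ennreal (1 / card I) * (\<integral>\<^sup>+ u. over_mass u \<partial>\<G> U n)"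
        using nn_integral_cmult[OF om[OF i]] by simp
    qed
    also have "\<dots> = (\<integral>\<^sup>+ u. over_mass u \<partial>\<G> U n)" by (rule sum_average_const[OF fI nI])
    finally show ?thesis using nn_integral_over_mass by simp
  qed
  have \<gamma>: "0 < \<gamma>" by (simp add: \<gamma>_def)
  have E2: "(\<integral>\<^sup>+ C. T2 C \<partial>books) \<le> ennreal (norm_tail U (U * \<eta>) n) + ennreal (norm_tail \<tau> (\<tau> * \<eta>) n) + ennreal (real M * real J) * ennreal (1 / \<gamma>)"
  proof -
    have "(\<integral>\<^sup>+ C. T2 C \<partial>books) = (\<Sum>i\<in>I. \<integral>\<^sup>+ C. ennreal (1 / card I) * (miss_mass \<gamma> (C i) + (\<Sum>i'\<in>I - {i}. hit_mass \<gamma> (C i) (C i'))) \<partial>books)"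
      unfolding T2_def by (rule nn_integral_sum) (intro borel_measurable_times_ennreal borel_measurable_const T2im)
    also have "\<dots> \<le> (\<Sum>i\<in>I. ennreal (1 / card I) * (ennreal (norm_tail U (U * \<eta>) n) + ennreal (norm_tail \<tau> (\<tau> * \<eta>) n) + ennreal (real M * real J) * ennreal (1 / \<gamma>)))"
    proof (intro sum_mono)
      fix i assume i: "i \<in> I"
      have "(\<integral>\<^sup>+ C. miss_mass \<gamma> (C i) \<partial>books) = (\<integral>\<^sup>+ u. miss_mass \<gamma> u \<partial>\<G> U n)"
        unfolding books_def by (rule nn_integral_PiM_component[OF GU.prob_space_axioms i]) measurable
      then have a: "(\<integral>\<^sup>+ C. miss_mass \<gamma> (C i) \<partial>books) \<le> ennreal (norm_tail U (U * \<eta>) n) + ennreal (norm_tail \<tau> (\<tau> * \<eta>) n)"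
        using nn_integral_miss_mass[OF \<eta> n] by (simp add: \<gamma>_def)
      have h: "(\<integral>\<^sup>+ C. hit_mass \<gamma> (C i) (C i') \<partial>books) \<le> ennreal (1 / \<gamma>)" if i': "i' \<in> I - {i}" for i'
      proof -
        have "(\<integral>\<^sup>+ C. hit_mass \<gamma> (fst (C i, C i')) (snd (C i, C i')) \<partial>books) = (\<integral>\<^sup>+ u. \<integral>\<^sup>+ u'. hit_mass \<gamma> (fst (u, u')) (snd (u, u')) \<partial>\<G> U n \<partial>\<G> U n)"
          unfolding books_def using i i' by (intro nn_integral_PiM_two_components[OF fI GU.prob_space_axioms, where F="\<lambda>q. hit_mass \<gamma> (fst q) (snd q)"]) auto
        then show ?thesis using nn_integral_hit_mass[OF \<gamma>] by simp
      qed
      have "(\<integral>\<^sup>+ C. (\<Sum>i'\<in>I - {i}. hit_mass \<gamma> (C i) (C i')) \<partial>books) = (\<Sum>i'\<in>I - {i}. \<integral>\<^sup>+ C. hit_mass \<gamma> (C i) (C i') \<partial>books)"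
        using i by (intro nn_integral_sum hm) auto
      also have "\<dots> \<le> (\<Sum>i'\<in>I - {i}. ennreal (1 / \<gamma>))" by (intro sum_mono h)
      also have "\<dots> \<le> (\<Sum>i'\<in>I. ennreal (1 / \<gamma>))" using fI by (intro sum_mono2) auto
      also have "\<dots> = ennreal (real M * real J) * ennreal (1 / \<gamma>)" by (simp add: cI[symmetric] ennreal_of_nat_eq_real_of_nat)
      finally have c: "(\<integral>\<^sup>+ C. (\<Sum>i'\<in>I - {i}. hit_mass \<gamma> (C i) (C i')) \<partial>books) \<le> ennreal (real M * real J) * ennreal (1 / \<gamma>)" .
      show "(\<integral>\<^sup>+ C. ennreal (1 / card I) * (miss_mass \<gamma> (C i) + (\<Sum>i'\<in>I - {i}. hit_mass \<gamma> (C i) (C i'))) \<partial>books) \<le> ennreal (1 / card I) * (ennreal (norm_tail U (U * \<eta>) n) + ennreal (norm_tail \<tau> (\<tau> * \<eta>) n) + ennreal (real M * real J) * ennreal (1 / \<gamma>))"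
        unfolding nn_integral_cmult[OF T2im[OF i]] nn_integral_add[OF mm[OF i] hsm[OF i]]
        by (intro mult_left_mono add_mono a c) simp
    qed
    also have "\<dots> = ennreal (norm_tail U (U * \<eta>) n) + ennreal (norm_tail \<tau> (\<tau> * \<eta>) n) + ennreal (real M * real J) * ennreal (1 / \<gamma>)"
      by (rule sum_average_const[OF fI nI])
    finally show ?thesis .
  qed
  define B where "B = 2 * eve_tail \<eta> + ennreal ((exp (n * (eve_info + 2 * \<eta>)) / (J * \<rho>) + \<rho>) / 2)"
  have E3: "(\<integral>\<^sup>+ C. T3 C \<partial>books) \<le> B"
  proof -
    have "(\<integral>\<^sup>+ C. T3 C \<partial>books) = (\<Sum>w\<in>{1..M}. \<integral>\<^sup>+ C. ennreal (1 / M) * S w C \<partial>books)"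
      unfolding T3_def by (rule nn_integral_sum) (intro borel_measurable_times_ennreal borel_measurable_const Sm)
    also have "\<dots> \<le> (\<Sum>w\<in>{1..M}. ennreal (1 / card {1..M}) * B)"
    proof (intro sum_mono)
      fix w assume w: "w \<in> {1..M}"
      have nrm: "(\<integral>\<^sup>+ u. ennreal (eve_ratio (fst (u, v)) (snd (snd (u, v))) (fst (snd (u, v)))) \<partial>\<G> U n) = 1" if "v \<in> space V" for v
        using that eve_ratio_normalized[of "snd v" "fst v"] by (auto simp: V_def space_pair_measure)
      have g0: "0 \<le> exp (n * (eve_info + 2 * \<eta>))" by simp
      have "(\<integral>\<^sup>+ C. S w C \<partial>books) \<le> 2 * (\<integral>\<^sup>+ v. \<integral>\<^sup>+ u. ennreal (if exp (n * (eve_info + 2 * \<eta>)) < eve_ratio u (snd v) (fst v) then eve_ratio u (snd v) (fst v) else 0) \<partial>\<G> U n \<partial>V)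
        + ennreal ((exp (n * (eve_info + 2 * \<eta>)) / (card ({w} \<times> {1..J}) * \<rho>) + \<rho>) / 2)"
        using soft_covering[OF GU.prob_space_axioms V Lm ratio_nonneg(2) nrm fI Jw[OF w] g0 \<rho>] unfolding S_def books_def fst_conv snd_conv .
      also have "\<dots> \<le> B"
      proof -
        have c: "card ({w} \<times> {1..J}) = J" by (simp add: card_cartesian_product)
        show ?thesis unfolding c B_def by (intro add_mono mult_left_mono order_refl nn_integral_eve_ratio_tail[of \<eta>, folded V_def]) simp
      qed
      finally have "(\<integral>\<^sup>+ C. S w C \<partial>books) \<le> B" .
      then show "(\<integral>\<^sup>+ C. ennreal (1 / M) * S w C \<partial>books) \<le> ennreal (1 / card {1..M}) * B"
        unfolding nn_integral_cmult[OF Sm[OF w]] by (simp add: mult_left_mono)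
    qed
    also have "\<dots> = B" using M by (intro sum_average_const) auto
    finally show ?thesis .
  qed
  have nt: "0 \<le> norm_tail v e n" for v e by (simp add: norm_tail_def)
  have "(\<integral>\<^sup>+ C. T3 C + (T1 C + T2 C) \<partial>books) = (\<integral>\<^sup>+ C. T3 C \<partial>books) + ((\<integral>\<^sup>+ C. T1 C \<partial>books) + (\<integral>\<^sup>+ C. T2 C \<partial>books))"
    unfolding nn_integral_add[OF T3m borel_measurable_add[OF T1m T2m]] nn_integral_add[OF T1m T2m] ..
  also have "\<dots> \<le> B + (ennreal (norm_tail p (P - p) n) + (ennreal (norm_tail U (U * \<eta>) n) + ennreal (norm_tail \<tau> (\<tau> * \<eta>) n) + ennreal (real M * real J) * ennreal (1 / \<gamma>)))"
    by (intro add_mono E1 E2 E3)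
  also have "\<dots> = ennreal ((2 * (norm_tail p (p * \<eta>) n + norm_tail N2 (N2 * \<eta>) n + norm_tail U (U * \<eta>) n + norm_tail (p + N2) ((p + N2) * \<eta>) n)
        + (exp (n * (eve_info + 2 * \<eta>)) / (J * \<rho>) + \<rho>) / 2) + (norm_tail p (P - p) n + (norm_tail U (U * \<eta>) n + norm_tail \<tau> (\<tau> * \<eta>) n + real M * real J * (1 / \<gamma>))))"
  proof -
    have "0 \<le> (exp (n * (eve_info + 2 * \<eta>)) / (J * \<rho>) + \<rho>) / 2" using \<rho> by (intro divide_nonneg_nonneg add_nonneg_nonneg) auto
    moreover have "0 \<le> real M * real J * (1 / \<gamma>)" using \<gamma> by simp
    moreover have "2 * (ennreal t1 + ennreal t2 + ennreal t3 + ennreal t4) + ennreal t5 + (ennreal t6 + (ennreal t7 + ennreal t8 + ennreal t9))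
      = ennreal ((2 * (t1 + t2 + t3 + t4) + t5) + (t6 + (t7 + t8 + t9)))"
      if "0 \<le> t1" "0 \<le> t2" "0 \<le> t3" "0 \<le> t4" "0 \<le> t5" "0 \<le> t6" "0 \<le> t7" "0 \<le> t8" "0 \<le> t9" for t1 t2 t3 t4 t5 t6 t7 t8 t9
    proof -
      have two: "2 * ennreal t = ennreal (2 * t)" for t by (simp add: ennreal_mult')
      show ?thesis
        by (simp only: ennreal_plus[symmetric] two add_nonneg_nonneg mult_nonneg_nonneg zero_le_numeral that)
    qed
    moreover have "ennreal (real M * real J) * ennreal (1 / \<gamma>) = ennreal (real M * real J * (1 / \<gamma>))"
      by (intro ennreal_mult'[symmetric]) simp
    ultimately show ?thesis unfolding B_def eve_tail_def using nt by presburger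
  qed
  also have "\<dots> < ennreal \<delta>"
  proof (rule ennreal_lessI)
    have g: "1 / \<gamma> = exp (- (n * (output_info - 2 * \<eta>)))" by (simp add: \<gamma>_def exp_minus inverse_eq_divide)
    show lt: "(2 * (norm_tail p (p * \<eta>) n + norm_tail N2 (N2 * \<eta>) n + norm_tail U (U * \<eta>) n + norm_tail (p + N2) ((p + N2) * \<eta>) n)
        + (exp (n * (eve_info + 2 * \<eta>)) / (J * \<rho>) + \<rho>) / 2) + (norm_tail p (P - p) n + (norm_tail U (U * \<eta>) n + norm_tail \<tau> (\<tau> * \<eta>) n + real M * real J * (1 / \<gamma>))) < \<delta>"
      using \<delta> unfolding g by linarith
    have "0 \<le> (exp (n * (eve_info + 2 * \<eta>)) / (J * \<rho>) + \<rho>) / 2" using \<rho> by (intro divide_nonneg_nonneg add_nonneg_nonneg) auto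
    then have "0 \<le> (2 * (norm_tail p (p * \<eta>) n + norm_tail N2 (N2 * \<eta>) n + norm_tail U (U * \<eta>) n + norm_tail (p + N2) ((p + N2) * \<eta>) n)
        + (exp (n * (eve_info + 2 * \<eta>)) / (J * \<rho>) + \<rho>) / 2) + (norm_tail p (P - p) n + (norm_tail U (U * \<eta>) n + norm_tail \<tau> (\<tau> * \<eta>) n + real M * real J * (1 / \<gamma>)))"
      using \<gamma> by (intro add_nonneg_nonneg mult_nonneg_nonneg nt) simp_all
    from le_less_trans[OF this lt] show "0 < \<delta>" .
  qed
  finally have lt: "(\<integral>\<^sup>+ C. T3 C + (T1 C + T2 C) \<partial>books) < ennreal \<delta>" .
  have "\<exists>C\<in>space books. T3 C + (T1 C + T2 C) \<le> ennreal \<delta>"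
  proof (rule ccontr)
    assume "\<not> ?thesis"
    then have "(\<integral>\<^sup>+ C. ennreal \<delta> \<partial>books) \<le> (\<integral>\<^sup>+ C. T3 C + (T1 C + T2 C) \<partial>books)"
      by (intro nn_integral_mono) (auto simp: not_le less_imp_le)
    then show False using lt books.emeasure_space_1 by simp
  qed
  then obtain C where C: "C \<in> space books" "T3 C + (T1 C + T2 C) \<le> ennreal \<delta>" by blast
  have Cs: "C (w, j) \<in> space (blk n)" if "w \<in> {1..M}" "j \<in> {1..J}" for w j
    using measurable_space[OF comp C(1), of "(w, j)"] that by (simp add: I_def)
  interpret D: dirty_paper_code p P Q N1 N2 n M J \<gamma> C
    using n M J Cs by unfold_locales
  have d0: "0 \<le> \<delta>" using lt by (cases "0 \<le> \<delta>") (auto simp: ennreal_neg)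
  have "D.leakage + (D.overload + D.confusion) \<le> ennreal \<delta>"
    using C(2) unfolding T1_def T2_def T3_def S_def V_def cI unfolding I_def D.leakage_eq D.overload_eq D.confusion_eq .
  from D.code_properties[OF b d0 this] D.wf_code D.power_code
  show ?thesis by (intro exI[of _ D.code]) simp
qed

end

subsection \<open>The secrecy capacity\<close>

text \<open>With \<open>2 ^ (a * t)\<close> messages and block length \<open>k * t\<close> the rate
  is the same for every \<open>t\<close>, as achievability demands an exact rate along the whole
  sequence. \<open>rate\<close> compares it in nats with the capacity difference at power
  \<open>p\<close>.\<close>

lemma eventually_exists_code:
  fixes p P Q N1 N2 b \<delta> :: real and a k :: nat
  assumes p: "0 < p" "p < P" and Q: "0 < Q" and N1: "0 < N1" and N2: "0 < N2" and b: "1 < b" and \<delta>: "0 < \<delta>" and k: "0 < k"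
    and rate: "a * ln 2 / k < (ln (1 + p / N1) - ln (1 + p / N2)) / 2"
  shows "\<forall>\<^sub>F t in sequentially. \<exists>c. wellformed_code c \<and> block_length c = k * t \<and> num_messages c = 2 ^ (a * t) \<and>
    power_constraint P Q N1 N2 c \<and> error_prob Q N1 N2 c \<le> \<delta> \<and>
    log b (2 ^ (a * t)) - 4 * (ln (2 ^ (a * t)) + 1) * \<delta> / ln b \<le> real (k * t) * equivocation b Q N1 N2 c"
proof -
  \<comment> \<open>The block length 0 is a placeholder: \<open>U\<close>, \<open>\<tau>\<close> and
    the two information rates do not involve \<open>n\<close>.\<close>
  interpret D: dirty_paper p P Q N1 N2 0 using p Q N1 N2 by unfold_locales
  define r where "r = a * ln 2 / k"
  \<comment> \<open>An eighth of the gap between available and wanted rate: three parts enlarge the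
    bundle, two lower the decoding threshold, and three remain as the exponent of the union
    bound.\<close>
  define \<eta> where "\<eta> = ((ln (1 + p / N1) - ln (1 + p / N2)) / 2 - r) / 8"
  have \<eta>: "0 < \<eta>" using rate by (simp add: \<eta>_def r_def)
  have info: "D.output_info - D.eve_info = r + 8 * \<eta>"
  proof -
    have "1 + p / N1 = (p + N1) / N1" "1 + p / N2 = (p + N2) / N2"
      using N1 N2 by (simp_all add: add_divide_distrib)
    then have l: "ln (1 + p / N1) = ln (p + N1) - ln N1" "ln (1 + p / N2) = ln (p + N2) - ln N2"
      using p N1 N2 by (simp_all add: ln_div)
    have l': "ln D.\<tau> = ln p + ln N1 - ln (p + N1)"
      using p N1 unfolding D.\<tau>_def by (simp add: ln_div ln_mult)
    show ?thesis unfolding D.output_info_def D.eve_info_def \<eta>_def l l' by (simp add: field_simps)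
  qed
  have ei: "0 \<le> D.eve_info"
  proof -
    have "ln p \<le> ln D.U" using p Q unfolding D.U_def by (intro ln_mono) (auto intro: add_pos_nonneg)
    moreover have "ln N2 \<le> ln (p + N2)" using p N2 by (intro ln_mono) auto
    ultimately show ?thesis by (simp add: D.eve_info_def)
  qed
  define bound where "bound n = norm_tail p (P - p) n + (norm_tail D.U (D.U * \<eta>) n + norm_tail D.\<tau> (D.\<tau> * \<eta>) n + 2 * exp (- (3 * \<eta>)) ^ n)
      + (2 * (norm_tail p (p * \<eta>) n + norm_tail N2 (N2 * \<eta>) n + norm_tail D.U (D.U * \<eta>) n + norm_tail (p + N2) ((p + N2) * \<eta>) n)
        + exp (- (\<eta> / 2)) ^ n)" for n
  have "bound \<longlonglongrightarrow> 0 + (0 + 0 + 2 * 0) + (2 * (0 + 0 + 0 + 0) + 0)"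
    unfolding bound_def[abs_def] using p N1 N2 \<eta> D.U D.\<tau> D.pN2
    by (intro tendsto_add tendsto_mult tendsto_const norm_tail_tendsto_0 LIMSEQ_power_zero mult_pos_pos) auto
  then have b0: "bound \<longlonglongrightarrow> 0" by simp
  have "filterlim (\<lambda>t. k * t) sequentially sequentially"
    using k by (intro filterlim_subseq) (auto simp: strict_mono_def)
  from filterlim_compose[OF b0 this] have "(\<lambda>t. bound (k * t)) \<longlonglongrightarrow> 0" .
  from order_tendstoD(2)[OF this \<delta>] have ev: "\<forall>\<^sub>F t in sequentially. bound (k * t) < \<delta>" .
  show ?thesis
    using ev eventually_gt_at_top[of 0]
  proof eventually_elim
    fix t :: nat assume small: "bound (k * t) < \<delta>" and t: "0 < t"
    define n where "n = k * t"
    have n: "0 < n" using k t by (simp add: n_def)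
    \<comment> \<open>The soft covering threshold has exponent \<open>eve_info + 2 * \<eta>\<close>;
      the extra \<open>\<eta>\<close> makes the bundle exponentially larger than the
      threshold.\<close>
    define E where "E = exp (n * (D.eve_info + 3 * \<eta>))"
    define J where "J = nat \<lceil>E\<rceil>"
    \<comment> \<open>Makes rounding up to an integer cost at most a factor 2.\<close>
    have E1: "1 \<le> E" unfolding E_def using ei \<eta> by simp
    have J: "E \<le> J" "J \<le> 2 * E" "0 < J"
      using E1 unfolding J_def by linarith+
    \<comment> \<open>Balances the two covering terms: the variance term is at most
      \<open>exp (- (n * \<eta>)) / \<rho>\<close>, which equals \<open>\<rho>\<close> for this
      choice.\<close>
    define \<rho> where "\<rho> = exp (- (\<eta> / 2)) ^ n"
    have \<rho>: "0 < \<rho>" by (simp add: \<rho>_def)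
    have \<rho>e: "\<rho> = exp (- (n * (\<eta> / 2)))" by (simp add: \<rho>_def exp_of_nat_mult[symmetric])
    have M: "real (2 ^ (a * t)) = exp (n * r)"
    proof -
      have "n * r = real (a * t) * ln 2" using k by (simp add: n_def r_def)
      then show ?thesis by (simp add: exp_of_nat_mult del: of_nat_mult)
    qed
    have h1: "real (2 ^ (a * t)) * real J * exp (- (n * (D.output_info - 2 * \<eta>))) \<le> 2 * exp (- (3 * \<eta>)) ^ n"
    proof -
      have "real (2 ^ (a * t)) * real J * exp (- (n * (D.output_info - 2 * \<eta>))) \<le> real (2 ^ (a * t)) * (2 * E) * exp (- (n * (D.output_info - 2 * \<eta>)))"
        using J by (intro mult_right_mono mult_left_mono) auto
      also have "\<dots> = 2 * exp (n * r + n * (D.eve_info + 3 * \<eta>) + - (n * (D.output_info - 2 * \<eta>)))"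
        unfolding M E_def exp_add by simp
      also have "n * r + n * (D.eve_info + 3 * \<eta>) + - (n * (D.output_info - 2 * \<eta>)) = n * (r + 5 * \<eta> - (D.output_info - D.eve_info))"
        by (simp add: algebra_simps)
      also have "\<dots> = n * (- (3 * \<eta>))" unfolding info by simp
      finally show ?thesis by (simp only: exp_of_nat_mult)
    qed
    have h2: "(exp (n * (D.eve_info + 2 * \<eta>)) / (J * \<rho>) + \<rho>) / 2 \<le> exp (- (\<eta> / 2)) ^ n"
    proof -
      have "exp (n * (D.eve_info + 2 * \<eta>)) / (J * \<rho>) \<le> exp (n * (D.eve_info + 2 * \<eta>)) / (E * \<rho>)"
        using J E1 \<rho> by (intro divide_left_mono mult_right_mono mult_pos_pos) auto
      also have "\<dots> = exp (n * (D.eve_info + 2 * \<eta>) - (n * (D.eve_info + 3 * \<eta>) + - (n * (\<eta> / 2))))"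
        unfolding E_def \<rho>e exp_diff exp_add ..
      also have "n * (D.eve_info + 2 * \<eta>) - (n * (D.eve_info + 3 * \<eta>) + - (n * (\<eta> / 2))) = - (n * (\<eta> / 2))"
        by (simp add: algebra_simps)
      finally have "exp (n * (D.eve_info + 2 * \<eta>)) / (J * \<rho>) \<le> \<rho>" by (simp only: \<rho>e)
      then have "(exp (n * (D.eve_info + 2 * \<eta>)) / (J * \<rho>) + \<rho>) / 2 \<le> (\<rho> + \<rho>) / 2"
        by (intro divide_right_mono add_right_mono) auto
      then show ?thesis by (simp add: \<rho>_def)
    qed
    have "norm_tail p (P - p) n + (norm_tail D.U (D.U * \<eta>) n + norm_tail D.\<tau> (D.\<tau> * \<eta>) n + real (2 ^ (a * t)) * real J * exp (- (n * (D.output_info - 2 * \<eta>))))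
      + (2 * (norm_tail p (p * \<eta>) n + norm_tail N2 (N2 * \<eta>) n + norm_tail D.U (D.U * \<eta>) n + norm_tail (p + N2) ((p + N2) * \<eta>) n)
        + (exp (n * (D.eve_info + 2 * \<eta>)) / (J * \<rho>) + \<rho>) / 2) \<le> bound n"
      unfolding bound_def by (intro add_mono order_refl h1 h2)
    also have "\<dots> < \<delta>" using small by (simp add: n_def)
    finally have lt: "norm_tail p (P - p) n + (norm_tail D.U (D.U * \<eta>) n + norm_tail D.\<tau> (D.\<tau> * \<eta>) n + real (2 ^ (a * t)) * real J * exp (- (n * (D.output_info - 2 * \<eta>))))
      + (2 * (norm_tail p (p * \<eta>) n + norm_tail N2 (N2 * \<eta>) n + norm_tail D.U (D.U * \<eta>) n + norm_tail (p + N2) ((p + N2) * \<eta>) n)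
        + (exp (n * (D.eve_info + 2 * \<eta>)) / (J * \<rho>) + \<rho>) / 2) < \<delta>" .
    have dp: "dirty_paper p P Q N1 N2" by (rule D.dirty_paper_axioms)
    have M0: "0 < (2 ^ (a * t) :: nat)" by simp
    from dirty_paper.exists_code[OF dp n M0 J(3) \<eta> \<rho> b lt]
    show "\<exists>c. wellformed_code c \<and> block_length c = k * t \<and> num_messages c = 2 ^ (a * t) \<and>
      power_constraint P Q N1 N2 c \<and> error_prob Q N1 N2 c \<le> \<delta> \<and>
      log b (2 ^ (a * t)) - 4 * (ln (2 ^ (a * t)) + 1) * \<delta> / ln b \<le> real (k * t) * equivocation b Q N1 N2 c"
      unfolding n_def by (simp only: of_nat_power of_nat_numeral)
  qed
qed

text \<open>The rate lies strictly below the capacity difference at power \<open>P\<close>, so by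
  continuity also below that of some \<open>p < P\<close>. Codes of quality \<open>\<delta>\<close>
  lose only a multiple of \<open>\<delta>\<close> in equivocation; letting \<open>\<delta>\<close>
  tend to 0 along the sequence, the limit inferior reaches the full rate.\<close>

lemma achievable_rate:
  fixes P Q N1 N2 b :: real and a k :: nat
  assumes P: "0 < P" and Q: "0 < Q" and N1: "0 < N1" and N2: "0 < N2" and b: "1 < b" and k: "0 < k"
    and rate: "a * ln 2 / k < (ln (1 + P / N1) - ln (1 + P / N2)) / 2"
  shows "achievable_secrecy_rate b P Q N1 N2 (a * ln 2 / k / ln b)"
proof -
  define r where "r = a * ln 2 / k"
  define R where "R = r / ln b"
  have lb: "0 < ln b" using b by simp
  have r0: "0 \<le> r" by (simp add: r_def)
  obtain p where p: "0 < p" "p < P" "r < (ln (1 + p / N1) - ln (1 + p / N2)) / 2"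
  proof -
    have "0 < 1 + P / N1" "0 < 1 + P / N2" using P N1 N2 by (auto intro!: add_pos_pos)
    then have pos: "1 + P / N1 \<noteq> 0" "1 + P / N2 \<noteq> 0" by auto
    have "((\<lambda>p. (ln (1 + p / N1) - ln (1 + p / N2)) / 2) \<longlongrightarrow> (ln (1 + P / N1) - ln (1 + P / N2)) / 2) (at_left P)"
      by (intro tendsto_divide tendsto_diff tendsto_ln tendsto_add tendsto_const tendsto_ident_at pos) (use N1 N2 in auto)
    from order_tendstoD(1)[OF this, of r] rate
    have "\<forall>\<^sub>F p in at_left P. r < (ln (1 + p / N1) - ln (1 + p / N2)) / 2" by (simp add: r_def)
    then obtain q where q: "q < P" "\<And>y. q < y \<Longrightarrow> y < P \<Longrightarrow> r < (ln (1 + y / N1) - ln (1 + y / N2)) / 2"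
      unfolding eventually_at_left[OF P] by blast
    define p where "p = (max q 0 + P) / 2"
    have "0 < p" "p < P" "q < p" using P q(1) by (auto simp: p_def max_def)
    then show ?thesis using that[of p] q(2)[of p] by simp
  qed
  \<comment> \<open>Loss of normalised equivocation per unit of \<open>\<delta>\<close>:
    \<open>4 * (ln M + 1) / (n * ln b)\<close>, bounded by means of \<open>ln M = n * r\<close> and
    \<open>1 \<le> n\<close>.\<close>
  define K where "K = 4 * (r + 1) / ln b"
  define good where "good \<delta> c \<longleftrightarrow> wellformed_code c \<and> power_constraint P Q N1 N2 c \<and> code_rate b c = R \<and>
    error_prob Q N1 N2 c \<le> \<delta> \<and> R - K * \<delta> \<le> equivocation b Q N1 N2 c" for \<delta> c
  have ex: "\<exists>c. good \<delta> c \<and> L < block_length c" if \<delta>: "0 < \<delta>" for \<delta> L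
  proof -
    have "\<forall>\<^sub>F t in sequentially. \<exists>c. wellformed_code c \<and> block_length c = k * t \<and> num_messages c = 2 ^ (a * t) \<and>
      power_constraint P Q N1 N2 c \<and> error_prob Q N1 N2 c \<le> \<delta> \<and>
      log b (2 ^ (a * t)) - 4 * (ln (2 ^ (a * t)) + 1) * \<delta> / ln b \<le> real (k * t) * equivocation b Q N1 N2 c"
      using p by (intro eventually_exists_code[where p=p] Q N1 N2 b \<delta> k) (auto simp: r_def)
    then have "\<exists>t. L < t \<and> (\<exists>c. wellformed_code c \<and> block_length c = k * t \<and> num_messages c = 2 ^ (a * t) \<and>
      power_constraint P Q N1 N2 c \<and> error_prob Q N1 N2 c \<le> \<delta> \<and>
      log b (2 ^ (a * t)) - 4 * (ln (2 ^ (a * t)) + 1) * \<delta> / ln b \<le> real (k * t) * equivocation b Q N1 N2 c)"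
      by (intro eventually_happens'[OF sequentially_bot eventually_conj[OF eventually_gt_at_top[of L]]])
    then obtain t c where t: "L < t" and c: "wellformed_code c" "block_length c = k * t" "num_messages c = 2 ^ (a * t)"
      "power_constraint P Q N1 N2 c" "error_prob Q N1 N2 c \<le> \<delta>"
      "log b (2 ^ (a * t)) - 4 * (ln (2 ^ (a * t)) + 1) * \<delta> / ln b \<le> real (k * t) * equivocation b Q N1 N2 c" by blast
    define n where "n = real (k * t)"
    have n: "1 \<le> n" 
    proof -
      have "0 < k * t" using k t by simp
      then show ?thesis unfolding n_def real_of_nat_ge_one_iff by linarith
    qed
    have lnM: "ln (2 ^ (a * t)) = n * r" using k by (simp add: n_def r_def ln_realpow)
    obtain k' where "k = Suc k'" using k by (cases k) auto
    then have lt: "L < block_length c" using t c(2) by simp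
    have rateR: "code_rate b c = R" using n lnM c by (simp add: code_rate_def R_def log_def n_def[symmetric] del: of_nat_mult)
    have "n * (R - K * \<delta>) = n * R - 4 * (n * r + n) * \<delta> / ln b" 
    proof -
      have "n * (R - K * \<delta>) = n * R - n * (4 * (r + 1) / ln b * \<delta>)" by (simp only: right_diff_distrib K_def)
      also have "n * (4 * (r + 1) / ln b * \<delta>) = 4 * (n * r + n) * \<delta> / ln b" by (simp add: distrib_left distrib_right)
      finally show ?thesis .
    qed
    also have "\<dots> \<le> n * R - 4 * (n * r + 1) * \<delta> / ln b"
      using n \<delta> lb by (intro diff_left_mono divide_right_mono mult_right_mono) auto
    also have "\<dots> \<le> n * equivocation b Q N1 N2 c"
      using c(6) unfolding log_def lnM by (simp add: R_def n_def)
    finally have "R - K * \<delta> \<le> equivocation b Q N1 N2 c" using n by simp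
    then show ?thesis using c lt rateR by (auto simp: good_def)
  qed
  have "achievable b P Q N1 N2 R R"
    unfolding achievable_def
  proof (intro conjI allI impI)
    show "0 \<le> R" using r0 lb by (simp add: R_def)
    fix \<epsilon> :: real assume \<epsilon>: "0 < \<epsilon>"
    \<comment> \<open>Capped by \<open>\<epsilon>\<close> for the error bound, and tending to 0 for
      the equivocation.\<close>
    define d where "d j = min \<epsilon> (inverse (real (Suc j)))" for j
    have d: "0 < d j" "d j \<le> \<epsilon>" "d j \<le> inverse (real (Suc j))" for j using \<epsilon> by (auto simp: d_def)
    \<comment> \<open>Block lengths must increase strictly, so each code is chosen after its
      predecessor.\<close>
    have "\<exists>c. \<forall>j. good (d j) (c j) \<and> block_length (c j) < block_length (c (Suc j))"
    proof (rule dependent_nat_choice)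
      show "\<exists>x. good (d 0) x" using ex[OF d(1), of 0] by blast
      show "\<exists>y. good (d (Suc j)) y \<and> block_length x < block_length y" for x j using ex[OF d(1)] by blast
    qed
    then obtain c where c: "\<And>j. good (d j) (c j)" "\<And>j. block_length (c j) < block_length (c (Suc j))" by blast
    have K0: "0 \<le> K" using r0 lb by (simp add: K_def)
    have lim: "(\<lambda>j. R - K * inverse (real (Suc j))) \<longlonglongrightarrow> R - K * 0"
      by (rule tendsto_diff[OF tendsto_const tendsto_mult[OF tendsto_const LIMSEQ_inverse_real_of_nat]])
    have "ereal R = liminf (\<lambda>j. ereal (R - K * inverse (real (Suc j))))"
      using lim by (intro lim_imp_Liminf[symmetric]) auto
    also have "\<dots> \<le> liminf (\<lambda>j. ereal (equivocation b Q N1 N2 (c j)))"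
    proof (intro Liminf_mono always_eventually allI)
      fix j
      have "R - K * inverse (real (Suc j)) \<le> R - K * d j" using K0 d(3) by (intro diff_left_mono mult_left_mono) auto
      then show "ereal (R - K * inverse (real (Suc j))) \<le> ereal (equivocation b Q N1 N2 (c j))" using c(1)[of j] by (simp add: good_def)
    qed
    finally have "ereal R \<le> liminf (\<lambda>j. ereal (equivocation b Q N1 N2 (c j)))" .
    moreover have "strict_mono (\<lambda>j. block_length (c j))" using c(2) by (simp add: strict_mono_Suc_iff)
    moreover have "error_prob Q N1 N2 (c j) \<le> \<epsilon>" for j using c(1)[of j] d(2)[of j] by (simp add: good_def)
    ultimately show "\<exists>c. strict_mono (\<lambda>k. block_length (c k)) \<and>
        (\<forall>k. wellformed_code (c k) \<and> power_constraint P Q N1 N2 (c k) \<and> code_rate b (c k) = R \<and> error_prob Q N1 N2 (c k) \<le> \<epsilon>) \<and>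
        ereal R \<le> liminf (\<lambda>k. ereal (equivocation b Q N1 N2 (c k)))"
      using c(1) by (intro exI[of _ c]) (auto simp: good_def)
  qed
  then show ?thesis unfolding achievable_secrecy_rate_def R_def r_def by blast
qed

lemma (in discrete_conditional) cond_entropy_nonneg: "0 \<le> conditional_entropy b (count_space A) T X Y"
proof -
  have "(\<integral>x. p x * ln (p x / marg (snd x)) \<partial>CT) \<le> (\<integral>x. 0 \<partial>CT)"
  proof (intro integral_mono log_ratio_int)
    fix x assume "x \<in> space CT"
    then obtain w v where x: "x = (w, v)" "w \<in> A" by (auto simp: space_pair_measure)
    show "p x * ln (p x / marg (snd x)) \<le> 0"
    proof (cases "p x = 0")
      case False
      then have "0 < p x" "p x \<le> marg (snd x)" using p0[of x] p_le_marg[of w v] x by auto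
      then show ?thesis by (intro mult_nonneg_nonpos) auto
    qed simp
  qed simp
  then show ?thesis unfolding cond_entropy_eq using ln_base_pos by (intro divide_nonneg_pos) auto
qed

lemma (in wiretap) equivocation_nonneg: "1 < b \<Longrightarrow> 0 \<le> equivocation b Q N1 N2 c"
  unfolding equivocation_def
  by (intro mult_nonneg_nonneg discrete_conditional.cond_entropy_nonneg[OF discrete_conditional_eve]) auto

text \<open>A single message sent silently. This keeps the set of achievable rates nonempty, so that
  its supremum in the extended reals is not -\<infinity>, and it settles the case in which the
  capacity difference is not positive.\<close>

lemma achievable_rate_zero:
  fixes P Q N1 N2 b :: real
  assumes P: "0 \<le> P" and Q: "0 < Q" and N1: "0 < N1" and N2: "0 < N2" and b: "1 < b"
  shows "achievable_secrecy_rate b P Q N1 N2 0"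
proof -
  define silent where "silent k = \<lparr>block_length = Suc k, num_messages = 1,
    encoder = (\<lambda>_. return (blk (Suc k)) (\<lambda>i\<in>{..<Suc k}. 0)), decoder = (\<lambda>_. 1)\<rparr>" for k
  have wf: "wellformed_code (silent k)" for k
    unfolding wellformed_code_def silent_def block_space_def
    by (auto simp: space_PiM space_prob_algebra intro!: measurable_const prob_space_return)
  have props: "power_constraint P Q N1 N2 (silent k) \<and> code_rate b (silent k) = 0 \<and> error_prob Q N1 N2 (silent k) = 0 \<and> 0 \<le> equivocation b Q N1 N2 (silent k)" for k
  proof -
    interpret wiretap Q N1 N2 "silent k" using Q N1 N2 wf by unfold_locales
    interpret I: prob_space "input_law Q (silent k)" by (rule prob_space_input_law)
    have s: "block_length (silent k) = Suc k" "num_messages (silent k) = 1" "decoder (silent k) y = 1"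
      "encoder (silent k) ws = return (blk (Suc k)) (\<lambda>i\<in>{..<Suc k}. 0)" for y ws by (simp_all add: silent_def)
    have z: "(\<lambda>i\<in>{..<Suc k}. 0 :: real) \<in> space (blk (Suc k))" by (simp add: space_PiM)
    have "(\<integral>\<^sup>+ t. ennreal (\<Sum>i<block_length (silent k). (snd (snd t) i)\<^sup>2) \<partial>input_law Q (silent k)) = 0"
    proof -
      have "(\<integral>\<^sup>+ x. ennreal (\<Sum>i<Suc k. (x i)\<^sup>2) \<partial>return (blk (Suc k)) (\<lambda>i\<in>{..<Suc k}. 0)) = 0"
        using z by (subst nn_integral_return) auto
      then show ?thesis using nn_integral_input_law[of "\<lambda>t. ennreal (\<Sum>i<block_length (silent k). (snd (snd t) i)\<^sup>2)"]
        by (simp add: s del: sum.lessThan_Suc)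
    qed
    then have "power_constraint P Q N1 N2 (silent k)" using P by (subst power_constraint_iff[OF P]) simp
    moreover have "error_prob Q N1 N2 (silent k) = 0"
      unfolding error_prob_def cond_prob_def by (simp add: s)
    ultimately show ?thesis using equivocation_nonneg[OF b] by (simp add: code_rate_def s)
  qed
  have "achievable b P Q N1 N2 0 0"
    unfolding achievable_def
  proof (intro conjI allI impI exI[of _ silent])
    show "ereal 0 \<le> liminf (\<lambda>k. ereal (equivocation b Q N1 N2 (silent k)))"
      using props by (intro Liminf_bounded always_eventually) auto
  qed (use wf props in \<open>auto simp: silent_def strict_mono_def\<close>)
  then show ?thesis unfolding achievable_secrecy_rate_def by blast
qed

text \<open>Achievability fixes \<open>\<epsilon>\<close> before the codes, so the Fano term
  \<open>\<epsilon> * R\<close> survives the limit of the block lengths. An excess of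
  \<open>R\<close> over the bound is refuted by choosing \<open>\<epsilon>\<close> small in
  comparison with it.\<close>

lemma achievable_secrecy_rate_le:
  fixes P Q N1 N2 b R :: real
  assumes P: "0 \<le> P" and Q: "0 < Q" and N1: "0 < N1" and N2: "0 < N2" and b: "1 < b"
    and ach: "achievable_secrecy_rate b P Q N1 N2 R"
  shows "R \<le> max 0 (gaussian_capacity b (P / N1) - gaussian_capacity b (P / N2))"
proof (rule ccontr)
  define Cs where "Cs = max 0 (gaussian_capacity b (P / N1) - gaussian_capacity b (P / N2))"
  assume "\<not> ?thesis"
  then have R: "Cs < R" "0 < R" by (auto simp: Cs_def)
  \<comment> \<open>Makes \<open>\<epsilon> * R\<close> half of the excess
    \<open>R - Cs\<close>.\<close>
  define \<epsilon> where "\<epsilon> = (R - Cs) / (2 * R)"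
  have \<epsilon>: "0 < \<epsilon>" using R by (simp add: \<epsilon>_def)
  obtain Req where Req: "achievable b P Q N1 N2 R Req" "R \<le> Req" using ach unfolding achievable_secrecy_rate_def by blast
  obtain c where c: "strict_mono (\<lambda>k. block_length (c k))"
    "\<And>k. wellformed_code (c k)" "\<And>k. power_constraint P Q N1 N2 (c k)" "\<And>k. code_rate b (c k) = R" "\<And>k. error_prob Q N1 N2 (c k) \<le> \<epsilon>"
    "ereal Req \<le> liminf (\<lambda>k. ereal (equivocation b Q N1 N2 (c k)))"
    using Req(1) \<epsilon> unfolding achievable_def by meson
  have u: "equivocation b Q N1 N2 (c k) \<le> Cs + ln 2 / ln b * inverse (real (block_length (c k))) + \<epsilon> * R" for k
  proof -
    interpret wiretap Q N1 N2 "c k" using Q N1 N2 c(2) by unfold_locales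
    show ?thesis using converse[OF b P c(3) c(5)] \<epsilon> c(4)[of k] by (simp add: Cs_def divide_inverse)
  qed
  have "filterlim (\<lambda>k. block_length (c k)) sequentially sequentially" using c(1) by (rule filterlim_subseq)
  from filterlim_compose[OF lim_inverse_n this] have inv: "(\<lambda>k. inverse (real (block_length (c k)))) \<longlonglongrightarrow> 0" .
  have lim: "(\<lambda>k. Cs + ln 2 / ln b * inverse (real (block_length (c k))) + \<epsilon> * R) \<longlonglongrightarrow> Cs + ln 2 / ln b * 0 + \<epsilon> * R"
    by (rule tendsto_add[OF tendsto_add[OF tendsto_const tendsto_mult[OF tendsto_const inv]] tendsto_const])
  have "ereal Req \<le> liminf (\<lambda>k. ereal (Cs + ln 2 / ln b * inverse (real (block_length (c k))) + \<epsilon> * R))"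
    using u by (intro order_trans[OF c(6)] Liminf_mono always_eventually) auto
  also have "\<dots> = ereal (Cs + \<epsilon> * R)"
    using lim by (intro lim_imp_Liminf) auto
  finally have "R \<le> Cs + \<epsilon> * R" using Req(2) by simp
  also have "\<epsilon> * R = (R - Cs) / 2" using R by (simp add: \<epsilon>_def)
  finally have "2 * R \<le> 2 * Cs + (R - Cs)" by (simp add: field_simps)
  then show False using R(1) by linarith
qed

theorem theorem5:
  fixes b P Q N1 N2 :: real
  assumes "1 < b" and "0 \<le> P" and "0 < Q" and "0 < N1" and "0 < N2"
  shows "secrecy_capacity b P Q N1 N2 =
    ereal (max 0 (gaussian_capacity b (P / N1) - gaussian_capacity b (P / N2)))"
proof -
  define Cs where "Cs = gaussian_capacity b (P / N1) - gaussian_capacity b (P / N2)"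
  have lb: "0 < ln b" using assms by simp
  have Cs: "Cs * ln b = (ln (1 + P / N1) - ln (1 + P / N2)) / 2"
    using lb by (simp add: Cs_def gaussian_capacity_def log_def field_simps)
  show ?thesis
    unfolding secrecy_capacity_def Cs_def[symmetric]
  proof (rule antisym)
    show "Sup (ereal ` {R. achievable_secrecy_rate b P Q N1 N2 R}) \<le> ereal (max 0 Cs)"
    proof (rule Sup_least)
      fix y assume "y \<in> ereal ` {R. achievable_secrecy_rate b P Q N1 N2 R}"
      then obtain R where R: "y = ereal R" "achievable_secrecy_rate b P Q N1 N2 R" by auto
      show "y \<le> ereal (max 0 Cs)"
        using achievable_secrecy_rate_le[OF assms(2-5,1) R(2)] unfolding R(1) Cs_def by (simp only: ereal_less_eq(3))
    qed
    show "ereal (max 0 Cs) \<le> Sup (ereal ` {R. achievable_secrecy_rate b P Q N1 N2 R})"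
    proof (cases "Cs \<le> 0")
      case True
      then show ?thesis using achievable_rate_zero[OF assms(2-5,1)] by (intro Sup_upper) auto
    next
      case False
      \<comment> \<open>Without power both capacities vanish and their difference is 0.\<close>
      then have "P \<noteq> 0" by (auto simp: Cs_def)
      then have P: "0 < P" using assms by simp
      have "ereal Cs \<le> Sup (ereal ` {R. achievable_secrecy_rate b P Q N1 N2 R})"
      proof (rule dense_le)
        fix y :: ereal assume y: "y < ereal Cs"
        \<comment> \<open>Replaces a possibly infinite or negative \<open>y\<close> by a nonnegative
          real rate still below the capacity.\<close>
        define y' where "y' = max 0 (real_of_ereal y)"
        have y': "y \<le> ereal y'" "y' < Cs" using y False by (cases y; auto simp: y'_def)+
        \<comment> \<open>The constructed rates are \<open>q * ln 2 / ln b\<close> with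
          \<open>q\<close> a nonnegative rational, so a rational is sought between the rescaled
          bounds.\<close>
        have "y' * ln b / ln 2 < Cs * ln b / ln 2" using y'(2) lb by (simp add: divide_strict_right_mono)
        from Rats_dense_in_real[OF this] obtain q where q: "q \<in> \<rat>" "y' * ln b / ln 2 < q" "q < Cs * ln b / ln 2" by blast
        have "0 \<le> y' * ln b / ln 2" using lb by (simp add: y'_def)
        then have "0 < q" using q(2) by simp
        then obtain a k :: nat where k: "k \<noteq> 0" "q = a / k" using q(1) Rats_abs_nat_div_natE[of q] by (metis abs_of_pos)
        have "a * ln 2 / k < (ln (1 + P / N1) - ln (1 + P / N2)) / 2"
          using q(3) k unfolding Cs[symmetric] by (simp add: field_simps)
        from achievable_rate[OF P assms(3-5,1) _ this] k have R: "achievable_secrecy_rate b P Q N1 N2 (a * ln 2 / k / ln b)" by simp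
        have "y' \<le> a * ln 2 / k / ln b" using q(2) k lb by (simp add: field_simps)
        then have "y \<le> ereal (a * ln 2 / k / ln b)" using y'(1) order_trans by fastforce
        also have "\<dots> \<le> Sup (ereal ` {R. achievable_secrecy_rate b P Q N1 N2 R})" using R by (intro Sup_upper) auto
        finally show "y \<le> Sup (ereal ` {R. achievable_secrecy_rate b P Q N1 N2 R})" .
      qed
      then show ?thesis using False by (simp add: max_def)
    qed
  qed
qed

end
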